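(* Let $\rho^{in},\rho^f:\Omega\to[0,+\infty)$ be two densities with the same total mass. Suppose that $\phi:[0,1]\times\Omega\to\mathbb{R}$ is an optimal potential for the dual Wasserstein problem from $\rho^{in}$ to $\rho^f$, and that $\rho:[0,1]\times\Omega\to[0,+\infty)$ is the associated interpolation. Let the reconstruction be the linear one. Then, denoting $\boldsymbol{\rho}^{in}:=\Pi_{\mathcal{T}'}\rho^{in}$ and $\boldsymbol{\rho}^f:=\Pi_{\mathcal{T}'}\rho^f$, and with $\zeta$ and $\eta_h$ the constants in the mesh assumptions of the context, the following holds. 1. If $\phi\in C^{1,1}([0,1]\times\Omega)$, there exists a constant $C>0$ depending only on $\phi$ and $\zeta$ such that $$W_{N,\mathcal{T}}^2(\boldsymbol{\rho}^{in},\boldsymbol{\rho}^f)\ \ge\ W_2^2(\rho^{in},\rho^f)-C(h+\tau+\eta_h).$$ 2. If $\phi\in L^\infty([0,1],C^{1,1}(\Omega))$ and $\rho,\partial_t\rho\in L^\infty([0,1],C^{0,1}(\Omega))$, with $\rho\ge\varepsilon>0$, there exists a constant $C>0$ depending only on $\rho,\phi,\varepsilon,\zeta$ and $\Omega$ such that $$W_{N,\mathcal{T}}^2(\boldsymbol{\rho}^{in},\boldsymbol{\rho}^f)\ \le\ W_2^2(\rho^{in},\rho^f)+C(h+\tau+\eta_h).$$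
   Context: **Continuous problem.** $\Omega\subset\mathbb{R}^d$ is convex and compact, polygonal if $d=2$, polyhedral if $d=3$. Let $B(p,Q)=\frac{|Q|^2}{2p}$ if $p>0$, $B(0,0)=0$, and $B(p,Q)=+\infty$ otherwise. $W_2$ is given by $$\tfrac12W_2^2(\rho^{in},\rho^f)=\inf_{\rho,F}\int_0^1\int_\Omega B(\rho,F)\,dx\,dt$$ over densities $\rho\ge0$ and momenta $F$ with $\partial_t\rho+\nabla\cdot F=0$ in $[0,1]\times\Omega$, $F\cdot n_{\partial\Omega}=0$ on $[0,1]\times\partial\Omega$, $\rho(0,\cdot)=\rho^{in}$, $\rho(1,\cdot)=\rho^f$. The dual Wasserstein problem is $$\sup_\phi\int_\Omega\phi(1,\cdot)\rho^f-\int_\Omega\phi(0,\cdot)\rho^{in}\quad\text{subject to }\ \partial_t\phi+\tfrac12|\nabla\phi|^2\le0\ \text{ in }[0,1]\times\Omega,$$ and its value is also $\tfrac12W_2^2(\rho^{in},\rho^f)$. An optimal potential is a maximizer $\phi$; the associated interpolation $\rho$ is the density such that $(\rho,\rho\nabla\phi)$ is a minimizer of the primal problem (so $\partial_t\rho+\nabla\cdot(\rho\nabla\phi)=0$ with $\rho\nabla\phi\cdot n_{\partial\Omega}=0$, $\rho(0,\cdot)=\rho^{in}$, $\rho(1,\cdot)=\rho^f$). **Meshes.** An admissible mesh $(\mathcal{T},\overline\Sigma,(\mathbf{x}_K)_{K\in\mathcal{T}})$ (for two-point flux finite volumes) consists of a finite set $\mathcal{T}$ of disjoint open convex polytopal cells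 whose closures cover $\Omega$, the set $\overline\Sigma$ of their planar faces, and cell centers $\mathbf{x}_K\in\Omega$. Each face is either contained in $\partial\Omega$ or is an internal face $\sigma=K|L$ shared by exactly two cells; $\Sigma$ is the set of internal faces, $\Sigma_K$ those contained in $\partial K$. For $\sigma=K|L$, $\mathbf{x}_L-\mathbf{x}_K$ is orthogonal to $\sigma$ and has the same orientation as the unit normal $\boldsymbol{n}_{K,\sigma}$ to $\sigma$ outward with respect to $K$. $m_K$ and $m_\sigma$ are the $d$- and $(d-1)$-dimensional Lebesgue measures, $d_\sigma=|\mathbf{x}_K-\mathbf{x}_L|$, and $d_{K,\sigma}$ is the Euclidean distance between the cell center $\mathbf{x}_K$ and the midpoint of the face $\sigma$. Two admissible meshes of $\Omega$ are given: a coarse one $\mathcal{T}'$ (cells $K'$) and a fine one $\mathcal{T}$ (cells $K$, faces $\Sigma$), such that every $K\in\mathcal{T}$ satisfies $\overline K\subseteq\overline{K'}$ for some $K'\in\mathcal{T}'$ (the two may coincide). Set $h=\max_{K\in\mathcal{T}}\mathrm{diam}(K)$. Mesh assumptions (on the fine mesh): there is a constant $\zeta$, not depending on $h$, with $\mathrm{diam}(K)\le\zeta d_\sigma\le\zeta^2\mathrm{diam}(K)$ for all $K\in\mathcal{T}$, $\sigma\in\Sigma_K$, and $\mathrm{dist}(\mathbf{x}_K,K)\le\zeta\,\mathrm{diam}(K)$ for all $K\in\mathcal{T}$; and there is a constant $\eta_h>0$ depending only on $h$, with $\eta_h\to0$ as $h\to0$, such that (as symmetric matrices) $\sum_{\sigma\in\Sigma_K}m_\sigma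 d_{K,\sigma}\,\boldsymbol{n}_{K,\sigma}\otimes\boldsymbol{n}_{K,\sigma}\le m_K(1+\eta_h)\mathrm{Id}$ for all $K\in\mathcal{T}$. **Discrete spaces and operators.** $\mathbb{P}_{\mathcal{T}}=\mathbb{R}^{\mathcal{T}}$, $\mathbb{P}_{\mathcal{T}'}=\mathbb{R}^{\mathcal{T}'}$, $\mathbb{P}_\Sigma=\mathbb{R}^\Sigma$. $\mathcal{I}:\mathbb{P}_{\mathcal{T}'}\to\mathbb{P}_{\mathcal{T}}$ is the injection $(\mathcal{I}\rho)_K=\rho_{K'}$ for $K\subset K'$. Discrete fluxes: $\mathbb{F}_{\mathcal{T}}=\{(F_{K,\sigma},F_{L,\sigma})_{\sigma=K|L\in\Sigma}:F_{K,\sigma}+F_{L,\sigma}=0\}$, $F_\sigma=|F_{K,\sigma}|=|F_{L,\sigma}|$. Discrete divergence: $(\mathrm{div}_{\mathcal{T}}\boldsymbol{F})_K=\frac1{m_K}\sum_{\sigma\in\Sigma_K}F_{K,\sigma}m_\sigma$. Linear reconstruction: $(\mathcal{L}_\Sigma\boldsymbol{a})_\sigma=\frac{d_{K,\sigma}}{d_\sigma}a_K+\frac{d_{L,\sigma}}{d_\sigma}a_L$ for $\sigma=K|L$, $\boldsymbol{a}\in\mathbb{P}_{\mathcal{T}}$. Sampling of densities: $(\Pi_{\mathcal{T}'}f)_{K'}=\frac1{m_{K'}}\int_{K'}f\,dx$. **Discrete distance.** The time interval $[0,1]$ is divided into $N+1$ subintervals of length $\tau=\frac1{N+1}$. For $\boldsymbol{\rho}=(\boldsymbol{\rho}^k)_{k=0}^{N+1}\in[\mathbb{P}_{\mathcal{T}'}]^{N+2}$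 and $\boldsymbol{F}=(\boldsymbol{F}^k)_{k=1}^{N+1}\in[\mathbb{F}_{\mathcal{T}}]^{N+1}$, $$\mathcal{B}_{N,\mathcal{T}}(\boldsymbol{\rho},\boldsymbol{F})=\sum_{k=1}^{N+1}\tau\sum_{\sigma\in\Sigma}B\Big(\big(\mathcal{L}_\Sigma\mathcal{I}\tfrac{\boldsymbol{\rho}^k+\boldsymbol{\rho}^{k-1}}2\big)_\sigma,F^k_\sigma\Big)m_\sigma d_\sigma$$ if all $\rho^k_{K'}\ge0$, and $+\infty$ otherwise. Then $$\tfrac12W_{N,\mathcal{T}}^2(\boldsymbol{\rho}^{in},\boldsymbol{\rho}^f)=\inf\mathcal{B}_{N,\mathcal{T}}(\boldsymbol{\rho},\boldsymbol{F})$$ over $(\boldsymbol{\rho},\boldsymbol{F})$ with $\mathcal{I}\big(\frac{\boldsymbol{\rho}^k-\boldsymbol{\rho}^{k-1}}\tau\big)+\mathrm{div}_{\mathcal{T}}\boldsymbol{F}^k=0$ for $k=1,\dots,N+1$, $\boldsymbol{\rho}^0=\boldsymbol{\rho}^{in}$, $\boldsymbol{\rho}^{N+1}=\boldsymbol{\rho}^f$ (the infimum is attained).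
   Formalization: In part 1 the constant C may also depend on the common total mass of the densities; in both parts the coarse mesh is assumed comparable to the fine one: max diam(K') ≤ max(1,ζ)·h. Without these the claims fail. *)

theory Defs
  imports "HOL-Analysis.Analysis"
begin

section \<open>Regularity classes on a closed convex body\<close>

definition has_gradient_on :: "'b::euclidean_space set \<Rightarrow> ('b \<Rightarrow> real) \<Rightarrow> ('b \<Rightarrow> 'b) \<Rightarrow> bool" where
  "has_gradient_on S f g \<longleftrightarrow> (\<forall>z\<in>S. (f has_derivative (\<lambda>v. g z \<bullet> v)) (at z within S))"

definition grad :: "'b::euclidean_space set \<Rightarrow> ('b \<Rightarrow> real) \<Rightarrow> 'b \<Rightarrow> 'b" where
  "grad S f x = (THE g. (f has_derivative (\<lambda>v. g \<bullet> v)) (at x within S))"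

definition C11_on :: "'b::euclidean_space set \<Rightarrow> ('b \<Rightarrow> real) \<Rightarrow> bool" where
  "C11_on S f \<longleftrightarrow> (\<exists>g L. has_gradient_on S f g \<and> L-lipschitz_on S g)"

text \<open>The classes \<open>L\<^sup>\<infinity>([0,1], C\<^sup>1\<^sup>,\<^sup>1(\<Omega>))\<close> and \<open>L\<^sup>\<infinity>([0,1], C\<^sup>0\<^sup>,\<^sup>1(\<Omega>))\<close>: the norms of the
  time slices are essentially bounded.\<close>

definition Linf_C11 :: "'a::euclidean_space set \<Rightarrow> (real \<Rightarrow> 'a \<Rightarrow> real) \<Rightarrow> bool" where
  "Linf_C11 \<Omega> f \<longleftrightarrow> (\<exists>L. AE t in lebesgue_on {0..1}. \<exists>g.
      has_gradient_on \<Omega> (f t) g \<and> L-lipschitz_on \<Omega> g \<and>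
      (\<forall>x\<in>\<Omega>. \<bar>f t x\<bar> \<le> L \<and> norm (g x) \<le> L))"

definition Linf_C01 :: "'a::euclidean_space set \<Rightarrow> (real \<Rightarrow> 'a \<Rightarrow> real) \<Rightarrow> bool" where
  "Linf_C01 \<Omega> f \<longleftrightarrow> (\<exists>L. AE t in lebesgue_on {0..1}.
      L-lipschitz_on \<Omega> (f t) \<and> (\<forall>x\<in>\<Omega>. \<bar>f t x\<bar> \<le> L))"

text \<open>\<open>r = \<partial>\<^sub>t f\<close>, where \<open>f\<close> is taken to be the representative that is absolutely continuous
  in time.\<close>

definition has_time_derivative ::
  "'a::euclidean_space set \<Rightarrow> (real \<Rightarrow> 'a \<Rightarrow> real) \<Rightarrow> (real \<Rightarrow> 'a \<Rightarrow> real) \<Rightarrow> bool" where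
  "has_time_derivative \<Omega> f r \<longleftrightarrow>
     (\<forall>x\<in>\<Omega>. \<forall>t\<in>{0..1}. ((\<lambda>s. r s x) has_integral (f t x - f 0 x)) {0..t})"


section \<open>The continuous problem\<close>

definition B :: "real \<Rightarrow> 'b::real_normed_vector \<Rightarrow> ennreal" where
  "B p Q = (if p > 0 then ennreal ((norm Q)\<^sup>2 / (2 * p))
            else if p = 0 \<and> Q = 0 then 0 else \<infinity>)"

definition is_density :: "'a::euclidean_space set \<Rightarrow> ('a \<Rightarrow> real) \<Rightarrow> bool" where
  "is_density \<Omega> r \<longleftrightarrow> integrable (lebesgue_on \<Omega>) r \<and> (\<forall>x\<in>\<Omega>. 0 \<le> r x)"

definition mass :: "'a::euclidean_space set \<Rightarrow> ('a \<Rightarrow> real) \<Rightarrow> real" where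
  "mass \<Omega> r = integral\<^sup>L (lebesgue_on \<Omega>) r"

text \<open>Weak form of the continuity equation. As the test functions \<open>\<psi> \<in> C\<^sup>1([0,1] \<times> \<Omega>)\<close> need not
  vanish on the boundary, the identity also contains the no-flux condition and the initial and
  final conditions. The gradient \<open>g = (\<partial>\<^sub>t \<psi>, \<nabla>\<psi>)\<close> is a space-time vector.\<close>

definition continuity_equation ::
  "'a::euclidean_space set \<Rightarrow> ('a \<Rightarrow> real) \<Rightarrow> ('a \<Rightarrow> real) \<Rightarrow>
    (real \<Rightarrow> 'a \<Rightarrow> real) \<times> (real \<Rightarrow> 'a \<Rightarrow> 'a) \<Rightarrow> bool" where
  "continuity_equation \<Omega> \<rho>in \<rho>f = (\<lambda>(\<rho>, F).
     (\<forall>t\<in>{0..1}. \<forall>x\<in>\<Omega>. 0 \<le> \<rho> t x) \<and>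
     integrable (lebesgue_on ({0..1} \<times> \<Omega>)) (\<lambda>(t, x). \<rho> t x) \<and>
     integrable (lebesgue_on ({0..1} \<times> \<Omega>)) (\<lambda>(t, x). F t x) \<and>
     (\<forall>\<psi> g. has_gradient_on ({0..1} \<times> \<Omega>) \<psi> g \<and> continuous_on ({0..1} \<times> \<Omega>) g \<longrightarrow>
        integral\<^sup>L (lebesgue_on ({0..1} \<times> \<Omega>))
          (\<lambda>(t, x). \<rho> t x * fst (g (t, x)) + F t x \<bullet> snd (g (t, x)))
        = integral\<^sup>L (lebesgue_on \<Omega>) (\<lambda>x. \<psi> (1, x) * \<rho>f x)
          - integral\<^sup>L (lebesgue_on \<Omega>) (\<lambda>x. \<psi> (0, x) * \<rho>in x)))"

definition action ::
  "'a::euclidean_space set \<Rightarrow> (real \<Rightarrow> 'a \<Rightarrow> real) \<times> (real \<Rightarrow> 'a \<Rightarrow> 'a) \<Rightarrow> ennreal" where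
  "action \<Omega> = (\<lambda>(\<rho>, F). \<integral>\<^sup>+ (t, x). B (\<rho> t x) (F t x) \<partial>lebesgue_on ({0..1} \<times> \<Omega>))"

definition W2_sq :: "'a::euclidean_space set \<Rightarrow> ('a \<Rightarrow> real) \<Rightarrow> ('a \<Rightarrow> real) \<Rightarrow> ennreal" where
  "W2_sq \<Omega> \<rho>in \<rho>f = 2 * (INF c\<in>Collect (continuity_equation \<Omega> \<rho>in \<rho>f). action \<Omega> c)"

text \<open>Competitors of the dual problem are Lipschitz, so that the Hamilton-Jacobi inequality makes
  sense almost everywhere.\<close>

definition dual_admissible :: "'a::euclidean_space set \<Rightarrow> (real \<Rightarrow> 'a \<Rightarrow> real) \<Rightarrow> bool" where
  "dual_admissible \<Omega> \<phi> \<longleftrightarrow>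
     (\<exists>L. L-lipschitz_on ({0..1} \<times> \<Omega>) (\<lambda>(t, x). \<phi> t x)) \<and>
     (AE (t, x) in lebesgue_on ({0..1} \<times> \<Omega>).
        deriv (\<lambda>s. \<phi> s x) t + (norm (grad \<Omega> (\<phi> t) x))\<^sup>2 / 2 \<le> 0)"

definition dual_value ::
  "'a::euclidean_space set \<Rightarrow> ('a \<Rightarrow> real) \<Rightarrow> ('a \<Rightarrow> real) \<Rightarrow> (real \<Rightarrow> 'a \<Rightarrow> real) \<Rightarrow> real" where
  "dual_value \<Omega> \<rho>in \<rho>f \<phi> =
     integral\<^sup>L (lebesgue_on \<Omega>) (\<lambda>x. \<phi> 1 x * \<rho>f x)
     - integral\<^sup>L (lebesgue_on \<Omega>) (\<lambda>x. \<phi> 0 x * \<rho>in x)"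

definition optimal_potential ::
  "'a::euclidean_space set \<Rightarrow> ('a \<Rightarrow> real) \<Rightarrow> ('a \<Rightarrow> real) \<Rightarrow> (real \<Rightarrow> 'a \<Rightarrow> real) \<Rightarrow> bool" where
  "optimal_potential \<Omega> \<rho>in \<rho>f \<phi> \<longleftrightarrow> is_arg_max (dual_value \<Omega> \<rho>in \<rho>f) (dual_admissible \<Omega>) \<phi>"

definition associated_interpolation ::
  "'a::euclidean_space set \<Rightarrow> ('a \<Rightarrow> real) \<Rightarrow> ('a \<Rightarrow> real) \<Rightarrow> (real \<Rightarrow> 'a \<Rightarrow> real) \<Rightarrow>
    (real \<Rightarrow> 'a \<Rightarrow> real) \<Rightarrow> bool" where
  "associated_interpolation \<Omega> \<rho>in \<rho>f \<phi> \<rho> \<longleftrightarrow>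
     is_arg_min (action \<Omega>) (continuity_equation \<Omega> \<rho>in \<rho>f)
       (\<rho>, \<lambda>t x. \<rho> t x *\<^sub>R grad \<Omega> (\<phi> t) x)"


section \<open>Meshes\<close>

text \<open>Faces are represented by closed sets.\<close>

record 'a mesh =
  cells :: "'a set set"
  faces :: "'a set set"
  center :: "'a set \<Rightarrow> 'a"

definition face_cells :: "('a::euclidean_space) mesh \<Rightarrow> 'a set \<Rightarrow> 'a set set" where
  "face_cells T \<sigma> = {K \<in> cells T. \<sigma> \<subseteq> frontier K}"

definition internal_faces :: "('a::euclidean_space) mesh \<Rightarrow> 'a set set" where
  "internal_faces T = {\<sigma> \<in> faces T. card (face_cells T \<sigma>) = 2}"

definition cell_faces :: "('a::euclidean_space) mesh \<Rightarrow> 'a set \<Rightarrow> 'a set set" where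
  "cell_faces T K = {\<sigma> \<in> internal_faces T. \<sigma> \<subseteq> frontier K}"

definition outward_normal :: "'a::euclidean_space set \<Rightarrow> 'a set \<Rightarrow> 'a" where
  "outward_normal K \<sigma> = (THE n. norm n = 1 \<and> (\<forall>y\<in>\<sigma>. \<forall>z\<in>\<sigma>. n \<bullet> (y - z) = 0) \<and>
     (\<forall>x\<in>K. \<forall>y\<in>\<sigma>. n \<bullet> (x - y) < 0))"

definition admissible_mesh :: "'a::euclidean_space set \<Rightarrow> 'a mesh \<Rightarrow> bool" where
  "admissible_mesh \<Omega> T \<longleftrightarrow>
     finite (cells T) \<and>
     (\<forall>K\<in>cells T. K \<noteq> {} \<and> open K \<and> convex K \<and> polytope (closure K)) \<and>
     pairwise disjnt (cells T) \<and>
     (\<Union>K\<in>cells T. closure K) = \<Omega> \<and>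
     finite (faces T) \<and>
     (\<forall>\<sigma>\<in>faces T. polytope \<sigma> \<and> aff_dim \<sigma> = int DIM('a) - 1) \<and>
     pairwise (\<lambda>\<sigma> \<sigma>'. disjnt (rel_interior \<sigma>) (rel_interior \<sigma>')) (faces T) \<and>
     (\<forall>K\<in>cells T. frontier K = \<Union>{\<sigma> \<in> faces T. \<sigma> \<subseteq> frontier K}) \<and>
     (\<forall>\<sigma>\<in>faces T. face_cells T \<sigma> \<noteq> {} \<and> (\<sigma> \<subseteq> frontier \<Omega> \<or> \<sigma> \<in> internal_faces T)) \<and>
     (\<forall>K\<in>cells T. center T K \<in> \<Omega>) \<and>
     (\<forall>\<sigma>\<in>internal_faces T. \<forall>K L. face_cells T \<sigma> = {K, L} \<and> K \<noteq> L \<longrightarrow>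
        (\<exists>c>0. center T L - center T K = c *\<^sub>R outward_normal K \<sigma>))"

text \<open>The right prism of height 1 with mid-section \<open>\<sigma>\<close>: its volume is the \<open>(d-1)\<close>-dimensional
  measure of \<open>\<sigma>\<close> and its barycenter is that of \<open>\<sigma>\<close>. It does not depend on the choice of sign of
  the unit normal.\<close>

definition prism :: "'a::euclidean_space set \<Rightarrow> 'a set" where
  "prism \<sigma> = (let n = (SOME n. norm n = 1 \<and> (\<forall>y\<in>\<sigma>. \<forall>z\<in>\<sigma>. n \<bullet> (y - z) = 0))
     in {y + s *\<^sub>R n | y s. y \<in> \<sigma> \<and> \<bar>s\<bar> \<le> 1/2})"

definition face_measure :: "'a::euclidean_space set \<Rightarrow> real" where
  "face_measure \<sigma> = measure lebesgue (prism \<sigma>)"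

definition face_midpoint :: "'a::euclidean_space set \<Rightarrow> 'a" where
  "face_midpoint \<sigma> = (1 / face_measure \<sigma>) *\<^sub>R integral\<^sup>L (lebesgue_on (prism \<sigma>)) (\<lambda>z. z)"

definition cell_measure :: "'a::euclidean_space set \<Rightarrow> real" where
  "cell_measure K = measure lebesgue K"

definition face_dist :: "('a::euclidean_space) mesh \<Rightarrow> 'a set \<Rightarrow> real" where
  "face_dist T \<sigma> = (THE d. \<exists>K L. face_cells T \<sigma> = {K, L} \<and> K \<noteq> L \<and>
     d = dist (center T K) (center T L))"

definition cell_face_dist :: "('a::euclidean_space) mesh \<Rightarrow> 'a set \<Rightarrow> 'a set \<Rightarrow> real" where
  "cell_face_dist T K \<sigma> = dist (center T K) (face_midpoint \<sigma>)"

definition mesh_size :: "('a::euclidean_space) mesh \<Rightarrow> real" where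
  "mesh_size T = Max (diameter ` cells T)"

definition subordinate :: "('a::euclidean_space) mesh \<Rightarrow> 'a mesh \<Rightarrow> bool" where
  "subordinate T' T \<longleftrightarrow> (\<forall>K\<in>cells T. \<exists>K'\<in>cells T'. closure K \<subseteq> closure K')"

definition mesh_regular :: "real \<Rightarrow> ('a::euclidean_space) mesh \<Rightarrow> bool" where
  "mesh_regular \<zeta> T \<longleftrightarrow>
     (\<forall>K\<in>cells T. \<forall>\<sigma>\<in>cell_faces T K.
        diameter K \<le> \<zeta> * face_dist T \<sigma> \<and> \<zeta> * face_dist T \<sigma> \<le> \<zeta>\<^sup>2 * diameter K) \<and>
     (\<forall>K\<in>cells T. infdist (center T K) K \<le> \<zeta> * diameter K)"

text \<open>The coarse mesh may not be arbitrarily coarser than the fine one: if \<open>\<T>'\<close> has the single cell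
  \<open>interior \<Omega>\<close>, the discrete distance vanishes for every fine mesh \<open>\<T>\<close>. The condition holds
  trivially when both meshes have the same size.\<close>

definition coarse_comparable ::
  "real \<Rightarrow> ('a::euclidean_space) mesh \<Rightarrow> 'a mesh \<Rightarrow> bool" where
  "coarse_comparable \<zeta> T' T \<longleftrightarrow> mesh_size T' \<le> max 1 \<zeta> * mesh_size T"

definition loewner_le :: "('a::euclidean_space \<Rightarrow> 'a) \<Rightarrow> ('a \<Rightarrow> 'a) \<Rightarrow> bool" where
  "loewner_le S R \<longleftrightarrow> (\<forall>v. S v \<bullet> v \<le> R v \<bullet> v)"

definition outer_product :: "'a::euclidean_space \<Rightarrow> 'a \<Rightarrow> 'a \<Rightarrow> 'a" where
  "outer_product a b = (\<lambda>v. (b \<bullet> v) *\<^sub>R a)"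

definition mesh_isotropic :: "real \<Rightarrow> ('a::euclidean_space) mesh \<Rightarrow> bool" where
  "mesh_isotropic e T \<longleftrightarrow> (\<forall>K\<in>cells T. loewner_le
     (\<lambda>v. \<Sum>\<sigma>\<in>cell_faces T K. (face_measure \<sigma> * cell_face_dist T K \<sigma>) *\<^sub>R
        outer_product (outward_normal K \<sigma>) (outward_normal K \<sigma>) v)
     (\<lambda>v. (cell_measure K * (1 + e)) *\<^sub>R v))"

definition vanishing_rate :: "(real \<Rightarrow> real) \<Rightarrow> bool" where
  "vanishing_rate \<eta> \<longleftrightarrow> (\<forall>h>0. \<eta> h > 0) \<and> (\<eta> \<longlongrightarrow> 0) (at_right 0)"

definition mesh_assumptions ::
  "'a::euclidean_space set \<Rightarrow> real \<Rightarrow> (real \<Rightarrow> real) \<Rightarrow> 'a mesh \<Rightarrow> 'a mesh \<Rightarrow> bool" where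
  "mesh_assumptions \<Omega> \<zeta> \<eta> T' T \<longleftrightarrow>
     admissible_mesh \<Omega> T' \<and> admissible_mesh \<Omega> T \<and> subordinate T' T \<and>
     mesh_regular \<zeta> T \<and> coarse_comparable \<zeta> T' T \<and> mesh_isotropic (\<eta> (mesh_size T)) T"


section \<open>Discrete operators and the discrete distance\<close>

definition injection ::
  "('a::euclidean_space) mesh \<Rightarrow> ('a set \<Rightarrow> real) \<Rightarrow> 'a set \<Rightarrow> real" where
  "injection T' r K = r (THE K'. K' \<in> cells T' \<and> K \<subseteq> K')"

definition is_flux :: "('a::euclidean_space) mesh \<Rightarrow> ('a set \<Rightarrow> 'a set \<Rightarrow> real) \<Rightarrow> bool" where
  "is_flux T F \<longleftrightarrow> (\<forall>\<sigma>\<in>internal_faces T. \<forall>K L. face_cells T \<sigma> = {K, L} \<and> K \<noteq> L \<longrightarrow>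
     F K \<sigma> + F L \<sigma> = 0)"

definition flux_size ::
  "('a::euclidean_space) mesh \<Rightarrow> ('a set \<Rightarrow> 'a set \<Rightarrow> real) \<Rightarrow> 'a set \<Rightarrow> real" where
  "flux_size T F \<sigma> = (THE q. \<forall>K\<in>face_cells T \<sigma>. q = \<bar>F K \<sigma>\<bar>)"

definition discrete_div ::
  "('a::euclidean_space) mesh \<Rightarrow> ('a set \<Rightarrow> 'a set \<Rightarrow> real) \<Rightarrow> 'a set \<Rightarrow> real" where
  "discrete_div T F K =
     (1 / cell_measure K) * (\<Sum>\<sigma>\<in>cell_faces T K. F K \<sigma> * face_measure \<sigma>)"

definition linear_reconstruction ::
  "('a::euclidean_space) mesh \<Rightarrow> ('a set \<Rightarrow> real) \<Rightarrow> 'a set \<Rightarrow> real" where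
  "linear_reconstruction T a \<sigma> =
     (\<Sum>K\<in>face_cells T \<sigma>. cell_face_dist T K \<sigma> / face_dist T \<sigma> * a K)"

definition sampling :: "('a::euclidean_space \<Rightarrow> real) \<Rightarrow> 'a set \<Rightarrow> real" where
  "sampling f K = (1 / cell_measure K) * integral\<^sup>L (lebesgue_on K) f"

definition time_step :: "nat \<Rightarrow> real" where
  "time_step N = 1 / (real N + 1)"

definition discrete_action ::
  "nat \<Rightarrow> ('a::euclidean_space) mesh \<Rightarrow> 'a mesh \<Rightarrow>
    (nat \<Rightarrow> 'a set \<Rightarrow> real) \<times> (nat \<Rightarrow> 'a set \<Rightarrow> 'a set \<Rightarrow> real) \<Rightarrow> ennreal" where
  "discrete_action N T' T = (\<lambda>(\<rho>, F).
     if \<forall>k\<le>N+1. \<forall>K'\<in>cells T'. 0 \<le> \<rho> k K' then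
       (\<Sum>k=1..N+1. ennreal (time_step N) * (\<Sum>\<sigma>\<in>internal_faces T.
          B (linear_reconstruction T (injection T' (\<lambda>K'. (\<rho> k K' + \<rho> (k-1) K') / 2)) \<sigma>)
            (flux_size T (F k) \<sigma>)
          * ennreal (face_measure \<sigma> * face_dist T \<sigma>)))
     else \<infinity>)"

definition discrete_continuity_equation ::
  "nat \<Rightarrow> ('a::euclidean_space) mesh \<Rightarrow> 'a mesh \<Rightarrow> ('a set \<Rightarrow> real) \<Rightarrow> ('a set \<Rightarrow> real) \<Rightarrow>
    (nat \<Rightarrow> 'a set \<Rightarrow> real) \<times> (nat \<Rightarrow> 'a set \<Rightarrow> 'a set \<Rightarrow> real) \<Rightarrow> bool" where
  "discrete_continuity_equation N T' T \<rho>in \<rho>f = (\<lambda>(\<rho>, F).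
     (\<forall>k\<in>{1..N+1}. is_flux T (F k)) \<and>
     (\<forall>k\<in>{1..N+1}. \<forall>K\<in>cells T.
        injection T' (\<lambda>K'. (\<rho> k K' - \<rho> (k-1) K') / time_step N) K + discrete_div T (F k) K = 0) \<and>
     (\<forall>K'\<in>cells T'. \<rho> 0 K' = \<rho>in K' \<and> \<rho> (N+1) K' = \<rho>f K'))"

definition discrete_W2_sq ::
  "nat \<Rightarrow> ('a::euclidean_space) mesh \<Rightarrow> 'a mesh \<Rightarrow> ('a set \<Rightarrow> real) \<Rightarrow> ('a set \<Rightarrow> real) \<Rightarrow> ennreal"
  where
  "discrete_W2_sq N T' T \<rho>in \<rho>f =
     2 * (INF c\<in>Collect (discrete_continuity_equation N T' T \<rho>in \<rho>f). discrete_action N T' T c)"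

end

theory Submission imports Defs begin

text \<open>Both inequalities compare a problem with a competitor built from the solution of the other side.

 \<^emph>\<open>Lower bound.\<close> The potential \<open>\<phi>\<close>, evaluated at the times \<open>k \<tau>\<close> and the cell centers, is nearly
 admissible for the dual of the discrete problem. For any discrete competitor, summation by parts in
 time and space, Young's inequality on each face and the isotropy assumption on the mesh bound the
 dual value of \<open>\<phi>\<close> by the discrete action plus the error made in the Hamilton-Jacobi inequality,
 integrated against a discrete density of total mass \<open>M\<close>; this is \<open>discrete_dual_bound\<close>. It remains to
 know that the dual value of \<open>\<phi>\<close> is not smaller than half the squared distance
 (\<open>duality_gap_le_0\<close>). By optimality of \<open>\<phi>\<close>, this amounts to the Hamilton-Jacobi equation holding
 where the interpolation \<open>\<rho>\<close> charges: the defect \<open>c = - (\<partial>\<^sub>t \<phi> + |\<nabla>\<phi>|\<^sup>2 / 2) \<ge> 0\<close> leaves room to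
 increase \<open>\<phi>\<close> along its own flow, so solving \<open>\<partial>\<^sub>t \<psi> + \<nabla>\<phi> \<bullet> \<nabla>\<psi> = c\<close> approximately
 (\<open>transport_equation_approx\<close>) and perturbing \<open>\<phi>\<close> by a small multiple of \<open>\<psi>\<close> gives
 \<open>\<integral> \<rho> c \<le> 0\<close>.

 \<^emph>\<open>Upper bound.\<close> The competitor samples \<open>\<rho>\<close> at the times \<open>k \<tau>\<close> on the coarse cells. Averaged over a
 time step, the momentum is a Lipschitz field \<open>V\<close> whose divergence is minus the increment of \<open>\<rho>\<close>
 (\<open>time_average\<close>). The discrete continuity equation on the fine mesh asks for minus the
 coarse cell averages of the increment instead. The difference is of the order of the mesh size
 and has zero mean, hence it is the divergence of a continuous field \<open>W\<close> of the same order
 (\<open>bounded_field_with_divergence\<close>, \<open>cell_average_correction\<close>). The mean fluxes of \<open>V + W\<close> through the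
 faces then satisfy the discrete continuity equation by the divergence theorem on each cell
 (\<open>cell_flux_balance\<close>), which is derived here from the weak formulation by letting smooth bumps tend to
 the indicator of the cell. The isotropy assumption bounds their energy by the continuous one up to
 an error of first order (\<open>mean_flux_energy\<close>, \<open>average_energy\<close>); the lower bound \<open>\<epsilon>\<close> on the density makes
 the energy density Lipschitz in the density.\<close>

section \<open>Geometry of polytopal meshes\<close>

abbreviation int_on :: "'b::euclidean_space set \<Rightarrow> ('b \<Rightarrow> 'c::{banach, second_countable_topology}) \<Rightarrow> 'c" where
 "int_on S \<equiv> integral\<^sup>L (lebesgue_on S)"

lemma unit_normal_unique:
 fixes S :: "'a::euclidean_space set"
 assumes dim: "aff_dim S = int DIM('a) - 1"
  and a: "norm a = 1" "\<And>y z. y \<in> S \<Longrightarrow> z \<in> S \<Longrightarrow> a \<bullet> (y - z) = 0"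
  and b: "norm b = 1" "\<And>y z. y \<in> S \<Longrightarrow> z \<in> S \<Longrightarrow> b \<bullet> (y - z) = 0"
 shows "a = b \<or> a = - b"
proof -
 have "S \<noteq> {}" using dim by auto
 then obtain p where p: "p \<in> S" by auto
 define D where "D = (\<lambda>x. -p + x) ` S"
 have dimD: "dim D = DIM('a) - 1"
  using aff_dim_eq_dim[of p S] p dim hull_inc[OF p, of affine]
  unfolding D_def by (simp add: image_def)
 define u where "u = b - (a \<bullet> b) *\<^sub>R a"
 have au: "a \<bullet> u = 0"
  using a(1) by (simp add: u_def inner_diff_right power2_norm_eq_inner[symmetric])
 have D0: "a \<bullet> x = 0" "b \<bullet> x = 0" if "x \<in> D" for x
  using that a(2) b(2) p unfolding D_def by auto
 have uD: "u \<bullet> x = 0" if "x \<in> D" for x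
  using D0[OF that] by (simp add: u_def inner_diff_left)
 have "u = 0"
 proof (rule ccontr)
  assume u0: "u \<noteq> 0"
  define E where "E = span D"
  have dE: "dim E = DIM('a) - 1" using dimD by (simp add: E_def)
  have E0: "a \<bullet> x = 0" "u \<bullet> x = 0" if "x \<in> E" for x
  proof -
   have "E \<subseteq> {x. a \<bullet> x = 0}" unfolding E_def
    by (rule span_minimal) (auto simp: D0 subspace_hyperplane)
   moreover have "E \<subseteq> {x. u \<bullet> x = 0}" unfolding E_def
    by (rule span_minimal) (auto simp: uD subspace_hyperplane)
   ultimately show "a \<bullet> x = 0" "u \<bullet> x = 0" using that by auto
  qed
  have "E \<subseteq> {x. a \<bullet> x = 0}" using E0 by auto
  moreover have "dim {x. a \<bullet> x = 0} = DIM('a) - 1"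
   using a(1) by (intro dim_hyperplane) auto
  ultimately have "E = {x. a \<bullet> x = 0}"
   using dE subspace_hyperplane[of a]
   by (intro subspace_dim_equal) (auto simp: E_def)
  then have "u \<in> E" using au by simp
  then have "u \<bullet> u = 0" using E0(2) by blast
  then show False using u0 by simp
 qed
 then have ba: "b = (a \<bullet> b) *\<^sub>R a" by (simp add: u_def)
 then have "\<bar>a \<bullet> b\<bar> = 1" using a(1) b(1) by (metis mult.right_neutral norm_scaleR)
 then have "a \<bullet> b = 1 \<or> a \<bullet> b = -1" by linarith
 then show ?thesis using ba by (metis scaleR_minus1_left scaleR_one minus_minus)
qed

lemma linear_max_at_rel_interior_const:
 fixes S :: "'a::euclidean_space set"
 assumes "convex S" "y \<in> rel_interior S" "\<And>z. z \<in> S \<Longrightarrow> a \<bullet> z \<le> a \<bullet> y" "z \<in> S"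
 shows "a \<bullet> z = a \<bullet> y"
proof (rule ccontr)
 assume "a \<bullet> z \<noteq> a \<bullet> y"
 then have lt: "a \<bullet> z < a \<bullet> y" using assms(3)[OF assms(4)] by simp
 have zy: "z \<noteq> y" using lt by auto
 obtain e where e: "e > 1" "(1 - e) *\<^sub>R z + e *\<^sub>R y \<in> S"
  using convex_rel_interior_iff[OF assms(1), of y] assms by blast
 have "a \<bullet> ((1 - e) *\<^sub>R z + e *\<^sub>R y) \<le> a \<bullet> y" using assms(3)[OF e(2)] .
 then have "(1 - e) * (a \<bullet> z) + e * (a \<bullet> y) \<le> a \<bullet> y" by (simp add: inner_add_right)
 then have "(e - 1) * (a \<bullet> y) \<le> (e - 1) * (a \<bullet> z)" by (simp add: algebra_simps)
 then show False using e lt by auto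
qed

text \<open>Separate the open convex set from the face: both lie in the same closed half-space, and since
  the face lies in the frontier the separating form is constant on it.\<close>

lemma facet_normal_exists:
 fixes S :: "'a::euclidean_space set"
 assumes S: "convex S" "aff_dim S = int DIM('a) - 1" and K: "open K" "convex K" "K \<noteq> {}" "S \<subseteq> frontier K"
 shows "\<exists>n. norm n = 1 \<and> (\<forall>y\<in>S. \<forall>z\<in>S. n \<bullet> (y - z) = 0) \<and> (\<forall>x\<in>K. \<forall>y\<in>S. n \<bullet> (x - y) < 0)"
proof -
 have "S \<noteq> {}" using S(2) by auto
 then obtain y where y: "y \<in> rel_interior S" using rel_interior_eq_empty[OF S(1)] by auto
 have yS: "y \<in> S" using y rel_interior_subset by auto
 have "y \<notin> K" using yS K(4) by (auto simp: frontier_def interior_open[OF K(1)])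
 then obtain a where a: "a \<noteq> 0" "\<And>x. x \<in> K \<Longrightarrow> a \<bullet> x \<le> a \<bullet> y"
 proof -
  obtain a b where "a \<noteq> 0" "\<forall>x\<in>K. a \<bullet> x \<le> b" "\<forall>x\<in>{y}. b \<le> a \<bullet> x"
   using separating_hyperplane_sets[of K "{y}"] K(2,3) \<open>y \<notin> K\<close> by auto
  then show ?thesis by (intro that[of a]) force+
 qed
 have acl: "a \<bullet> x \<le> a \<bullet> y" if "x \<in> closure K" for x
 proof -
  have "closure K \<subseteq> {x. a \<bullet> x \<le> a \<bullet> y}"
   by (rule closure_minimal) (auto simp: a closed_halfspace_le)
  then show ?thesis using that by auto
 qed
 have aS: "a \<bullet> z = a \<bullet> y" if "z \<in> S" for z
  using linear_max_at_rel_interior_const[OF S(1) y _ that] acl K(4) by (auto simp: frontier_def)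
 have strict: "a \<bullet> x < a \<bullet> y" if "x \<in> K" for x
 proof -
  have "K \<subseteq> interior {x. a \<bullet> x \<le> a \<bullet> y}" using K(1) a(2) by (intro interior_maximal) auto
  then show ?thesis using that interior_halfspace_le[OF a(1)] by auto
 qed
 show ?thesis
 proof (intro exI[of _ "a /\<^sub>R norm a"] conjI ballI)
  show "norm (a /\<^sub>R norm a) = 1" using a(1) by simp
 next
  fix u v assume "u \<in> S" "v \<in> S"
  then show "(a /\<^sub>R norm a) \<bullet> (u - v) = 0" using aS[of u] aS[of v] by (simp add: inner_diff_right)
 next
  fix u v assume "u \<in> K" "v \<in> S"
  then have "a \<bullet> (u - v) < 0" using aS[of v] strict[of u] by (simp add: inner_diff_right)
  then show "(a /\<^sub>R norm a) \<bullet> (u - v) < 0" using a(1) by (simp add: mult_pos_neg)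
 qed
qed

locale mesh =
 fixes \<Omega> :: "'a::euclidean_space set" and T :: "'a mesh"
 assumes adm: "admissible_mesh \<Omega> T" and poly: "polytope \<Omega>" and int\<Omega>: "interior \<Omega> \<noteq> {}"
begin

lemma \<Omega>: "compact \<Omega>" "convex \<Omega>" "closed \<Omega>" "bounded \<Omega>" "\<Omega> \<noteq> {}"
 using poly int\<Omega> polytope_imp_compact polytope_imp_convex polytope_imp_closed polytope_imp_bounded
 interior_subset by blast+

lemma adm_parts:
 "finite (cells T)" "\<forall>K\<in>cells T. K \<noteq> {} \<and> open K \<and> convex K \<and> polytope (closure K)"
 "pairwise disjnt (cells T)" "(\<Union>K\<in>cells T. closure K) = \<Omega>" "finite (faces T)"
 "\<forall>s\<in>faces T. polytope s \<and> aff_dim s = int DIM('a) - 1"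
 "pairwise (\<lambda>s s'. disjnt (rel_interior s) (rel_interior s')) (faces T)"
 "\<forall>K\<in>cells T. frontier K = \<Union>{s \<in> faces T. s \<subseteq> frontier K}"
 "\<forall>s\<in>faces T. face_cells T s \<noteq> {} \<and> (s \<subseteq> frontier \<Omega> \<or> s \<in> internal_faces T)"
 "\<forall>K\<in>cells T. center T K \<in> \<Omega>"
 "\<forall>s\<in>internal_faces T. \<forall>K L. face_cells T s = {K, L} \<and> K \<noteq> L \<longrightarrow>
    (\<exists>c>0. center T L - center T K = c *\<^sub>R outward_normal K s)"
 by (insert adm, unfold admissible_mesh_def, (elim conjE, assumption)+)

lemma finite_cells: "finite (cells T)" and finite_faces: "finite (faces T)"
 using adm_parts(1,5) .

lemma finite_internal: "finite (internal_faces T)" "finite (cell_faces T K)" "finite (face_cells T s)"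
 using finite_faces finite_cells by (auto simp: internal_faces_def cell_faces_def face_cells_def)

lemma cell:
 assumes "K \<in> cells T"
 shows "K \<noteq> {}" "open K" "convex K" "bounded K" "closure K \<subseteq> \<Omega>" "K \<subseteq> \<Omega>" "center T K \<in> \<Omega>"
proof -
 show "K \<noteq> {}" "open K" "convex K" "center T K \<in> \<Omega>" using adm_parts(2,10) assms by auto
 have "(\<Union>K\<in>cells T. closure K) = \<Omega>" using adm_parts(4) .
 then show "closure K \<subseteq> \<Omega>" using assms by blast
 then show "K \<subseteq> \<Omega>" using closure_subset by blast
 then show "bounded K" using \<Omega>(4) bounded_subset by blast
qed

lemma \<Omega>_cover: "(\<Union>K\<in>cells T. closure K) = \<Omega>"
 using adm_parts(4) .

lemma cells_disjoint: "K \<in> cells T \<Longrightarrow> L \<in> cells T \<Longrightarrow> K \<noteq> L \<Longrightarrow> K \<inter> L = {}"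
 using adm_parts(3) by (auto simp: pairwise_def disjnt_def)

lemma face:
 assumes "s \<in> faces T"
 shows "polytope s" "aff_dim s = int DIM('a) - 1" "convex s" "compact s" "s \<noteq> {}"
proof -
 show *: "polytope s" "aff_dim s = int DIM('a) - 1" using adm_parts(6) assms by auto
 then show "convex s" "compact s" using polytope_imp_compact polytope_imp_convex by blast+
 show "s \<noteq> {}" using *(2) by auto
qed

lemma frontier_cell: "K \<in> cells T \<Longrightarrow> frontier K = \<Union>{s \<in> faces T. s \<subseteq> frontier K}"
 using adm_parts(8) by blast

lemma faces_disjoint: "s \<in> faces T \<Longrightarrow> t \<in> faces T \<Longrightarrow> s \<noteq> t \<Longrightarrow> rel_interior s \<inter> rel_interior t = {}"
 using adm_parts(7) unfolding pairwise_def disjnt_def by blast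

lemma face_boundary_or_internal: "s \<in> faces T \<Longrightarrow> s \<subseteq> frontier \<Omega> \<or> s \<in> internal_faces T"
 using adm_parts(9) by blast

lemma normal:
 assumes "K \<in> cells T" "s \<in> faces T" "s \<subseteq> frontier K"
 shows "norm (outward_normal K s) = 1"
  "y \<in> s \<Longrightarrow> z \<in> s \<Longrightarrow> outward_normal K s \<bullet> (y - z) = 0"
  "x \<in> K \<Longrightarrow> y \<in> s \<Longrightarrow> outward_normal K s \<bullet> (x - y) < 0"
proof -
 let ?P = "\<lambda>n. norm n = 1 \<and> (\<forall>y\<in>s. \<forall>z\<in>s. n \<bullet> (y - z) = 0) \<and> (\<forall>x\<in>K. \<forall>y\<in>s. n \<bullet> (x - y) < 0)"
 obtain n where n: "?P n"
  using facet_normal_exists[OF face(3,2)[OF assms(2)] cell(2,3,1)[OF assms(1)] assms(3)] by blast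
 obtain x0 y0 where xy: "x0 \<in> K" "y0 \<in> s" using face(5)[OF assms(2)] cell(1)[OF assms(1)] by blast
 have "m = n" if m: "?P m" for m
 proof -
  have "m = n \<or> m = - n"
   using unit_normal_unique[OF face(2)[OF assms(2)], of m n] m n by blast
  moreover have "m \<noteq> - n"
  proof
   assume "m = - n"
   moreover have "m \<bullet> (x0 - y0) < 0" "n \<bullet> (x0 - y0) < 0" using m n xy by blast+
   ultimately show False by simp
  qed
  ultimately show ?thesis by blast
 qed
 then have "?P (outward_normal K s)" unfolding outward_normal_def by (intro theI[of ?P n]) (use n in blast)+
 then show "norm (outward_normal K s) = 1"
  "y \<in> s \<Longrightarrow> z \<in> s \<Longrightarrow> outward_normal K s \<bullet> (y - z) = 0"
  "x \<in> K \<Longrightarrow> y \<in> s \<Longrightarrow> outward_normal K s \<bullet> (x - y) < 0" by blast+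
qed

lemma internal_face_cells:
 assumes "s \<in> internal_faces T"
 obtains K L where "face_cells T s = {K, L}" "K \<noteq> L" "K \<in> cells T" "L \<in> cells T" "s \<in> faces T"
  "s \<subseteq> frontier K" "s \<subseteq> frontier L"
proof -
 have "card (face_cells T s) = 2" using assms by (auto simp: internal_faces_def)
 then obtain K L where KL: "face_cells T s = {K, L}" "K \<noteq> L" by (auto simp: card_2_iff)
 then have "K \<in> face_cells T s" "L \<in> face_cells T s" by auto
 then show ?thesis using KL that assms unfolding face_cells_def internal_faces_def by blast
qed

lemma face_dist_eq:
 assumes "face_cells T s = {K, L}" "K \<noteq> L"
 shows "face_dist T s = dist (center T K) (center T L)"
 unfolding face_dist_def
proof (rule the_equality)
 show "\<exists>K' L'. face_cells T s = {K', L'} \<and> K' \<noteq> L' \<and> dist (center T K) (center T L) = dist (center T K') (center T L')"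
  by (intro exI[of _ K] exI[of _ L]) (simp add: assms)
next
 fix d assume "\<exists>K' L'. face_cells T s = {K', L'} \<and> K' \<noteq> L' \<and> d = dist (center T K') (center T L')"
 then obtain K' L' where "{K, L} = {K', L'}" "d = dist (center T K') (center T L')"
  using assms by auto
 then show "d = dist (center T K) (center T L)"
  by (metis dist_commute doubleton_eq_iff)
qed

lemma centers_along_normal:
 assumes "s \<in> internal_faces T" "face_cells T s = {K, L}" "K \<noteq> L"
 shows "center T L - center T K = face_dist T s *\<^sub>R outward_normal K s"
  "face_dist T s > 0" "outward_normal L s = - outward_normal K s"
proof -
 have mem: "K \<in> cells T" "L \<in> cells T" "s \<in> faces T" "s \<subseteq> frontier K" "s \<subseteq> frontier L"
 proof -
  have "K \<in> face_cells T s" "L \<in> face_cells T s" using assms(2) by auto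
  then show "K \<in> cells T" "L \<in> cells T" "s \<subseteq> frontier K" "s \<subseteq> frontier L" by (auto simp: face_cells_def)
  show "s \<in> faces T" using assms(1) by (auto simp: internal_faces_def)
 qed
 have A: "\<exists>c>0. center T L - center T K = c *\<^sub>R outward_normal K s" if
  "face_cells T s = {K, L}" "K \<noteq> L" for K L
  using adm_parts(11) assms(1) that by blast
 obtain c where c: "c > 0" "center T L - center T K = c *\<^sub>R outward_normal K s" using A assms by blast
 obtain c' where c': "c' > 0" "center T K - center T L = c' *\<^sub>R outward_normal L s"
  using A[of L K] assms by blast
 have n: "norm (outward_normal K s) = 1" "norm (outward_normal L s) = 1" using normal(1) mem by blast+
 have d: "face_dist T s = norm (center T L - center T K)"
  using face_dist_eq[OF assms(2,3)] by (simp add: dist_norm norm_minus_commute)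
 have dc: "face_dist T s = c" using c n d by simp
 have "face_dist T s = c'" using c' n d by (simp add: norm_minus_commute[of "center T L"])
 then have "c = c'" using dc by simp
 have "c *\<^sub>R outward_normal L s = c *\<^sub>R (- outward_normal K s)"
  using c c' \<open>c = c'\<close> by (metis minus_diff_eq scaleR_minus_right)
 then show "outward_normal L s = - outward_normal K s" using c(1) by (metis scaleR_left_imp_eq less_numeral_extra(3))
 show "center T L - center T K = face_dist T s *\<^sub>R outward_normal K s" "face_dist T s > 0" using c dc by auto
qed

lemma sum_cells_faces:
 "(\<Sum>K\<in>cells T. \<Sum>s\<in>cell_faces T K. a K s) = (\<Sum>s\<in>internal_faces T. \<Sum>K\<in>face_cells T s. a K s)"
 unfolding cell_faces_def face_cells_def using finite_cells finite_internal
 by (intro sum.swap_restrict) auto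

end

section \<open>Integrals over thin layers along a hyperplane\<close>

definition hp :: "'a::euclidean_space \<Rightarrow> real \<Rightarrow> 'a \<Rightarrow> 'a" where
 "hp n b x = x - (n \<bullet> x - b) *\<^sub>R n"

lemma hp_borel [measurable]: "hp n b \<in> borel_measurable borel"
 unfolding hp_def by (intro borel_measurable_continuous_onI continuous_intros)

lemma nn_integral_lborel_translate:
 fixes f :: "'a::euclidean_space \<Rightarrow> ennreal"
 assumes [measurable]: "f \<in> borel_measurable borel"
 shows "(\<integral>\<^sup>+x. f (x + c) \<partial>lborel) = (\<integral>\<^sup>+x. f x \<partial>lborel)"
proof -
 have "(\<integral>\<^sup>+x. f x \<partial>lborel) = (\<integral>\<^sup>+x. f x \<partial>distr lborel borel ((+) c))"
  by (simp add: lborel_distr_plus)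
 also have "\<dots> = (\<integral>\<^sup>+x. f (c + x) \<partial>lborel)" by (subst nn_integral_distr) auto
 finally show ?thesis by (simp add: add.commute)
qed

text \<open>Fubini in the direction \<open>n\<close> by translations only: the slab of width one around the hyperplane
  plays the role of the \<open>(d-1)\<close>-dimensional measure, exactly as in the definition of a prism.\<close>

lemma nn_integral_layer:
 fixes n :: "'a::euclidean_space" and H :: "'a \<Rightarrow> ennreal" and w :: "real \<Rightarrow> ennreal"
 assumes n: "norm n = 1" and d: "\<delta> > 0"
  and [measurable]: "H \<in> borel_measurable borel" "w \<in> borel_measurable borel"
 shows "(\<integral>\<^sup>+x. H x * w ((b - n \<bullet> x) / \<delta>) \<partial>lborel) =
  ennreal \<delta> * (\<integral>\<^sup>+x. \<integral>\<^sup>+s. indicator {-1/2..1/2} (n \<bullet> x - b) * w s * H (hp n b x - (\<delta> * s) *\<^sub>R n) \<partial>lborel \<partial>lborel)"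
proof -
 have nn: "n \<bullet> n = 1" using n by (simp add: norm_eq_1)
 let ?u = "indicator {-1/2..1/2::real} :: real \<Rightarrow> ennreal"
 have one: "(\<integral>\<^sup>+r. ?u (a - r) \<partial>lborel) = 1" for a
 proof -
  have "?u (a - r) = indicator {a - 1/2..a + 1/2} r" for r by (auto simp: indicator_def)
  then show ?thesis by simp
 qed
 have "(\<integral>\<^sup>+x. H x * w ((b - n \<bullet> x) / \<delta>) \<partial>lborel) =
    (\<integral>\<^sup>+x. \<integral>\<^sup>+r. H x * w ((b - n \<bullet> x) / \<delta>) * ?u ((n \<bullet> x - b) - r) \<partial>lborel \<partial>lborel)"
  by (subst nn_integral_cmult) (auto simp: one[simplified])
 also have "\<dots> = (\<integral>\<^sup>+r. \<integral>\<^sup>+x. H x * w ((b - n \<bullet> x) / \<delta>) * ?u ((n \<bullet> x - b) - r) \<partial>lborel \<partial>lborel)"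
  by (rule lborel_pair.Fubini'[symmetric]) measurable
 also have "\<dots> = (\<integral>\<^sup>+r. \<integral>\<^sup>+x. H (x + r *\<^sub>R n) * w ((b - n \<bullet> x - r) / \<delta>) * ?u (n \<bullet> x - b) \<partial>lborel \<partial>lborel)"
 proof (rule nn_integral_cong)
  fix r :: real
  show "(\<integral>\<^sup>+x. H x * w ((b - n \<bullet> x) / \<delta>) * ?u ((n \<bullet> x - b) - r) \<partial>lborel) =
   (\<integral>\<^sup>+x. H (x + r *\<^sub>R n) * w ((b - n \<bullet> x - r) / \<delta>) * ?u (n \<bullet> x - b) \<partial>lborel)"
   by (subst nn_integral_lborel_translate[symmetric, where c="r *\<^sub>R n"])
    (auto simp: inner_add_right nn algebra_simps)
 qed
 also have "\<dots> = (\<integral>\<^sup>+x. \<integral>\<^sup>+r. H (x + r *\<^sub>R n) * w ((b - n \<bullet> x - r) / \<delta>) * ?u (n \<bullet> x - b) \<partial>lborel \<partial>lborel)"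
  by (rule lborel_pair.Fubini') measurable
 also have "\<dots> = (\<integral>\<^sup>+x. ennreal \<delta> * (\<integral>\<^sup>+s. ?u (n \<bullet> x - b) * w s * H (hp n b x - (\<delta> * s) *\<^sub>R n) \<partial>lborel) \<partial>lborel)"
 proof (rule nn_integral_cong)
  fix x :: 'a
  show "(\<integral>\<^sup>+r. H (x + r *\<^sub>R n) * w ((b - n \<bullet> x - r) / \<delta>) * ?u (n \<bullet> x - b) \<partial>lborel) =
    ennreal \<delta> * (\<integral>\<^sup>+s. ?u (n \<bullet> x - b) * w s * H (hp n b x - (\<delta> * s) *\<^sub>R n) \<partial>lborel)"
   by (subst nn_integral_real_affine[where c="-\<delta>" and t="b - n \<bullet> x"])
    (use d in \<open>auto simp: hp_def algebra_simps intro!: arg_cong2[where f="(*)"] nn_integral_cong\<close>)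
 qed
 also have "\<dots> = ennreal \<delta> * (\<integral>\<^sup>+x. \<integral>\<^sup>+s. ?u (n \<bullet> x - b) * w s * H (hp n b x - (\<delta> * s) *\<^sub>R n) \<partial>lborel \<partial>lborel)"
  by (subst nn_integral_cmult) auto
 finally show ?thesis .
qed

lemma layer_measure:
 fixes n :: "'a::euclidean_space" and w :: "real \<Rightarrow> real"
 assumes n: "norm n = 1" and d: "\<delta> > 0" and [measurable]: "w \<in> borel_measurable borel"
 shows "density lborel (\<lambda>x. ennreal (w ((b - n \<bullet> x) / \<delta>) / \<delta>)) =
  distr (density (lborel \<Otimes>\<^sub>M lborel) (\<lambda>(x, s). ennreal (indicator {-1/2..1/2} (n \<bullet> x - b) * w s)))
   borel (\<lambda>(x, s). hp n b x - (\<delta> * s) *\<^sub>R n)" (is "?A = ?B")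
proof (rule measure_eqI)
 show "sets ?A = sets ?B" by simp
 fix S assume "S \<in> sets ?A"
 then have [measurable]: "S \<in> sets borel" by simp
 let ?t = "\<lambda>(x, s). hp n b x - (\<delta> * s) *\<^sub>R n"
 have t[measurable]: "?t \<in> borel_measurable (lborel \<Otimes>\<^sub>M lborel)" by measurable
 have "ennreal (w a / \<delta>) = ennreal (1/\<delta>) * ennreal (w a)" for a using d by (simp flip: ennreal_mult')
 then have "emeasure ?A S = ennreal (1/\<delta>) * (\<integral>\<^sup>+x. indicator S x * ennreal (w ((b - n \<bullet> x) / \<delta>)) \<partial>lborel)"
  by (subst emeasure_density) (auto simp: mult_ac nn_integral_cmult[symmetric])
 also have "\<dots> = (ennreal (1/\<delta>) * ennreal \<delta>) * (\<integral>\<^sup>+x. \<integral>\<^sup>+s. indicator {-1/2..1/2} (n \<bullet> x - b) * ennreal (w s) * indicator S (?t (x, s)) \<partial>lborel \<partial>lborel)"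
  by (subst nn_integral_layer[OF n d]) (auto simp: mult.assoc)
 also have "ennreal (1/\<delta>) * ennreal \<delta> = 1" using d by (simp flip: ennreal_mult')
 also have "1 * (\<integral>\<^sup>+x. \<integral>\<^sup>+s. indicator {-1/2..1/2} (n \<bullet> x - b) * ennreal (w s) * indicator S (?t (x, s)) \<partial>lborel \<partial>lborel)
   = (\<integral>\<^sup>+z. (case z of (x,s) \<Rightarrow> indicator {-1/2..1/2} (n \<bullet> x - b) * ennreal (w s)) * indicator S (?t z) \<partial>(lborel \<Otimes>\<^sub>M lborel))"
  by (subst lborel.nn_integral_fst[symmetric]) auto
 also have "\<dots> = emeasure ?B S"
 proof -
  have "?t -` S \<inter> space (lborel \<Otimes>\<^sub>M lborel) \<in> sets (lborel \<Otimes>\<^sub>M lborel)"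
   by (rule measurable_sets[OF t]) simp
  then show ?thesis
   by (subst emeasure_distr)
    (auto simp: emeasure_density indicator_def ennreal_mult' split: prod.splits if_splits intro!: nn_integral_cong)
 qed
 finally show "emeasure ?A S = emeasure ?B S" .
qed

lemma integral_layer:
 fixes n :: "'a::euclidean_space" and w :: "real \<Rightarrow> real" and H :: "'a \<Rightarrow> real"
 assumes n: "norm n = 1" and d: "\<delta> > 0" and [measurable]: "w \<in> borel_measurable borel" "H \<in> borel_measurable borel"
  and w0: "\<And>s. w s \<ge> 0"
 shows "(\<integral>x. H x * (w ((b - n \<bullet> x) / \<delta>) / \<delta>) \<partial>lborel) =
  (\<integral>z. (case z of (x, s) \<Rightarrow> indicator {-1/2..1/2} (n \<bullet> x - b) * w s * H (hp n b x - (\<delta> * s) *\<^sub>R n)) \<partial>(lborel \<Otimes>\<^sub>M lborel))"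
proof -
 have "(\<integral>x. H x * (w ((b - n \<bullet> x) / \<delta>) / \<delta>) \<partial>lborel) = (\<integral>x. H x \<partial>density lborel (\<lambda>x. ennreal (w ((b - n \<bullet> x) / \<delta>) / \<delta>)))"
  by (subst integral_density) (auto simp: w0 d less_imp_le mult_ac)
 also have "\<dots> = (\<integral>z. H (case z of (x, s) \<Rightarrow> hp n b x - (\<delta> * s) *\<^sub>R n) \<partial>density (lborel \<Otimes>\<^sub>M lborel) (\<lambda>(x, s). ennreal (indicator {-1/2..1/2} (n \<bullet> x - b) * w s)))"
  by (subst layer_measure[OF n d]; (subst integral_distr)?) auto
 also have "\<dots> = (\<integral>z. (case z of (x, s) \<Rightarrow> indicator {-1/2..1/2} (n \<bullet> x - b) * w s) * H (case z of (x, s) \<Rightarrow> hp n b x - (\<delta> * s) *\<^sub>R n) \<partial>(lborel \<Otimes>\<^sub>M lborel))"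
  unfolding case_prod_unfold by (subst integral_density) (auto simp: w0)
 finally show ?thesis by (simp add: case_prod_unfold)
qed

lemma max0_sq_has_derivative:
 "((\<lambda>x::real. (max 0 x)\<^sup>2) has_real_derivative 2 * max 0 x) (at x within S)"
proof -
 have "((\<lambda>x::real. (max 0 x)\<^sup>2) has_real_derivative 2 * max 0 x) (at x)"
 proof -
  consider "x < 0" | "x > 0" | "x = 0" by linarith
  then show ?thesis
  proof cases
   case 1
   have "eventually (\<lambda>y. (max 0 y)\<^sup>2 = 0) (nhds x)"
    using eventually_nhds_in_open[of "{..<0}" x] 1 by (auto elim!: eventually_mono)
   then show ?thesis using 1 by (subst DERIV_cong_ev[OF refl _ refl, where g="\<lambda>_. 0"]) auto
  next
   case 2
   have "eventually (\<lambda>y. (max 0 y)\<^sup>2 = y\<^sup>2) (nhds x)"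
    using eventually_nhds_in_open[of "{0<..}" x] 2 by (auto elim!: eventually_mono)
   then show ?thesis using 2
    by (subst DERIV_cong_ev[OF refl _ refl, where g="\<lambda>y. y\<^sup>2"]) (auto intro!: derivative_eq_intros)
  next
   case 3
   have "((\<lambda>h::real. (max 0 h)\<^sup>2 / h) \<longlongrightarrow> 0) (at 0)"
   proof (rule Lim_null_comparison)
    show "\<forall>\<^sub>F h in at 0. norm ((max 0 h)\<^sup>2 / h) \<le> \<bar>h\<bar>"
     by (intro always_eventually) (auto simp: power2_eq_square max_def)
   qed (auto intro!: tendsto_eq_intros)
   then show ?thesis using 3 by (simp add: DERIV_def)
  qed
 qed
 then show ?thesis by (rule DERIV_subset) auto
qed

text \<open>The hat function on \<open>[0,1]\<close> of integral one, with peak at \<open>1/2\<close>.\<close>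

definition tent :: "real \<Rightarrow> real" where
 "tent t = 4 * max 0 t - 8 * max 0 (t - 1/2) + 4 * max 0 (t - 1)"

text \<open>The primitive of \<open>tent\<close>: a \<open>C\<^sup>1\<close> step from 0 to 1.\<close>

definition smoothstep :: "real \<Rightarrow> real" where
 "smoothstep t = 2 * (max 0 t)\<^sup>2 - 4 * (max 0 (t - 1/2))\<^sup>2 + 2 * (max 0 (t - 1))\<^sup>2"

lemma smoothstep_derivative: "(smoothstep has_real_derivative tent t) (at t within S)"
proof -
 have "((\<lambda>t. (max 0 (t - a))\<^sup>2) has_real_derivative 2 * max 0 (t - a)) (at t within S)" for a
 proof -
  have "((\<lambda>t. t - a) has_real_derivative 1) (at t within S)" by (auto intro!: derivative_eq_intros)
  from DERIV_chain2[OF max0_sq_has_derivative this] show ?thesis by simp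
 qed
 note d = this[of 0] this[of "1/2"] this[of 1]
 show ?thesis unfolding smoothstep_def[abs_def] tent_def
  using DERIV_add[OF DERIV_diff[OF DERIV_cmult[OF d(1), of 2] DERIV_cmult[OF d(2), of 4]] DERIV_cmult[OF d(3), of 2]]
  by (simp add: algebra_simps)
qed

lemma tent: "tent t \<ge> 0" "t \<le> 0 \<or> t \<ge> 1 \<Longrightarrow> tent t = 0" "tent t \<le> 2"
 by (auto simp: tent_def max_def)

lemma continuous_tent: "continuous_on S tent"
 unfolding tent_def by (intro continuous_intros)

lemma tent_borel [measurable]: "tent \<in> borel_measurable borel"
 by (intro borel_measurable_continuous_onI continuous_tent)

lemma smoothstep: "t \<le> 0 \<Longrightarrow> smoothstep t = 0" "t \<ge> 1 \<Longrightarrow> smoothstep t = 1"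
 "0 \<le> smoothstep t" "smoothstep t \<le> 1"
proof -
 show 0: "t \<le> 0 \<Longrightarrow> smoothstep t = 0" by (simp add: smoothstep_def)
 show 1: "t \<ge> 1 \<Longrightarrow> smoothstep t = 1" by (simp add: smoothstep_def max_def power2_eq_square algebra_simps)
 have mono: "mono smoothstep"
 proof (rule monoI)
  fix x y :: real assume "x \<le> y"
  then show "smoothstep x \<le> smoothstep y"
   by (rule DERIV_nonneg_imp_nondecreasing) (use smoothstep_derivative tent(1) in blast)
 qed
 show "0 \<le> smoothstep t" using monoD[OF mono, of "min t 0" t] by (auto simp: smoothstep_def)
 have "smoothstep (max t 1) = 1" by (simp add: smoothstep_def max_def power2_eq_square algebra_simps)
 then show "smoothstep t \<le> 1" using monoD[OF mono, of t "max t 1"] by auto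
qed

lemma continuous_smoothstep: "continuous_on S smoothstep"
 unfolding smoothstep_def by (intro continuous_intros)

lemma smoothstep_borel [measurable]: "smoothstep \<in> borel_measurable borel"
 by (intro borel_measurable_continuous_onI continuous_smoothstep)

lemma integral_tent: "(\<integral>t. tent t \<partial>lborel) = 1" "integrable lborel tent"
proof -
 have "(\<integral>t. indicator {0..1} t *\<^sub>R tent t \<partial>lborel) = smoothstep 1 - smoothstep 0"
  by (rule integral_FTC_Icc) (use smoothstep_derivative continuous_tent in \<open>auto simp: has_real_derivative_iff_has_vector_derivative[symmetric]\<close>)
 moreover have "integrable lborel (\<lambda>t. indicator {0..1} t *\<^sub>R tent t)"
  by (rule borel_integrable_compact) (auto intro: continuous_tent)
 moreover have "indicator {0..1} t *\<^sub>R tent t = tent t" for t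
  using tent(2)[of t] by (cases "t \<in> {0..1}") auto
 ultimately show "(\<integral>t. tent t \<partial>lborel) = 1" "integrable lborel tent"
  by (simp_all only: smoothstep(1)[OF order_refl] smoothstep(2)[OF order_refl] diff_zero)
qed

text \<open>The set lies in the frontier of the convex set \<open>S + \<real> n\<close>, which is negligible.\<close>

lemma negligible_hp_rel_frontier:
 fixes S :: "'a::euclidean_space set"
 assumes S: "convex S" and n: "norm n = 1" and b: "\<And>y. y \<in> S \<Longrightarrow> n \<bullet> y = b"
 shows "negligible {x. hp n b x \<in> S - rel_interior S}"
proof -
 have nn: "n \<bullet> n = 1" using n by (simp add: norm_eq_1)
 define C where "C = {x + y |x y. x \<in> S \<and> y \<in> span {n}}"
 have hp: "hp n b (y + v) = y" if "y \<in> S" and v: "v \<in> span {n}" for y v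
 proof -
  obtain k where "v = k *\<^sub>R n" using v by (auto simp: span_singleton)
  then show ?thesis using b[OF \<open>y \<in> S\<close>] nn by (simp add: hp_def inner_add_right)
 qed
 have C: "C = S + span {n}" by (auto simp: C_def set_plus_def)
 have cC: "convex C" unfolding C by (intro convex_set_plus S subspace_imp_convex subspace_span)
 have "{x. hp n b x \<in> S - rel_interior S} \<subseteq> frontier C"
 proof
  fix x assume x: "x \<in> {x. hp n b x \<in> S - rel_interior S}"
  have "x = hp n b x + (n \<bullet> x - b) *\<^sub>R n" by (simp add: hp_def)
  then have "x \<in> C" unfolding C_def using x span_base[of n "{n}"] span_scale by blast
  moreover have "x \<notin> interior C"
  proof
   assume "x \<in> interior C"
   then have "x \<in> rel_interior C" using interior_subset_rel_interior by blast
   also have "rel_interior C = rel_interior S + rel_interior (span {n})"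
    unfolding C by (intro rel_interior_sum S subspace_imp_convex subspace_span)
   finally obtain y v where "x = y + v" "y \<in> rel_interior S" "v \<in> rel_interior (span {n})"
    by (auto simp: set_plus_def)
   then have "hp n b x \<in> rel_interior S" using hp rel_interior_subset by (metis subsetD)
   then show False using x by auto
  qed
  ultimately show "x \<in> frontier C" using closure_subset by (auto simp: frontier_def)
 qed
 then show ?thesis using negligible_convex_frontier[OF cC] negligible_subset by blast
qed

lemma negligible_hp_other_hyperplane:
 assumes n: "norm n = 1" and m: "norm m = 1" and ne: "m = n \<Longrightarrow> b \<noteq> c" "m = -n \<Longrightarrow> b \<noteq> - c"
 shows "negligible {x. m \<bullet> hp n b x = c}"
proof -
 have nn: "n \<bullet> n = 1" "m \<bullet> m = 1" using n m by (simp_all add: norm_eq_1)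
 have eq: "m \<bullet> hp n b x = (m - (m \<bullet> n) *\<^sub>R n) \<bullet> x + b * (m \<bullet> n)" for x
  by (simp add: hp_def inner_diff_left inner_diff_right algebra_simps)
 show ?thesis
 proof (cases "m - (m \<bullet> n) *\<^sub>R n = 0")
  case False
  have "{x. m \<bullet> hp n b x = c} = {x. (m - (m \<bullet> n) *\<^sub>R n) \<bullet> x = c - b * (m \<bullet> n)}"
   unfolding eq by (auto simp: algebra_simps)
  then show ?thesis using negligible_hyperplane[of "m - (m \<bullet> n) *\<^sub>R n"] False by auto
 next
  case True
  then have mn: "m = (m \<bullet> n) *\<^sub>R n" by simp
  then have "\<bar>m \<bullet> n\<bar> = 1" using n m by (metis mult.right_neutral norm_scaleR)
  then have "(m \<bullet> n = 1 \<and> m = n) \<or> (m \<bullet> n = -1 \<and> m = -n)" using mn by (metis abs_eq_iff' abs_neg_one abs_one scaleR_minus1_left scaleR_one)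
  then have "{x. m \<bullet> hp n b x = c} = {}" unfolding eq True using ne by auto
  then show ?thesis by simp
 qed
qed

section \<open>Cells as limits of smooth bumps\<close>

definition face_level :: "'a::euclidean_space set \<Rightarrow> 'a set \<Rightarrow> real" where
 "face_level K s = outward_normal K s \<bullet> (SOME y. y \<in> s)"

text \<open>The flux through the face \<open>s\<close>, written as an integral over the unit prism on which the field is
  constant in the normal direction.\<close>

definition face_flux :: "('a::euclidean_space \<Rightarrow> 'a) \<Rightarrow> 'a set \<Rightarrow> 'a set \<Rightarrow> real" where
 "face_flux V K s = (LINT x:prism s|lborel. V (hp (outward_normal K s) (face_level K s) x) \<bullet> outward_normal K s)"

lemma prism_eq:
 fixes s :: "'a::euclidean_space set"
 assumes s: "aff_dim s = int DIM('a) - 1" and n: "norm n = 1" and b: "\<And>y. y \<in> s \<Longrightarrow> n \<bullet> y = b"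
 shows "prism s = {x. hp n b x \<in> s \<and> \<bar>n \<bullet> x - b\<bar> \<le> 1/2}"
proof -
 have nn: "n \<bullet> n = 1" using n by (simp add: norm_eq_1)
 let ?P = "\<lambda>n. norm n = 1 \<and> (\<forall>y\<in>s. \<forall>z\<in>s. n \<bullet> (y - z) = 0)"
 define m where "m = (SOME n. ?P n)"
 have "?P n" using n b by (simp add: inner_diff_right)
 then have Pm: "?P m" unfolding m_def by (rule someI)
 have mn: "m = n \<or> m = - n"
 proof (rule unit_normal_unique[OF s])
  show "n \<bullet> (y - z) = 0" if "y \<in> s" "z \<in> s" for y z
   using b[OF that(1)] b[OF that(2)] by (simp add: inner_diff_right)
 qed (use Pm n in blast)+
 have "prism s = {y + t *\<^sub>R m | y t. y \<in> s \<and> \<bar>t\<bar> \<le> 1/2}" by (simp add: prism_def Let_def m_def)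
 also have "\<dots> = {y + t *\<^sub>R n | y t. y \<in> s \<and> \<bar>t\<bar> \<le> 1/2}"
  using mn
 proof
  assume "m = - n"
  then have "y + t *\<^sub>R m = y + (-t) *\<^sub>R n" "y + t *\<^sub>R n = y + (-t) *\<^sub>R m" for y t by auto
  then show ?thesis by (intro Collect_cong) (metis abs_minus_cancel)
 qed simp
 also have "\<dots> = {x. hp n b x \<in> s \<and> \<bar>n \<bullet> x - b\<bar> \<le> 1/2}"
 proof (intro equalityI subsetI)
  fix x assume "x \<in> {y + t *\<^sub>R n | y t. y \<in> s \<and> \<bar>t\<bar> \<le> 1/2}"
  then obtain y t where "x = y + t *\<^sub>R n" "y \<in> s" "\<bar>t\<bar> \<le> 1/2" by blast
  then show "x \<in> {x. hp n b x \<in> s \<and> \<bar>n \<bullet> x - b\<bar> \<le> 1/2}"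
   using b[of y] by (simp add: hp_def inner_add_right nn)
 next
  fix x assume x: "x \<in> {x. hp n b x \<in> s \<and> \<bar>n \<bullet> x - b\<bar> \<le> 1/2}"
  have "x = hp n b x + (n \<bullet> x - b) *\<^sub>R n" by (simp add: hp_def)
  then show "x \<in> {y + t *\<^sub>R n | y t. y \<in> s \<and> \<bar>t\<bar> \<le> 1/2}" using x by blast
 qed
 finally show ?thesis .
qed

lemma AE_lborel_pair_fst:
 assumes "AE x in lborel. P x"
 shows "AE z in (lborel :: 'a::euclidean_space measure) \<Otimes>\<^sub>M (lborel :: 'b::euclidean_space measure). P (fst z)"
proof -
 obtain N where N: "{x \<in> space lborel. \<not> P x} \<subseteq> N" "emeasure lborel N = 0" "N \<in> sets lborel"
  using AE_E[OF assms] by blast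
 have "N \<times> UNIV \<in> null_sets ((lborel :: 'a measure) \<Otimes>\<^sub>M (lborel :: 'b measure))"
 proof (rule null_setsI)
  have "emeasure ((lborel :: 'a measure) \<Otimes>\<^sub>M (lborel :: 'b measure)) (N \<times> UNIV) = emeasure lborel N * emeasure (lborel :: 'b measure) UNIV"
   using N(3) by (intro lborel.emeasure_pair_measure_Times) auto
  then show "emeasure ((lborel :: 'a measure) \<Otimes>\<^sub>M (lborel :: 'b measure)) (N \<times> UNIV) = 0" using N(2) by simp
  show "N \<times> (UNIV :: 'b set) \<in> sets (lborel \<Otimes>\<^sub>M lborel)" using N(3) by (intro pair_measureI) auto
 qed
 then show ?thesis by (rule AE_I') (use N(1) in auto)
qed

lemma negligible_AE_lborel: "negligible S \<Longrightarrow> AE x in lborel. x \<notin> S"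
 using AE_not_in[of S lebesgue] by (simp add: negligible_iff_null_sets AE_completion_iff)

context mesh begin

lemma face_level:
 assumes "K \<in> cells T" "s \<in> faces T" "s \<subseteq> frontier K"
 shows "y \<in> s \<Longrightarrow> outward_normal K s \<bullet> y = face_level K s"
  "x \<in> K \<Longrightarrow> outward_normal K s \<bullet> x < face_level K s"
  "x \<in> closure K \<Longrightarrow> outward_normal K s \<bullet> x \<le> face_level K s"
proof -
 define q where "q = (SOME y. y \<in> s)"
 have q: "q \<in> s" unfolding q_def using face(5)[OF assms(2)] by (simp add: some_in_eq)
 have l: "face_level K s = outward_normal K s \<bullet> q" by (simp add: face_level_def q_def)
 show "outward_normal K s \<bullet> y = face_level K s" if "y \<in> s"
  using normal(2)[OF assms that q] l by (simp add: inner_diff_right)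
 show *: "outward_normal K s \<bullet> x < face_level K s" if "x \<in> K" for x
  using normal(3)[OF assms that q] l by (simp add: inner_diff_right)
 have "closure K \<subseteq> {x. outward_normal K s \<bullet> x \<le> face_level K s}"
 proof (rule closure_minimal)
  show "K \<subseteq> {x. outward_normal K s \<bullet> x \<le> face_level K s}" using * less_imp_le by blast
 qed (rule closed_halfspace_le)
 then show "x \<in> closure K \<Longrightarrow> outward_normal K s \<bullet> x \<le> face_level K s" by auto
qed

lemma cell_facesD:
 assumes "s \<in> cell_faces T K" shows "s \<in> faces T" "s \<subseteq> frontier K" "s \<in> internal_faces T"
 using assms by (auto simp: cell_faces_def internal_faces_def)

lemma face_prism:
 assumes "K \<in> cells T" "s \<in> faces T" "s \<subseteq> frontier K"
 shows "prism s = {x. hp (outward_normal K s) (face_level K s) x \<in> s \<and> \<bar>outward_normal K s \<bullet> x - face_level K s\<bar> \<le> 1/2}"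
 using assms by (intro prism_eq face normal face_level)

lemma closure_interior_\<Omega>: "closure (interior \<Omega>) = \<Omega>"
 using convex_closure_interior[OF \<Omega>(2) int\<Omega>] \<Omega>(3) by simp

lemma supporting_hyperplane_\<Omega>:
 assumes "y \<notin> interior \<Omega>" shows "\<exists>a. a \<noteq> 0 \<and> (\<forall>x\<in>\<Omega>. a \<bullet> x \<le> a \<bullet> y)"
proof -
 obtain a b where ab: "a \<noteq> 0" "\<forall>x\<in>interior \<Omega>. a \<bullet> x \<le> b" "\<forall>x\<in>{y}. b \<le> a \<bullet> x"
  using separating_hyperplane_sets[of "interior \<Omega>" "{y}"] \<Omega>(2) int\<Omega> assms by auto
 have "closure (interior \<Omega>) \<subseteq> {x. a \<bullet> x \<le> b}"
  by (rule closure_minimal) (use ab in \<open>auto simp: closed_halfspace_le\<close>)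
 then show ?thesis using ab closure_interior_\<Omega> by (intro exI[of _ a]) force
qed

text \<open>The hyperplane of an internal face of \<open>K\<close> has a cell on either side, so it does not support
 \<open>\<Omega>\<close>. Hence no face of \<open>K\<close> inside that hyperplane lies on the boundary of \<open>\<Omega>\<close>.\<close>

lemma rel_interior_coplanar_face:
 assumes K: "K \<in> cells T" and s: "s \<in> cell_faces T K" and t: "t \<in> faces T" "t \<subseteq> frontier K"
  and eq: "outward_normal K t = outward_normal K s" "face_level K t = face_level K s"
  and y: "y \<in> rel_interior t"
 shows "y \<in> interior \<Omega>"
proof (rule ccontr)
 assume "y \<notin> interior \<Omega>"
 then obtain a where a: "a \<noteq> 0" "\<And>x. x \<in> \<Omega> \<Longrightarrow> a \<bullet> x \<le> a \<bullet> y" using supporting_hyperplane_\<Omega> by blast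
 have yt: "y \<in> t" using y rel_interior_subset by auto
 have tO: "t \<subseteq> \<Omega>" using t(2) cell(5)[OF K] by (auto simp: frontier_def)
 have const: "a \<bullet> z = a \<bullet> y" if "z \<in> t" for z
  using linear_max_at_rel_interior_const[OF face(3)[OF t(1)] y, of a z] a(2) tO that by blast
 let ?n = "outward_normal K s"
 note sD = cell_facesD[OF s]
 have "a /\<^sub>R norm a = ?n \<or> a /\<^sub>R norm a = - ?n"
 proof (rule unit_normal_unique[OF face(2)[OF t(1)]])
  show "norm (a /\<^sub>R norm a) = 1" using a by simp
  show "norm ?n = 1" using normal(1)[OF K sD(1,2)] .
  show "(a /\<^sub>R norm a) \<bullet> (u - v) = 0" if "u \<in> t" "v \<in> t" for u v
   using const[OF that(1)] const[OF that(2)] by (simp add: inner_diff_right)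
  show "?n \<bullet> (u - v) = 0" if "u \<in> t" "v \<in> t" for u v
   using normal(2)[OF K t that] eq by simp
 qed
 then have an: "a = norm a *\<^sub>R ?n \<or> a = norm a *\<^sub>R (- ?n)"
 proof -
  have h: "norm a *\<^sub>R (a /\<^sub>R norm a) = a" using a(1) by simp
  assume "a /\<^sub>R norm a = ?n \<or> a /\<^sub>R norm a = - ?n"
  then show ?thesis using h by metis
 qed
 have ny: "?n \<bullet> y = face_level K s" using face_level(1)[OF K t yt] eq by simp
 have pos: "norm a > 0" using a by simp
 show False using an
 proof
  assume *: "a = norm a *\<^sub>R ?n"
  obtain K1 K2 where KK: "face_cells T s = {K1, K2}" "K1 \<noteq> K2" "K1 \<in> cells T" "K2 \<in> cells T"
   using internal_face_cells[OF sD(3)] by metis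
  have "K \<in> face_cells T s" using K sD by (auto simp: face_cells_def)
  then obtain L where L: "face_cells T s = {K, L}" "K \<noteq> L" "L \<in> cells T" using KK by auto
  have "L \<in> face_cells T s" using L by auto
  then have sL: "s \<subseteq> frontier L" by (auto simp: face_cells_def)
  have nL: "outward_normal L s = - ?n" using centers_along_normal(3)[OF sD(3) L(1,2)] .
  obtain x where x: "x \<in> L" using cell(1)[OF L(3)] by auto
  obtain q where q: "q \<in> s" using face(5)[OF sD(1)] by auto
  have "?n \<bullet> x > ?n \<bullet> q" using normal(3)[OF L(3) sD(1) sL x q] nL by (simp add: inner_diff_right)
  then have "?n \<bullet> x > ?n \<bullet> y" using face_level(1)[OF K sD(1,2) q] ny by simp
  then have "norm a * (?n \<bullet> x) > norm a * (?n \<bullet> y)" using pos by simp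
  moreover have "a \<bullet> x \<le> a \<bullet> y" using a(2) x cell(6)[OF L(3)] by auto
  ultimately show False using * by (metis inner_scaleR_left not_le)
 next
  assume *: "a = norm a *\<^sub>R (- ?n)"
  obtain x where x: "x \<in> K" using cell(1)[OF K] by auto
  have "?n \<bullet> x < ?n \<bullet> y" using face_level(2)[OF K sD(1,2) x] ny by simp
  then have "norm a * (- ?n \<bullet> x) > norm a * (- ?n \<bullet> y)" using pos by simp
  moreover have "a \<bullet> x \<le> a \<bullet> y" using a(2) x cell(6)[OF K] by auto
  ultimately show False using * by (metis inner_scaleR_left not_le)
 qed
qed

text \<open>A segment in the interior of \<open>\<Omega>\<close> that leaves a cell does so through an internal face.\<close>

lemma cell_eq_halfspaces:
 assumes K: "K \<in> cells T" and x: "x \<in> interior \<Omega>"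
  and lt: "\<And>s. s \<in> cell_faces T K \<Longrightarrow> outward_normal K s \<bullet> x < face_level K s"
 shows "x \<in> K"
proof (rule ccontr)
 assume xK: "x \<notin> K"
 obtain p where p: "p \<in> K" using cell(1)[OF K] by auto
 have pO: "p \<in> interior \<Omega>" using p cell(2,6)[OF K] by (meson interior_maximal subsetD)
 have "closed_segment p x \<inter> frontier K \<noteq> {}"
  by (rule connected_Int_frontier) (use p xK in auto)
 then obtain z where z: "z \<in> closed_segment p x" "z \<in> frontier K" by auto
 have zO: "z \<in> interior \<Omega>" using z(1) pO x closed_segment_subset[of p "interior \<Omega>" x] \<Omega>(2) by auto
 obtain t where t: "t \<in> faces T" "t \<subseteq> frontier K" "z \<in> t" using frontier_cell[OF K] z(2) by blast
 have "\<not> t \<subseteq> frontier \<Omega>" using t(3) zO by (auto simp: frontier_def)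
 then have tK: "t \<in> cell_faces T K" using face_boundary_or_internal[OF t(1)] t by (auto simp: cell_faces_def)
 have "closed_segment p x \<subseteq> {u. outward_normal K t \<bullet> u < face_level K t}"
  by (rule closed_segment_subset) (use face_level(2)[OF K t(1,2) p] lt[OF tK] in \<open>auto simp: convex_halfspace_lt\<close>)
 then show False using face_level(1)[OF K t] z(1) by auto
qed

text \<open>Different faces of a cell may lie in one hyperplane, so the bump below is a product over
  hyperplanes rather than over faces.\<close>

definition planes :: "'a set \<Rightarrow> ('a \<times> real) set" where
 "planes K = (\<lambda>s. (outward_normal K s, face_level K s)) ` cell_faces T K"

definition bump :: "'a set \<Rightarrow> real \<Rightarrow> 'a \<Rightarrow> real" where
 "bump K d x = (\<Prod>i\<in>planes K. smoothstep ((snd i - fst i \<bullet> x) / d))"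

definition bump_grad :: "'a set \<Rightarrow> real \<Rightarrow> 'a \<Rightarrow> 'a" where
 "bump_grad K d x = - (\<Sum>i\<in>planes K. (tent ((snd i - fst i \<bullet> x) / d) / d *
   (\<Prod>j\<in>planes K - {i}. smoothstep ((snd j - fst j \<bullet> x) / d))) *\<^sub>R fst i)"

lemma finite_planes: "finite (planes K)" by (simp add: planes_def finite_internal)

lemma bump_gradient:
 assumes "d > 0" shows "has_gradient_on S (bump K d) (bump_grad K d)"
 unfolding has_gradient_on_def
proof
 fix x
 have f: "((\<lambda>x. smoothstep ((snd i - fst i \<bullet> x) / d)) has_derivative
   (\<lambda>v. tent ((snd i - fst i \<bullet> x) / d) * (- (fst i \<bullet> v) / d))) (at x within S)" for i :: "'a \<times> real"
 proof -
  have g: "((\<lambda>x. (snd i - fst i \<bullet> x) / d) has_derivative (\<lambda>v. - (fst i \<bullet> v) / d)) (at x within S)"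
   using assms by (auto intro!: derivative_eq_intros)
  have "(smoothstep has_derivative (*) (tent ((snd i - fst i \<bullet> x) / d))) (at ((snd i - fst i \<bullet> x) / d))"
   using smoothstep_derivative[of "(snd i - fst i \<bullet> x) / d" UNIV] by (simp add: has_field_derivative_def)
  from has_derivative_compose[OF g this] show ?thesis .
 qed
 have "((\<lambda>x. \<Prod>i\<in>planes K. smoothstep ((snd i - fst i \<bullet> x) / d)) has_derivative
  (\<lambda>v. \<Sum>i\<in>planes K. tent ((snd i - fst i \<bullet> x) / d) * (- (fst i \<bullet> v) / d) *
    (\<Prod>j\<in>planes K - {i}. smoothstep ((snd j - fst j \<bullet> x) / d)))) (at x within S)"
  by (rule has_derivative_prod) (rule f)
 moreover have "(\<lambda>v. \<Sum>i\<in>planes K. tent ((snd i - fst i \<bullet> x) / d) * (- (fst i \<bullet> v) / d) *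
    (\<Prod>j\<in>planes K - {i}. smoothstep ((snd j - fst j \<bullet> x) / d))) = (\<lambda>v. bump_grad K d x \<bullet> v)"
  by (auto simp: bump_grad_def inner_sum_left sum_negf[symmetric] intro!: sum.cong)
 ultimately show "(bump K d has_derivative (\<lambda>v. bump_grad K d x \<bullet> v)) (at x within S)"
  by (simp add: bump_def[abs_def])
qed

lemma continuous_bump_grad: "continuous_on S (bump_grad K d)"
proof (cases "d = 0")
 case True then show ?thesis by (simp add: bump_grad_def[abs_def])
next
 case False then show ?thesis
 unfolding bump_grad_def
 by (intro continuous_intros continuous_on_prod' continuous_on_compose2[OF continuous_tent[of UNIV]]
   continuous_on_compose2[OF continuous_smoothstep[of UNIV]]) auto
qed

lemma continuous_bump: "continuous_on S (bump K d)"
proof (cases "d = 0")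
 case True then show ?thesis by (simp add: bump_def[abs_def])
next
 case False then show ?thesis
 unfolding bump_def
 by (intro continuous_intros continuous_on_prod' continuous_on_compose2[OF continuous_smoothstep[of UNIV]]) auto
qed

lemma bump_range: "0 \<le> bump K d x" "bump K d x \<le> 1"
 unfolding bump_def by (auto intro!: prod_nonneg prod_le_1 smoothstep)

lemma bump_borel [measurable]: "bump K d \<in> borel_measurable borel"
 by (intro borel_measurable_continuous_onI continuous_bump)

lemma tendsto_smoothstep_scaled:
 fixes y :: "nat \<Rightarrow> real"
 assumes "y \<longlonglongrightarrow> c"
 shows "c > 0 \<Longrightarrow> (\<lambda>m. smoothstep (y m / (1 / real (Suc m)))) \<longlonglongrightarrow> 1"
  "c < 0 \<Longrightarrow> eventually (\<lambda>m. smoothstep (y m / (1 / real (Suc m))) = 0) sequentially"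
proof -
 assume c: "c > 0"
 have "eventually (\<lambda>m. y m > c / 2) sequentially" using order_tendstoD(1)[OF assms, of "c/2"] c by simp
 moreover have "eventually (\<lambda>m. real (Suc m) \<ge> 2 / c) sequentially"
  using eventually_ge_at_top[of "nat \<lceil>2 / c\<rceil>"] by eventually_elim linarith
 ultimately have "eventually (\<lambda>m. smoothstep (y m / (1 / real (Suc m))) = 1) sequentially"
 proof eventually_elim
  case (elim m)
  have "1 = (c/2) * (2 / c)" using c by simp
  also have "\<dots> \<le> y m * real (Suc m)" using elim c by (intro mult_mono) auto
  finally show ?case by (intro smoothstep(2)) simp
 qed
 then show "(\<lambda>m. smoothstep (y m / (1 / real (Suc m)))) \<longlonglongrightarrow> 1" by (rule tendsto_eventually)
next
 assume c: "c < 0"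
 have "eventually (\<lambda>m. y m < 0) sequentially" using order_tendstoD(2)[OF assms, of 0] c by simp
 then show "eventually (\<lambda>m. smoothstep (y m / (1 / real (Suc m))) = 0) sequentially"
  by eventually_elim (auto intro!: smoothstep(1) mult_nonpos_nonneg)
qed

lemma bump_tendsto:
 assumes K: "K \<in> cells T" and x: "x \<in> interior \<Omega>"
 shows "(\<lambda>m. bump K (1 / real (Suc m)) x) \<longlonglongrightarrow> indicator K x"
proof (cases "x \<in> K")
 case True
 have "(\<lambda>m. \<Prod>i\<in>planes K. smoothstep ((snd i - fst i \<bullet> x) / (1 / real (Suc m)))) \<longlonglongrightarrow> (\<Prod>i\<in>planes K. 1)"
 proof (rule tendsto_prod)
  fix i assume "i \<in> planes K"
  then have "snd i - fst i \<bullet> x > 0" using face_level(2)[OF K _ _ True] cell_facesD by (auto simp: planes_def)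
  then show "(\<lambda>m. smoothstep ((snd i - fst i \<bullet> x) / (1 / real (Suc m)))) \<longlonglongrightarrow> 1"
   by (intro tendsto_smoothstep_scaled(1)[OF tendsto_const])
 qed
 then show ?thesis using True by (simp add: bump_def)
next
 case False
 then obtain s where s: "s \<in> cell_faces T K" "\<not> outward_normal K s \<bullet> x < face_level K s"
  using cell_eq_halfspaces[OF K x] by blast
 have "bump K (1 / real (Suc m)) x = 0" for m
  unfolding bump_def
  by (rule prod_zero[OF finite_planes], rule bexI[of _ "(outward_normal K s, face_level K s)"])
   (use s in \<open>auto simp: planes_def intro!: smoothstep(1) mult_nonpos_nonneg\<close>)
 then show ?thesis using False by simp
qed

end

section \<open>Flux balance of a cell\<close>

context mesh begin

text \<open>Near a point of the hyperplane that is relatively interior to a face, the other steps of the bump are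
  eventually 1; at a point of the hyperplane outside the cell one of them is eventually 0, or the
  point is outside \<open>\<Omega>\<close>. The exceptional points project onto lower-dimensional sets.\<close>

lemma layer_pointwise_limit:
 assumes K: "K \<in> cells T" and i: "(n, b) \<in> planes K" and V: "continuous_on \<Omega> V"
 defines "y \<equiv> \<lambda>x m s. hp n b x - (1 / real (Suc m) * s) *\<^sub>R n"
 shows "AE x in lborel. \<forall>s. (\<lambda>m. indicator \<Omega> (y x m s) * (V (y x m s) \<bullet> n) *
    (\<Prod>j\<in>planes K - {(n, b)}. smoothstep ((snd j - fst j \<bullet> y x m s) / (1 / real (Suc m)))))
   \<longlonglongrightarrow> (\<Sum>t\<in>{t \<in> cell_faces T K. (outward_normal K t, face_level K t) = (n, b)}.
     indicator t (hp n b x) * (V (hp n b x) \<bullet> n))"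
proof -
 obtain s0 where s0: "s0 \<in> cell_faces T K" "n = outward_normal K s0" "b = face_level K s0"
  using i by (auto simp: planes_def)
 note s0D = cell_facesD[OF s0(1)]
 have n: "norm n = 1" "n \<bullet> n = 1" using normal(1)[OF K s0D(1,2)] s0(2) by (auto simp: norm_eq_1)
 obtain p where p: "p \<in> K" using cell(1)[OF K] by auto
 have np: "n \<bullet> p < b" using face_level(2)[OF K s0D(1,2) p] s0 by simp
 let ?Fs = "{t \<in> faces T. t \<subseteq> frontier K}"
 have "AE x in lborel. \<forall>t\<in>?Fs. (outward_normal K t, face_level K t) \<noteq> (n, b) \<longrightarrow>
   outward_normal K t \<bullet> hp n b x \<noteq> face_level K t"
 proof (intro AE_finite_allI)
  fix t assume t: "t \<in> ?Fs"
  show "AE x in lborel. (outward_normal K t, face_level K t) \<noteq> (n, b) \<longrightarrow>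
   outward_normal K t \<bullet> hp n b x \<noteq> face_level K t"
  proof (cases "(outward_normal K t, face_level K t) = (n, b)")
   case False
   have "negligible {x. outward_normal K t \<bullet> hp n b x = face_level K t}"
   proof (rule negligible_hp_other_hyperplane[OF n(1)])
    show "norm (outward_normal K t) = 1" using normal(1)[OF K] t by auto
    show "b \<noteq> face_level K t" if "outward_normal K t = n" using that False by auto
    show "b \<noteq> - face_level K t" if "outward_normal K t = - n"
     using face_level(2)[OF K _ _ p, of t] t that np by auto
   qed
   from negligible_AE_lborel[OF this] show ?thesis by (rule AE_mp) auto
  qed simp
 next
  show "finite ?Fs" using finite_faces by simp
 qed
 moreover have "AE x in lborel. \<forall>t\<in>?Fs. (outward_normal K t, face_level K t) = (n, b) \<longrightarrow>
   hp n b x \<notin> t - rel_interior t"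
 proof (intro AE_finite_allI)
  fix t assume t: "t \<in> ?Fs"
  show "AE x in lborel. (outward_normal K t, face_level K t) = (n, b) \<longrightarrow>
   hp n b x \<notin> t - rel_interior t"
  proof (cases "(outward_normal K t, face_level K t) = (n, b)")
   case True
   have "negligible {x. hp n b x \<in> t - rel_interior t}"
    by (rule negligible_hp_rel_frontier[OF face(3) n(1)]) (use t True face_level(1)[OF K] in auto)
   from negligible_AE_lborel[OF this] show ?thesis by (rule AE_mp) auto
  qed auto
 next
  show "finite ?Fs" using finite_faces by simp
 qed
 ultimately show ?thesis
 proof eventually_elim
  case (elim x)
  define P where "P = hp n b x"
  have nP: "n \<bullet> P = b" using n by (simp add: P_def hp_def inner_diff_right)
  have y: "(\<lambda>m. y x m s) \<longlonglongrightarrow> P" for s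
  proof -
   have "(\<lambda>m. P - (1 / real (Suc m) * s) *\<^sub>R n) \<longlonglongrightarrow> P - (0 * s) *\<^sub>R n"
    using LIMSEQ_inverse_real_of_nat by (intro tendsto_intros) (simp add: inverse_eq_divide)
   then show ?thesis by (simp add: y_def P_def)
  qed
  have tO: "t \<subseteq> \<Omega>" if "t \<in> cell_faces T K" for t
   using cell_facesD[OF that] cell(5)[OF K] by (auto simp: frontier_def)
  let ?A = "{t \<in> cell_faces T K. (outward_normal K t, face_level K t) = (n, b)}"
  let ?R = "\<Sum>t\<in>?A. indicator t P * (V P \<bullet> n)"
  let ?E = "\<lambda>s m. indicator \<Omega> (y x m s) * (V (y x m s) \<bullet> n) *
    (\<Prod>j\<in>planes K - {(n, b)}. smoothstep ((snd j - fst j \<bullet> y x m s) / (1 / real (Suc m))))"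
  have "?E s \<longlonglongrightarrow> ?R" for s
  proof -
   have yj: "(\<lambda>m. snd j - fst j \<bullet> y x m s) \<longlonglongrightarrow> snd j - fst j \<bullet> P" for j :: "'a \<times> real"
    by (intro tendsto_intros y)
   consider "P \<notin> \<Omega>" | "P \<in> \<Omega>" "\<exists>j\<in>planes K - {(n, b)}. snd j - fst j \<bullet> P < 0"
    | "P \<in> \<Omega>" "\<forall>j\<in>planes K - {(n, b)}. snd j - fst j \<bullet> P \<ge> 0" by force
   then show ?thesis
   proof cases
    case 1
    have "eventually (\<lambda>m. y x m s \<in> - \<Omega>) sequentially"
     using topological_tendstoD[OF y, of "- \<Omega>"] 1 \<Omega>(3) by (simp add: open_Compl)
    then have ev: "eventually (\<lambda>m. ?E s m = 0) sequentially" by eventually_elim simp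
    have R0: "?R = 0" using 1 tO by (intro sum.neutral) (auto simp: indicator_def)
    show ?thesis unfolding R0 by (rule tendsto_eventually[OF ev])
   next
    case 2
    then obtain j where j: "j \<in> planes K - {(n, b)}" "snd j - fst j \<bullet> P < 0" by blast
    have "eventually (\<lambda>m. smoothstep ((snd j - fst j \<bullet> y x m s) / (1 / real (Suc m))) = 0) sequentially"
     by (rule tendsto_smoothstep_scaled(2)[OF yj j(2)])
    then have ev: "eventually (\<lambda>m. ?E s m = 0) sequentially"
     by eventually_elim (use j finite_planes[of K] in \<open>auto intro!: prod_zero\<close>)
    have R0: "?R = 0"
    proof (rule sum.neutral, safe)
     fix t assume t: "t \<in> cell_faces T K"
     obtain u where u: "u \<in> cell_faces T K" "j = (outward_normal K u, face_level K u)"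
      using j by (auto simp: planes_def)
     have "P \<notin> closure K" using face_level(3)[OF K, of u P] cell_facesD[OF u(1)] u j by auto
     then show "indicator t P * (V P \<bullet> outward_normal K t) = 0"
      using cell_facesD[OF t] by (auto simp: indicator_def frontier_def)
    qed
    show ?thesis unfolding R0 by (rule tendsto_eventually[OF ev])
   next
    case 3
    have pos: "snd j - fst j \<bullet> P > 0" if j: "j \<in> planes K - {(n, b)}" for j
    proof -
     obtain u where u: "u \<in> cell_faces T K" "j = (outward_normal K u, face_level K u)"
      using j by (auto simp: planes_def)
     then have "outward_normal K u \<bullet> P \<noteq> face_level K u"
      using elim(1) cell_facesD[OF u(1)] j unfolding P_def by auto
     moreover have "snd j - fst j \<bullet> P \<ge> 0" using 3(2) j by blast
     ultimately show ?thesis using u(2) by auto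
    qed
    have pO: "p \<in> interior \<Omega>" using p cell(2,6)[OF K] by (meson interior_maximal subsetD)
    have inK: "P - e *\<^sub>R (P - p) \<in> K" if e: "0 < e" "e \<le> 1" for e
    proof (rule cell_eq_halfspaces[OF K])
     show "P - e *\<^sub>R (P - p) \<in> interior \<Omega>"
      by (rule mem_interior_convex_shrink[OF \<Omega>(2) pO 3(1) e])
     fix u assume u: "u \<in> cell_faces T K"
     let ?m = "outward_normal K u"
     have le: "?m \<bullet> P \<le> face_level K u"
     proof (cases "(?m, face_level K u) = (n, b)")
      case True then show ?thesis using nP by simp
     next
      case False
      then have "(?m, face_level K u) \<in> planes K - {(n, b)}" using u by (auto simp: planes_def)
      then show ?thesis using pos by force
     qed
     have lt: "?m \<bullet> p < face_level K u" using face_level(2)[OF K cell_facesD(1,2)[OF u] p] .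
     have "?m \<bullet> (P - e *\<^sub>R (P - p)) = (1 - e) * (?m \<bullet> P) + e * (?m \<bullet> p)"
      by (simp add: inner_diff_right algebra_simps)
     also have "\<dots> < (1 - e) * face_level K u + e * face_level K u"
      using le lt e by (intro add_le_less_mono mult_left_mono mult_strict_left_mono) auto
     finally show "?m \<bullet> (P - e *\<^sub>R (P - p)) < face_level K u" by (simp add: algebra_simps)
    qed
    have "P \<in> closure K"
     unfolding closure_sequential
    proof (intro exI[of _ "\<lambda>k. P - (1 / real (Suc k)) *\<^sub>R (P - p)"] conjI allI)
     show "P - (1 / real (Suc k)) *\<^sub>R (P - p) \<in> K" for k by (rule inK) auto
     have "(\<lambda>k. P - (1 / real (Suc k)) *\<^sub>R (P - p)) \<longlonglongrightarrow> P - 0 *\<^sub>R (P - p)"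
      using LIMSEQ_inverse_real_of_nat by (intro tendsto_intros) (simp add: inverse_eq_divide)
     then show "(\<lambda>k. P - (1 / real (Suc k)) *\<^sub>R (P - p)) \<longlonglongrightarrow> P" by simp
    qed
    moreover have "P \<notin> K" using face_level(2)[OF K s0D(1,2), of P] s0 nP by auto
    ultimately have "P \<in> frontier K" by (simp add: frontier_def interior_open[OF cell(2)[OF K]])
    then obtain t where t: "t \<in> faces T" "t \<subseteq> frontier K" "P \<in> t" using frontier_cell[OF K] by blast
    have idx: "(outward_normal K t, face_level K t) = (n, b)"
     using elim(1) t face_level(1)[OF K t] unfolding P_def by blast
    have rel: "P \<in> rel_interior t" using elim(2) t idx unfolding P_def by blast
    have Pint: "P \<in> interior \<Omega>"
     using rel_interior_coplanar_face[OF K s0(1) t(1,2) _ _ rel] idx s0 by auto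
    then have "\<not> t \<subseteq> frontier \<Omega>" using t(3) by (auto simp: frontier_def)
    then have tK: "t \<in> cell_faces T K" using face_boundary_or_internal[OF t(1)] t by (auto simp: cell_faces_def)
    have uniq: "u = t" if u: "u \<in> ?A" "P \<in> u" for u
    proof (rule ccontr)
     assume "u \<noteq> t"
     have uf: "u \<in> faces T" "u \<subseteq> frontier K" using u cell_facesD by auto
     then have "P \<in> rel_interior u" using elim(2) u unfolding P_def by blast
     then show False using faces_disjoint[OF uf(1) t(1) \<open>u \<noteq> t\<close>] rel by blast
    qed
    have "?R = (\<Sum>u\<in>?A. if u = t then V P \<bullet> n else 0)"
    proof (rule sum.cong[OF refl])
     fix u assume u: "u \<in> ?A"
     show "indicator u P * (V P \<bullet> n) = (if u = t then V P \<bullet> n else 0)"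
     proof (cases "P \<in> u")
      case True then show ?thesis using uniq[OF u True] by simp
     next
      case False
      then have "u \<noteq> t" using t(3) by blast
      then show ?thesis using False by simp
     qed
    qed
    also have "\<dots> = V P \<bullet> n" using tK idx finite_internal by (subst sum.delta) auto
    finally have R: "?R = V P \<bullet> n" .
    have evO: "eventually (\<lambda>m. y x m s \<in> interior \<Omega>) sequentially"
     using topological_tendstoD[OF y, of "interior \<Omega>"] Pint by simp
    have "(\<lambda>m. (1::real)) \<longlonglongrightarrow> 1" by simp
    then have i1: "(\<lambda>m. indicator \<Omega> (y x m s) :: real) \<longlonglongrightarrow> 1"
     by (rule Lim_transform_eventually) (use evO interior_subset in \<open>auto elim!: eventually_mono simp: indicator_def\<close>)
    have "isCont V P" using continuous_on_interior[OF V Pint] .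
    then have i2: "(\<lambda>m. V (y x m s)) \<longlonglongrightarrow> V P" using isCont_tendsto_compose y by blast
    have i3: "(\<lambda>m. \<Prod>j\<in>planes K - {(n, b)}. smoothstep ((snd j - fst j \<bullet> y x m s) / (1 / real (Suc m)))) \<longlonglongrightarrow> (\<Prod>j\<in>planes K - {(n, b)}. 1)"
     by (intro tendsto_prod tendsto_smoothstep_scaled(1)[OF yj] pos)
    have "?E s \<longlonglongrightarrow> 1 * (V P \<bullet> n) * (\<Prod>j\<in>planes K - {(n, b)}. 1)"
     by (intro tendsto_mult i1 i3 tendsto_inner i2 tendsto_const)
    then show ?thesis using R by simp
   qed
  qed
  then show ?case unfolding P_def by blast
 qed
qed

end

lemma lebesgue_on_eq_lborel:
 fixes h :: "'a::euclidean_space \<Rightarrow> 'b::euclidean_space"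
 assumes "S \<in> sets borel" "(\<lambda>x. indicator S x *\<^sub>R h x) \<in> borel_measurable borel"
 shows "int_on S h = (\<integral>x. indicator S x *\<^sub>R h x \<partial>lborel)"
 using assms by (simp add: integral_restrict_space integral_completion)

lemma AE_lebesgue_on_interior:
 fixes S :: "'a::euclidean_space set"
 assumes "convex S" "S \<in> sets lebesgue"
 shows "AE x in lebesgue_on S. x \<in> interior S"
proof -
 have "AE x in lebesgue. x \<notin> frontier S"
  using negligible_convex_frontier[OF assms(1)] AE_not_in by (auto simp: negligible_iff_null_sets)
 then have "AE x in lebesgue. x \<in> S \<longrightarrow> x \<in> interior S"
  by (rule AE_mp) (use closure_subset in \<open>auto simp: frontier_def\<close>)
 then show ?thesis using assms(2) by (simp add: AE_restrict_space_iff)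
qed

context mesh begin

lemma \<Omega>_sets [measurable]: "\<Omega> \<in> sets borel" "\<Omega> \<in> sets lebesgue"
 using borel_compact[OF \<Omega>(1)] fmeasurableD[OF lmeasurable_compact[OF \<Omega>(1)]] .

lemma bump_integral_tendsto:
 assumes K: "K \<in> cells T" and f: "integrable (lebesgue_on \<Omega>) f"
 shows "(\<lambda>m. int_on \<Omega> (\<lambda>x. bump K (1 / real (Suc m)) x * f x)) \<longlonglongrightarrow> int_on K f"
proof -
 have Ks: "K \<in> sets borel" "K \<in> sets lebesgue" using cell(2)[OF K] by auto
 have b: "bump K d \<in> borel_measurable (lebesgue_on \<Omega>)" for d
  using measurable_completion[of "bump K d" lborel borel] measurable_restrict_space1 by auto
 have iK: "(indicator K :: _ \<Rightarrow> real) \<in> borel_measurable (lebesgue_on \<Omega>)"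
  by (intro measurable_restrict_space1 borel_measurable_indicator Ks)
 have "(\<lambda>m. int_on \<Omega> (\<lambda>x. bump K (1 / real (Suc m)) x * f x)) \<longlonglongrightarrow>
  int_on \<Omega> (\<lambda>x. indicator K x * f x)"
 proof (rule integral_dominated_convergence[where w = "\<lambda>x. \<bar>f x\<bar>"])
  show "(\<lambda>x. indicator K x * f x) \<in> borel_measurable (lebesgue_on \<Omega>)" using iK f by auto
  show "(\<lambda>x. bump K (1 / real (Suc m)) x * f x) \<in> borel_measurable (lebesgue_on \<Omega>)" for m
   using b f by auto
  show "integrable (lebesgue_on \<Omega>) (\<lambda>x. \<bar>f x\<bar>)" using f by simp
  show "AE x in lebesgue_on \<Omega>. (\<lambda>m. bump K (1 / real (Suc m)) x * f x) \<longlonglongrightarrow> indicator K x * f x"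
   using AE_lebesgue_on_interior[OF \<Omega>(2) \<Omega>_sets(2)]
   by eventually_elim (intro tendsto_intros bump_tendsto K)
  show "AE x in lebesgue_on \<Omega>. norm (bump K (1 / real (Suc m)) x * f x) \<le> \<bar>f x\<bar>" for m
   using bump_range by (intro AE_I2) (auto simp: abs_mult intro!: mult_left_le_one_le)
 qed
 also have "int_on \<Omega> (\<lambda>x. indicator K x * f x) = int_on K f"
  using cell(6)[OF K] Ks \<Omega>_sets(2)
  by (auto simp: integral_restrict_space indicator_def intro!: Bochner_Integration.integral_cong)
 finally show ?thesis .
qed

lemma face_sets: "s \<in> faces T \<Longrightarrow> s \<in> sets borel" using face(4) borel_compact by auto

text \<open>Each plane contributes in the limit the fluxes through the faces that it contains.\<close>

lemma plane_flux_tendsto: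
 assumes K: "K \<in> cells T" and i: "(n, b) \<in> planes K" and V: "continuous_on \<Omega> V"
 shows "(\<lambda>m. \<integral>x. (indicator \<Omega> x * (V x \<bullet> n) *
    (\<Prod>j\<in>planes K - {(n, b)}. smoothstep ((snd j - fst j \<bullet> x) / (1 / real (Suc m))))) *
    (tent ((b - n \<bullet> x) / (1 / real (Suc m))) / (1 / real (Suc m))) \<partial>lborel)
   \<longlonglongrightarrow> (\<Sum>t\<in>{t \<in> cell_faces T K. (outward_normal K t, face_level K t) = (n, b)}. face_flux V K t)"
proof -
 obtain s0 where s0: "s0 \<in> cell_faces T K" "n = outward_normal K s0" "b = face_level K s0"
  using i by (auto simp: planes_def)
 note s0D = cell_facesD[OF s0(1)]
 have n: "norm n = 1" "n \<bullet> n = 1" using normal(1)[OF K s0D(1,2)] s0(2) by (auto simp: norm_eq_1)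
 let ?A = "{t \<in> cell_faces T K. (outward_normal K t, face_level K t) = (n, b)}"
 let ?H = "\<lambda>m x. indicator \<Omega> x * (V x \<bullet> n) *
    (\<Prod>j\<in>planes K - {(n, b)}. smoothstep ((snd j - fst j \<bullet> x) / (1 / real (Suc m))))"
 let ?y = "\<lambda>m z. hp n b (fst z) - (1 / real (Suc m) * snd z) *\<^sub>R n"
 let ?G = "\<lambda>m z. indicator {-1/2..1/2} (n \<bullet> fst z - b) * tent (snd z) * ?H m (?y m z)"
 let ?R = "\<lambda>x. \<Sum>t\<in>?A. indicator t (hp n b x) * (V (hp n b x) \<bullet> n)"
 let ?L = "\<lambda>z. indicator {-1/2..1/2} (n \<bullet> fst z - b) * tent (snd z) * ?R (fst z)"
 let ?M = "(lborel :: 'a measure) \<Otimes>\<^sub>M (lborel :: real measure)"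
 have tO: "t \<subseteq> \<Omega>" if "t \<in> ?A" for t
  using that cell_facesD[of t K] cell(5)[OF K] by (auto simp: frontier_def)
 have Vm[measurable]: "(\<lambda>x. indicator \<Omega> x * (V x \<bullet> n)) \<in> borel_measurable borel"
 proof -
  have "(\<lambda>x. indicator \<Omega> x *\<^sub>R (V x \<bullet> n)) \<in> borel_measurable borel"
   by (intro borel_measurable_continuous_on_indicator continuous_intros V) auto
  then show ?thesis by simp
 qed
 have Hm[measurable]: "?H m \<in> borel_measurable borel" for m
  by measurable
 have Rm[measurable]: "?R \<in> borel_measurable borel"
 proof (intro borel_measurable_sum)
  fix t assume t: "t \<in> ?A"
  then have ts: "t \<in> sets borel" using face_sets cell_facesD by auto
  have "(\<lambda>x. indicator t (hp n b x) * (indicator \<Omega> (hp n b x) * (V (hp n b x) \<bullet> n))) \<in> borel_measurable borel"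
   using ts by measurable
  moreover have "indicator t (hp n b x) * (indicator \<Omega> (hp n b x) * (V (hp n b x) \<bullet> n)) = indicator t (hp n b x) * (V (hp n b x) \<bullet> n)" for x
   using tO[OF t] by (auto simp: indicator_def)
  ultimately show "(\<lambda>x. indicator t (hp n b x) * (V (hp n b x) \<bullet> n)) \<in> borel_measurable borel" by simp
 qed
 have Gm[measurable]: "?G m \<in> borel_measurable ?M" for m by measurable
 have Lm[measurable]: "?L \<in> borel_measurable ?M" by measurable
 obtain C where C: "\<And>x. x \<in> \<Omega> \<Longrightarrow> norm (V x) \<le> C"
  using compact_imp_bounded[OF compact_continuous_image[OF V \<Omega>(1)]] by (auto simp: bounded_iff)
 then have C0: "C \<ge> 0" using \<Omega>(5) norm_ge_zero order_trans by blast
 obtain R where R: "\<And>x. x \<in> \<Omega> \<Longrightarrow> norm x \<le> R"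
  using \<Omega>(4) by (auto simp: bounded_iff)
 have Hb: "\<bar>?H m x\<bar> \<le> C * indicator \<Omega> x" for m :: nat and x
 proof -
  have "\<bar>V x \<bullet> n\<bar> \<le> C" if "x \<in> \<Omega>" using Cauchy_Schwarz_ineq2[of "V x" n] C[OF that] n by simp
  moreover have "\<bar>\<Prod>j\<in>planes K - {(n, b)}. smoothstep ((snd j - fst j \<bullet> x) / (1 / real (Suc m)))\<bar> \<le> 1"
   using smoothstep(3,4) by (auto simp: abs_prod intro!: prod_le_1)
  ultimately show ?thesis
   by (auto simp: indicator_def abs_mult intro: order_trans[OF mult_mono[of _ C _ 1]])
 qed
 let ?D = "cball 0 (R + 2) \<times> {0..1::real}"
 let ?W = "\<lambda>z. 2 * C * indicator ?D z :: real"
 have W: "integrable ?M ?W"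
 proof -
  have "emeasure (lborel :: ('a \<times> real) measure) ?D < \<infinity>"
   by (intro emeasure_bounded_finite bounded_Times) auto
  then have "integrable (lborel :: ('a \<times> real) measure) (indicator ?D :: _ \<Rightarrow> real)"
   by (intro integrable_real_indicator) (auto intro!: borel_closed closed_Times)
  then show ?thesis unfolding lborel_prod by simp
 qed
 have Gb: "norm (?G m z) \<le> ?W z" for m :: nat and z
 proof (cases "?G m z = 0")
  case False
  then have "tent (snd z) \<noteq> 0" by auto
  then have "snd z \<in> {0..1}" using tent(2)[of "snd z"] by (meson atLeastAtMost_iff le_cases)
  with False have 1: "snd z \<in> {0..1}" "n \<bullet> fst z - b \<in> {-1/2..1/2}" "?y m z \<in> \<Omega>"
   by (auto simp: indicator_def split: if_splits)
  have "fst z = ?y m z + (1 / real (Suc m) * snd z) *\<^sub>R n + (n \<bullet> fst z - b) *\<^sub>R n" by (simp add: hp_def)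
  also have "norm \<dots> \<le> R + (1 / real (Suc m) * snd z) + \<bar>n \<bullet> fst z - b\<bar>"
   using R[OF 1(3)] 1(1) n by (intro order_trans[OF norm_triangle_ineq] add_mono) auto
  also have "\<dots> \<le> R + 1 + 1"
  proof (intro add_mono order_refl)
   have "1 / real (Suc m) * snd z \<le> 1 * 1" using 1(1) by (intro mult_mono) auto
   then show "1 / real (Suc m) * snd z \<le> 1" by simp
  qed (use 1 in auto)
  finally have "z \<in> ?D" using 1 by (auto simp: mem_Times_iff)
  moreover have "\<bar>tent (snd z)\<bar> \<le> 2" using tent(1,3)[of "snd z"] by simp
  moreover have "\<bar>?H m (?y m z)\<bar> \<le> C" using Hb[where m = m and x = "?y m z"] 1 by simp
  ultimately show ?thesis using 1 C0 by (simp add: abs_mult mult_mono)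
 qed (use C0 in auto)
 have "(\<lambda>m. integral\<^sup>L ?M (?G m)) \<longlonglongrightarrow> integral\<^sup>L ?M ?L \<and> integrable ?M ?L"
 proof -
  have ae: "AE z in ?M. (\<lambda>m. ?G m z) \<longlonglongrightarrow> ?L z"
   using AE_lborel_pair_fst[OF layer_pointwise_limit[OF K i V]]
  proof eventually_elim
   case (elim z)
   show ?case by (rule tendsto_mult[OF tendsto_const elim[THEN spec, of "snd z"]])
  qed
  have bd: "AE z in ?M. norm (?G m z) \<le> ?W z" for m using Gb by (intro AE_I2)
  show ?thesis
   using integral_dominated_convergence[OF Lm Gm W ae bd] integrable_dominated_convergence[OF Lm Gm W ae bd] by blast
 qed
 then have lim: "(\<lambda>m. integral\<^sup>L ?M (?G m)) \<longlonglongrightarrow> integral\<^sup>L ?M ?L" and Li: "integrable ?M ?L" by auto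
 have "integral\<^sup>L ?M ?L = (\<integral>x. \<integral>s. ?L (x, s) \<partial>lborel \<partial>lborel)"
  using lborel_pair.integral_fst'[OF Li] by simp
 also have "\<dots> = (\<integral>x. indicator {-1/2..1/2} (n \<bullet> x - b) * ?R x \<partial>lborel)"
 proof (rule Bochner_Integration.integral_cong[OF refl])
  fix x :: 'a
  have "(\<integral>s. ?L (x, s) \<partial>lborel) = (\<integral>s. (indicator {-1/2..1/2} (n \<bullet> x - b) * ?R x) * tent s \<partial>lborel)"
   by (simp add: mult_ac)
  also have "\<dots> = indicator {-1/2..1/2} (n \<bullet> x - b) * ?R x" using integral_tent by simp
  finally show "(\<integral>s. ?L (x, s) \<partial>lborel) = indicator {-1/2..1/2} (n \<bullet> x - b) * ?R x" .
 qed
 also have "\<dots> = (\<integral>x. (\<Sum>t\<in>?A. indicator (prism t) x *\<^sub>R (V (hp n b x) \<bullet> n)) \<partial>lborel)"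
 proof (rule Bochner_Integration.integral_cong[OF refl])
  fix x :: 'a
  have "indicator {-1/2..1/2} (n \<bullet> x - b) * indicator t (hp n b x) = (indicator (prism t) x :: real)" if "t \<in> ?A" for t
  proof -
   have p: "prism t = {x. hp n b x \<in> t \<and> \<bar>n \<bullet> x - b\<bar> \<le> 1/2}"
    using that cell_facesD[of t K] face_prism[OF K, of t] by auto
   have "\<bar>n \<bullet> x - b\<bar> \<le> 1/2 \<longleftrightarrow> n \<bullet> x - b \<in> {-1/2..1/2}"
    unfolding abs_le_iff atLeastAtMost_iff by linarith
   then have "x \<in> prism t \<longleftrightarrow> n \<bullet> x - b \<in> {-1/2..1/2} \<and> hp n b x \<in> t" unfolding p by blast
   then show ?thesis by (simp only: indicator_def of_bool_conj)
  qed
  then show "indicator {-1/2..1/2} (n \<bullet> x - b) * ?R x = (\<Sum>t\<in>?A. indicator (prism t) x *\<^sub>R (V (hp n b x) \<bullet> n))"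
   by (simp add: sum_distrib_left mult.assoc[symmetric])
 qed
 also have "\<dots> = (\<Sum>t\<in>?A. (\<integral>x. indicator (prism t) x *\<^sub>R (V (hp n b x) \<bullet> n) \<partial>lborel))"
 proof (rule Bochner_Integration.integral_sum)
  fix t assume t: "t \<in> ?A"
  then have ts: "t \<in> sets borel" using face_sets cell_facesD by auto
  have p: "prism t = {x. hp n b x \<in> t \<and> \<bar>n \<bullet> x - b\<bar> \<le> 1/2}"
   using t cell_facesD[of t K] face_prism[OF K, of t] by auto
  have pm: "prism t \<in> sets borel" unfolding p using ts by measurable
  have bt: "hp n b x \<in> \<Omega>" "norm x \<le> R + 2" if "x \<in> prism t" for x
  proof -
   show 1: "hp n b x \<in> \<Omega>" using that p tO[OF t] by auto
   have "x = hp n b x + (n \<bullet> x - b) *\<^sub>R n" by (simp add: hp_def)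
   also have "norm \<dots> \<le> R + 1/2" using that p R[OF 1] n by (intro order_trans[OF norm_triangle_ineq] add_mono) auto
   finally show "norm x \<le> R + 2" by simp
  qed
  have "integrable lborel (\<lambda>x. C * indicator (cball (0::'a) (R+2)) x :: real)"
   using emeasure_bounded_finite[of "cball (0::'a) (R+2)"] by (intro integrable_mult_right integrable_real_indicator) auto
  then show "integrable lborel (\<lambda>x. indicator (prism t) x *\<^sub>R (V (hp n b x) \<bullet> n))"
  proof (rule Bochner_Integration.integrable_bound)
   have "(\<lambda>x. indicator (prism t) x *\<^sub>R (indicator \<Omega> (hp n b x) * (V (hp n b x) \<bullet> n))) \<in> borel_measurable borel"
    using pm by measurable
   moreover have "indicator (prism t) x *\<^sub>R (indicator \<Omega> (hp n b x) * (V (hp n b x) \<bullet> n)) = indicator (prism t) x *\<^sub>R (V (hp n b x) \<bullet> n)" for x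
    using bt by (auto simp: indicator_def)
   ultimately show "(\<lambda>x. indicator (prism t) x *\<^sub>R (V (hp n b x) \<bullet> n)) \<in> borel_measurable lborel"
    by (simp only: measurable_lborel1 measurable_lborel2)
   show "AE x in lborel. norm (indicator (prism t) x *\<^sub>R (V (hp n b x) \<bullet> n)) \<le> norm (C * indicator (cball 0 (R+2)) x :: real)"
   proof (rule AE_I2)
    fix x
    show "norm (indicator (prism t) x *\<^sub>R (V (hp n b x) \<bullet> n)) \<le> norm (C * indicator (cball 0 (R+2)) x :: real)"
     using Cauchy_Schwarz_ineq2[of "V (hp n b x)" n] C[of "hp n b x"] n bt[of x] C0 by (auto simp: indicator_def)
   qed
  qed
 qed
 also have "\<dots> = (\<Sum>t\<in>?A. face_flux V K t)"
  by (intro sum.cong refl) (auto simp: face_flux_def set_lebesgue_integral_def)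
 finally have "integral\<^sup>L ?M ?L = (\<Sum>t\<in>?A. face_flux V K t)" .
 moreover have "(\<integral>x. ?H m x * (tent ((b - n \<bullet> x) / (1 / real (Suc m))) / (1 / real (Suc m))) \<partial>lborel) = integral\<^sup>L ?M (?G m)" for m
  by (subst integral_layer[OF n(1) _ tent_borel Hm tent(1)]) (auto simp: case_prod_unfold)
 ultimately show ?thesis using lim by simp
qed

text \<open>The divergence theorem on a cell for a field that is only continuous, with a divergence known only in
  the weak sense. Testing with the bumps of the cell, each derivative of a step concentrates on its
  hyperplane. As the test functions need not vanish on the boundary of \<open>\<Omega>\<close>, faces on the boundary do
  not contribute.\<close>

lemma cell_flux_balance:
 assumes K: "K \<in> cells T" and f: "integrable (lebesgue_on \<Omega>) f" and V: "continuous_on \<Omega> V"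
  and weak: "\<And>\<psi> g. has_gradient_on \<Omega> \<psi> g \<Longrightarrow> continuous_on \<Omega> g \<Longrightarrow>
   int_on \<Omega> (\<lambda>x. \<psi> x * f x) = int_on \<Omega> (\<lambda>x. V x \<bullet> g x)"
 shows "int_on K f = - (\<Sum>s\<in>cell_faces T K. face_flux V K s)"
proof -
 let ?I = "\<lambda>i m. \<integral>x. (indicator \<Omega> x * (V x \<bullet> fst i) *
    (\<Prod>j\<in>planes K - {i}. smoothstep ((snd j - fst j \<bullet> x) / (1 / real (Suc m))))) *
    (tent ((snd i - fst i \<bullet> x) / (1 / real (Suc m))) / (1 / real (Suc m))) \<partial>lborel"
 have eq: "int_on \<Omega> (\<lambda>x. bump K (1 / real (Suc m)) x * f x) = - (\<Sum>i\<in>planes K. ?I i m)" for m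
 proof -
  let ?d = "1 / real (Suc m)"
  let ?h = "\<lambda>i x. (V x \<bullet> fst i) *
    (\<Prod>j\<in>planes K - {i}. smoothstep ((snd j - fst j \<bullet> x) / ?d)) * (tent ((snd i - fst i \<bullet> x) / ?d) / ?d)"
  have ch: "continuous_on \<Omega> (?h i)" for i
   by (intro continuous_intros V continuous_on_prod' continuous_on_compose2[OF continuous_tent[of UNIV]]
   continuous_on_compose2[OF continuous_smoothstep[of UNIV]]) auto
  have ih: "integrable lborel (\<lambda>x. indicator \<Omega> x *\<^sub>R ?h i x)" for i
   by (rule borel_integrable_compact[OF \<Omega>(1) ch])
  have "int_on \<Omega> (\<lambda>x. bump K ?d x * f x) = int_on \<Omega> (\<lambda>x. V x \<bullet> bump_grad K ?d x)"
   by (intro weak bump_gradient continuous_bump_grad) simp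
  also have "\<dots> = (\<integral>x. indicator \<Omega> x *\<^sub>R (V x \<bullet> bump_grad K ?d x) \<partial>lborel)"
   by (intro lebesgue_on_eq_lborel \<Omega>_sets borel_measurable_continuous_on_indicator continuous_on_inner V continuous_bump_grad)
  also have "\<dots> = (\<integral>x. - (\<Sum>i\<in>planes K. indicator \<Omega> x *\<^sub>R ?h i x) \<partial>lborel)"
   by (intro Bochner_Integration.integral_cong refl)
    (simp add: bump_grad_def inner_sum_right sum_distrib_left mult_ac)
  also have "\<dots> = - (\<Sum>i\<in>planes K. (\<integral>x. indicator \<Omega> x *\<^sub>R ?h i x \<partial>lborel))"
   by (subst Bochner_Integration.integral_minus, subst Bochner_Integration.integral_sum) (use ih in auto)
  finally show ?thesis by (simp add: mult.assoc)
 qed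
 have "(\<lambda>m. \<Sum>i\<in>planes K. ?I i m) \<longlonglongrightarrow>
  (\<Sum>i\<in>planes K. \<Sum>t\<in>{t \<in> cell_faces T K. (outward_normal K t, face_level K t) = i}. face_flux V K t)"
  using plane_flux_tendsto[OF K _ V] by (intro tendsto_sum) auto
 also have "(\<Sum>i\<in>planes K. \<Sum>t\<in>{t \<in> cell_faces T K. (outward_normal K t, face_level K t) = i}. face_flux V K t)
   = (\<Sum>t\<in>cell_faces T K. face_flux V K t)"
  by (rule sum.group) (auto simp: finite_internal finite_planes, auto simp: planes_def)
 finally have "(\<lambda>m. - (\<Sum>i\<in>planes K. ?I i m)) \<longlonglongrightarrow> - (\<Sum>t\<in>cell_faces T K. face_flux V K t)"
  by (rule tendsto_minus)
 then show ?thesis using bump_integral_tendsto[OF K f] LIMSEQ_unique unfolding eq by blast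
qed

end

section \<open>A bounded field with prescribed divergence\<close>

lemma integrable_lborel_bounded_support:
 fixes f :: "'a::euclidean_space \<Rightarrow> 'b::{banach,second_countable_topology}"
 assumes "f \<in> borel_measurable borel" "\<And>x. norm (f x) \<le> C" "\<And>x. x \<notin> S \<Longrightarrow> f x = 0" "bounded S"
 shows "integrable lborel f"
proof -
 obtain R where R: "\<And>x. x \<in> S \<Longrightarrow> norm x \<le> R" using assms(4) by (auto simp: bounded_iff)
 have C: "0 \<le> C" using assms(2) norm_ge_zero order_trans by blast
 have "emeasure lborel (cball (0::'a) R) < \<infinity>" by (intro emeasure_bounded_finite) auto
 then have "integrable lborel (\<lambda>x. C * indicator (cball (0::'a) R) x :: real)"
  by (intro integrable_mult_right integrable_real_indicator) auto
 then show ?thesis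
 proof (rule Bochner_Integration.integrable_bound)
  show "AE x in lborel. norm (f x) \<le> norm (C * indicator (cball (0::'a) R) x :: real)"
  proof (rule AE_I2)
   fix x show "norm (f x) \<le> norm (C * indicator (cball (0::'a) R) x :: real)"
    using assms(2)[of x] assms(3)[of x] R[of x] C by (cases "x \<in> S") (auto simp: indicator_def)
  qed
 qed (use assms(1) in simp)
qed

lemma integral_lborel_fst:
 fixes f :: "'a::euclidean_space \<times> 'b::euclidean_space \<Rightarrow> 'c::{banach,second_countable_topology}"
 assumes "integrable lborel f"
 shows "(\<integral>x. \<integral>y. f (x, y) \<partial>lborel \<partial>lborel) = integral\<^sup>L lborel f"
 using lborel_pair.integral_fst'[of f] assms by (simp add: lborel_prod)

lemma integral_lborel_snd:
 fixes f :: "'a::euclidean_space \<times> 'b::euclidean_space \<Rightarrow> 'c::{banach,second_countable_topology}"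
 assumes "integrable lborel f"
 shows "(\<integral>y. \<integral>x. f (x, y) \<partial>lborel \<partial>lborel) = integral\<^sup>L lborel f"
 using lborel_pair.integral_snd[of "\<lambda>x y. f (x, y)"] assms by (simp add: lborel_prod)

lemma integral_lborel_affine:
 fixes f :: "'a::euclidean_space \<Rightarrow> real"
 assumes [measurable]: "f \<in> borel_measurable borel" and c: "c \<noteq> 0"
 shows "(\<integral>x. f x \<partial>lborel) = \<bar>c\<bar> ^ DIM('a) * (\<integral>x. f (t + c *\<^sub>R x) \<partial>lborel)"
proof -
 have "(\<integral>x. f x \<partial>lborel) = (\<integral>x. f x \<partial>density (distr lborel borel (\<lambda>x. t + c *\<^sub>R x)) (\<lambda>_. ennreal (\<bar>c\<bar> ^ DIM('a))))"
  using lborel_affine[OF c, of t] by simp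
 also have "\<dots> = \<bar>c\<bar> ^ DIM('a) * (\<integral>x. f (t + c *\<^sub>R x) \<partial>lborel)"
  by (subst integral_density) (auto simp: integral_distr)
 finally show ?thesis .
qed

lemma gradient_segment_integral:
 fixes h :: "'a::euclidean_space \<Rightarrow> 'a"
 assumes \<Omega>: "convex \<Omega>" and h: "has_gradient_on \<Omega> \<psi> h" "continuous_on \<Omega> h" and xy: "x \<in> \<Omega>" "y \<in> \<Omega>"
 shows "(\<integral>s. indicator {0..1/2} s *\<^sub>R ((x - y) \<bullet> h ((1 - s) *\<^sub>R y + s *\<^sub>R x)) \<partial>lborel) = \<psi> ((1/2) *\<^sub>R (x + y)) - \<psi> y"
proof -
 let ?p = "\<lambda>s. (1 - s) *\<^sub>R y + s *\<^sub>R x"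
 have mem: "?p s \<in> \<Omega>" if "s \<in> {0..1/2}" for s using that convexD_alt[OF \<Omega> xy(2,1)] by auto
 have "(\<integral>s. indicator {0..1/2} s *\<^sub>R ((x - y) \<bullet> h (?p s)) \<partial>lborel) = \<psi> (?p (1/2)) - \<psi> (?p 0)"
 proof (rule integral_FTC_Icc)
  fix s :: real assume s: "0 \<le> s" "s \<le> 1/2"
  have p: "(?p has_derivative (\<lambda>v. v *\<^sub>R (x - y))) (at s within {0..1/2})"
   by (auto intro!: derivative_eq_intros simp: algebra_simps)
  have "(\<psi> has_derivative (\<lambda>v. h (?p s) \<bullet> v)) (at (?p s) within ?p ` {0..1/2})"
   by (rule has_derivative_subset[of _ _ _ \<Omega>]) (use h(1) mem s in \<open>auto simp: has_gradient_on_def\<close>)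
  from has_derivative_in_compose[OF p this]
  have "((\<lambda>s. \<psi> (?p s)) has_derivative (\<lambda>v. h (?p s) \<bullet> (v *\<^sub>R (x - y)))) (at s within {0..1/2})" .
  then show "((\<lambda>s. \<psi> (?p s)) has_vector_derivative (x - y) \<bullet> h (?p s)) (at s within {0..1/2})"
   by (simp add: has_vector_derivative_def inner_commute)
 next
  have "continuous_on {0..1/2} (\<lambda>s. h (?p s))"
   by (rule continuous_on_compose2[OF h(2)]) (use mem in \<open>auto intro!: continuous_intros\<close>)
  then show "continuous_on {0..1/2} (\<lambda>s. (x - y) \<bullet> h (?p s))" by (intro continuous_intros)
 qed simp
 then show ?thesis by (simp add: algebra_simps)
qed

lemma bounded_convergence_lborel:
 fixes f :: "nat \<Rightarrow> 'a::euclidean_space \<Rightarrow> 'b::{banach,second_countable_topology}"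
 assumes f: "\<And>m. f m \<in> borel_measurable borel" and l: "l \<in> borel_measurable borel"
  and C: "\<And>m x. norm (f m x) \<le> C" and S: "\<And>m x. x \<notin> S \<Longrightarrow> f m x = 0" "bounded S"
  and lim: "AE x in lborel. (\<lambda>m. f m x) \<longlonglongrightarrow> l x"
 shows "(\<lambda>m. integral\<^sup>L lborel (f m)) \<longlonglongrightarrow> integral\<^sup>L lborel l"
proof -
 obtain R where R: "\<And>x. x \<in> S \<Longrightarrow> norm x \<le> R" using S(2) by (auto simp: bounded_iff)
 have C0: "0 \<le> C" using C norm_ge_zero order_trans by blast
 have "emeasure lborel (cball (0::'a) R) < \<infinity>" by (intro emeasure_bounded_finite) auto
 then have w: "integrable lborel (\<lambda>x. C * indicator (cball (0::'a) R) x :: real)"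
  by (intro integrable_mult_right integrable_real_indicator) auto
 show ?thesis
 proof (rule integral_dominated_convergence[OF _ _ w lim])
  show "AE x in lborel. norm (f m x) \<le> C * indicator (cball 0 R) x" for m
  proof (rule AE_I2)
   fix x show "norm (f m x) \<le> C * indicator (cball 0 R) x"
    using C[of m x] S(1)[of x m] R[of x] C0 by (cases "x \<in> S") (auto simp: indicator_def)
  qed
 qed (use f l in auto)
qed

text \<open>A Bogovskii-type formula adapted to convex sets. For a function \<open>g\<close> of zero mean, by symmetry in
  \<open>x\<close> and \<open>y\<close>,
  \<open>\<integral> \<psi> g = (1 / |\<Omega>|) \<integral>\<integral> (g x - g y) (\<psi> ((x + y) / 2) - \<psi> y)\<close>, and the increment of \<open>\<psi>\<close> along the half
  segment is the integral of its gradient at \<open>z = (1 - s) y + s x\<close> for \<open>s \<in> [0, 1/2]\<close>. Substituting \<open>z\<close> for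
  \<open>y\<close> exhibits the field. Only half of each segment is used in order that the Jacobian
  \<open>(1 - s)\<^sup>-\<^sup>d\<close> stays below \<open>2\<^sup>d\<close>.\<close>

theorem bounded_field_with_divergence:
 fixes \<Omega> :: "'a::euclidean_space set" and g :: "'a \<Rightarrow> real"
 assumes \<Omega>: "compact \<Omega>" "convex \<Omega>" "interior \<Omega> \<noteq> {}"
  and g[measurable]: "g \<in> borel_measurable borel" and A: "\<And>x. \<bar>g x\<bar> \<le> A"
  and N: "closed N" "negligible N" and cont: "\<And>x. x \<in> interior \<Omega> \<Longrightarrow> x \<notin> N \<Longrightarrow> isCont g x"
  and mean: "(\<integral>x. indicator \<Omega> x * g x \<partial>lborel) = 0"
 shows "\<exists>W. continuous_on UNIV W \<and> (\<forall>z. norm (W z) \<le> 2 ^ DIM('a) * 2 * diameter \<Omega> * A) \<and>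
  (\<forall>\<psi> h. has_gradient_on \<Omega> \<psi> h \<and> continuous_on \<Omega> h \<longrightarrow>
    (\<integral>x. indicator \<Omega> x * (\<psi> x * g x) \<partial>lborel) = (\<integral>x. indicator \<Omega> x * (W x \<bullet> h x) \<partial>lborel))"
proof -
 define v where "v = measure lborel \<Omega>"
 have \<Omega>m[measurable]: "\<Omega> \<in> sets borel" using borel_compact[OF \<Omega>(1)] .
 have finO: "emeasure lborel \<Omega> < \<infinity>" using emeasure_bounded_finite[OF compact_imp_bounded[OF \<Omega>(1)]] .
 have v: "v > 0"
 proof -
  have "\<not> negligible \<Omega>" using \<Omega>(3) by (meson interior_subset negligible_subset open_interior open_not_negligible)
  then have "emeasure lborel \<Omega> \<noteq> 0" by (auto simp: negligible_iff_null_sets null_sets_def)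
  then show ?thesis unfolding v_def using finO by (simp add: measure_def enn2real_positive_iff top.not_eq_extremum zero_less_iff_neq_zero)
 qed
 define D where "D = diameter \<Omega>"
 have D: "norm (x - y) \<le> D" if "x \<in> \<Omega>" "y \<in> \<Omega>" for x y
  using diameter_bounded_bound[OF compact_imp_bounded[OF \<Omega>(1)] that] by (simp add: D_def dist_norm)
 have A0: "A \<ge> 0" using A[of 0] by linarith
 have D0: "D \<ge> 0" unfolding D_def by (rule diameter_ge_0[OF compact_imp_bounded[OF \<Omega>(1)]])
 \<comment> \<open>the end point \<open>y\<close> for which \<open>z = (1 - s) y + s x\<close>, where \<open>p = (s, x)\<close>\<close>
 define Y where "Y z p = (1 / (1 - fst p)) *\<^sub>R (z - fst p *\<^sub>R snd p)" for z :: 'a and p :: "real \<times> 'a"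
 define G where "G z p = (indicator {0..1/2} (fst p) * indicator \<Omega> (snd p) * indicator \<Omega> (Y z p) * (g (snd p) - g (Y z p)) *
   (1 / (1 - fst p)) ^ DIM('a)) *\<^sub>R (snd p - Y z p)" for z and p :: "real \<times> 'a"
 define W where "W z = (1 / v) *\<^sub>R integral\<^sup>L lborel (G z)" for z
 have Ym: "(\<lambda>q. Y (fst q) (snd q)) \<in> borel_measurable borel"
  unfolding Y_def by (simp flip: borel_prod)
 have Gm: "(\<lambda>q. G (fst q) (snd q)) \<in> borel_measurable borel"
  using Ym unfolding G_def by (simp flip: borel_prod)
 have Gz: "G z \<in> borel_measurable borel" for z
  using measurable_compose[OF _ Gm, of "\<lambda>p. (z, p)" borel] by (simp flip: borel_prod)
 have G0: "G z p = 0" if "p \<notin> {0..1/2} \<times> \<Omega>" for z p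
  using that by (cases p) (auto simp: G_def indicator_def)
 have Gb: "norm (G z p) \<le> 2 ^ DIM('a) * (2 * A) * D" for z p
 proof (cases "G z p = 0")
  case False
  then have m: "fst p \<in> {0..1/2}" "snd p \<in> \<Omega>" "Y z p \<in> \<Omega>" by (auto simp: G_def indicator_def split: if_splits)
  have "(1 / (1 - fst p)) ^ DIM('a) \<le> 2 ^ DIM('a)"
   using m by (intro power_mono) (auto simp: field_simps)
  moreover have "\<bar>g (snd p) - g (Y z p)\<bar> \<le> 2 * A" using A[of "snd p"] A[of "Y z p"] by linarith
  moreover have "norm (snd p - Y z p) \<le> D" using D m by blast
  moreover have "norm (G z p) = (1 / (1 - fst p)) ^ DIM('a) * \<bar>g (snd p) - g (Y z p)\<bar> * norm (snd p - Y z p)"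
   using m by (simp add: G_def abs_mult power_abs)
  ultimately show ?thesis using A0 D0 m by (auto intro!: mult_mono)
 qed (use A0 D0 in auto)
 have Gi: "integrable lborel (G z)" for z
  by (rule integrable_lborel_bounded_support[OF Gz Gb G0], assumption)
   (intro bounded_Times compact_imp_bounded[OF \<Omega>(1)] compact_imp_bounded[OF compact_Icc])
 have Wb: "norm (W z) \<le> 2 ^ DIM('a) * 2 * D * A" for z
 proof -
  have fin: "emeasure lborel ({0..1/2::real} \<times> \<Omega>) < \<infinity>"
   by (intro emeasure_bounded_finite bounded_Times compact_imp_bounded[OF \<Omega>(1)] compact_imp_bounded[OF compact_Icc])
  have meas: "measure lborel ({0..1/2::real} \<times> \<Omega>) = v / 2"
  proof -
   have "measure (lborel \<Otimes>\<^sub>M lborel) ({0..1/2::real} \<times> \<Omega>) = measure lborel {0..1/2::real} * measure lborel \<Omega>"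
    unfolding measure_def by (subst lborel.emeasure_pair_measure_Times) (simp_all add: enn2real_mult)
   then show ?thesis by (simp add: lborel_prod v_def)
  qed
  have ms: "{0..1/2::real} \<times> \<Omega> \<in> sets borel" by (rule borel_compact[OF compact_Times[OF compact_Icc \<Omega>(1)]])
  have "norm (integral\<^sup>L lborel (G z)) \<le> (\<integral>p. norm (G z p) \<partial>lborel)" by (rule integral_norm_bound)
  also have "\<dots> \<le> (\<integral>p. (2 ^ DIM('a) * (2 * A) * D) * indicator ({0..1/2::real} \<times> \<Omega>) p \<partial>lborel)"
  proof (rule integral_mono)
   show "integrable lborel (\<lambda>p. norm (G z p))" using Gi by simp
   show "integrable lborel (\<lambda>p. (2 ^ DIM('a) * (2 * A) * D) * indicator ({0..1/2::real} \<times> \<Omega>) p)"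
    using fin ms by (intro integrable_mult_right integrable_real_indicator) auto
   show "norm (G z p) \<le> (2 ^ DIM('a) * (2 * A) * D) * indicator ({0..1/2::real} \<times> \<Omega>) p" for p
    using G0[of p z] Gb[of z p] by (cases "p \<in> {0..1/2} \<times> \<Omega>") auto
  qed
  also have "\<dots> = 2 ^ DIM('a) * A * D * v" using ms by (simp add: meas)
  finally have "norm (W z) \<le> (1 / v) * (2 ^ DIM('a) * A * D * v)"
   using v by (simp add: W_def pos_divide_le_eq)
  also have "\<dots> = 2 ^ DIM('a) * A * D" using v by simp
  also have "\<dots> \<le> 2 ^ DIM('a) * 2 * D * A" using A0 D0 by (simp add: mult_ac)
  finally show ?thesis .
 qed
 have "continuous_on UNIV (\<lambda>z. integral\<^sup>L lborel (G z))"
  unfolding continuous_on_sequentially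
 proof (intro allI ballI impI, elim conjE)
  fix u and z :: 'a assume u: "u \<longlonglongrightarrow> z"
  let ?B = "N \<union> frontier \<Omega>"
  have B: "closed ?B" "negligible ?B"
   using N negligible_convex_frontier[OF \<Omega>(2)] by auto
  have ae: "AE p in lborel. fst p \<in> {0..1/2} \<longrightarrow> Y z p \<notin> ?B"
  proof -
   have "AE p in lborel \<Otimes>\<^sub>M lborel. fst p \<in> {0..1/2} \<longrightarrow> Y z p \<notin> ?B"
   proof (rule lborel_pair.AE_pair_measure)
    have [measurable]: "?B \<in> sets borel" using B(1) by auto
    have [measurable]: "Y z \<in> borel_measurable (lborel \<Otimes>\<^sub>M lborel)" unfolding Y_def by measurable
    show "{p \<in> space (lborel \<Otimes>\<^sub>M lborel). fst p \<in> {0..1/2} \<longrightarrow> Y z p \<notin> ?B} \<in> sets (lborel \<Otimes>\<^sub>M lborel)"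
     by measurable
    have "AE s in lborel. s \<noteq> (0::real)" by (rule AE_lborel_singleton)
    then show "AE s in lborel. AE x in lborel. fst (s, x) \<in> {0..1/2} \<longrightarrow> Y z (s, x) \<notin> ?B"
    proof eventually_elim
     case (elim s)
     show ?case
     proof (cases "s \<in> {0..1/2}")
      case True
      have "negligible ((\<lambda>y. (1 / s) *\<^sub>R z + (- (1 - s) / s) *\<^sub>R y) ` ?B)"
       by (rule negligible_differentiable_image_negligible[OF order_refl B(2)])
        (intro derivative_intros differentiable_on_scaleR differentiable_on_const differentiable_on_id differentiable_on_add)
      then have "AE x in lborel. x \<notin> (\<lambda>y. (1 / s) *\<^sub>R z + (- (1 - s) / s) *\<^sub>R y) ` ?B"
       using AE_not_in[of _ lebesgue] by (simp add: negligible_iff_null_sets AE_completion_iff)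
      then show ?thesis
      proof eventually_elim
       case (elim x)
       have "x = (1 / s) *\<^sub>R z + (- (1 - s) / s) *\<^sub>R Y z (s, x)"
       proof -
        have "(- (1 - s) / s) * (1 / (1 - s)) = - (1 / s)"
        proof -
         have "1 - s \<noteq> 0" using True by auto
         then have "(1 - s) * (1 / (1 - s)) = 1" by simp
         then show ?thesis by (metis minus_divide_left mult.commute mult_minus_right times_divide_eq_left)
        qed
        then have "(- (1 - s) / s) *\<^sub>R Y z (s, x) = - (1 / s) *\<^sub>R (z - s *\<^sub>R x)"
         unfolding Y_def scaleR_scaleR fst_conv snd_conv by (simp only:)
        then show ?thesis using \<open>s \<noteq> 0\<close> by (simp add: scaleR_diff_right)
       qed
       then show ?case using elim by blast
      qed
     next
      case False then show ?thesis by (intro AE_I2) auto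
     qed
    qed
   qed
   then show ?thesis by (simp only: lborel_prod)
  qed
  have "(\<lambda>m. integral\<^sup>L lborel (G (u m))) \<longlonglongrightarrow> integral\<^sup>L lborel (G z)"
  proof (rule bounded_convergence_lborel[OF Gz Gz Gb G0])
   show "bounded ({0..1/2::real} \<times> \<Omega>)" by (intro bounded_Times compact_imp_bounded[OF \<Omega>(1)] compact_imp_bounded[OF compact_Icc])
   show "AE p in lborel. (\<lambda>m. G (u m) p) \<longlonglongrightarrow> G z p"
    using ae
   proof eventually_elim
    case (elim p)
    show ?case
    proof (cases "fst p \<in> {0..1/2}")
     case True
     then have yB: "Y z p \<notin> ?B" using elim by blast
     have Yl: "(\<lambda>m. Y (u m) p) \<longlonglongrightarrow> Y z p" unfolding Y_def by (intro tendsto_intros u)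
     show ?thesis
     proof (cases "Y z p \<in> \<Omega>")
      case True
      then have yi: "Y z p \<in> interior \<Omega>" using yB closure_subset by (auto simp: frontier_def)
      have gl: "(\<lambda>m. g (Y (u m) p)) \<longlonglongrightarrow> g (Y z p)"
       using isCont_tendsto_compose[OF cont[OF yi] Yl] yB by blast
      have "eventually (\<lambda>m. Y (u m) p \<in> interior \<Omega>) sequentially"
       using topological_tendstoD[OF Yl, of "interior \<Omega>"] yi by simp
      then have "eventually (\<lambda>m. indicator \<Omega> (Y (u m) p) = (1::real)) sequentially"
       by eventually_elim (use interior_subset in \<open>auto simp: indicator_def\<close>)
      then have il: "(\<lambda>m. indicator \<Omega> (Y (u m) p) :: real) \<longlonglongrightarrow> indicator \<Omega> (Y z p)"
       using tendsto_eventually True by auto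
      show ?thesis unfolding G_def by (intro tendsto_intros gl il Yl)
     next
      case False
      have "eventually (\<lambda>m. Y (u m) p \<in> - \<Omega>) sequentially"
       using topological_tendstoD[OF Yl, of "- \<Omega>"] False compact_imp_closed[OF \<Omega>(1)] by (simp add: open_Compl)
      then have "eventually (\<lambda>m. G (u m) p = 0) sequentially"
       by eventually_elim (simp add: G_def)
      moreover have "G z p = 0" using False by (simp add: G_def)
      ultimately show ?thesis using tendsto_eventually by metis
     qed
    qed (simp add: G_def)
   qed
  qed
  then show "((\<lambda>z. integral\<^sup>L lborel (G z)) \<circ> u) \<longlonglongrightarrow> integral\<^sup>L lborel (G z)" by (simp add: o_def)
 qed
 then have Wc: "continuous_on UNIV W" unfolding W_def by (intro continuous_intros)
 have weak: "(\<integral>x. indicator \<Omega> x * (\<psi> x * g x) \<partial>lborel) = (\<integral>x. indicator \<Omega> x * (W x \<bullet> h x) \<partial>lborel)"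
  if h: "has_gradient_on \<Omega> \<psi> h" "continuous_on \<Omega> h" for \<psi> h
 proof -
  define hb where "hb z = indicator \<Omega> z *\<^sub>R h z" for z
  define pb where "pb z = indicator \<Omega> z * \<psi> z" for z
  have c\<psi>: "continuous_on \<Omega> \<psi>"
   by (rule has_derivative_continuous_on[where f' = "\<lambda>z v. h z \<bullet> v"])
    (use h(1) in \<open>simp add: has_gradient_on_def\<close>)
  have hbm[measurable]: "hb \<in> borel_measurable borel"
   unfolding hb_def by (intro borel_measurable_continuous_on_indicator h \<Omega>m)
  have pbm[measurable]: "pb \<in> borel_measurable borel"
   using borel_measurable_continuous_on_indicator[OF \<Omega>m c\<psi>] unfolding pb_def[abs_def] by simp
  obtain H where H: "\<And>x. x \<in> \<Omega> \<Longrightarrow> norm (h x) \<le> H"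
   using compact_imp_bounded[OF compact_continuous_image[OF h(2) \<Omega>(1)]] by (auto simp: bounded_iff)
  obtain P where P: "\<And>x. x \<in> \<Omega> \<Longrightarrow> \<bar>\<psi> x\<bar> \<le> P"
   using compact_imp_bounded[OF compact_continuous_image[OF c\<psi> \<Omega>(1)]] by (auto simp: bounded_iff)
  obtain x0 where x0: "x0 \<in> \<Omega>" using \<Omega>(3) interior_subset by blast
  have H0: "H \<ge> 0" using H[OF x0] norm_ge_zero order_trans by blast
  have P0: "P \<ge> 0" using P[OF x0] by linarith
  have Hb: "norm (hb z) \<le> H" for z using H[of z] H0 by (auto simp: hb_def indicator_def)
  have Pb: "\<bar>pb z\<bar> \<le> P" for z using P[of z] P0 by (auto simp: pb_def indicator_def)
  have bO: "bounded \<Omega>" using compact_imp_bounded[OF \<Omega>(1)] .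
  define E where "E q = G (fst q) (snd q) \<bullet> hb (fst q)" for q
  have Em: "E \<in> borel_measurable borel"
   unfolding E_def using Gm by (intro borel_measurable_inner) (simp_all flip: borel_prod)
  have Ei: "integrable lborel E"
  proof (rule integrable_lborel_bounded_support[OF Em])
   show "norm (E q) \<le> (2 ^ DIM('a) * (2 * A) * D) * H" for q
    unfolding E_def real_norm_def using Gb[of "fst q" "snd q"] Hb[of "fst q"]
    by (intro order_trans[OF Cauchy_Schwarz_ineq2] mult_mono) (auto simp: A0 D0)
   show "E q = 0" if "q \<notin> \<Omega> \<times> ({0..1/2} \<times> \<Omega>)" for q
    using that G0[of "snd q" "fst q"] by (cases "fst q \<in> \<Omega>") (auto simp: E_def hb_def mem_Times_iff)
   show "bounded (\<Omega> \<times> ({0..1/2::real} \<times> \<Omega>))" by (intro bounded_Times bO) auto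
  qed
  define F where "F w = indicator {0..1/2} (fst w) * indicator \<Omega> (fst (snd w)) * indicator \<Omega> (snd (snd w)) *
    (g (fst (snd w)) - g (snd (snd w))) *
    ((fst (snd w) - snd (snd w)) \<bullet> hb ((1 - fst w) *\<^sub>R snd (snd w) + fst w *\<^sub>R fst (snd w)))" for w :: "real \<times> 'a \<times> 'a"
  have Fm: "F \<in> borel_measurable borel"
   unfolding F_def by (simp flip: borel_prod)
  have F0: "F w = 0" if "w \<notin> {0..1/2} \<times> (\<Omega> \<times> \<Omega>)" for w
   using that by (auto simp: F_def mem_Times_iff)
  have Fb: "norm (F w) \<le> (2 * A) * (D * H)" for w
  proof (cases "w \<in> {0..1/2} \<times> (\<Omega> \<times> \<Omega>)")
   case True
   have "\<bar>g (fst (snd w)) - g (snd (snd w))\<bar> \<le> 2 * A"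
    using A[of "fst (snd w)"] A[of "snd (snd w)"] by linarith
   moreover have "\<bar>(fst (snd w) - snd (snd w)) \<bullet> hb ((1 - fst w) *\<^sub>R snd (snd w) + fst w *\<^sub>R fst (snd w))\<bar> \<le> D * H"
    using D[of "fst (snd w)" "snd (snd w)"] Hb True
    by (intro order_trans[OF Cauchy_Schwarz_ineq2] mult_mono) (auto simp: D0)
   ultimately show ?thesis using True A0 D0 H0 by (auto simp: F_def abs_mult mem_Times_iff intro!: mult_mono)
  qed (use F0 A0 D0 H0 in auto)
  have Fi: "integrable lborel F"
   by (rule integrable_lborel_bounded_support[OF Fm Fb F0]) (auto intro!: bounded_Times bO)
  have Fsm: "(\<lambda>w. F (s, w)) \<in> borel_measurable borel" for s
   using measurable_compose[OF _ Fm, of "\<lambda>w. (s, w)" borel] by (simp flip: borel_prod)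
  have Fsi: "integrable lborel (\<lambda>w. F (s, w))" for s
   by (rule integrable_lborel_bounded_support[OF Fsm Fb, where S = "\<Omega> \<times> \<Omega>"])
    (use F0 in \<open>auto intro!: bounded_Times bO\<close>)
  have sub: "(\<integral>z. E (z, (s, x)) \<partial>lborel) = (\<integral>y. F (s, (x, y)) \<partial>lborel)" for s x
  proof (cases "s \<in> {0..1/2}")
   case True
   have Em': "(\<lambda>z. E (z, (s, x))) \<in> borel_measurable borel"
    using measurable_compose[OF _ Em, of "\<lambda>z. (z, (s, x))" borel] by (simp flip: borel_prod)
   have "(\<integral>z. E (z, (s, x)) \<partial>lborel) = \<bar>1 - s\<bar> ^ DIM('a) * (\<integral>y. E (s *\<^sub>R x + (1 - s) *\<^sub>R y, (s, x)) \<partial>lborel)"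
    by (rule integral_lborel_affine[OF Em']) (use True in auto)
   also have "\<dots> = (\<integral>y. \<bar>1 - s\<bar> ^ DIM('a) * E (s *\<^sub>R x + (1 - s) *\<^sub>R y, (s, x)) \<partial>lborel)" by simp
   also have "\<dots> = (\<integral>y. F (s, (x, y)) \<partial>lborel)"
   proof (rule Bochner_Integration.integral_cong[OF refl])
    fix y
    have s1: "1 - s > 0" using True by auto
    have Yy: "Y (s *\<^sub>R x + (1 - s) *\<^sub>R y) (s, x) = y" using s1 by (simp add: Y_def)
    have "\<bar>1 - s\<bar> ^ DIM('a) * (1 / (1 - s)) ^ DIM('a) = 1"
     using s1 by (simp flip: power_mult_distrib)
    then show "\<bar>1 - s\<bar> ^ DIM('a) * E (s *\<^sub>R x + (1 - s) *\<^sub>R y, (s, x)) = F (s, (x, y))"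
     by (simp add: E_def G_def F_def Yy add.commute mult_ac)
   qed
   finally show ?thesis .
  qed (simp add: E_def F_def G_def)
  have "v * (\<integral>x. indicator \<Omega> x * (W x \<bullet> h x) \<partial>lborel) = (\<integral>z. integral\<^sup>L lborel (G z) \<bullet> hb z \<partial>lborel)"
   using v by (subst integral_mult_right_zero[symmetric], intro Bochner_Integration.integral_cong)
    (auto simp: W_def hb_def)
  also have "\<dots> = (\<integral>z. \<integral>p. E (z, p) \<partial>lborel \<partial>lborel)"
   using Gi by (intro Bochner_Integration.integral_cong refl) (simp add: E_def)
  also have "\<dots> = (\<integral>p. \<integral>z. E (z, p) \<partial>lborel \<partial>lborel)"
   unfolding integral_lborel_fst[OF Ei] integral_lborel_snd[OF Ei] ..
  also have "\<dots> = (\<integral>s. \<integral>x. \<integral>z. E (z, (s, x)) \<partial>lborel \<partial>lborel \<partial>lborel)"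
  proof (rule integral_lborel_fst[symmetric])
   have "integrable (lborel \<Otimes>\<^sub>M lborel) (case_prod (\<lambda>z p. E (z, p)))" using Ei by (simp add: lborel_prod)
   then show "integrable lborel (\<lambda>p. \<integral>z. E (z, p) \<partial>lborel)" by (rule lborel_pair.integrable_snd)
  qed
  also have "\<dots> = (\<integral>s. \<integral>w. F (s, w) \<partial>lborel \<partial>lborel)"
   unfolding sub using integral_lborel_fst[OF Fsi] by simp
  also have "\<dots> = (\<integral>w. \<integral>s. F (s, w) \<partial>lborel \<partial>lborel)"
   unfolding integral_lborel_fst[OF Fi] integral_lborel_snd[OF Fi] ..
  also have "\<dots> = (\<integral>w. indicator \<Omega> (fst w) * indicator \<Omega> (snd w) * (g (fst w) - g (snd w)) * pb ((1/2) *\<^sub>R (fst w + snd w))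
    - indicator \<Omega> (fst w) * indicator \<Omega> (snd w) * (g (fst w) - g (snd w)) * pb (snd w) \<partial>lborel)"
  proof (rule Bochner_Integration.integral_cong[OF refl])
   fix w :: "'a \<times> 'a"
   obtain x y where w: "w = (x, y)" by (cases w)
   show "(\<integral>s. F (s, w) \<partial>lborel) = indicator \<Omega> (fst w) * indicator \<Omega> (snd w) * (g (fst w) - g (snd w)) * pb ((1/2) *\<^sub>R (fst w + snd w))
    - indicator \<Omega> (fst w) * indicator \<Omega> (snd w) * (g (fst w) - g (snd w)) * pb (snd w)"
   proof (cases "x \<in> \<Omega> \<and> y \<in> \<Omega>")
    case True
    have seg: "(1 - s) *\<^sub>R y + s *\<^sub>R x \<in> \<Omega>" if "s \<in> {0..1/2}" for s
     using that convexD_alt[OF \<Omega>(2), of y x s] True by auto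
    have mid: "(1/2) *\<^sub>R (x + y) \<in> \<Omega>" using convexD_alt[OF \<Omega>(2), of y x "1/2"] True by (simp add: algebra_simps)
    have "(\<integral>s. F (s, w) \<partial>lborel) = (\<integral>s. (g x - g y) * (indicator {0..1/2} s *\<^sub>R ((x - y) \<bullet> h ((1 - s) *\<^sub>R y + s *\<^sub>R x))) \<partial>lborel)"
     by (intro Bochner_Integration.integral_cong refl) (use True seg w in \<open>auto simp: F_def hb_def indicator_def\<close>)
    also have "\<dots> = (g x - g y) * (\<psi> ((1/2) *\<^sub>R (x + y)) - \<psi> y)"
     using gradient_segment_integral[OF \<Omega>(2) h, of x y] True by simp
    finally show ?thesis using True mid w by (simp add: pb_def algebra_simps)
   qed (use w in \<open>auto simp: F_def\<close>)
  qed
  also have "\<dots> = (\<integral>w. indicator \<Omega> (fst w) * indicator \<Omega> (snd w) * (g (fst w) - g (snd w)) * pb ((1/2) *\<^sub>R (fst w + snd w)) \<partial>lborel)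
    - (\<integral>w. indicator \<Omega> (fst w) * indicator \<Omega> (snd w) * (g (fst w) - g (snd w)) * pb (snd w) \<partial>lborel)" (is "_ = integral\<^sup>L lborel ?f1 - integral\<^sup>L lborel ?f2")
  proof (rule Bochner_Integration.integral_diff)
   have b: "norm (indicator \<Omega> (fst w) * indicator \<Omega> (snd w) * (g (fst w) - g (snd w)) * pb c) \<le> 2 * A * P" for w c
   proof -
    have "\<bar>g (fst w) - g (snd w)\<bar> \<le> 2 * A" using A[of "fst w"] A[of "snd w"] by linarith
    then show ?thesis using Pb[of c] A0 P0 by (auto simp: indicator_def abs_mult intro!: mult_mono)
   qed
   show "integrable lborel ?f1"
    by (rule integrable_lborel_bounded_support[OF _ b, where S = "\<Omega> \<times> \<Omega>"])
     (auto simp: indicator_def intro!: bounded_Times bO simp flip: borel_prod)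
   show "integrable lborel ?f2"
    by (rule integrable_lborel_bounded_support[OF _ b, where S = "\<Omega> \<times> \<Omega>"])
     (auto simp: indicator_def intro!: bounded_Times bO simp flip: borel_prod)
  qed
  also have "integral\<^sup>L lborel ?f1 = 0"
  proof -
   have m: "?f1 \<in> borel_measurable (lborel \<Otimes>\<^sub>M lborel)" by measurable
   have "integral\<^sup>L (lborel \<Otimes>\<^sub>M lborel) ?f1 = (\<integral>(x, y). ?f1 (y, x) \<partial>(lborel \<Otimes>\<^sub>M lborel))"
    by (rule lborel_pair.integral_product_swap[OF m, symmetric])
   also have "\<dots> = (\<integral>w. - ?f1 w \<partial>(lborel \<Otimes>\<^sub>M lborel))"
    by (intro Bochner_Integration.integral_cong refl) (auto simp: add.commute algebra_simps split: prod.splits)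
   also have "\<dots> = - integral\<^sup>L (lborel \<Otimes>\<^sub>M lborel) ?f1" by (rule Bochner_Integration.integral_minus)
   finally have "integral\<^sup>L (lborel \<Otimes>\<^sub>M lborel) ?f1 = 0" by linarith
   then show ?thesis by (simp only: lborel_prod)
  qed
  also have "integral\<^sup>L lborel ?f2 = (\<integral>y. \<integral>x. ?f2 (x, y) \<partial>lborel \<partial>lborel)"
  proof (rule integral_lborel_snd[symmetric])
   have b: "norm (?f2 w) \<le> 2 * A * P" for w
   proof -
    have "\<bar>g (fst w) - g (snd w)\<bar> \<le> 2 * A" using A[of "fst w"] A[of "snd w"] by linarith
    then show ?thesis using Pb[of "snd w"] A0 P0 by (auto simp: indicator_def abs_mult intro!: mult_mono)
   qed
   show "integrable lborel ?f2"
    by (rule integrable_lborel_bounded_support[OF _ b, where S = "\<Omega> \<times> \<Omega>"])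
     (auto simp: indicator_def intro!: bounded_Times bO simp flip: borel_prod)
  qed
  also have "\<dots> = (\<integral>y. - v * (indicator \<Omega> y * (\<psi> y * g y)) \<partial>lborel)"
  proof (rule Bochner_Integration.integral_cong[OF refl])
   fix y
   have i1: "integrable lborel (\<lambda>x. indicator \<Omega> x * g x)"
    by (rule integrable_lborel_bounded_support[where C = A and S = \<Omega>]) (use A A0 bO in \<open>auto simp: indicator_def\<close>)
   have i2: "integrable lborel (\<lambda>x. indicator \<Omega> x * g y)"
    by (rule integrable_lborel_bounded_support[where C = A and S = \<Omega>]) (use A A0 bO in \<open>auto simp: indicator_def\<close>)
   have "(\<integral>x. ?f2 (x, y) \<partial>lborel) = (\<integral>x. (indicator \<Omega> x * g x - indicator \<Omega> x * g y) * (indicator \<Omega> y * pb y) \<partial>lborel)"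
    by (intro Bochner_Integration.integral_cong refl) (simp add: algebra_simps)
   also have "\<dots> = (0 - v * g y) * (indicator \<Omega> y * pb y)"
    using i1 i2 mean by (simp add: v_def)
   also have "\<dots> = - v * (indicator \<Omega> y * (\<psi> y * g y))" by (simp add: pb_def indicator_def)
   finally show "(\<integral>x. ?f2 (x, y) \<partial>lborel) = - v * (indicator \<Omega> y * (\<psi> y * g y))" .
  qed
  also have "\<dots> = - v * (\<integral>y. indicator \<Omega> y * (\<psi> y * g y) \<partial>lborel)" by simp
  finally show ?thesis using v by simp
 qed
 show ?thesis
  using Wc Wb weak unfolding D_def by (intro exI[of _ W]) auto
qed

section \<open>Gradients and sets of full measure\<close>

lemma gradient_unique:
 fixes D :: "'a::euclidean_space set"
 assumes D: "convex D" "interior D \<noteq> {}" and z: "z \<in> D"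
  and a: "(f has_derivative (\<lambda>v. a \<bullet> v)) (at z within D)" and b: "(f has_derivative (\<lambda>v. b \<bullet> v)) (at z within D)"
 shows "a = b"
proof -
 have dir: "a \<bullet> (q - z) = b \<bullet> (q - z)" if q: "q \<in> D" for q
 proof -
  let ?p = "\<lambda>s. z + s *\<^sub>R (q - z)"
  have sub: "?p ` {0..1} \<subseteq> D"
  proof safe
   fix s :: real assume "s \<in> {0..1}"
   then show "?p s \<in> D" using convexD_alt[OF D(1) z q, of s] by (simp add: algebra_simps)
  qed
  have *: "((\<lambda>s. f (?p s)) has_vector_derivative c \<bullet> (q - z)) (at 0 within {0..1})"
   if c: "(f has_derivative (\<lambda>v. c \<bullet> v)) (at z within D)" for c
  proof -
   have p: "(?p has_derivative (\<lambda>v. v *\<^sub>R (q - z))) (at 0 within {0..1})"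
    by (auto intro!: derivative_eq_intros)
   have "(f has_derivative (\<lambda>v. c \<bullet> v)) (at (?p 0) within ?p ` {0..1})"
    using has_derivative_subset[OF c sub] by simp
   from has_derivative_in_compose[OF p this] show ?thesis
    by (simp add: has_vector_derivative_def)
  qed
  show ?thesis
   by (rule vector_derivative_unique_within[OF _ *[OF a] *[OF b]])
    (simp add: trivial_limit_within islimpt_Icc)
 qed
 obtain x e where e: "e > 0" "ball x e \<subseteq> D" using D(2) by (meson all_not_in_conv mem_interior)
 show "a = b"
 proof (rule ccontr)
  assume "a \<noteq> b"
  define w where "w = (e / (2 * norm (a - b))) *\<^sub>R (a - b)"
  have "norm w < e" using e \<open>a \<noteq> b\<close> by (simp add: w_def)
  then have "x + w \<in> D" "x \<in> D" using e by (auto simp: subset_iff dist_norm)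
  then have "(a - b) \<bullet> (x + w - z) = 0" "(a - b) \<bullet> (x - z) = 0" using dir by (auto simp: inner_diff_left)
  then have "(a - b) \<bullet> w = 0" by (simp add: inner_diff_right inner_add_right)
  then show False using e \<open>a \<noteq> b\<close> by (simp add: w_def)
 qed
qed

lemma AE_lebesgue_on_dense:
 fixes D :: "'a::euclidean_space set"
 assumes D: "convex D" "interior D \<noteq> {}" "D \<in> sets lebesgue" and ae: "AE z in lebesgue_on D. P z"
  and z: "z \<in> D" and e: "e > 0"
 shows "\<exists>y\<in>D. dist z y < e \<and> P y"
proof (rule ccontr)
 assume no: "\<not> ?thesis"
 have "z \<in> closure (interior D)" using convex_closure_interior[OF D(1,2)] z closure_subset by auto
 then obtain y where y: "y \<in> interior D" "dist y z < e" using e by (auto simp: closure_approachable)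
 let ?U = "interior D \<inter> ball z e"
 have "AE x in lebesgue. x \<in> D \<longrightarrow> P x" using ae D(3) by (simp add: AE_restrict_space_iff)
 then have "AE x in lebesgue. x \<notin> ?U"
  by (rule AE_mp) (use no interior_subset in \<open>fastforce intro!: AE_I2\<close>)
 then have "negligible ?U"
  by (simp add: negligible_iff_null_sets AE_iff_null_sets)
 moreover have "open ?U" "?U \<noteq> {}" using y by (auto simp: dist_commute)
 ultimately show False using open_not_negligible by blast
qed

lemma AE_lebesgue_on_imp_le:
 fixes D :: "'a::euclidean_space set" and h :: "'a \<Rightarrow> real"
 assumes D: "convex D" "interior D \<noteq> {}" "D \<in> sets lebesgue" and h: "continuous_on D h"
  and ae: "AE z in lebesgue_on D. h z \<le> c" and z: "z \<in> D"
 shows "h z \<le> c"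
proof (rule field_le_epsilon)
 fix e :: real assume e: "e > 0"
 obtain d where d: "d > 0" "\<And>y. y \<in> D \<Longrightarrow> dist y z < d \<Longrightarrow> dist (h y) (h z) < e"
  using h z e unfolding continuous_on_iff by metis
 obtain y where "y \<in> D" "dist z y < d" "h y \<le> c" using AE_lebesgue_on_dense[OF D ae z d(1)] by blast
 then show "h z \<le> c + e" using d(2)[of y] by (auto simp: dist_commute dist_real_def)
qed

lemma has_gradient_lipschitz:
 fixes D :: "'a::euclidean_space set"
 assumes "compact D" "convex D" "has_gradient_on D f g" "continuous_on D g"
 shows "\<exists>L. L-lipschitz_on D f"
proof -
 obtain C where C: "\<And>x. x \<in> D \<Longrightarrow> norm (g x) \<le> C"
  using compact_imp_bounded[OF compact_continuous_image[OF assms(4,1)]] by (auto simp: bounded_iff)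
 have "(max C 0)-lipschitz_on D f"
 proof (rule lipschitz_onI)
  fix x y assume xy: "x \<in> D" "y \<in> D"
  have "norm (f x - f y) \<le> max C 0 * norm (x - y)"
  proof (rule differentiable_bound[OF assms(2)])
   show "(f has_derivative (\<lambda>v. g z \<bullet> v)) (at z within D)" if "z \<in> D" for z
    using assms(3) that by (auto simp: has_gradient_on_def)
   show "onorm (\<lambda>v. g z \<bullet> v) \<le> max C 0" if "z \<in> D" for z
   proof (rule onorm_le)
    fix v
    have "norm (g z \<bullet> v) \<le> norm (g z) * norm v" using Cauchy_Schwarz_ineq2 by simp
    also have "\<dots> \<le> max C 0 * norm v" using C[OF that] by (intro mult_right_mono) auto
    finally show "norm (g z \<bullet> v) \<le> max C 0 * norm v" .
   qed
  qed (use xy in auto)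
  then show "dist (f x) (f y) \<le> max C 0 * dist x y" by (simp add: dist_norm)
 qed simp
 then show ?thesis by blast
qed

section \<open>Mollification\<close>

text \<open>A polynomial bump supported in the ball of radius \<open>e\<close>, regular enough for its mollifications to be \<open>C\<^sup>1\<close>.\<close>

definition kern :: "real \<Rightarrow> 'e::euclidean_space \<Rightarrow> real" where
 "kern e y = (max 0 (e\<^sup>2 - y \<bullet> y))\<^sup>2"

definition kern_grad :: "real \<Rightarrow> 'e::euclidean_space \<Rightarrow> 'e" where
 "kern_grad e y = (- 4 * max 0 (e\<^sup>2 - y \<bullet> y)) *\<^sub>R y"

lemma max0_sq_taylor: "\<bar>(max 0 r')\<^sup>2 - (max 0 r)\<^sup>2 - 2 * max 0 r * (r' - r)\<bar> \<le> (r' - r)\<^sup>2" for r r' :: real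
proof -
 consider "r \<ge> 0" "r' \<ge> 0" | "r \<ge> 0" "r' < 0" | "r < 0" "r' \<ge> 0" | "r < 0" "r' < 0" by linarith
 then show ?thesis
 proof cases
  case 2
  then have "r * r' \<le> 0" by (simp add: mult_nonneg_nonpos)
  moreover have "(max 0 r')\<^sup>2 - (max 0 r)\<^sup>2 - 2 * max 0 r * (r' - r) = r * r - 2 * (r * r')"
   using 2 by (simp add: power2_eq_square algebra_simps)
  moreover have "(r' - r)\<^sup>2 = r' * r' + (r * r - 2 * (r * r'))" by (simp add: power2_eq_square algebra_simps)
  moreover have "r * r \<ge> 0" "r' * r' \<ge> 0" by simp_all
  ultimately show ?thesis by linarith
 next
  case 3
  then have "r * r' \<le> 0" by (simp add: mult_nonneg_nonpos2 mult.commute)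
  moreover have "(r' - r)\<^sup>2 = r'\<^sup>2 + (r * r - 2 * (r * r'))" by (simp add: power2_eq_square algebra_simps)
  moreover have "r * r \<ge> 0" by simp
  ultimately have "r'\<^sup>2 \<le> (r' - r)\<^sup>2" by linarith
  then show ?thesis using 3 by simp
 next
  case 1
  then have "(max 0 r')\<^sup>2 - (max 0 r)\<^sup>2 - 2 * max 0 r * (r' - r) = (r' - r)\<^sup>2"
   by (simp add: power2_eq_square algebra_simps)
  then show ?thesis by simp
 next
  case 4
  then show ?thesis by simp
 qed
qed

lemma kern_nonneg: "kern e y \<ge> 0" by (simp add: kern_def)

lemma kern_0: "e \<ge> 0 \<Longrightarrow> norm y \<ge> e \<Longrightarrow> kern e y = 0" "e \<ge> 0 \<Longrightarrow> norm y \<ge> e \<Longrightarrow> kern_grad e y = 0"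
 using power_mono[of e "norm y" 2] by (auto simp: kern_def kern_grad_def power2_norm_eq_inner)

lemma continuous_kern: "continuous_on S (kern e)" "continuous_on S (kern_grad e)"
 unfolding kern_def[abs_def] kern_grad_def[abs_def] by (intro continuous_intros)+

lemma kern_taylor:
 fixes a h :: "'e::euclidean_space"
 assumes e: "0 < e" "e \<le> 1" and h: "norm h \<le> 1"
 shows "\<bar>kern e (a + h) - kern e a - kern_grad e a \<bullet> h\<bar> \<le> 27 * (norm h)\<^sup>2 * indicator (cball 0 2) a"
proof (cases "norm a \<le> 2")
 case False
 have "norm a \<le> norm (a + h) + norm h" by (metis add_diff_cancel_right' norm_triangle_ineq4)
 then have "norm (a + h) \<ge> e" using False e h by linarith
 then show ?thesis using False e kern_0[of e a] kern_0[of e "a + h"] by simp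
next
 case True
 let ?r = "e\<^sup>2 - a \<bullet> a" and ?r' = "e\<^sup>2 - (a + h) \<bullet> (a + h)"
 have d: "?r' - ?r = - 2 * (a \<bullet> h) - h \<bullet> h" by (simp add: inner_add_left inner_add_right inner_commute)
 have hh: "h \<bullet> h = (norm h)\<^sup>2" by (simp add: power2_norm_eq_inner)
 have "\<bar>?r' - ?r\<bar> \<le> 5 * norm h"
 proof -
  have "\<bar>a \<bullet> h\<bar> \<le> 2 * norm h"
   using Cauchy_Schwarz_ineq2[of a h] True mult_right_mono[OF True, of "norm h"] by simp
  moreover have "h \<bullet> h \<le> norm h" unfolding hh power2_eq_square using h by (simp add: mult_left_le)
  moreover have "h \<bullet> h \<ge> 0" by simp
  ultimately show ?thesis unfolding d by linarith
 qed
 then have 1: "(?r' - ?r)\<^sup>2 \<le> 25 * (norm h)\<^sup>2"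
  using power_mono[of "\<bar>?r' - ?r\<bar>" "5 * norm h" 2] by (simp add: power_mult_distrib)
 have "max 0 ?r \<le> 1" using e by (auto simp: power_le_one intro: order_trans[of _ "e\<^sup>2"])
 then have 2: "2 * max 0 ?r * (h \<bullet> h) \<le> 2 * (norm h)\<^sup>2" unfolding hh by (intro mult_right_mono) auto
 have "kern e (a + h) - kern e a - kern_grad e a \<bullet> h =
   ((max 0 ?r')\<^sup>2 - (max 0 ?r)\<^sup>2 - 2 * max 0 ?r * (?r' - ?r)) - 2 * max 0 ?r * (h \<bullet> h)"
  unfolding d by (simp add: kern_def kern_grad_def algebra_simps)
 also have "\<bar>\<dots>\<bar> \<le> (?r' - ?r)\<^sup>2 + 2 * max 0 ?r * (h \<bullet> h)"
 proof -
  have gen: "\<bar>A - B\<bar> \<le> C + B" if "\<bar>A\<bar> \<le> C" "0 \<le> B" for A B C :: real using that by linarith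
  show ?thesis by (rule gen[OF max0_sq_taylor]) simp
 qed
 also have "\<dots> \<le> 27 * (norm h)\<^sup>2" using 1 2 by linarith
 finally show ?thesis using True by simp
qed

definition kern_mass :: "real \<Rightarrow> 'e::euclidean_space itself \<Rightarrow> real" where
 "kern_mass e _ = (\<integral>y. kern e (y::'e) \<partial>lborel)"

definition moll :: "real \<Rightarrow> ('e::euclidean_space \<Rightarrow> real) \<Rightarrow> 'e \<Rightarrow> real" where
 "moll e f z = (\<integral>y. kern e (z - y) * f y \<partial>lborel) / kern_mass e TYPE('e)"

definition moll_grad :: "real \<Rightarrow> ('e::euclidean_space \<Rightarrow> real) \<Rightarrow> 'e \<Rightarrow> 'e" where
 "moll_grad e f z = (1 / kern_mass e TYPE('e)) *\<^sub>R (\<integral>y. f y *\<^sub>R kern_grad e (z - y) \<partial>lborel)"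

context
 fixes e :: real and f :: "'e::euclidean_space \<Rightarrow> real" and B :: real
 assumes e: "0 < e" "e \<le> 1" and f[measurable]: "f \<in> borel_measurable borel" and B: "\<And>x. \<bar>f x\<bar> \<le> B"
begin

lemma kern_borel [measurable]: "kern e \<in> borel_measurable borel" "kern_grad e \<in> borel_measurable borel"
 by (intro borel_measurable_continuous_onI continuous_kern)+

lemma kern_bound: "kern e y \<le> 1" "norm (kern_grad e y) \<le> 4"
proof -
 have m: "max 0 (e\<^sup>2 - y \<bullet> y) \<le> 1" using e by (auto simp: power_le_one intro: order_trans[of _ "e\<^sup>2"])
 show "kern e y \<le> 1" using power_mono[OF m, of 2] by (simp add: kern_def)
 show "norm (kern_grad e y) \<le> 4"
 proof (cases "norm y \<le> 1")
  case True
  have "max 0 (e\<^sup>2 - y \<bullet> y) * norm y \<le> 1 * 1" using m True by (intro mult_mono) auto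
  then show ?thesis by (simp add: kern_grad_def abs_mult)
 next
  case False then show ?thesis using kern_0(2)[of e y] e by simp
 qed
qed

lemma kern_mass_pos: "kern_mass e TYPE('e) > 0" and kern_integrable: "integrable lborel (kern e :: 'e \<Rightarrow> real)"
proof -
 show i: "integrable lborel (kern e :: 'e \<Rightarrow> real)"
 proof (rule integrable_lborel_bounded_support[where C = 1 and S = "cball 0 1"])
  show "norm (kern e y) \<le> 1" for y :: 'e using kern_bound(1)[of y] kern_nonneg[of e y] by simp
  show "kern e y = 0" if "y \<notin> cball 0 1" for y :: 'e using that e kern_0(1)[of e y] by auto
 qed auto
 have "kern_mass e TYPE('e) \<noteq> 0"
 proof
  assume "kern_mass e TYPE('e) = 0"
  then have "AE y in lborel. kern e (y::'e) = 0"
   using integral_nonneg_eq_0_iff_AE[OF i AE_I2[OF kern_nonneg]] by (simp add: kern_mass_def)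
  then have "AE y in lborel. (y::'e) \<notin> ball 0 e"
  proof eventually_elim
   case (elim y)
   then have "e\<^sup>2 \<le> (norm y)\<^sup>2" by (simp add: kern_def power2_norm_eq_inner max_def split: if_splits)
   then have "e \<le> norm y" by (rule power2_le_imp_le) simp
   then show ?case by simp
  qed
  then have "AE y in lebesgue. (y::'e) \<notin> ball 0 e" by (simp add: AE_completion_iff)
  then have "negligible (ball (0::'e) e)" by (simp add: negligible_iff_null_sets AE_iff_null_sets)
  then show False using open_not_negligible[of "ball (0::'e) e"] e by auto
 qed
 moreover have "kern_mass e TYPE('e) \<ge> 0" unfolding kern_mass_def by (intro Bochner_Integration.integral_nonneg kern_nonneg)
 ultimately show "kern_mass e TYPE('e) > 0" by simp
qed

lemma moll_integrable: "integrable lborel (\<lambda>y. kern e (z - y) * f y)"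
 "integrable lborel (\<lambda>y. f y *\<^sub>R kern_grad e (z - y))"
proof -
 have B0: "B \<ge> 0" using B[of 0] by linarith
 have out: "kern e (z - y) = 0" "kern_grad e (z - y) = 0" if "y \<notin> cball z 1" for y
  using that kern_0[of e "z - y"] e by (auto simp: dist_norm)
 show "integrable lborel (\<lambda>y. kern e (z - y) * f y)"
 proof (rule integrable_lborel_bounded_support[where C = B and S = "cball z 1"])
  show "norm (kern e (z - y) * f y) \<le> B" for y
   using mult_mono[OF kern_bound(1)[of "z - y"] B[of y]] kern_nonneg[of e "z - y"] by (simp add: abs_mult)
 qed (use out in auto)
 show "integrable lborel (\<lambda>y. f y *\<^sub>R kern_grad e (z - y))"
 proof (rule integrable_lborel_bounded_support[where C = "B * 4" and S = "cball z 1"])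
  show "norm (f y *\<^sub>R kern_grad e (z - y)) \<le> B * 4" for y
   using mult_mono[OF B[of y] kern_bound(2)[of "z - y"]] B0 by simp
 qed (use out in auto)
qed

lemma moll_taylor:
 assumes h: "norm h \<le> 1"
 shows "\<bar>moll e f (z + h) - moll e f z - moll_grad e f z \<bullet> h\<bar>
   \<le> (27 * B * measure lborel (cball (0::'e) 2) / kern_mass e TYPE('e)) * (norm h)\<^sup>2"
proof -
 let ?I = "\<integral>y. f y * (kern e (z + h - y) - kern e (z - y) - kern_grad e (z - y) \<bullet> h) \<partial>lborel"
 let ?c = "kern_mass e TYPE('e)"
 have i1: "integrable lborel (\<lambda>y. f y * kern e (z - y))" for z using moll_integrable(1)[of z] by (simp add: mult.commute)
 have i2: "integrable lborel (\<lambda>y. f y * (kern_grad e (z - y) \<bullet> h))"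
  using integrable_inner_left[OF moll_integrable(2)[of z], of h] by simp
 have g: "moll_grad e f z \<bullet> h = (\<integral>y. f y * (kern_grad e (z - y) \<bullet> h) \<partial>lborel) / ?c"
  using integral_inner_left[OF moll_integrable(2)[of z], of h] by (simp add: moll_grad_def)
 have m: "moll e f z = (\<integral>y. f y * kern e (z - y) \<partial>lborel) / ?c" for z by (simp add: moll_def mult.commute)
 have "moll e f (z + h) - moll e f z - moll_grad e f z \<bullet> h = ?I / ?c"
  unfolding m g right_diff_distrib
  by (subst Bochner_Integration.integral_diff, use i1 i2 in simp, use i2 in simp,
    subst Bochner_Integration.integral_diff) (use i1 in \<open>auto simp: diff_divide_distrib\<close>)
 moreover have "\<bar>?I\<bar> \<le> (\<integral>y. B * 27 * (norm h)\<^sup>2 * indicator (cball z 2) y \<partial>lborel)"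
 proof (rule order_trans[OF integral_abs_bound integral_mono])
  show "integrable lborel (\<lambda>y. \<bar>f y * (kern e (z + h - y) - kern e (z - y) - kern_grad e (z - y) \<bullet> h)\<bar>)"
   using i1 i2 unfolding right_diff_distrib by (intro integrable_abs Bochner_Integration.integrable_diff)
  show "integrable lborel (\<lambda>y. B * 27 * (norm h)\<^sup>2 * indicator (cball z 2) y)"
   using emeasure_bounded_finite[of "cball z 2"] by (intro integrable_mult_right integrable_real_indicator) auto
  fix y
  have "\<bar>kern e (z - y + h) - kern e (z - y) - kern_grad e (z - y) \<bullet> h\<bar> \<le> 27 * (norm h)\<^sup>2 * indicator (cball 0 2) (z - y)"
   by (rule kern_taylor[OF e h])
  also have "indicator (cball 0 2) (z - y) = (indicator (cball z 2) y :: real)"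
   by (simp add: indicator_def dist_norm norm_minus_commute)
  finally have "\<bar>kern e (z + h - y) - kern e (z - y) - kern_grad e (z - y) \<bullet> h\<bar> \<le> 27 * (norm h)\<^sup>2 * indicator (cball z 2) y"
   by (simp add: algebra_simps)
  from mult_mono[OF B[of y] this]
  show "\<bar>f y * (kern e (z + h - y) - kern e (z - y) - kern_grad e (z - y) \<bullet> h)\<bar> \<le> B * 27 * (norm h)\<^sup>2 * indicator (cball z 2) y"
   using B[of y] by (simp add: abs_mult mult.assoc)
 qed
 moreover have "measure lborel (cball z 2) = measure lborel (cball (0::'e) 2)"
 proof -
  have "(\<integral>y. indicator (cball z 2) y \<partial>lborel) = \<bar>1\<bar> ^ DIM('e) * (\<integral>y. indicator (cball z 2) (z + 1 *\<^sub>R y) \<partial>lborel :: real)"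
   by (rule integral_lborel_affine) (intro borel_measurable_indicator, simp_all)
  also have "(\<lambda>y. indicator (cball z 2) (z + 1 *\<^sub>R y)) = (indicator (cball 0 2) :: 'e \<Rightarrow> real)"
   by (auto simp: indicator_def dist_norm)
  finally show ?thesis by simp
 qed
 ultimately show ?thesis using kern_mass_pos
  by (simp add: abs_divide divide_right_mono mult_ac)
qed

lemma moll_convolution: "moll e f z = (\<integral>y. kern e y * f (z - y) \<partial>lborel) / kern_mass e TYPE('e)"
proof -
 have "(\<integral>y. kern e (z - y) * f y \<partial>lborel) = \<bar>-1\<bar> ^ DIM('e) * (\<integral>y. kern e (z - (z + (-1) *\<^sub>R y)) * f (z + (-1) *\<^sub>R y) \<partial>lborel)"
  by (rule integral_lborel_affine) auto
 then show ?thesis by (simp add: moll_def)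
qed

lemma moll_has_gradient: "has_gradient_on S (moll e f) (moll_grad e f)"
 unfolding has_gradient_on_def
proof
 fix z
 let ?C = "27 * B * measure lborel (cball (0::'e) 2) / kern_mass e TYPE('e)"
 have "(moll e f has_derivative (\<lambda>v. moll_grad e f z \<bullet> v)) (at z)"
  unfolding has_derivative_at
 proof
  show "bounded_linear (\<lambda>v. moll_grad e f z \<bullet> v)" by (rule bounded_linear_inner_right)
  show "(\<lambda>h. norm (moll e f (z + h) - moll e f z - moll_grad e f z \<bullet> h) / norm h) \<midarrow>0\<rightarrow> 0"
  proof (rule Lim_null_comparison)
   have "eventually (\<lambda>h::'e. norm h < 1) (at 0)"
    using eventually_at_ball[of 1 "0::'e" UNIV] by (auto simp: dist_norm elim: eventually_mono)
   then show "\<forall>\<^sub>F h in at 0. norm (norm (moll e f (z + h) - moll e f z - moll_grad e f z \<bullet> h) / norm h) \<le> ?C * norm h"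
   proof eventually_elim
    case (elim h)
    show ?case
    proof (cases "h = 0")
     case False
     then show ?thesis using moll_taylor[of h z] elim by (simp add: pos_divide_le_eq power2_eq_square mult.assoc)
    qed simp
   qed
   show "((\<lambda>h. ?C * norm h) \<longlongrightarrow> 0) (at 0)" by (rule tendsto_eq_intros | simp)+
  qed
 qed
 then show "(moll e f has_derivative (\<lambda>v. moll_grad e f z \<bullet> v)) (at z within S)" by (rule has_derivative_at_withinI)
qed

lemma continuous_moll_grad: "continuous_on UNIV (moll_grad e f)"
proof -
 have "continuous_on UNIV (\<lambda>z. \<integral>y. f y *\<^sub>R kern_grad e (z - y) \<partial>lborel)"
  unfolding continuous_on_sequentially
 proof (intro allI ballI impI, elim conjE)
  fix u and z :: 'e assume u: "u \<longlonglongrightarrow> z"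
  have B0: "B \<ge> 0" using B[of 0] by linarith
  have "bounded (range u)" using u convergent_imp_bounded by blast
  then obtain R where R: "\<And>m. norm (u m) \<le> R" by (auto simp: bounded_iff)
  have "(\<lambda>m. \<integral>y. f y *\<^sub>R kern_grad e (u m - y) \<partial>lborel) \<longlonglongrightarrow> (\<integral>y. f y *\<^sub>R kern_grad e (z - y) \<partial>lborel)"
  proof (rule bounded_convergence_lborel[where C = "B * 4" and S = "cball 0 (R + 1)"])
   show "norm (f y *\<^sub>R kern_grad e (u m - y)) \<le> B * 4" for m y
    using mult_mono[OF B[of y] kern_bound(2)[of "u m - y"]] B0 by simp
   show "f y *\<^sub>R kern_grad e (u m - y) = 0" if "y \<notin> cball 0 (R + 1)" for m y
   proof -
    have "norm y \<le> norm (u m) + norm (u m - y)" by (metis norm_triangle_sub norm_minus_commute add.commute)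
    then have "norm (u m - y) \<ge> 1" using that R[of m] by simp
    then show ?thesis using kern_0(2)[of e "u m - y"] e by simp
   qed
   show "AE y in lborel. (\<lambda>m. f y *\<^sub>R kern_grad e (u m - y)) \<longlonglongrightarrow> f y *\<^sub>R kern_grad e (z - y)"
   proof (rule AE_I2)
    fix y
    have "(\<lambda>m. kern_grad e (u m - y)) \<longlonglongrightarrow> kern_grad e (z - y)"
     by (rule continuous_on_tendsto_compose[OF continuous_kern(2)[of UNIV]]) (auto intro!: tendsto_intros u)
    then show "(\<lambda>m. f y *\<^sub>R kern_grad e (u m - y)) \<longlonglongrightarrow> f y *\<^sub>R kern_grad e (z - y)" by (intro tendsto_intros)
   qed
  qed auto
  then show "((\<lambda>z. \<integral>y. f y *\<^sub>R kern_grad e (z - y) \<partial>lborel) \<circ> u) \<longlonglongrightarrow> (\<integral>y. f y *\<^sub>R kern_grad e (z - y) \<partial>lborel)"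
   by (simp add: o_def)
 qed
 then show ?thesis unfolding moll_grad_def[abs_def] by (intro continuous_intros)
qed

end

section \<open>Approximate solution of a transport equation\<close>

lemma power_1p_le_exp:
 assumes "K \<ge> 0" "m > 0" "n \<le> 3 * m"
 shows "(1 + K / real m) ^ n \<le> exp (3 * K)"
proof -
 have "(1 + K / real m) ^ n \<le> (1 + K / real m) ^ (3 * m)" using assms by (intro power_increasing) auto
 also have "\<dots> \<le> exp (K / real m) ^ (3 * m)" using assms exp_ge_add_one_self by (intro power_mono) auto
 also have "\<dots> = exp (3 * K)" using assms by (simp add: exp_of_nat_mult[symmetric])
 finally show ?thesis .
qed

text \<open>Characteristics replaced by Euler steps: the orbit of \<open>z \<mapsto> z + V z / m\<close> advances in time by
  \<open>1/m\<close> per step and leaves the support of \<open>c\<close> after at most \<open>3 m\<close> steps. Summing \<open>c\<close> along the orbit solves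
  the difference equation exactly, and by the discrete Gronwall estimate the sum is Lipschitz uniformly in
  \<open>m\<close>.\<close>

lemma transport_equation_euler:
 fixes V :: "real \<times> 'a::euclidean_space \<Rightarrow> real \<times> 'a" and c :: "real \<times> 'a \<Rightarrow> real"
 assumes V: "K-lipschitz_on UNIV V" "\<And>z. fst (V z) = 1"
  and c: "M-lipschitz_on UNIV c" "\<And>z. \<bar>c z\<bar> \<le> Bd" "\<And>z. fst z \<ge> 2 \<Longrightarrow> c z = 0"
  and m: "(m::nat) > 0"
 obtains f where "(3 * M * exp (3 * K))-lipschitz_on UNIV f" "\<And>z. \<bar>f z\<bar> \<le> 3 * Bd"
  "\<And>z. fst z \<ge> -1 \<Longrightarrow> f (z + (1 / real m) *\<^sub>R V z) - f z = c z / real m"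
proof -
 define \<Phi> where "\<Phi> z = z + (1 / real m) *\<^sub>R V z" for z
 have K: "K \<ge> 0" using V(1) lipschitz_on_nonneg by blast
 have M: "M \<ge> 0" using c(1) lipschitz_on_nonneg by blast
 \<comment> \<open>from a time \<open>\<ge> -1\<close>, \<open>3 m\<close> steps reach a time \<open>\<ge> 2\<close>, where \<open>c\<close> vanishes, so that the sum telescopes\<close>
 define f where "f z = - (\<Sum>n<3*m. c ((\<Phi> ^^ n) z) / real m)" for z
 have lip1: "dist (\<Phi> x) (\<Phi> y) \<le> (1 + K / real m) * dist x y" for x y
 proof -
  have "dist (\<Phi> x) (\<Phi> y) \<le> dist x y + (1 / real m) * dist (V x) (V y)"
  proof -
   have "dist (\<Phi> x) (\<Phi> y) = norm ((x - y) + (1 / real m) *\<^sub>R (V x - V y))"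
    by (simp add: \<Phi>_def dist_norm algebra_simps)
   also have "\<dots> \<le> norm (x - y) + norm ((1 / real m) *\<^sub>R (V x - V y))" by (rule norm_triangle_ineq)
   finally show ?thesis by (simp add: dist_norm)
  qed
  also have "\<dots> \<le> dist x y + (1 / real m) * (K * dist x y)"
   using lipschitz_onD[OF V(1)] by (intro add_left_mono mult_left_mono) auto
  finally show ?thesis by (simp add: algebra_simps)
 qed
 have lipn: "dist ((\<Phi> ^^ n) x) ((\<Phi> ^^ n) y) \<le> (1 + K / real m) ^ n * dist x y" for n x y
 proof (induction n)
  case (Suc n)
  have "dist ((\<Phi> ^^ Suc n) x) ((\<Phi> ^^ Suc n) y) \<le> (1 + K / real m) * dist ((\<Phi> ^^ n) x) ((\<Phi> ^^ n) y)"
   using lip1 by simp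
  also have "\<dots> \<le> (1 + K / real m) * ((1 + K / real m) ^ n * dist x y)"
   using Suc K by (intro mult_left_mono) auto
  finally show ?case by (simp add: mult.assoc)
 qed simp
 have fstn: "fst ((\<Phi> ^^ n) z) = fst z + real n / real m" for n z
  by (induction n) (auto simp: \<Phi>_def V(2) add_divide_distrib)
 show ?thesis
 proof (rule that[of f])
  show "(3 * M * exp (3 * K))-lipschitz_on UNIV f"
  proof (rule lipschitz_onI)
   fix x y
   have "dist (f x) (f y) = \<bar>\<Sum>n<3*m. (c ((\<Phi> ^^ n) x) - c ((\<Phi> ^^ n) y)) / real m\<bar>"
    by (simp add: f_def dist_real_def sum_subtractf diff_divide_distrib)
   also have "\<dots> \<le> (\<Sum>n<3*m. M * exp (3 * K) * dist x y / real m)"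
   proof (rule order_trans[OF sum_abs sum_mono])
    fix n assume n: "n \<in> {..<3*m}"
    have "\<bar>c ((\<Phi> ^^ n) x) - c ((\<Phi> ^^ n) y)\<bar> \<le> M * dist ((\<Phi> ^^ n) x) ((\<Phi> ^^ n) y)"
     using lipschitz_onD[OF c(1)] by (simp add: dist_real_def)
    also have "\<dots> \<le> M * (exp (3 * K) * dist x y)"
     using power_1p_le_exp[OF K m, of n] n M
     by (intro mult_left_mono order_trans[OF lipn] mult_right_mono) auto
    finally show "\<bar>(c ((\<Phi> ^^ n) x) - c ((\<Phi> ^^ n) y)) / real m\<bar> \<le> M * exp (3 * K) * dist x y / real m"
     by (simp add: abs_divide divide_right_mono mult.assoc)
   qed
   also have "\<dots> = 3 * M * exp (3 * K) * dist x y" using m by simp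
   finally show "dist (f x) (f y) \<le> 3 * M * exp (3 * K) * dist x y" .
  qed (use M in auto)
  show "\<bar>f z\<bar> \<le> 3 * Bd" for z
  proof -
   have "\<bar>f z\<bar> \<le> (\<Sum>n<3*m. Bd / real m)"
    unfolding f_def abs_minus_cancel
    by (rule order_trans[OF sum_abs sum_mono]) (use c(2) in \<open>auto simp: abs_divide divide_right_mono\<close>)
   also have "\<dots> = 3 * Bd" using m by simp
   finally show ?thesis .
  qed
  show "f (z + (1 / real m) *\<^sub>R V z) - f z = c z / real m" if z: "fst z \<ge> -1" for z
  proof -
   have c0: "c ((\<Phi> ^^ (3*m)) z) = 0" using z m by (intro c(3)) (simp add: fstn)
   have "f (\<Phi> z) = - (\<Sum>n<3*m. c ((\<Phi> ^^ Suc n) z) / real m)" by (simp add: f_def funpow_swap1)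
   also have "(\<Sum>n<3*m. c ((\<Phi> ^^ Suc n) z) / real m) = (\<Sum>n<Suc (3*m). c ((\<Phi> ^^ n) z) / real m) - c z / real m"
    by (subst sum.lessThan_Suc_shift) simp
   also have "\<dots> = (\<Sum>n<3*m. c ((\<Phi> ^^ n) z) / real m) - c z / real m" using c0 by simp
   finally show ?thesis by (simp add: f_def \<Phi>_def)
  qed
 qed
qed

text \<open>Mollify the solution of the difference equation. Since its Lipschitz constant is independent of
  \<open>m\<close>, the radius can be fixed by the oscillation of \<open>V\<close> and \<open>c\<close> first; then \<open>m\<close> is taken so large
  that the difference quotient is close to the derivative along \<open>V\<close>.\<close>

lemma transport_equation_approx:
 fixes V :: "real \<times> 'a::euclidean_space \<Rightarrow> real \<times> 'a" and c :: "real \<times> 'a \<Rightarrow> real"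
 assumes V: "K-lipschitz_on UNIV V" "\<And>z. fst (V z) = 1" "\<And>z. norm (V z) \<le> U"
  and c: "M-lipschitz_on UNIV c" "\<And>z. \<bar>c z\<bar> \<le> Bd" "\<And>z. fst z \<ge> 2 \<Longrightarrow> c z = 0"
  and d: "d > 0"
 shows "\<exists>F G. has_gradient_on UNIV F G \<and> continuous_on UNIV G \<and> (\<forall>z. fst z \<ge> 0 \<longrightarrow> \<bar>G z \<bullet> V z - c z\<bar> \<le> d)"
proof -
 have K: "K \<ge> 0" using V(1) lipschitz_on_nonneg by blast
 have M: "M \<ge> 0" using c(1) lipschitz_on_nonneg by blast
 define \<Lambda> where "\<Lambda> = 3 * M * exp (3 * K)"
 have \<Lambda>: "\<Lambda> \<ge> 0" using M by (simp add: \<Lambda>_def)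
 define e where "e = min 1 (d / 2 / (\<Lambda> * K + M + 1))"
 have pos: "\<Lambda> * K + M + 1 > 0" using K M \<Lambda> by (simp add: add_nonneg_pos)
 have e: "0 < e" "e \<le> 1" using d pos by (auto simp: e_def)
 have ee: "e * (\<Lambda> * K + M) \<le> d / 2"
 proof -
  have "e * (\<Lambda> * K + M) \<le> e * (\<Lambda> * K + M + 1)" using e by simp
  also have "\<dots> \<le> (d / 2 / (\<Lambda> * K + M + 1)) * (\<Lambda> * K + M + 1)"
   using pos by (intro mult_right_mono) (auto simp: e_def)
  also have "\<dots> = d / 2"
  proof -
   have "(d / 2 / P) * P = d / 2" if "P > 0" for P :: real using that by simp
   then show ?thesis using pos by blast
  qed
  finally show ?thesis .
 qed
 define k where "k = kern_mass e TYPE(real \<times> 'a)"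
 define C where "C = 27 * (3 * Bd) * measure lborel (cball (0::real \<times> 'a) 2) / k"
 obtain m :: nat where m: "real m > max U (2 * C * U\<^sup>2 / d)" "m > 0"
  using reals_Archimedean2[of "max 1 (max U (2 * C * U\<^sup>2 / d))"] by (auto)
 let ?s = "1 / real m"
 obtain f where f: "\<Lambda>-lipschitz_on UNIV f" "\<And>z. \<bar>f z\<bar> \<le> 3 * Bd"
  "\<And>z. fst z \<ge> -1 \<Longrightarrow> f (z + ?s *\<^sub>R V z) - f z = c z / real m"
  using transport_equation_euler[OF V(1,2) c m(2)] unfolding \<Lambda>_def by metis
 have fm[measurable]: "f \<in> borel_measurable borel"
  using lipschitz_on_continuous_on[OF f(1)] by (intro borel_measurable_continuous_onI)
 note mo = e fm f(2)
 have k: "k > 0" unfolding k_def by (rule kern_mass_pos[OF mo])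
 have U: "U \<ge> 0" using V(3)[of 0] norm_ge_zero order_trans by blast
 have B0: "Bd \<ge> 0" using c(2)[of 0] by linarith
 have C: "C \<ge> 0" using B0 k by (simp add: C_def)
 show ?thesis
 proof (intro exI conjI allI impI)
  show "has_gradient_on UNIV (moll e f) (moll_grad e f)" by (rule moll_has_gradient[OF mo])
  show "continuous_on UNIV (moll_grad e f)" by (rule continuous_moll_grad[OF mo])
  fix z :: "real \<times> 'a" assume z: "fst z \<ge> 0"
  let ?h = "?s *\<^sub>R V z"
  have nh: "norm ?h \<le> U / real m" using V(3)[of z] by (simp add: divide_right_mono)
  have "U / real m \<le> 1" using m by (simp add: field_simps)
  then have h1: "norm ?h \<le> 1" using nh by linarith
  have T: "\<bar>moll e f (z + ?h) - moll e f z - moll_grad e f z \<bullet> ?h\<bar> \<le> C * (norm ?h)\<^sup>2"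
   using moll_taylor[OF mo h1, of z] by (simp add: C_def k_def)
  have T2: "C * (norm ?h)\<^sup>2 \<le> ?s * (d / 2)"
  proof -
   have "C * (norm ?h)\<^sup>2 \<le> C * (U / real m)\<^sup>2" using nh C by (intro mult_left_mono power_mono) auto
   also have "\<dots> = ?s * (C * U\<^sup>2 / real m)" by (simp add: power2_eq_square field_simps)
   also have "\<dots> \<le> ?s * (d / 2)"
   proof (intro mult_left_mono)
    have "2 * C * U\<^sup>2 / d < real m" using m by simp
    then have "2 * C * U\<^sup>2 < real m * d" using d by (simp add: pos_divide_less_eq)
    then show "C * U\<^sup>2 / real m \<le> d / 2" using m(2) by (simp add: field_simps)
   qed simp
   finally show ?thesis .
  qed
  have ci: "integrable lborel (\<lambda>y. kern e y * f (w - y))" for w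
  proof (rule integrable_lborel_bounded_support[where C = "3 * Bd" and S = "cball 0 1"])
   have "(\<lambda>y. f (w - y)) \<in> borel_measurable borel" by (rule measurable_compose[OF _ fm]) simp
   then show "(\<lambda>y. kern e y * f (w - y)) \<in> borel_measurable borel"
    by (intro borel_measurable_times kern_borel(1)[OF mo])
   show "norm (kern e y * f (w - y)) \<le> 3 * Bd" for y
    using mult_mono[OF kern_bound(1)[OF mo, of y] f(2)[of "w - y"]] kern_nonneg[of e y] by (simp add: abs_mult)
   show "kern e y * f (w - y) = 0" if "y \<notin> cball 0 1" for y using kern_0(1)[of e y] e that by auto
  qed auto
  have ki: "integrable lborel (kern e :: real \<times> 'a \<Rightarrow> real)" by (rule kern_integrable[OF mo])
  let ?q = "\<lambda>y. kern e y * f (z + ?h - y) - kern e y * f (z - y) - kern e y * (?s * c z)"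
  have E1: "(\<integral>y. ?q y \<partial>lborel) = (moll e f (z + ?h) - moll e f z - ?s * c z) * k"
  proof -
   have ml: "(\<integral>y. kern e y * f (w - y) \<partial>lborel) = moll e f w * k" for w
    using k by (simp add: moll_convolution[OF mo] k_def)
   have "(\<integral>y. ?q y \<partial>lborel) = (\<integral>y. kern e y * f (z + ?h - y) \<partial>lborel) - (\<integral>y. kern e y * f (z - y) \<partial>lborel) - (\<integral>y. kern e (y :: real \<times> 'a) * (?s * c z) \<partial>lborel)"
    by (subst Bochner_Integration.integral_diff[OF Bochner_Integration.integrable_diff[OF ci ci] integrable_mult_left[OF ki]],
      subst Bochner_Integration.integral_diff[OF ci ci]) simp
   also have "(\<integral>y. kern e (y :: real \<times> 'a) * (?s * c z) \<partial>lborel) = k * (?s * c z)" by (simp add: k_def kern_mass_def)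
   finally show ?thesis unfolding ml by (simp add: algebra_simps)
  qed
  have E2: "\<bar>\<integral>y. ?q y \<partial>lborel\<bar> \<le> (\<integral>y. kern e (y :: real \<times> 'a) * (?s * (d / 2)) \<partial>lborel)"
  proof (rule order_trans[OF integral_abs_bound integral_mono])
   show "integrable lborel (\<lambda>y. \<bar>?q y\<bar>)" using ci ki by (intro integrable_abs Bochner_Integration.integrable_diff) auto
   show "integrable lborel (\<lambda>y :: real \<times> 'a. kern e y * (?s * (d / 2)))" using ki by simp
   fix y :: "real \<times> 'a"
   show "\<bar>?q y\<bar> \<le> kern e y * (?s * (d / 2))"
   proof (cases "norm y < e")
    case True
    have fy: "fst (z - y) \<ge> -1" using z True e norm_fst_le[of "fst y" "snd y"] by (auto simp: abs_if split: if_splits)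
    have a: "\<bar>f (z + ?h - y) - f (z - y + ?s *\<^sub>R V (z - y))\<bar> \<le> ?s * (\<Lambda> * K * e)"
    proof -
     have "\<bar>f (z + ?h - y) - f (z - y + ?s *\<^sub>R V (z - y))\<bar> \<le> \<Lambda> * dist (z + ?h - y) (z - y + ?s *\<^sub>R V (z - y))"
      using lipschitz_onD[OF f(1)] by (simp add: dist_real_def)
     also have "dist (z + ?h - y) (z - y + ?s *\<^sub>R V (z - y)) = norm (?s *\<^sub>R (V z - V (z - y)))"
      by (simp add: dist_norm algebra_simps)
     also have "\<dots> = ?s * dist (V z) (V (z - y))" by (simp add: dist_norm)
     also have "\<Lambda> * \<dots> \<le> \<Lambda> * (?s * (K * e))"
     proof (intro mult_left_mono)
      have "dist (V z) (V (z - y)) \<le> K * dist z (z - y)" using lipschitz_onD[OF V(1), of z "z - y"] by simp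
      also have "\<dots> \<le> K * e" using True K by (intro mult_left_mono) (auto simp: dist_norm)
      finally show "dist (V z) (V (z - y)) \<le> K * e" .
     qed (use \<Lambda> in auto)
     finally show ?thesis by (simp add: mult_ac)
    qed
    have b: "f (z - y + ?s *\<^sub>R V (z - y)) - f (z - y) = ?s * c (z - y)" using f(3)[OF fy] by simp
    have "\<bar>c (z - y) - c z\<bar> \<le> M * e"
    proof -
     have "\<bar>c (z - y) - c z\<bar> \<le> M * dist (z - y) z" using lipschitz_onD[OF c(1), of "z - y" z] by (simp add: dist_real_def)
     also have "\<dots> \<le> M * e" using True M by (intro mult_left_mono) (auto simp: dist_norm)
     finally show ?thesis .
    qed
    then have cc: "\<bar>?s * c (z - y) - ?s * c z\<bar> \<le> ?s * (M * e)"
     by (simp add: diff_divide_distrib[symmetric] abs_divide divide_right_mono)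
    have "\<bar>f (z + ?h - y) - f (z - y) - ?s * c z\<bar> \<le> ?s * (\<Lambda> * K * e) + ?s * (M * e)"
     using a b cc by linarith
    also have "\<dots> = ?s * (e * (\<Lambda> * K + M))" by (simp add: algebra_simps)
    also have "\<dots> \<le> ?s * (d / 2)" using ee by (intro mult_left_mono) auto
    finally have "kern e y * \<bar>f (z + ?h - y) - f (z - y) - ?s * c z\<bar> \<le> kern e y * (?s * (d / 2))"
     by (intro mult_left_mono kern_nonneg)
    moreover have "?q y = kern e y * (f (z + ?h - y) - f (z - y) - ?s * c z)" by (simp only: right_diff_distrib)
    ultimately show ?thesis using kern_nonneg[of e y] by (simp only: abs_mult abs_of_nonneg)
   next
    case False
    then show ?thesis using kern_0(1)[of e y] e by simp
   qed
  qed
  have E3: "(\<integral>y. kern e (y :: real \<times> 'a) * (?s * (d / 2)) \<partial>lborel) = k * (?s * (d / 2))"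
   by (simp add: k_def kern_mass_def)
  have "\<bar>moll e f (z + ?h) - moll e f z - ?s * c z\<bar> * k \<le> (?s * (d / 2)) * k"
   using E2 unfolding E1 E3 abs_mult abs_of_pos[OF k] by (simp only: mult.commute)
  then have D: "\<bar>moll e f (z + ?h) - moll e f z - ?s * c z\<bar> \<le> ?s * (d / 2)"
   by (simp only: mult_le_cancel_right_pos[OF k])
  have gen: "\<bar>g - s\<bar> \<le> x + x" if "\<bar>a - b - s\<bar> \<le> x" "\<bar>a - b - g\<bar> \<le> y" "y \<le> x" for a b g s x y :: real
   using that by linarith
  have "\<bar>moll_grad e f z \<bullet> ?h - ?s * c z\<bar> \<le> ?s * (d / 2) + ?s * (d / 2)" by (rule gen[OF D T T2])
  also have "\<dots> = ?s * d" by simp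
  also have "moll_grad e f z \<bullet> ?h - ?s * c z = ?s * (moll_grad e f z \<bullet> V z - c z)" by (simp add: algebra_simps)
  finally have "?s * \<bar>moll_grad e f z \<bullet> V z - c z\<bar> \<le> ?s * d" by (simp add: abs_mult)
  then show "\<bar>moll_grad e f z \<bullet> V z - c z\<bar> \<le> d" using m(2) by (simp add: divide_le_cancel)
 qed
qed

section \<open>Absence of a duality gap\<close>

lemma norm_fst_le_norm: "norm (fst z) \<le> norm z" and norm_snd_le_norm: "norm (snd z) \<le> norm z"
 by (cases z, simp add: norm_fst_le norm_snd_le)+

lemma integrable_mult_continuous:
 fixes D :: "'a::euclidean_space set" and h r :: "'a \<Rightarrow> real"
 assumes D: "compact D" and r: "integrable (lebesgue_on D) r" and h: "continuous_on D h"
 shows "integrable (lebesgue_on D) (\<lambda>z. r z * h z)"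
proof -
 obtain C where C: "\<And>x. x \<in> D \<Longrightarrow> \<bar>h x\<bar> \<le> C"
  using compact_imp_bounded[OF compact_continuous_image[OF h D]] by (auto simp: bounded_iff)
 have Ds: "D \<in> sets lebesgue" using fmeasurableD[OF lmeasurable_compact[OF D]] .
 have hm: "h \<in> borel_measurable (lebesgue_on D)"
  by (rule continuous_imp_measurable_on_sets_lebesgue[OF h Ds])
 show ?thesis
 proof (rule Bochner_Integration.integrable_bound)
  show "integrable (lebesgue_on D) (\<lambda>z. C * \<bar>r z\<bar>)" using r by simp
  show "(\<lambda>z. r z * h z) \<in> borel_measurable (lebesgue_on D)" using hm r by auto
  show "AE z in lebesgue_on D. norm (r z * h z) \<le> norm (C * \<bar>r z\<bar>)"
  proof (rule AE_I2)
   fix z assume "z \<in> space (lebesgue_on D)"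
   then have zD: "z \<in> D" by simp
   then have "\<bar>h z\<bar> \<le> C" by (rule C)
   then have "\<bar>r z\<bar> * \<bar>h z\<bar> \<le> \<bar>r z\<bar> * \<bar>C\<bar>" by (intro mult_left_mono) auto
   then show "norm (r z * h z) \<le> norm (C * \<bar>r z\<bar>)" by (simp add: abs_mult mult.commute)
  qed
 qed
qed

lemma space_gradient:
 fixes \<Omega> :: "'a::euclidean_space set"
 assumes "(f has_derivative (\<lambda>v. g \<bullet> v)) (at (t, x) within {0..1} \<times> \<Omega>)" "t \<in> {0..1::real}"
 shows "((\<lambda>y. f (t, y)) has_derivative (\<lambda>v. snd g \<bullet> v)) (at x within \<Omega>)"
proof -
 have p: "((\<lambda>y. (t, y)) has_derivative (\<lambda>v. (0, v))) (at x within \<Omega>)"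
  by (auto intro!: derivative_eq_intros)
 have "(f has_derivative (\<lambda>v. g \<bullet> v)) (at (t, x) within (\<lambda>y. (t, y)) ` \<Omega>)"
  by (rule has_derivative_subset[OF assms(1)]) (use assms(2) in auto)
 from has_derivative_in_compose[OF p this] show ?thesis by (simp add: inner_prod_def)
qed

lemma time_derivative:
 fixes \<Omega> :: "'a::euclidean_space set"
 assumes "(f has_derivative (\<lambda>v. g \<bullet> v)) (at (t, x) within {0..1} \<times> \<Omega>)" "t \<in> {0<..<1::real}" "x \<in> \<Omega>"
 shows "deriv (\<lambda>s. f (s, x)) t = fst g"
proof -
 have p: "((\<lambda>s. (s, x)) has_derivative (\<lambda>v. (v, 0))) (at t within {0<..<1})"
  by (auto intro!: derivative_eq_intros)
 have "(f has_derivative (\<lambda>v. g \<bullet> v)) (at (t, x) within (\<lambda>s. (s, x)) ` {0<..<1})"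
  by (rule has_derivative_subset[OF assms(1)]) (use assms(3) in auto)
 from has_derivative_in_compose[OF p this]
 have "((\<lambda>s. f (s, x)) has_derivative (\<lambda>v. fst g * v)) (at t within {0<..<1})" by (simp add: inner_prod_def)
 then have "((\<lambda>s. f (s, x)) has_field_derivative fst g) (at t)"
  using assms(2) by (simp add: has_field_derivative_def at_within_open[OF _ open_greaterThanLessThan])
 then show ?thesis by (rule DERIV_imp_deriv)
qed

lemma grad_eq:
 fixes D :: "'a::euclidean_space set"
 assumes "convex D" "interior D \<noteq> {}" "x \<in> D" "(f has_derivative (\<lambda>v. g \<bullet> v)) (at x within D)"
 shows "grad D f x = g"
 unfolding grad_def
 by (rule the_equality) (use assms gradient_unique[OF assms(1,2,3)] in auto)

lemma B_scaleR:
 assumes "r \<ge> 0" shows "B r (r *\<^sub>R v) = ennreal (r * ((norm v)\<^sup>2 / 2))"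
 using assms by (auto simp: B_def power_mult_distrib power2_eq_square)

locale convex_body =
 fixes \<Omega> :: "'a::euclidean_space set"
 assumes compact: "compact \<Omega>" and conv: "convex \<Omega>" and int: "interior \<Omega> \<noteq> {}"
begin

definition Q :: "(real \<times> 'a) set" where "Q = {0..1} \<times> \<Omega>"

lemma Q: "compact Q" "convex Q" "interior Q \<noteq> {}" "Q \<in> sets lebesgue" "closed Q" "Q \<noteq> {}"
proof -
 show c: "compact Q" unfolding Q_def by (intro compact_Times compact_Icc compact)
 show "convex Q" unfolding Q_def by (intro convex_Times conv) simp
 show i: "interior Q \<noteq> {}" unfolding Q_def using int by (simp add: interior_Times)
 show "Q \<in> sets lebesgue" using fmeasurableD[OF lmeasurable_compact[OF c]] .
 show "closed Q" using c compact_imp_closed by auto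
 show "Q \<noteq> {}" using i interior_subset by blast
qed

lemma AE_Q_interior_time: "AE z in lebesgue_on Q. fst z \<in> {0<..<1}"
 using AE_lebesgue_on_interior[OF Q(2,4)]
proof eventually_elim
 case (elim z)
 then have "z \<in> {0<..<1} \<times> interior \<Omega>" unfolding Q_def interior_Times by simp
 then show ?case by auto
qed

lemma hamilton_jacobi_expr:
 assumes f: "has_gradient_on Q (\<lambda>(t, x). \<phi> t x) g" and z: "z \<in> Q" "fst z \<in> {0<..<1}"
 shows "deriv (\<lambda>s. \<phi> s (snd z)) (fst z) + (norm (grad \<Omega> (\<phi> (fst z)) (snd z)))\<^sup>2 / 2 = fst (g z) + (norm (snd (g z)))\<^sup>2 / 2"
proof -
 obtain t x where tx: "z = (t, x)" by (cases z)
 have d: "((\<lambda>(t, x). \<phi> t x) has_derivative (\<lambda>v. g z \<bullet> v)) (at (t, x) within {0..1} \<times> \<Omega>)"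
  using f z tx by (auto simp: has_gradient_on_def Q_def)
 have x: "x \<in> \<Omega>" "t \<in> {0..1}" "t \<in> {0<..<1}" using z tx by (auto simp: Q_def)
 have "deriv (\<lambda>s. \<phi> s x) t = fst (g z)" using time_derivative[OF d x(3,1)] by simp
 moreover have "grad \<Omega> (\<phi> t) x = snd (g z)"
  by (rule grad_eq[OF conv int x(1)]) (use space_gradient[OF d x(2)] in simp)
 ultimately show ?thesis using tx by simp
qed

text \<open>For a \<open>C\<^sup>1\<close> potential the almost everywhere inequality extends to all of \<open>Q\<close> by continuity.\<close>

lemma dual_admissible_iff:
 assumes f: "has_gradient_on Q (\<lambda>(t, x). \<phi> t x) g" and g: "continuous_on Q g"
 shows "dual_admissible \<Omega> \<phi> \<longleftrightarrow> (\<forall>z\<in>Q. fst (g z) + (norm (snd (g z)))\<^sup>2 / 2 \<le> 0)"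
proof
 assume "dual_admissible \<Omega> \<phi>"
 then have "AE z in lebesgue_on Q. deriv (\<lambda>s. \<phi> s (snd z)) (fst z) + (norm (grad \<Omega> (\<phi> (fst z)) (snd z)))\<^sup>2 / 2 \<le> 0"
  unfolding dual_admissible_def Q_def by (simp add: case_prod_unfold)
 moreover have "AE z in lebesgue_on Q. z \<in> Q" by (rule AE_I2) simp
 ultimately have ae: "AE z in lebesgue_on Q. fst (g z) + (norm (snd (g z)))\<^sup>2 / 2 \<le> 0"
  using AE_Q_interior_time by eventually_elim (use hamilton_jacobi_expr[OF f] in auto)
 show "\<forall>z\<in>Q. fst (g z) + (norm (snd (g z)))\<^sup>2 / 2 \<le> 0"
 proof
  fix z assume z: "z \<in> Q"
  have "continuous_on Q (\<lambda>z. fst (g z) + (norm (snd (g z)))\<^sup>2 / 2)" by (intro continuous_intros g) auto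
  from AE_lebesgue_on_imp_le[OF Q(2,3,4) this ae z]
  show "fst (g z) + (norm (snd (g z)))\<^sup>2 / 2 \<le> 0" .
 qed
next
 assume *: "\<forall>z\<in>Q. fst (g z) + (norm (snd (g z)))\<^sup>2 / 2 \<le> 0"
 have "AE z in lebesgue_on Q. z \<in> Q" by (rule AE_I2) simp
 then have "AE z in lebesgue_on Q. deriv (\<lambda>s. \<phi> s (snd z)) (fst z) + (norm (grad \<Omega> (\<phi> (fst z)) (snd z)))\<^sup>2 / 2 \<le> 0"
  using AE_Q_interior_time by eventually_elim (use hamilton_jacobi_expr[OF f] * in auto)
 moreover have "\<exists>L. L-lipschitz_on Q (\<lambda>(t, x). \<phi> t x)" by (rule has_gradient_lipschitz[OF Q(1,2) f g])
 ultimately show "dual_admissible \<Omega> \<phi>"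
  unfolding dual_admissible_def Q_def by (simp add: case_prod_unfold)
qed

text \<open>If \<open>c\<close> denotes the defect of \<open>\<phi>\<close> in the Hamilton-Jacobi inequality, the weak continuity equation gives
  \<open>dual_value \<phi> = \<integral> \<rho> |\<nabla>\<phi>|\<^sup>2 / 2 - \<integral> \<rho> c\<close>, so it suffices that \<open>\<integral> \<rho> c \<le> 0\<close>. For every \<open>\<delta> > 0\<close> there is a
  \<open>C\<^sup>1\<close> function \<open>\<psi>\<close> with \<open>\<partial>\<^sub>t \<psi> + \<nabla>\<phi> \<bullet> \<nabla>\<psi>\<close> between \<open>c - 3 \<delta>\<close> and \<open>c - \<delta>\<close>; then \<open>\<phi> + e \<psi>\<close> is admissible for
  small \<open>e\<close>, and the optimality of \<open>\<phi>\<close> reads \<open>\<integral> \<rho> (\<partial>\<^sub>t \<psi> + \<nabla>\<phi> \<bullet> \<nabla>\<psi>) \<le> 0\<close>.\<close>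

theorem duality_gap_le_0:
 assumes f: "has_gradient_on Q (\<lambda>(t, x). \<phi> t x) g" and gL: "L-lipschitz_on Q g"
  and d: "is_density \<Omega> \<rho>in" "is_density \<Omega> \<rho>f"
  and opt: "optimal_potential \<Omega> \<rho>in \<rho>f \<phi>" and ass: "associated_interpolation \<Omega> \<rho>in \<rho>f \<phi> \<rho>"
 shows "W2_sq \<Omega> \<rho>in \<rho>f \<le> ennreal (2 * dual_value \<Omega> \<rho>in \<rho>f \<phi>)"
  "\<And>z. z \<in> Q \<Longrightarrow> fst (g z) + (norm (snd (g z)))\<^sup>2 / 2 \<le> 0"
proof -
 have gc: "continuous_on Q g" using lipschitz_on_continuous_on[OF gL] .
 have adm: "dual_admissible \<Omega> \<phi>" and best: "\<And>\<phi>'. dual_admissible \<Omega> \<phi>' \<Longrightarrow> dual_value \<Omega> \<rho>in \<rho>f \<phi>' \<le> dual_value \<Omega> \<rho>in \<rho>f \<phi>"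
  using opt unfolding optimal_potential_def is_arg_max_def by (auto simp: not_less)
 show HJ: "\<And>z. z \<in> Q \<Longrightarrow> fst (g z) + (norm (snd (g z)))\<^sup>2 / 2 \<le> 0"
  using dual_admissible_iff[OF f gc] adm by blast
 let ?F = "\<lambda>t x. \<rho> t x *\<^sub>R grad \<Omega> (\<phi> t) x"
 have ce: "continuity_equation \<Omega> \<rho>in \<rho>f (\<rho>, ?F)"
  and min: "\<And>c. continuity_equation \<Omega> \<rho>in \<rho>f c \<Longrightarrow> action \<Omega> (\<rho>, ?F) \<le> action \<Omega> c"
  using ass unfolding associated_interpolation_def is_arg_min_def by (auto simp: not_less)
 define r where "r z = \<rho> (fst z) (snd z)" for z
 have r0: "\<And>z. z \<in> Q \<Longrightarrow> r z \<ge> 0" and ri: "integrable (lebesgue_on Q) r"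
  using ce unfolding continuity_equation_def Q_def r_def by (auto simp: case_prod_unfold)
 have gr: "grad \<Omega> (\<phi> (fst z)) (snd z) = snd (g z)" if "z \<in> Q" for z
 proof -
  obtain t x where tx: "z = (t, x)" by (cases z)
  have d: "((\<lambda>(t, x). \<phi> t x) has_derivative (\<lambda>v. g z \<bullet> v)) (at (t, x) within {0..1} \<times> \<Omega>)"
   using f that tx by (auto simp: has_gradient_on_def Q_def)
  have x: "x \<in> \<Omega>" "t \<in> {0..1}" using that tx by (auto simp: Q_def)
  show ?thesis using grad_eq[OF conv int x(1), of "\<phi> t" "snd (g z)"] space_gradient[OF d x(2)] tx by simp
 qed
 have weak: "int_on Q (\<lambda>z. r z * (fst (G z) + snd (g z) \<bullet> snd (G z)))
   = int_on \<Omega> (\<lambda>x. \<psi> (1, x) * \<rho>f x) - int_on \<Omega> (\<lambda>x. \<psi> (0, x) * \<rho>in x)"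
  if "has_gradient_on Q \<psi> G" "continuous_on Q G" for \<psi> G
 proof -
  have "int_on Q (\<lambda>(t, x). \<rho> t x * fst (G (t, x)) + ?F t x \<bullet> snd (G (t, x)))
   = int_on \<Omega> (\<lambda>x. \<psi> (1, x) * \<rho>f x) - int_on \<Omega> (\<lambda>x. \<psi> (0, x) * \<rho>in x)"
   using ce that unfolding continuity_equation_def Q_def by auto
  also have "int_on Q (\<lambda>(t, x). \<rho> t x * fst (G (t, x)) + ?F t x \<bullet> snd (G (t, x)))
    = int_on Q (\<lambda>z. r z * (fst (G z) + snd (g z) \<bullet> snd (G z)))"
   by (intro Bochner_Integration.integral_cong refl)
    (use gr in \<open>auto simp: r_def case_prod_unfold distrib_left\<close>)
  finally show ?thesis .
 qed
 define c where "c z = - (fst (g z) + (norm (snd (g z)))\<^sup>2 / 2)" for z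
 have cc: "continuous_on Q c" unfolding c_def by (intro continuous_intros gc) simp
 have c0: "c z \<ge> 0" if "z \<in> Q" for z using HJ[OF that] by (simp add: c_def)
 have gap: "int_on Q (\<lambda>z. r z * c z) \<le> 3 * \<delta> * int_on Q r" if \<delta>: "\<delta> > 0" for \<delta>
 proof -
  obtain Gb where Gb: "\<And>z. z \<in> Q \<Longrightarrow> norm (g z) \<le> Gb"
   using compact_imp_bounded[OF compact_continuous_image[OF gc Q(1)]] by (auto simp: bounded_iff)
  have Gb0: "Gb \<ge> 0" using Gb Q(6) norm_ge_zero order_trans by blast
  have L0: "L \<ge> 0" using gL lipschitz_on_nonneg by blast
  let ?p = "closest_point Q"
  have pQ: "?p z \<in> Q" for z by (rule closest_point_in_set[OF Q(5,6)])
  have pid: "?p z = z" if "z \<in> Q" for z using closest_point_self[OF that] .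
  have plip: "dist (?p x) (?p y) \<le> dist x y" for x y by (rule closest_point_lipschitz[OF Q(2,5,6)])
  \<comment> \<open>extended from \<open>Q\<close> to the whole space by the nearest point projection, which is 1-Lipschitz\<close>
  define V where "V z = (1 :: real, snd (g (?p z)))" for z
  define cut where "cut t = max 0 (min 1 (2 - t))" for t :: real
  define ce where "ce z = c (?p z) * cut (fst z)" for z
  have glip: "norm (g (?p x) - g (?p y)) \<le> L * dist x y" for x y
  proof -
   have "dist (g (?p x)) (g (?p y)) \<le> L * dist (?p x) (?p y)" by (rule lipschitz_onD[OF gL pQ pQ])
   also have "\<dots> \<le> L * dist x y" by (intro mult_left_mono plip L0)
   finally show ?thesis by (simp add: dist_norm)
  qed
  have sndlip: "norm (snd (g (?p x)) - snd (g (?p y))) \<le> L * dist x y" for x y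
   using norm_snd_le_norm[of "g (?p x) - g (?p y)"] glip[of x y] by simp
  have fstlip: "\<bar>fst (g (?p x)) - fst (g (?p y))\<bar> \<le> L * dist x y" for x y
   using norm_fst_le_norm[of "g (?p x) - g (?p y)"] glip[of x y] by simp
  have sndb: "norm (snd (g (?p x))) \<le> Gb" for x
   using norm_snd_le_norm[of "g (?p x)"] Gb[OF pQ[of x]] by simp
  have fstb: "\<bar>fst (g (?p x))\<bar> \<le> Gb" for x
   using norm_fst_le_norm[of "g (?p x)"] Gb[OF pQ[of x]] by simp
  have VL: "L-lipschitz_on UNIV V"
   by (rule lipschitz_onI) (use sndlip L0 in \<open>auto simp: V_def dist_norm norm_Pair\<close>)
  have VU: "norm (V z) \<le> 1 + Gb" for z
   using norm_Pair_le[of "1::real" "snd (g (?p z))"] sndb[of z] by (simp add: V_def)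
  define Mc where "Mc = L + L * Gb"
  have Mc0: "Mc \<ge> 0" using L0 Gb0 by (simp add: Mc_def)
  have clip: "\<bar>c (?p x) - c (?p y)\<bar> \<le> Mc * dist x y" for x y
  proof -
   let ?a = "snd (g (?p x))" and ?b = "snd (g (?p y))"
   have "\<bar>(norm ?a)\<^sup>2 - (norm ?b)\<^sup>2\<bar> = (norm ?a + norm ?b) * \<bar>norm ?a - norm ?b\<bar>"
    by (simp add: power2_eq_square square_diff_square_factored abs_mult)
   also have "\<dots> \<le> (2 * Gb) * (L * dist x y)"
    using sndb[of x] sndb[of y] norm_triangle_ineq3[of ?a ?b] sndlip[of x y]
    by (intro mult_mono) (auto simp: Gb0)
   finally have "\<bar>(norm ?a)\<^sup>2 / 2 - (norm ?b)\<^sup>2 / 2\<bar> \<le> L * Gb * dist x y" by (simp add: mult_ac)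
   then have "\<bar>c (?p x) - c (?p y)\<bar> \<le> L * dist x y + L * Gb * dist x y"
    using fstlip[of x y] unfolding c_def by linarith
   then show ?thesis by (simp add: Mc_def algebra_simps)
  qed
  define Bc where "Bc = Gb + Gb\<^sup>2 / 2"
  have Bc0: "Bc \<ge> 0" using Gb0 by (simp add: Bc_def)
  have cb: "\<bar>c (?p x)\<bar> \<le> Bc" for x
  proof -
   have "(norm (snd (g (?p x))))\<^sup>2 \<le> Gb\<^sup>2" using sndb by (intro power_mono) auto
   moreover have "(norm (snd (g (?p x))))\<^sup>2 \<ge> 0" by simp
   ultimately show ?thesis using fstb[of x] unfolding c_def Bc_def by linarith
  qed
  have cutb: "0 \<le> cut t" "cut t \<le> 1" for t by (auto simp: cut_def)
  have cutl: "\<bar>cut s - cut t\<bar> \<le> \<bar>s - t\<bar>" for s t by (auto simp: cut_def)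
  have ceL: "(Mc + Bc)-lipschitz_on UNIV ce"
  proof (rule lipschitz_onI)
   fix x y
   have "\<bar>ce x - ce y\<bar> = \<bar>(c (?p x) - c (?p y)) * cut (fst x) + c (?p y) * (cut (fst x) - cut (fst y))\<bar>"
    by (simp add: ce_def algebra_simps)
   also have "\<dots> \<le> \<bar>c (?p x) - c (?p y)\<bar> * cut (fst x) + \<bar>c (?p y)\<bar> * \<bar>cut (fst x) - cut (fst y)\<bar>"
    using cutb by (intro order_trans[OF abs_triangle_ineq]) (auto simp: abs_mult)
   also have "\<dots> \<le> (Mc * dist x y) * 1 + Bc * dist x y"
   proof (intro add_mono mult_mono clip cb cutb)
    have "\<bar>fst x - fst y\<bar> \<le> dist x y" using dist_fst_le[of x y] by (simp add: dist_real_def)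
    then show "\<bar>cut (fst x) - cut (fst y)\<bar> \<le> dist x y" using cutl[of "fst x" "fst y"] by linarith
   qed (use Mc0 Bc0 in auto)
   finally show "dist (ce x) (ce y) \<le> (Mc + Bc) * dist x y" by (simp add: dist_real_def algebra_simps)
  qed (use Mc0 Bc0 in auto)
  have ceb: "\<bar>ce z\<bar> \<le> Bc" for z
   using mult_mono[OF cb[of z] cutb(2)[of "fst z"]] Bc0 cutb by (simp add: ce_def abs_mult)
  have ce2: "ce z = 0" if "fst z \<ge> 2" for z using that by (simp add: ce_def cut_def)
  obtain F G where FG: "has_gradient_on UNIV F G" "continuous_on UNIV G" "\<And>z. fst z \<ge> 0 \<Longrightarrow> \<bar>G z \<bullet> V z - ce z\<bar> \<le> \<delta>"
   using transport_equation_approx[OF VL _ VU ceL ceb ce2 \<delta>] by (auto simp: V_def)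
  have Dpsi: "\<bar>fst (G z) + snd (g z) \<bullet> snd (G z) - c z\<bar> \<le> \<delta>" if "z \<in> Q" for z
  proof -
   have "fst z \<in> {0..1}" using that by (auto simp: Q_def)
   then show ?thesis
    using FG(3)[of z] pid[OF that] by (simp add: V_def ce_def cut_def inner_prod_def inner_commute)
  qed
  define \<psi> where "\<psi> z = F z - 2 * \<delta> * fst z" for z
  \<comment> \<open>subtracting \<open>2 \<delta> t\<close> makes the transport term of the perturbation at most \<open>c - \<delta>\<close>\<close>
  define H where "H z = G z - (2 * \<delta>, 0)" for z
  have \<psi>: "has_gradient_on Q \<psi> H"
   unfolding has_gradient_on_def
  proof
   fix z
   have "(F has_derivative (\<lambda>v. G z \<bullet> v)) (at z within Q)"
    using FG(1) has_derivative_at_withinI unfolding has_gradient_on_def by blast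
   then have "(\<psi> has_derivative (\<lambda>v. G z \<bullet> v - 2 * \<delta> * fst v)) (at z within Q)"
    unfolding \<psi>_def by (auto intro!: derivative_eq_intros)
   then show "(\<psi> has_derivative (\<lambda>v. H z \<bullet> v)) (at z within Q)" by (simp add: H_def inner_prod_def algebra_simps)
  qed
  have Hc: "continuous_on Q H" unfolding H_def by (intro continuous_intros continuous_on_subset[OF FG(2)]) auto
  obtain Hb where Hb: "\<And>z. z \<in> Q \<Longrightarrow> norm (H z) \<le> Hb"
   using compact_imp_bounded[OF compact_continuous_image[OF Hc Q(1)]] by (auto simp: bounded_iff)
  define e where "e = min 1 (2 * \<delta> / (Hb\<^sup>2 + 1))"
  have Hb1: "Hb\<^sup>2 + 1 > 0" by (simp add: add_nonneg_pos)
  have e: "0 < e" "e \<le> 1" using \<delta> Hb1 by (auto simp: e_def)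
  have eH: "e * Hb\<^sup>2 / 2 \<le> \<delta>"
  proof -
   have "e * Hb\<^sup>2 \<le> e * (Hb\<^sup>2 + 1)" using e by (intro mult_left_mono) auto
   also have "\<dots> \<le> 2 * \<delta>" using Hb1 unfolding e_def by (simp add: min_le_iff_disj pos_le_divide_eq[symmetric])
   finally show ?thesis by simp
  qed
  define \<phi>' where "\<phi>' t x = \<phi> t x + e * \<psi> (t, x)" for t x
  have \<phi>'g: "has_gradient_on Q (\<lambda>(t, x). \<phi>' t x) (\<lambda>z. g z + e *\<^sub>R H z)"
   unfolding has_gradient_on_def
  proof
   fix z assume z: "z \<in> Q"
   have 1: "((\<lambda>(t, x). \<phi> t x) has_derivative (\<lambda>v. g z \<bullet> v)) (at z within Q)"
    using f z by (auto simp: has_gradient_on_def)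
   have 2: "(\<psi> has_derivative (\<lambda>v. H z \<bullet> v)) (at z within Q)" using \<psi> z by (auto simp: has_gradient_on_def)
   have "((\<lambda>z. (case z of (t, x) \<Rightarrow> \<phi> t x) + e * \<psi> z) has_derivative (\<lambda>v. g z \<bullet> v + e * (H z \<bullet> v))) (at z within Q)"
    by (intro has_derivative_add 1 has_derivative_mult_right 2)
   then show "((\<lambda>(t, x). \<phi>' t x) has_derivative (\<lambda>v. (g z + e *\<^sub>R H z) \<bullet> v)) (at z within Q)"
    by (simp add: \<phi>'_def case_prod_unfold inner_add_left)
  qed
  have Dlow: "c z - 3 * \<delta> \<le> fst (H z) + snd (g z) \<bullet> snd (H z)"
   and Dup: "fst (H z) + snd (g z) \<bullet> snd (H z) \<le> c z - \<delta>" if "z \<in> Q" for z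
   using Dpsi[OF that] unfolding H_def by (auto simp: abs_le_iff)
  have "dual_admissible \<Omega> \<phi>'"
  proof (subst dual_admissible_iff[OF \<phi>'g])
   show "continuous_on Q (\<lambda>z. g z + e *\<^sub>R H z)" by (intro continuous_intros gc Hc)
   show "\<forall>z\<in>Q. fst (g z + e *\<^sub>R H z) + (norm (snd (g z + e *\<^sub>R H z)))\<^sup>2 / 2 \<le> 0"
   proof
    fix z assume z: "z \<in> Q"
    have n: "(norm (snd (H z)))\<^sup>2 \<le> Hb\<^sup>2"
     using norm_snd_le_norm[of "H z"] Hb[OF z] by (intro power_mono) auto
    have q: "e * (norm (snd (H z)))\<^sup>2 / 2 \<le> \<delta>"
     using mult_left_mono[OF n, of e] e eH by linarith
    have "(norm (snd (g z + e *\<^sub>R H z)))\<^sup>2 = (norm (snd (g z)))\<^sup>2 + 2 * e * (snd (g z) \<bullet> snd (H z)) + e * (e * (norm (snd (H z)))\<^sup>2)"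
     unfolding power2_norm_eq_inner by (simp add: inner_add_left inner_add_right inner_commute)
    then have "fst (g z + e *\<^sub>R H z) + (norm (snd (g z + e *\<^sub>R H z)))\<^sup>2 / 2
      = - c z + e * (fst (H z) + snd (g z) \<bullet> snd (H z) + e * (norm (snd (H z)))\<^sup>2 / 2)"
     by (simp add: c_def algebra_simps)
    also have "\<dots> \<le> - c z + e * c z"
     using Dup[OF z] q e by (intro add_left_mono mult_left_mono) auto
    also have "\<dots> \<le> 0" using c0[OF z] e by (simp add: mult_left_le_one_le)
    finally show "fst (g z + e *\<^sub>R H z) + (norm (snd (g z + e *\<^sub>R H z)))\<^sup>2 / 2 \<le> 0" .
   qed
  qed
  then have le: "dual_value \<Omega> \<rho>in \<rho>f \<phi>' \<le> dual_value \<Omega> \<rho>in \<rho>f \<phi>" by (rule best)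
  have cont: "continuous_on \<Omega> (\<lambda>x. u (t, x))" if "has_gradient_on Q u gu" "t \<in> {0..1}" for u gu t
  proof (rule has_derivative_continuous_on)
   fix x assume "x \<in> \<Omega>"
   then have "(u has_derivative (\<lambda>v. gu (t, x) \<bullet> v)) (at (t, x) within {0..1} \<times> \<Omega>)"
    using that by (auto simp: has_gradient_on_def Q_def)
   from space_gradient[OF this that(2)]
   show "((\<lambda>x. u (t, x)) has_derivative (\<lambda>v. snd (gu (t, x)) \<bullet> v)) (at x within \<Omega>)" .
  qed
  have int1: "integrable (lebesgue_on \<Omega>) (\<lambda>x. u (t, x) * \<rho>' x)"
   if "has_gradient_on Q u gu" "t \<in> {0..1}" "is_density \<Omega> \<rho>'" for u gu t \<rho>'
   using integrable_mult_continuous[OF compact _ cont[OF that(1,2)], of \<rho>'] that(3)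
   by (simp add: is_density_def mult.commute)
  have "dual_value \<Omega> \<rho>in \<rho>f \<phi>' = dual_value \<Omega> \<rho>in \<rho>f \<phi> + e * (int_on \<Omega> (\<lambda>x. \<psi> (1, x) * \<rho>f x)
    - int_on \<Omega> (\<lambda>x. \<psi> (0, x) * \<rho>in x))"
  proof -
   have *: "int_on \<Omega> (\<lambda>x. \<phi>' t x * \<rho>' x) = int_on \<Omega> (\<lambda>x. \<phi> t x * \<rho>' x) +
     e * int_on \<Omega> (\<lambda>x. \<psi> (t, x) * \<rho>' x)" if "t \<in> {0..1}" "is_density \<Omega> \<rho>'" for t \<rho>'
   proof -
    have i: "integrable (lebesgue_on \<Omega>) (\<lambda>x. \<phi> t x * \<rho>' x)" "integrable (lebesgue_on \<Omega>) (\<lambda>x. e * (\<psi> (t, x) * \<rho>' x))"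
     using int1[OF f that] int1[OF \<psi> that] by auto
    have "int_on \<Omega> (\<lambda>x. \<phi>' t x * \<rho>' x) = int_on \<Omega> (\<lambda>x. \<phi> t x * \<rho>' x + e * (\<psi> (t, x) * \<rho>' x))"
     by (simp add: \<phi>'_def algebra_simps)
    then show ?thesis using Bochner_Integration.integral_add[OF i] by simp
   qed
   show ?thesis unfolding dual_value_def using *[OF _ d(1), of 0] *[OF _ d(2), of 1] by (simp add: algebra_simps)
  qed
  also have "int_on \<Omega> (\<lambda>x. \<psi> (1, x) * \<rho>f x) - int_on \<Omega> (\<lambda>x. \<psi> (0, x) * \<rho>in x)
    = int_on Q (\<lambda>z. r z * (fst (H z) + snd (g z) \<bullet> snd (H z)))"
   by (rule weak[OF \<psi> Hc, symmetric])
  finally have "e * int_on Q (\<lambda>z. r z * (fst (H z) + snd (g z) \<bullet> snd (H z))) \<le> 0" using le by linarith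
  then have neg: "int_on Q (\<lambda>z. r z * (fst (H z) + snd (g z) \<bullet> snd (H z))) \<le> 0"
   using e by (simp add: mult_le_0_iff)
  have "int_on Q (\<lambda>z. r z * (c z - 3 * \<delta>)) \<le> int_on Q (\<lambda>z. r z * (fst (H z) + snd (g z) \<bullet> snd (H z)))"
  proof (rule integral_mono)
   show "integrable (lebesgue_on Q) (\<lambda>z. r z * (c z - 3 * \<delta>))"
    by (intro integrable_mult_continuous[OF Q(1) ri] continuous_intros cc)
   show "integrable (lebesgue_on Q) (\<lambda>z. r z * (fst (H z) + snd (g z) \<bullet> snd (H z)))"
    by (intro integrable_mult_continuous[OF Q(1) ri] continuous_intros gc Hc)
   fix z assume "z \<in> space (lebesgue_on Q)"
   then have "z \<in> Q" by simp
   then show "r z * (c z - 3 * \<delta>) \<le> r z * (fst (H z) + snd (g z) \<bullet> snd (H z))"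
    by (intro mult_left_mono Dlow r0)
  qed
  also have "\<dots> \<le> 0" by (rule neg)
  also have "int_on Q (\<lambda>z. r z * (c z - 3 * \<delta>)) = int_on Q (\<lambda>z. r z * c z - 3 * \<delta> * r z)"
   by (intro Bochner_Integration.integral_cong refl) (simp add: algebra_simps)
  also have "\<dots> = int_on Q (\<lambda>z. r z * c z) - 3 * \<delta> * int_on Q r"
   using Bochner_Integration.integral_diff[OF integrable_mult_continuous[OF Q(1) ri cc], of "\<lambda>z. 3 * \<delta> * r z"] ri by simp
  finally show ?thesis by simp
 qed
 have rc: "int_on Q (\<lambda>z. r z * c z) \<le> 0"
 proof (rule field_le_epsilon)
  fix e :: real assume e: "e > 0"
  let ?R = "int_on Q r"
  have R: "?R \<ge> 0" using r0 by (intro Bochner_Integration.integral_nonneg) auto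
  have "int_on Q (\<lambda>z. r z * c z) \<le> 3 * (e / (3 * (?R + 1))) * ?R"
   by (rule gap) (use e R in auto)
  also have "\<dots> = e * (?R / (?R + 1))" using R by (simp add: field_simps)
  also have "\<dots> \<le> e * 1" using e R by (intro mult_left_mono) auto
  finally show "int_on Q (\<lambda>z. r z * c z) \<le> 0 + e" by simp
 qed
 have iv: "integrable (lebesgue_on Q) (\<lambda>z. r z * ((norm (snd (g z)))\<^sup>2 / 2))"
  by (intro integrable_mult_continuous[OF Q(1) ri] continuous_intros gc) simp
 have "W2_sq \<Omega> \<rho>in \<rho>f \<le> 2 * action \<Omega> (\<rho>, ?F)"
  unfolding W2_sq_def by (intro mult_left_mono INF_lower) (use ce in auto)
 also have "action \<Omega> (\<rho>, ?F) = (\<integral>\<^sup>+ z. ennreal (r z * ((norm (snd (g z)))\<^sup>2 / 2)) \<partial>lebesgue_on Q)"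
  unfolding action_def Q_def[symmetric] prod.case
  by (intro nn_integral_cong) (use gr r0 in \<open>auto simp: r_def case_prod_unfold B_scaleR\<close>)
 also have "\<dots> = ennreal (int_on Q (\<lambda>z. r z * ((norm (snd (g z)))\<^sup>2 / 2)))"
  by (intro nn_integral_eq_integral iv AE_I2) (use r0 in auto)
 also have "int_on Q (\<lambda>z. r z * ((norm (snd (g z)))\<^sup>2 / 2)) \<le> dual_value \<Omega> \<rho>in \<rho>f \<phi>"
 proof -
  have "dual_value \<Omega> \<rho>in \<rho>f \<phi> = int_on Q (\<lambda>z. r z * (fst (g z) + snd (g z) \<bullet> snd (g z)))"
   using weak[OF f gc] by (simp add: dual_value_def)
  also have "\<dots> = int_on Q (\<lambda>z. r z * ((norm (snd (g z)))\<^sup>2 / 2) - r z * c z)"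
   by (intro Bochner_Integration.integral_cong refl) (simp add: c_def power2_norm_eq_inner algebra_simps)
  also have "\<dots> = int_on Q (\<lambda>z. r z * ((norm (snd (g z)))\<^sup>2 / 2)) - int_on Q (\<lambda>z. r z * c z)"
   by (rule Bochner_Integration.integral_diff[OF iv integrable_mult_continuous[OF Q(1) ri cc]])
  finally show ?thesis using rc by linarith
 qed
 finally show "W2_sq \<Omega> \<rho>in \<rho>f \<le> ennreal (2 * dual_value \<Omega> \<rho>in \<rho>f \<phi>)"
  by (auto simp: ennreal_mult' mult_left_mono ennreal_leI)
qed

end

section \<open>Sums over cells and sampled densities\<close>

context mesh begin

lemma cell_sets: "K \<in> cells T \<Longrightarrow> K \<in> sets borel" "K \<in> cells T \<Longrightarrow> K \<in> sets lebesgue"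
 using cell(2) by auto

lemma cell_measure_pos: "K \<in> cells T \<Longrightarrow> cell_measure K > 0"
proof -
 assume K: "K \<in> cells T"
 have "\<not> negligible K" using open_not_negligible cell(1,2)[OF K] by blast
 then have "emeasure lebesgue K \<noteq> 0" using cell_sets(2)[OF K] by (auto simp: negligible_iff_null_sets null_sets_def)
 moreover have "emeasure lebesgue K < \<infinity>" using bounded_set_imp_lmeasurable[OF cell(4)[OF K] cell_sets(2)[OF K]] by (auto simp: fmeasurable_def)
 ultimately show ?thesis unfolding cell_measure_def measure_def
  by (simp add: enn2real_positive_iff zero_less_iff_neq_zero top.not_eq_extremum)
qed

lemma face_measure_nonneg: "face_measure s \<ge> 0" by (simp add: face_measure_def)

lemma cell_face_dist_nonneg: "cell_face_dist T K s \<ge> 0" by (simp add: cell_face_dist_def)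

lemma diameter_le_mesh_size: "K \<in> cells T \<Longrightarrow> diameter K \<le> mesh_size T"
 unfolding mesh_size_def using finite_cells by (intro Max_ge) auto

lemma diameter_cell_pos: "K \<in> cells T \<Longrightarrow> diameter K > 0"
proof -
 assume K: "K \<in> cells T"
 obtain x e where x: "e > 0" "ball x e \<subseteq> K" "x \<in> K" using cell(1,2)[OF K] by (meson all_not_in_conv openE)
 obtain b :: 'a where b: "b \<in> Basis" using nonempty_Basis by blast
 have "x + (e/2) *\<^sub>R b \<in> K" using x b by (auto simp: subset_iff dist_norm)
 then have "dist x (x + (e/2) *\<^sub>R b) \<le> diameter K" using diameter_bounded_bound[OF cell(4)[OF K] x(3)] by blast
 then show ?thesis using x b by (simp add: dist_norm)
qed

lemma cells_nonempty: "cells T \<noteq> {}" using \<Omega>_cover \<Omega>(5) by blast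

lemma mesh_size_pos: "mesh_size T > 0"
 using cells_nonempty diameter_cell_pos diameter_le_mesh_size by (meson all_not_in_conv less_le_trans)

lemma mesh_size_le: "mesh_size T \<le> diameter \<Omega>"
 unfolding mesh_size_def using finite_cells cells_nonempty diameter_subset[OF cell(6) \<Omega>(4)] by (intro Max.boundedI) auto

lemma AE_in_cell: "AE x in lebesgue_on \<Omega>. \<exists>K\<in>cells T. x \<in> K"
proof -
 have "AE x in lebesgue. \<forall>K\<in>cells T. x \<notin> frontier K"
 proof (rule AE_finite_allI[OF finite_cells])
  fix K assume "K \<in> cells T"
  then show "AE x in lebesgue. x \<notin> frontier K"
   using negligible_convex_frontier[OF cell(3)] by (intro AE_not_in) (simp add: negligible_iff_null_sets)
 qed
 then have "AE x in lebesgue. x \<in> \<Omega> \<longrightarrow> (\<exists>K\<in>cells T. x \<in> K)"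
 proof eventually_elim
  case (elim x)
  show ?case
  proof
   assume "x \<in> \<Omega>"
   then obtain K where K: "K \<in> cells T" "x \<in> closure K" using \<Omega>_cover by blast
   then have "x \<in> K" using elim interior_subset[of K] by (auto simp: frontier_def)
   then show "\<exists>K\<in>cells T. x \<in> K" using K by blast
  qed
 qed
 then show ?thesis by (simp add: AE_restrict_space_iff \<Omega>_sets(2))
qed

lemma cell_integral:
 fixes f :: "'a \<Rightarrow> real" assumes "K \<in> cells T"
 shows "int_on K f = int_on \<Omega> (\<lambda>x. indicator K x * f x)"
 using cell(6)[OF assms] cell_sets[OF assms] \<Omega>_sets(2)
  by (auto simp: integral_restrict_space indicator_def intro!: Bochner_Integration.integral_cong)

lemma indicator_measurable: "K \<in> sets lebesgue \<Longrightarrow> (indicator K :: 'a \<Rightarrow> real) \<in> borel_measurable (lebesgue_on \<Omega>)"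
 by (intro measurable_restrict_space1 borel_measurable_indicator)

lemma indicator_integrable:
 fixes f :: "'a \<Rightarrow> real" assumes "integrable (lebesgue_on \<Omega>) f" "K \<in> sets lebesgue"
 shows "integrable (lebesgue_on \<Omega>) (\<lambda>x. indicator K x * f x)"
proof (rule Bochner_Integration.integrable_bound[OF assms(1)])
 show "(\<lambda>x. indicator K x * f x) \<in> borel_measurable (lebesgue_on \<Omega>)"
  by (intro borel_measurable_times indicator_measurable assms borel_measurable_integrable)
qed (auto simp: indicator_def)

lemma sum_indicator_cells: "x \<in> K \<Longrightarrow> K \<in> cells T \<Longrightarrow> (\<Sum>L\<in>cells T. indicator L x * a L) = (a K :: real)"
proof -
 assume K: "x \<in> K" "K \<in> cells T"
 have "indicator L x * a L = (if L = K then a K else 0)" if "L \<in> cells T" for L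
  using cells_disjoint[OF that K(2)] K by (auto simp: indicator_def)
 then show ?thesis using K finite_cells by (simp add: sum.delta' cong: sum.cong)
qed

lemma integral_sum_cells:
 fixes f :: "'a \<Rightarrow> real" assumes f: "integrable (lebesgue_on \<Omega>) f"
 shows "int_on \<Omega> f = (\<Sum>K\<in>cells T. int_on K f)"
proof -
 have "int_on \<Omega> f = int_on \<Omega> (\<lambda>x. \<Sum>K\<in>cells T. indicator K x * f x)"
 proof (rule integral_cong_AE)
  show "(\<lambda>x. \<Sum>K\<in>cells T. indicator K x * f x) \<in> borel_measurable (lebesgue_on \<Omega>)"
   using indicator_integrable[OF f] cell_sets(2) by (intro borel_measurable_sum) auto
  show "AE x in lebesgue_on \<Omega>. f x = (\<Sum>K\<in>cells T. indicator K x * f x)"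
   using AE_in_cell by eventually_elim (auto simp: sum_indicator_cells)
 qed (use f in auto)
 also have "\<dots> = (\<Sum>K\<in>cells T. int_on \<Omega> (\<lambda>x. indicator K x * f x))"
  by (intro Bochner_Integration.integral_sum indicator_integrable[OF f] cell_sets(2))
 finally show ?thesis by (simp add: cell_integral)
qed

lemma integrable_cell: "K \<in> cells T \<Longrightarrow> integrable (lebesgue_on \<Omega>) f \<Longrightarrow> integrable (lebesgue_on K) (f :: 'a \<Rightarrow> real)"
proof -
 assume K: "K \<in> cells T" and "integrable (lebesgue_on \<Omega>) f"
 then have "set_integrable lebesgue \<Omega> f" by (simp add: set_integrable_def integrable_restrict_space \<Omega>_sets(2))
 then have "set_integrable lebesgue K f"
  by (rule set_integrable_subset) (use K cell(6) cell_sets(2) in auto)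
 then show ?thesis by (simp add: set_integrable_def integrable_restrict_space cell_sets(2)[OF K])
qed

lemma integral_const_cell: "K \<in> cells T \<Longrightarrow> int_on K (\<lambda>x. c) = c * cell_measure K"
 by (simp add: cell_measure_def measure_restrict_space cell_sets)

lemma isotropy:
 assumes iso: "mesh_isotropic e T" and K: "K \<in> cells T"
 shows "(\<Sum>s\<in>cell_faces T K. face_measure s * cell_face_dist T K s * (outward_normal K s \<bullet> v)\<^sup>2) \<le> cell_measure K * (1 + e) * (norm v)\<^sup>2"
proof -
 have "(\<Sum>s\<in>cell_faces T K. (face_measure s * cell_face_dist T K s) *\<^sub>R
    outer_product (outward_normal K s) (outward_normal K s) v) \<bullet> v \<le> ((cell_measure K * (1 + e)) *\<^sub>R v) \<bullet> v"
  using iso K unfolding mesh_isotropic_def loewner_le_def by blast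
 moreover have "(\<Sum>s\<in>cell_faces T K. (face_measure s * cell_face_dist T K s) *\<^sub>R
    outer_product (outward_normal K s) (outward_normal K s) v) \<bullet> v =
   (\<Sum>s\<in>cell_faces T K. face_measure s * cell_face_dist T K s * (outward_normal K s \<bullet> v)\<^sup>2)"
  by (simp add: inner_sum_left outer_product_def power2_eq_square mult.assoc)
 ultimately show ?thesis by (simp add: power2_norm_eq_inner)
qed

text \<open>The trace of the matrix inequality: sum over an orthonormal basis.\<close>

lemma isotropy_trace:
 assumes iso: "mesh_isotropic e T" and K: "K \<in> cells T"
 shows "(\<Sum>s\<in>cell_faces T K. face_measure s * cell_face_dist T K s) \<le> real DIM('a) * (cell_measure K * (1 + e))"
proof -
 have "(\<Sum>s\<in>cell_faces T K. face_measure s * cell_face_dist T K s) =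
  (\<Sum>s\<in>cell_faces T K. \<Sum>b\<in>Basis. face_measure s * cell_face_dist T K s * (outward_normal K s \<bullet> b)\<^sup>2)"
 proof (rule sum.cong[OF refl])
  fix s assume s: "s \<in> cell_faces T K"
  have "(\<Sum>b\<in>Basis. (outward_normal K s \<bullet> b)\<^sup>2) = 1"
   using normal(1)[OF K cell_facesD(1,2)[OF s]] euclidean_inner[of "outward_normal K s" "outward_normal K s"]
   by (simp add: norm_eq_1 power2_eq_square)
  then show "face_measure s * cell_face_dist T K s = (\<Sum>b\<in>Basis. face_measure s * cell_face_dist T K s * (outward_normal K s \<bullet> b)\<^sup>2)"
   by (simp flip: sum_distrib_left)
 qed
 also have "\<dots> = (\<Sum>b\<in>Basis. \<Sum>s\<in>cell_faces T K. face_measure s * cell_face_dist T K s * (outward_normal K s \<bullet> b)\<^sup>2)"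
  by (rule sum.swap)
 also have "\<dots> \<le> (\<Sum>b\<in>(Basis::'a set). cell_measure K * (1 + e) * (norm b)\<^sup>2)"
  by (intro sum_mono isotropy iso K)
 also have "\<dots> = real DIM('a) * (cell_measure K * (1 + e))" by simp
 finally show ?thesis .
qed

lemma linear_reconstruction_pair:
 assumes "face_cells T s = {K, L}" "K \<noteq> L"
 shows "linear_reconstruction T a s = (cell_face_dist T K s * a K + cell_face_dist T L s * a L) / face_dist T s"
 using assms by (simp add: linear_reconstruction_def add_divide_distrib)

lemma flux_size_eq:
 assumes "is_flux T F" "s \<in> internal_faces T" "face_cells T s = {K, L}" "K \<noteq> L"
 shows "flux_size T F s = \<bar>F K s\<bar>" "F L s = - F K s"
proof -
 show *: "F L s = - F K s" using assms unfolding is_flux_def by (metis add_eq_0_iff)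
 show "flux_size T F s = \<bar>F K s\<bar>"
  unfolding flux_size_def by (rule the_equality) (use assms * in auto)
qed

text \<open>Summation by parts: the discrete divergence is minus the adjoint of the differences across faces.\<close>

lemma sum_cells_flux:
 assumes F: "is_flux T F"
 shows "(\<Sum>K\<in>cells T. u K * (\<Sum>s\<in>cell_faces T K. F K s * face_measure s)) =
  (\<Sum>s\<in>internal_faces T. face_measure s * (\<Sum>K\<in>face_cells T s. F K s * u K))"
 unfolding sum_distrib_left sum_cells_faces by (simp add: mult_ac)

end

locale mesh_pair = mesh \<Omega> T for \<Omega> :: "'a::euclidean_space set" and T :: "'a mesh" +
 fixes T' :: "'a mesh"
 assumes adm': "admissible_mesh \<Omega> T'" and sub: "subordinate T' T"
begin

sublocale coarse: mesh \<Omega> T'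
 by unfold_locales (rule adm' poly int\<Omega>)+

definition parent :: "'a set \<Rightarrow> 'a set" where
 "parent K = (THE K'. K' \<in> cells T' \<and> K \<subseteq> K')"

lemma parent:
 assumes "K \<in> cells T" shows "parent K \<in> cells T'" "K \<subseteq> parent K"
  "K' \<in> cells T' \<Longrightarrow> K \<subseteq> K' \<Longrightarrow> parent K = K'" "K' \<in> cells T' \<Longrightarrow> parent K \<noteq> K' \<Longrightarrow> K \<inter> K' = {}"
proof -
 obtain K0 where K0: "K0 \<in> cells T'" "closure K \<subseteq> closure K0" using sub assms unfolding subordinate_def by blast
 have "K \<subseteq> interior (closure K0)"
  using K0(2) closure_subset[of K] cell(2)[OF assms] by (intro interior_maximal) auto
 also have "interior (closure K0) = K0"
  using convex_interior_closure[OF coarse.cell(3)[OF K0(1)]] interior_open[OF coarse.cell(2)[OF K0(1)]] by simp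
 finally have K: "K \<subseteq> K0" .
 have u: "K' = K0" if "K' \<in> cells T'" "K \<subseteq> K'" for K'
  using coarse.cells_disjoint[OF that(1) K0(1)] that(2) K cell(1)[OF assms] by blast
 have p: "parent K = K0" unfolding parent_def
 proof (rule the_equality)
  show "K0 \<in> cells T' \<and> K \<subseteq> K0" using K K0(1) by blast
  show "K' = K0" if "K' \<in> cells T' \<and> K \<subseteq> K'" for K' using u that by blast
 qed
 show "parent K \<in> cells T'" "K \<subseteq> parent K" unfolding p using K0(1) K .
 show "K' \<in> cells T' \<Longrightarrow> K \<subseteq> K' \<Longrightarrow> parent K = K'" unfolding p using u by blast
 show "K' \<in> cells T' \<Longrightarrow> parent K \<noteq> K' \<Longrightarrow> K \<inter> K' = {}"
  using coarse.cells_disjoint[of K' K0] K0 p K by blast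
qed

lemma injection_parent: "injection T' r K = r (parent K)" by (simp add: injection_def parent_def)

lemma coarse_cell_integral:
 fixes f :: "'a \<Rightarrow> real" assumes f: "integrable (lebesgue_on \<Omega>) f" and K': "K' \<in> cells T'"
 shows "int_on K' f = (\<Sum>K\<in>{K \<in> cells T. parent K = K'}. int_on K f)"
proof -
 have "int_on K' f = int_on \<Omega> (\<lambda>x. indicator K' x * f x)"
  by (rule coarse.cell_integral[OF K'])
 also have "\<dots> = (\<Sum>K\<in>cells T. int_on K (\<lambda>x. indicator K' x * f x))"
  by (rule integral_sum_cells[OF indicator_integrable[OF f coarse.cell_sets(2)[OF K']]])
 also have "\<dots> = (\<Sum>K\<in>cells T. if parent K = K' then int_on K f else 0)"
 proof (rule sum.cong[OF refl])
  fix K assume K: "K \<in> cells T"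
  show "int_on K (\<lambda>x. indicator K' x * f x) = (if parent K = K' then int_on K f else 0)"
  proof (cases "parent K = K'")
   case True
   have "int_on K (\<lambda>x. indicator K' x * f x) = int_on K f"
    by (intro Bochner_Integration.integral_cong refl) (use parent(2)[OF K] True in auto)
   then show ?thesis using True by simp
  next
   case False
   have "int_on K (\<lambda>x. indicator K' x * f x) = int_on K (\<lambda>x. 0)"
    by (intro Bochner_Integration.integral_cong refl) (use parent(4)[OF K K' False] in \<open>auto simp: indicator_def\<close>)
   then show ?thesis using False by simp
  qed
 qed
 also have "\<dots> = (\<Sum>K\<in>{K \<in> cells T. parent K = K'}. int_on K f)"
  using finite_cells by (simp add: sum.If_cases Int_def)
 finally show ?thesis .
qed

lemma coarse_cell_measure: "K' \<in> cells T' \<Longrightarrow> cell_measure K' = (\<Sum>K\<in>{K \<in> cells T. parent K = K'}. cell_measure K)"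
proof -
 assume K': "K' \<in> cells T'"
 have i: "integrable (lebesgue_on \<Omega>) (\<lambda>x. 1 :: real)"
  by (rule finite_measure.integrable_const[OF finite_measure_lebesgue_on[OF lmeasurable_compact[OF \<Omega>(1)]]])
 have "int_on K' (\<lambda>x. 1) = (\<Sum>K\<in>{K \<in> cells T. parent K = K'}. int_on K (\<lambda>x. 1 :: real))"
  by (rule coarse_cell_integral[OF i K'])
 then show ?thesis using coarse.integral_const_cell[OF K', of 1] integral_const_cell[of _ 1] by simp
qed

lemma sum_parent: "(\<Sum>K\<in>cells T. a (parent K) K) = (\<Sum>K'\<in>cells T'. \<Sum>K\<in>{K \<in> cells T. parent K = K'}. a K' K)"
proof -
 have "(\<Sum>K\<in>cells T. a (parent K) K) = (\<Sum>K'\<in>cells T'. \<Sum>K\<in>{K \<in> cells T. parent K = K'}. a (parent K) K)"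
  using finite_cells coarse.finite_cells parent(1) by (intro sum.group[symmetric]) auto
 also have "\<dots> = (\<Sum>K'\<in>cells T'. \<Sum>K\<in>{K \<in> cells T. parent K = K'}. a K' K)"
  by (intro sum.cong refl) auto
 finally show ?thesis .
qed

lemma sampled_mass:
 assumes f: "integrable (lebesgue_on \<Omega>) f"
 shows "(\<Sum>K\<in>cells T. cell_measure K * sampling f (parent K)) = int_on \<Omega> f"
proof -
 have "(\<Sum>K\<in>cells T. cell_measure K * sampling f (parent K)) =
   (\<Sum>K'\<in>cells T'. (\<Sum>K\<in>{K \<in> cells T. parent K = K'}. cell_measure K) * sampling f K')"
  unfolding sum_distrib_right by (rule sum_parent)
 also have "\<dots> = (\<Sum>K'\<in>cells T'. int_on K' f)"
 proof (rule sum.cong[OF refl])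
  fix K' assume K': "K' \<in> cells T'"
  show "(\<Sum>K\<in>{K \<in> cells T. parent K = K'}. cell_measure K) * sampling f K' = int_on K' f"
   using coarse.cell_measure_pos[OF K'] unfolding coarse_cell_measure[OF K', symmetric] by (simp add: sampling_def)
 qed
 also have "\<dots> = int_on \<Omega> f" by (rule coarse.integral_sum_cells[OF f, symmetric])
 finally show ?thesis .
qed

text \<open>The density is sampled on the coarse cells while the potential is evaluated at fine centers; only
  the oscillation of \<open>u\<close> over the parent cell enters the error, hence the comparability of the two
  mesh sizes.\<close>

lemma sampled_pairing:
 assumes r: "is_density \<Omega> r" and u: "continuous_on \<Omega> u"
  and close: "\<And>K x. K \<in> cells T \<Longrightarrow> x \<in> parent K \<Longrightarrow> \<bar>u x - w K\<bar> \<le> E"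
 shows "\<bar>(\<Sum>K\<in>cells T. cell_measure K * w K * sampling r (parent K)) - int_on \<Omega> (\<lambda>x. u x * r x)\<bar> \<le> E * mass \<Omega> r"
proof -
 have ri: "integrable (lebesgue_on \<Omega>) r" and r0: "\<And>x. x \<in> \<Omega> \<Longrightarrow> r x \<ge> 0" using r by (auto simp: is_density_def)
 have ui: "integrable (lebesgue_on \<Omega>) (\<lambda>x. u x * r x)"
  using integrable_mult_continuous[OF \<Omega>(1) ri u] by (simp add: mult.commute)
 have "(\<Sum>K\<in>cells T. cell_measure K * w K * sampling r (parent K)) - int_on \<Omega> (\<lambda>x. u x * r x)
   = (\<Sum>K'\<in>cells T'. (\<Sum>K\<in>{K \<in> cells T. parent K = K'}. cell_measure K * w K * sampling r K') - int_on K' (\<lambda>x. u x * r x))"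
  unfolding sum_subtractf coarse.integral_sum_cells[OF ui] by (simp add: sum_parent[of "\<lambda>K' K. cell_measure K * w K * sampling r K'"])
 also have "\<bar>\<dots>\<bar> \<le> (\<Sum>K'\<in>cells T'. E * int_on K' r)"
 proof (rule order_trans[OF sum_abs sum_mono])
  fix K' assume K': "K' \<in> cells T'"
  let ?S = "{K \<in> cells T. parent K = K'}"
  let ?m = "cell_measure K'"
  have m: "?m > 0" by (rule coarse.cell_measure_pos[OF K'])
  have ri': "integrable (lebesgue_on K') r" by (rule coarse.integrable_cell[OF K' ri])
  have ui': "integrable (lebesgue_on K') (\<lambda>x. u x * r x)" by (rule coarse.integrable_cell[OF K' ui])
  have diff: "w K * int_on K' r - int_on K' (\<lambda>x. u x * r x)
    = int_on K' (\<lambda>x. (w K - u x) * r x)" for K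
   using ri' ui' by (simp add: left_diff_distrib)
  have b: "\<bar>w K * int_on K' r - int_on K' (\<lambda>x. u x * r x)\<bar> \<le> E * int_on K' r" if K: "K \<in> ?S" for K
  proof -
   have "\<bar>int_on K' (\<lambda>x. (w K - u x) * r x)\<bar> \<le> int_on K' (\<lambda>x. E * r x)"
   proof (rule order_trans[OF integral_abs_bound integral_mono])
    show "integrable (lebesgue_on K') (\<lambda>x. \<bar>(w K - u x) * r x\<bar>)"
     unfolding left_diff_distrib using ri' ui' by (intro integrable_abs Bochner_Integration.integrable_diff) auto
    show "integrable (lebesgue_on K') (\<lambda>x. E * r x)" using ri' by simp
    fix x assume "x \<in> space (lebesgue_on K')"
    then have x: "x \<in> K'" by simp
    then have "\<bar>w K - u x\<bar> \<le> E" using close[of K x] K by (simp add: abs_minus_commute)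
    moreover have "r x \<ge> 0" using x coarse.cell(6)[OF K'] r0 by blast
    ultimately show "\<bar>(w K - u x) * r x\<bar> \<le> E * r x" by (simp add: abs_mult mult_right_mono)
   qed
   then show ?thesis unfolding diff by simp
  qed
  have "(\<Sum>K\<in>?S. cell_measure K * w K * sampling r K') - int_on K' (\<lambda>x. u x * r x)
    = (\<Sum>K\<in>?S. cell_measure K / ?m * (w K * int_on K' r - int_on K' (\<lambda>x. u x * r x)))"
  proof -
   have "(\<Sum>K\<in>?S. cell_measure K / ?m * int_on K' (\<lambda>x. u x * r x)) = int_on K' (\<lambda>x. u x * r x)"
    using m by (simp flip: sum_distrib_right sum_divide_distrib coarse_cell_measure[OF K'])
   then show ?thesis by (simp add: right_diff_distrib sum_subtractf sampling_def mult_ac)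
  qed
  also have "\<bar>\<dots>\<bar> \<le> (\<Sum>K\<in>?S. cell_measure K / ?m * (E * int_on K' r))"
  proof (rule order_trans[OF sum_abs sum_mono])
   fix K assume K: "K \<in> ?S"
   have "cell_measure K / ?m \<ge> 0" using m cell_measure_pos[of K] K by simp
   then show "\<bar>cell_measure K / ?m * (w K * int_on K' r - int_on K' (\<lambda>x. u x * r x))\<bar> \<le> cell_measure K / ?m * (E * int_on K' r)"
    unfolding abs_mult using b[OF K] by (simp only: abs_of_nonneg mult_left_mono)
  qed
  also have "\<dots> = E * int_on K' r"
   using m by (simp flip: sum_distrib_right sum_divide_distrib coarse_cell_measure[OF K'])
  finally show "\<bar>(\<Sum>K\<in>?S. cell_measure K * w K * sampling r K') - int_on K' (\<lambda>x. u x * r x)\<bar> \<le> E * int_on K' r" .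
 qed
 also have "\<dots> = E * mass \<Omega> r"
  unfolding mass_def coarse.integral_sum_cells[OF ri] by (simp add: sum_distrib_left)
 finally show ?thesis .
qed

end

section \<open>Discrete weak duality\<close>

lemma taylor_C11:
 fixes D :: "'a::euclidean_space set"
 assumes D: "convex D" and f: "has_gradient_on D f g" and g: "L-lipschitz_on D g" and xy: "x \<in> D" "y \<in> D"
 shows "\<bar>f y - f x - g x \<bullet> (y - x)\<bar> \<le> L * (norm (y - x))\<^sup>2"
proof -
 have L: "L \<ge> 0" using g lipschitz_on_nonneg by blast
 let ?S = "closed_segment x y"
 have S: "?S \<subseteq> D" using D xy by (simp add: closed_segment_subset)
 have "norm ((f y - g x \<bullet> y) - (f x - g x \<bullet> x)) \<le> L * norm (y - x) * norm (y - x)"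
 proof (rule differentiable_bound[where S = ?S and f' = "\<lambda>z v. g z \<bullet> v - g x \<bullet> v"])
  fix z assume z: "z \<in> ?S"
  have "(f has_derivative (\<lambda>v. g z \<bullet> v)) (at z within ?S)"
   using f S z has_derivative_subset unfolding has_gradient_on_def by blast
  then show "((\<lambda>z. f z - g x \<bullet> z) has_derivative (\<lambda>v. g z \<bullet> v - g x \<bullet> v)) (at z within ?S)"
   by (intro derivative_intros)
  show "onorm (\<lambda>v. g z \<bullet> v - g x \<bullet> v) \<le> L * norm (y - x)"
  proof (rule onorm_le)
   fix v
   have "norm (g z \<bullet> v - g x \<bullet> v) \<le> norm (g z - g x) * norm v"
    using Cauchy_Schwarz_ineq2[of "g z - g x" v] by (simp add: inner_diff_left)
   also have "\<dots> \<le> (L * norm (y - x)) * norm v"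
   proof (rule mult_right_mono)
    have "norm (g z - g x) \<le> L * norm (z - x)"
     using lipschitz_onD[OF g, of z x] S z xy by (auto simp: dist_norm)
    also have "norm (z - x) \<le> norm (y - x)" using segment_bound1[OF z] by simp
    finally show "norm (g z - g x) \<le> L * norm (y - x)" using L by (simp add: mult_left_mono)
   qed simp
   finally show "norm (g z \<bullet> v - g x \<bullet> v) \<le> L * norm (y - x) * norm v" .
  qed
 qed auto
 then show ?thesis by (simp add: inner_diff_right power2_eq_square algebra_simps)
qed

lemma gradient_bound_lipschitz:
 fixes D :: "'a::euclidean_space set"
 assumes D: "convex D" and f: "has_gradient_on D f g" and g: "\<And>z. z \<in> D \<Longrightarrow> norm (g z) \<le> G" and xy: "x \<in> D" "y \<in> D"
 shows "\<bar>f x - f y\<bar> \<le> G * norm (x - y)"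
proof -
 have "norm (f x - f y) \<le> G * norm (x - y)"
 proof (rule differentiable_bound[OF D])
  show "(f has_derivative (\<lambda>v. g z \<bullet> v)) (at z within D)" if "z \<in> D" for z
   using f that by (auto simp: has_gradient_on_def)
  show "onorm (\<lambda>v. g z \<bullet> v) \<le> G" if "z \<in> D" for z
  proof (rule onorm_le)
   fix v
   have "norm (g z \<bullet> v) \<le> norm (g z) * norm v" using Cauchy_Schwarz_ineq2 by simp
   also have "\<dots> \<le> G * norm v" using g[OF that] by (intro mult_right_mono) auto
   finally show "norm (g z \<bullet> v) \<le> G * norm v" .
  qed
 qed (use xy in auto)
 then show ?thesis by simp
qed

lemma weighted_sum_split:
 fixes t :: real
 shows "t * (\<Sum>s\<in>S. x s + m s * (\<Sum>K\<in>C s. y s K) / 2) = t * (\<Sum>s\<in>S. x s) + (t / 2) * (\<Sum>s\<in>S. \<Sum>K\<in>C s. m s * y s K)"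
 by (simp add: sum.distrib distrib_left sum_distrib_left sum_divide_distrib)

lemma weighted_sum_collect:
 fixes t :: real
 shows "(\<Sum>K\<in>C. m K * a K * x K) + (t * X + (t / 2) * (\<Sum>K\<in>C. a K * (m K * (1 + e) * n K + c * (D * (m K * (1 + e))))))
  = t * X + (\<Sum>K\<in>C. m K * a K * (x K + t * ((1 + e) * n K) / 2 + t * (D * (1 + e) * c / 2)))"
proof -
 have "(\<Sum>K\<in>C. m K * a K * (x K + t * ((1 + e) * n K) / 2 + t * (D * (1 + e) * c / 2))) =
  (\<Sum>K\<in>C. m K * a K * x K + (t / 2) * (a K * (m K * (1 + e) * n K + c * (D * (m K * (1 + e))))))"
  by (intro sum.cong refl) (simp add: field_simps)
 then show ?thesis by (simp add: sum.distrib sum_distrib_left)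
qed

lemma young_quotient:
 fixes f x :: real assumes "R > 0" "d > 0"
 shows "f * x \<le> f\<^sup>2 / (2 * R) * d + R * d * (x / d)\<^sup>2 / 2"
proof -
 have "0 \<le> (f * d - R * x)\<^sup>2 / (2 * R * d)" using assms by simp
 also have "\<dots> = f\<^sup>2 / (2 * R) * d + R * d * (x / d)\<^sup>2 / 2 - f * x"
  using assms by (simp add: power2_eq_square field_simps)
 finally show ?thesis by simp
qed

context mesh begin

lemma mesh_regularD:
 assumes reg: "mesh_regular \<zeta> T" and K: "K \<in> cells T"
 shows "\<zeta> \<ge> 0" "infdist (center T K) K \<le> \<zeta> * mesh_size T"
  "s \<in> cell_faces T K \<Longrightarrow> face_dist T s \<le> \<zeta> * mesh_size T"
proof -
 have i: "infdist (center T K) K \<le> \<zeta> * diameter K" using reg K by (auto simp: mesh_regular_def)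
 have d: "diameter K > 0" using diameter_cell_pos[OF K] .
 have "0 \<le> \<zeta> * diameter K" using infdist_nonneg[of "center T K" K] i by linarith
 then show z: "\<zeta> \<ge> 0" using d by (simp add: zero_le_mult_iff)
 have zm: "\<zeta> * diameter K \<le> \<zeta> * mesh_size T" using z diameter_le_mesh_size[OF K] by (rule mult_left_mono[rotated])
 then show "infdist (center T K) K \<le> \<zeta> * mesh_size T" using i by linarith
 show "face_dist T s \<le> \<zeta> * mesh_size T" if s: "s \<in> cell_faces T K"
 proof -
  have 1: "diameter K \<le> \<zeta> * face_dist T s" "\<zeta> * face_dist T s \<le> \<zeta>\<^sup>2 * diameter K"
   using reg K s by (auto simp: mesh_regular_def)
  have "\<zeta> \<noteq> 0" using 1(1) d by auto
  then have "\<zeta> > 0" using z by simp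
  then have "face_dist T s \<le> \<zeta> * diameter K" using 1(2) by (simp add: power2_eq_square mult.assoc)
  then show ?thesis using zm by linarith
 qed
qed

text \<open>Young's inequality on one face. The weights \<open>d\<^sub>K\<^sub>,\<^sub>\<sigma> / d\<^sub>\<sigma>\<close> of the linear reconstruction cancel the factor
  \<open>d\<^sub>\<sigma>\<close>, which leaves each cell with exactly the sum that the isotropy assumption controls.\<close>

lemma face_young:
 assumes F: "is_flux T F" and s: "s \<in> internal_faces T" and a: "\<And>K. K \<in> cells T \<Longrightarrow> a K \<ge> 0"
  and fin: "B (linear_reconstruction T a s) (flux_size T F s) * ennreal (face_measure s * face_dist T s) \<noteq> \<infinity>"
  and q: "\<And>K L. face_cells T s = {K, L} \<Longrightarrow> K \<noteq> L \<Longrightarrow> ((u L - u K) / face_dist T s)\<^sup>2 \<le> q K"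
 shows "- (face_measure s * (\<Sum>K\<in>face_cells T s. F K s * u K)) \<le>
  enn2real (B (linear_reconstruction T a s) (flux_size T F s) * ennreal (face_measure s * face_dist T s))
  + face_measure s * (\<Sum>K\<in>face_cells T s. cell_face_dist T K s * a K * q K) / 2"
proof -
 obtain K L where KL: "face_cells T s = {K, L}" "K \<noteq> L" "K \<in> cells T" "L \<in> cells T"
  using internal_face_cells[OF s] by metis
 have LK: "face_cells T s = {L, K}" using KL by auto
 define f where "f = F K s"
 define x where "x = u L - u K"
 define d where "d = face_dist T s"
 define m where "m = face_measure s"
 define R where "R = linear_reconstruction T a s"
 have d: "d > 0" unfolding d_def by (rule centers_along_normal(2)[OF s KL(1,2)])
 have m: "m \<ge> 0" by (simp add: m_def face_measure_nonneg)
 have fl: "flux_size T F s = \<bar>f\<bar>" "F L s = - f" using flux_size_eq[OF F s KL(1,2)] by (auto simp: f_def)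
 have Rd: "R * d = cell_face_dist T K s * a K + cell_face_dist T L s * a L"
  using d linear_reconstruction_pair[OF KL(1,2)] by (simp add: R_def d_def)
 have R0: "R \<ge> 0"
  using d linear_reconstruction_pair[OF KL(1,2), of a] a[OF KL(3)] a[OF KL(4)] by (simp add: R_def d_def cell_face_dist_nonneg)
 have qK: "(x / d)\<^sup>2 \<le> q K" using q[OF KL(1,2)] by (simp add: x_def d_def)
 have "(- x / d)\<^sup>2 \<le> q L" using q[OF LK] KL(2) by (simp add: x_def d_def)
 then have qL: "(x / d)\<^sup>2 \<le> q L" by simp
 have lhs: "- (face_measure s * (\<Sum>K\<in>face_cells T s. F K s * u K)) = m * (f * x)"
  using KL fl by (simp add: m_def f_def x_def algebra_simps)
 have "R * d * (x / d)\<^sup>2 \<le> (\<Sum>K\<in>face_cells T s. cell_face_dist T K s * a K * q K)"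
 proof -
  have "R * d * (x / d)\<^sup>2 = cell_face_dist T K s * a K * (x / d)\<^sup>2 + cell_face_dist T L s * a L * (x / d)\<^sup>2"
   unfolding Rd by (simp add: distrib_right)
  also have "\<dots> \<le> cell_face_dist T K s * a K * q K + cell_face_dist T L s * a L * q L"
   using qK qL a KL by (intro add_mono mult_left_mono) (auto simp: cell_face_dist_nonneg)
  finally show ?thesis using KL by simp
 qed
 then have rhs: "m * (R * d * (x / d)\<^sup>2) / 2 \<le> face_measure s * (\<Sum>K\<in>face_cells T s. cell_face_dist T K s * a K * q K) / 2"
  using m by (simp add: m_def mult_left_mono)
 have "m * (f * x) \<le> enn2real (B R (flux_size T F s) * ennreal (m * d)) + m * (R * d * (x / d)\<^sup>2) / 2"
 proof (cases "m = 0")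
  case False
  then have m0: "m > 0" using m by simp
  show ?thesis
  proof (cases "R > 0")
   case True
   have "B R (flux_size T F s) * ennreal (m * d) = ennreal (f\<^sup>2 / (2 * R) * (m * d))"
    using True m0 d by (simp add: B_def fl ennreal_mult'[symmetric])
   then have "enn2real (B R (flux_size T F s) * ennreal (m * d)) = f\<^sup>2 / (2 * R) * (m * d)"
    using True m0 d by simp
   moreover have "m * (f * x) \<le> m * (f\<^sup>2 / (2 * R) * d + R * d * (x / d)\<^sup>2 / 2)"
    using young_quotient[OF True d] m0 by (intro mult_left_mono) auto
   ultimately show ?thesis by (simp add: algebra_simps)
  next
   case False
   then have R: "R = 0" using R0 by simp
   have "f = 0"
   proof (rule ccontr)
    assume "f \<noteq> 0"
    then have "B R (flux_size T F s) = \<infinity>" using R by (simp add: B_def fl)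
    then show False using fin m0 d by (simp add: R_def m_def d_def ennreal_top_mult)
   qed
   then show ?thesis using R by simp
  qed
 qed simp
 then show ?thesis using lhs rhs unfolding R_def m_def d_def by linarith
qed

end

lemma (in convex_body) mem_Q: "(t, x) \<in> Q \<longleftrightarrow> t \<in> {0..1} \<and> x \<in> \<Omega>" by (auto simp: Q_def)

context mesh_pair begin

sublocale convex_body \<Omega> by unfold_locales (rule \<Omega> int\<Omega>)+

lemma discrete_mass_conservation:
 assumes ce: "discrete_continuity_equation N T' T \<rho>0 \<rho>1 (\<rho>, F)" and k: "k \<le> N + 1"
 shows "(\<Sum>K\<in>cells T. cell_measure K * \<rho> k (parent K)) = (\<Sum>K\<in>cells T. cell_measure K * \<rho>0 (parent K))"
  "k \<ge> 1 \<Longrightarrow> K \<in> cells T \<Longrightarrow> cell_measure K * (\<rho> k (parent K) - \<rho> (k-1) (parent K)) =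
    - time_step N * (\<Sum>s\<in>cell_faces T K. F k K s * face_measure s)"
proof -
 have t: "time_step N > 0" by (simp add: time_step_def)
 have step: "cell_measure K * (\<rho> k (parent K) - \<rho> (k-1) (parent K)) =
    - time_step N * (\<Sum>s\<in>cell_faces T K. F k K s * face_measure s)" if "k \<in> {1..N+1}" "K \<in> cells T" for k K
 proof -
  have m: "cell_measure K > 0" by (rule cell_measure_pos[OF that(2)])
  have "(\<rho> k (parent K) - \<rho> (k-1) (parent K)) / time_step N + (\<Sum>s\<in>cell_faces T K. F k K s * face_measure s) / cell_measure K = 0"
   using ce that unfolding discrete_continuity_equation_def by (simp add: injection_parent discrete_div_def)
  then show ?thesis using t m by (simp add: field_simps)
 qed
 then show "k \<ge> 1 \<Longrightarrow> K \<in> cells T \<Longrightarrow> cell_measure K * (\<rho> k (parent K) - \<rho> (k-1) (parent K)) =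
    - time_step N * (\<Sum>s\<in>cell_faces T K. F k K s * face_measure s)" using k by auto
 show "(\<Sum>K\<in>cells T. cell_measure K * \<rho> k (parent K)) = (\<Sum>K\<in>cells T. cell_measure K * \<rho>0 (parent K))"
  using k
 proof (induction k)
  case 0
  then show ?case using ce parent(1) unfolding discrete_continuity_equation_def by (intro sum.cong) auto
 next
  case (Suc k)
  then have kk: "Suc k \<in> {1..N+1}" by auto
  have fl: "is_flux T (F (Suc k))" using ce kk unfolding discrete_continuity_equation_def by auto
  have "(\<Sum>K\<in>cells T. cell_measure K * \<rho> (Suc k) (parent K)) - (\<Sum>K\<in>cells T. cell_measure K * \<rho> k (parent K))
   = (\<Sum>K\<in>cells T. - time_step N * (\<Sum>s\<in>cell_faces T K. F (Suc k) K s * face_measure s))"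
   unfolding sum_subtractf[symmetric] right_diff_distrib[symmetric]
   by (intro sum.cong refl) (use step[OF kk] in simp)
  also have "\<dots> = - time_step N * (\<Sum>K\<in>cells T. 1 * (\<Sum>s\<in>cell_faces T K. F (Suc k) K s * face_measure s))"
   by (simp add: sum_distrib_left)
  also have "\<dots> = 0"
  proof -
   have "(\<Sum>K\<in>face_cells T s. F (Suc k) K s * 1) = 0" if s: "s \<in> internal_faces T" for s
   proof -
    obtain K L where KL: "face_cells T s = {K, L}" "K \<noteq> L" using internal_face_cells[OF s] by metis
    show ?thesis using flux_size_eq(2)[OF fl s KL] KL by simp
   qed
   then show ?thesis unfolding sum_cells_flux[OF fl, of "\<lambda>_. 1"] by simp
  qed
  finally show ?case using Suc by simp
 qed
qed

lemma center_parent_dist: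
 assumes reg: "mesh_regular \<zeta> T" and K: "K \<in> cells T" and x: "x \<in> parent K"
 shows "norm (x - center T K) \<le> \<zeta> * mesh_size T + mesh_size T'"
proof -
 obtain y where y: "y \<in> closure K" "infdist (center T K) (closure K) = dist (center T K) y"
  using infdist_attains_inf[of "closure K" "center T K"] cell(1)[OF K] by auto
 have yP: "y \<in> closure (parent K)" using y(1) closure_mono[OF parent(2)[OF K]] by auto
 have "infdist (center T K) (closure K) \<le> infdist (center T K) K"
  by (rule infdist_mono[OF closure_subset cell(1)[OF K]])
 then have 1: "dist (center T K) y \<le> \<zeta> * mesh_size T" using y mesh_regularD(2)[OF reg K] by simp
 have P: "parent K \<in> cells T'" by (rule parent(1)[OF K])
 have "dist y x \<le> diameter (closure (parent K))"
  using yP x closure_subset coarse.cell(4)[OF P] by (intro diameter_bounded_bound) auto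
 also have "\<dots> = diameter (parent K)" by (rule diameter_closure[OF coarse.cell(4)[OF P]])
 also have "\<dots> \<le> mesh_size T'" by (rule coarse.diameter_le_mesh_size[OF P])
 finally have "dist (center T K) x \<le> \<zeta> * mesh_size T + mesh_size T'" using 1 dist_triangle[of "center T K" x y] by linarith
 then show ?thesis by (simp add: dist_norm norm_minus_commute)
qed

text \<open>Weak duality for the discrete problem with the multiplier \<open>\<phi> (k \<tau>, x\<^sub>K)\<close>. Summation by parts turns
  the discrete dual value into time increments minus flux terms; the latter are estimated by
  \<open>face_young\<close>. A Taylor expansion of the \<open>C\<^sup>1\<^sup>,\<^sup>1\<close> function \<open>\<phi>\<close> and \<open>mesh_isotropic\<close> reduce the remainder on each
  cell to the left-hand side of the Hamilton-Jacobi inequality up to first order errors, and these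
  are weighted by densities of total mass \<open>M\<close>.\<close>

theorem discrete_dual_bound:
 assumes f: "has_gradient_on Q (\<lambda>(t, x). \<phi> t x) g" and gL: "L-lipschitz_on Q g"
  and gG: "\<And>z. z \<in> Q \<Longrightarrow> norm (g z) \<le> G"
  and HJ: "\<And>z. z \<in> Q \<Longrightarrow> fst (g z) + (norm (snd (g z)))\<^sup>2 / 2 \<le> 0"
  and d: "is_density \<Omega> \<rho>in" "is_density \<Omega> \<rho>f" and mass: "mass \<Omega> \<rho>in = M" "mass \<Omega> \<rho>f = M"
  and reg: "mesh_regular \<zeta> T" and iso: "mesh_isotropic e T" and e: "e \<ge> 0" and cmp: "coarse_comparable \<zeta> T' T"
  and ce: "discrete_continuity_equation N T' T (sampling \<rho>in) (sampling \<rho>f) (\<rho>, F)"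
  and fin: "discrete_action N T' T (\<rho>, F) \<noteq> \<infinity>"
 defines "C1 \<equiv> (2 * G + L * \<zeta> * diameter \<Omega>) * (L * \<zeta>)"
 shows "dual_value \<Omega> \<rho>in \<rho>f \<phi> \<le> enn2real (discrete_action N T' T (\<rho>, F)) +
  M * (2 * G * (\<zeta> + max 1 \<zeta>) * mesh_size T + L * time_step N + e * G\<^sup>2 / 2 + real DIM('a) * (1 + e) * (C1 * mesh_size T) / 2)"
proof -
 define \<tau> where "\<tau> = time_step N"
 have \<tau>: "\<tau> > 0" "\<tau> * real (N + 1) = 1" by (auto simp: \<tau>_def time_step_def)
 define h where "h = mesh_size T"
 have h: "h > 0" unfolding h_def by (rule mesh_size_pos)
 have L: "L \<ge> 0" using gL lipschitz_on_nonneg by blast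
 have G: "G \<ge> 0" using gG Q(6) norm_ge_zero order_trans by blast
 obtain K0 where K0: "K0 \<in> cells T" using cells_nonempty by blast
 have \<zeta>: "\<zeta> \<ge> 0" by (rule mesh_regularD(1)[OF reg K0])
 have D0: "diameter \<Omega> \<ge> 0" by (rule diameter_ge_0[OF \<Omega>(4)])
 have C1: "C1 \<ge> 0" unfolding C1_def using G L \<zeta> D0 by simp
 define a where "a k K = \<rho> k (parent K)" for k K
 define xx where "xx = center T"
 have xx: "xx K \<in> \<Omega>" if "K \<in> cells T" for K using cell(7)[OF that] by (simp add: xx_def)
 define t where "t k = real k * \<tau>" for k
 have t: "t k \<in> {0..1}" if "k \<le> N + 1" for k
 proof -
  have "real k * \<tau> \<le> real (N + 1) * \<tau>" using that \<tau>(1) by (intro mult_right_mono) auto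
  also have "real (N + 1) * \<tau> = 1" using \<tau>(2) by (simp only: mult.commute)
  finally show ?thesis using \<tau>(1) by (simp add: t_def)
 qed
 have t0: "t 0 = 0" and t1: "t (N + 1) = 1" using \<tau>(2) by (simp_all only: t_def mult.commute[of _ \<tau>] of_nat_0 mult_zero_right)
 \<comment> \<open>the discrete potential\<close>
 define w where "w k K = \<phi> (t k) (xx K)" for k K
 define p where "p k K = (t k, xx K)" for k K
 have p: "p k K \<in> Q" if "k \<le> N + 1" "K \<in> cells T" for k K
  using t[OF that(1)] xx[OF that(2)] by (simp add: p_def mem_Q)
 have \<rho>0: "\<rho> k K' \<ge> 0" if "k \<le> N + 1" "K' \<in> cells T'" for k K'
  using fin that unfolding discrete_action_def by (auto split: if_splits)
 have a0: "a k K \<ge> 0" if "k \<le> N + 1" "K \<in> cells T" for k K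
  using \<rho>0 parent(1) that by (simp add: a_def)
 have aM: "(\<Sum>K\<in>cells T. cell_measure K * a k K) = M" if "k \<le> N + 1" for k
  using discrete_mass_conservation(1)[OF ce that] sampled_mass[of \<rho>in] d(1) mass(1)
  by (simp add: a_def is_density_def mass_def)
 have M: "M \<ge> 0"
 proof -
  have "0 \<le> (\<Sum>K\<in>cells T. cell_measure K * a 0 K)"
   by (intro sum_nonneg mult_nonneg_nonneg less_imp_le[OF cell_measure_pos] a0) auto
  then show ?thesis using aM[of 0] by simp
 qed
 let ?av = "\<lambda>u k K. (u k K + u (k - 1) K) / 2 :: real"
 let ?b = "\<lambda>k s. B (linear_reconstruction T (?av a k) s) (flux_size T (F k) s) * ennreal (face_measure s * face_dist T s)"
 have inj: "injection T' (\<lambda>K'. (\<rho> k K' + \<rho> (k-1) K') / 2) = ?av a k" for k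
  by (auto simp: a_def injection_parent)
 have act: "discrete_action N T' T (\<rho>, F) = (\<Sum>k=1..N+1. ennreal \<tau> * (\<Sum>s\<in>internal_faces T. ?b k s))"
  using \<rho>0 unfolding discrete_action_def \<tau>_def prod.case inj by simp
 have bfin: "?b k s \<noteq> \<infinity>" if "k \<in> {1..N+1}" "s \<in> internal_faces T" for k s
 proof
  assume "?b k s = \<infinity>"
  moreover have "?b k s \<le> (\<Sum>s\<in>internal_faces T. ?b k s)" by (rule member_le_sum) (use that(2) finite_internal(1) in auto)
  ultimately have "(\<Sum>s\<in>internal_faces T. ?b k s) = \<infinity>" by (simp add: top_unique)
  then have "ennreal \<tau> * (\<Sum>s\<in>internal_faces T. ?b k s) = \<infinity>" using \<tau> by (simp add: ennreal_mult_top)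
  moreover have "ennreal \<tau> * (\<Sum>s\<in>internal_faces T. ?b k s) \<le> discrete_action N T' T (\<rho>, F)"
   unfolding act by (rule member_le_sum) (use that(1) in auto)
  ultimately have "discrete_action N T' T (\<rho>, F) = \<infinity>" by (simp add: top_unique)
  then show False using fin by simp
 qed
 have actr: "enn2real (discrete_action N T' T (\<rho>, F)) = (\<Sum>k=1..N+1. \<tau> * (\<Sum>s\<in>internal_faces T. enn2real (?b k s)))"
 proof -
  have 1: "(\<Sum>s\<in>internal_faces T. ?b k s) = ennreal (\<Sum>s\<in>internal_faces T. enn2real (?b k s))" if "k \<in> {1..N+1}" for k
  proof -
   have "(\<Sum>s\<in>internal_faces T. ?b k s) = (\<Sum>s\<in>internal_faces T. ennreal (enn2real (?b k s)))"
    using bfin[OF that] by (intro sum.cong refl) (simp add: top.not_eq_extremum)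
   then show ?thesis by (simp add: sum_ennreal)
  qed
  have "discrete_action N T' T (\<rho>, F) = (\<Sum>k=1..N+1. ennreal (\<tau> * (\<Sum>s\<in>internal_faces T. enn2real (?b k s))))"
   unfolding act using \<tau> by (intro sum.cong refl) (simp add: 1 ennreal_mult' del: One_nat_def)
  also have "\<dots> = ennreal (\<Sum>k=1..N+1. \<tau> * (\<Sum>s\<in>internal_faces T. enn2real (?b k s)))"
   using \<tau> by (intro sum_ennreal) (simp add: sum_nonneg)
  finally have E: "discrete_action N T' T (\<rho>, F) = ennreal (\<Sum>k=1..N+1. \<tau> * (\<Sum>s\<in>internal_faces T. enn2real (?b k s)))" .
  show ?thesis unfolding E
   by (intro enn2real_ennreal sum_nonneg mult_nonneg_nonneg enn2real_nonneg less_imp_le[OF \<tau>(1)])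
 qed
 define R where "R = L * \<tau> + e * G\<^sup>2 / 2 + real DIM('a) * (1 + e) * (C1 * h) / 2"
 have step: "(\<Sum>K\<in>cells T. cell_measure K * (w k K * a k K - w (k-1) K * a (k-1) K)) \<le>
   \<tau> * (\<Sum>s\<in>internal_faces T. enn2real (?b k s)) + \<tau> * (M * R)" if k: "k \<in> {1..N+1}" for k
 proof -
  have k': "k \<le> N + 1" "k - 1 \<le> N + 1" "k \<ge> 1" using k by auto
  have tk: "t k - t (k-1) = \<tau>" using k by (simp add: t_def of_nat_diff algebra_simps)
  define v where "v K = (1/2) *\<^sub>R (snd (g (p k K)) + snd (g (p (k-1) K)))" for K
  define q where "q K s = (outward_normal K s \<bullet> v K)\<^sup>2 + C1 * h" for K s
  have fl: "is_flux T (F k)" using ce k unfolding discrete_continuity_equation_def by auto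
  have sb: "norm (snd (g (p j K))) \<le> G" if "j \<le> N + 1" "K \<in> cells T" for j K
   using gG[OF p[OF that]] norm_snd_le_norm order_trans by blast
  have vG: "norm (v K) \<le> G" if K: "K \<in> cells T" for K
  proof -
   have "norm (snd (g (p k K)) + snd (g (p (k-1) K))) \<le> G + G"
    by (intro order_trans[OF norm_triangle_ineq] add_mono sb k' K)
   then show ?thesis by (simp add: v_def)
  qed
  have qb: "((?av w k L' - ?av w k K) / face_dist T s)\<^sup>2 \<le> q K s"
   if s: "s \<in> internal_faces T" and KL: "face_cells T s = {K, L'}" "K \<noteq> L'" for s K L'
  proof -
   have "K \<in> face_cells T s" "L' \<in> face_cells T s" using KL by auto
   then have mem: "K \<in> cells T" "L' \<in> cells T" and sK: "s \<in> cell_faces T K" using s by (auto simp: face_cells_def cell_faces_def)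
   let ?n = "outward_normal K s" and ?d = "face_dist T s"
   have n: "norm ?n = 1" using normal(1)[OF mem(1) cell_facesD(1,2)[OF sK]] .
   have dd: "xx L' - xx K = ?d *\<^sub>R ?n" "?d > 0" using centers_along_normal[OF s KL] by (auto simp: xx_def)
   have dz: "?d \<le> \<zeta> * h" unfolding h_def by (rule mesh_regularD(3)[OF reg mem(1) sK])
   have T1: "\<bar>w j L' - w j K - ?d * (?n \<bullet> snd (g (p j K)))\<bar> \<le> L * ?d\<^sup>2" if j: "j \<le> N + 1" for j
   proof -
    have pd: "p j L' - p j K = (0, ?d *\<^sub>R ?n)" using dd by (simp add: p_def)
    have "\<bar>w j L' - w j K - g (p j K) \<bullet> (p j L' - p j K)\<bar> \<le> L * (norm (p j L' - p j K))\<^sup>2"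
     using taylor_C11[OF Q(2) f gL p[OF j mem(1)] p[OF j mem(2)]] by (simp add: w_def p_def)
    then show ?thesis unfolding pd using n by (simp add: inner_prod_def norm_Pair inner_commute)
   qed
   define y where "y = (?av w k L' - ?av w k K) / ?d"
   have "\<bar>(?av w k L' - ?av w k K) - ?d * (?n \<bullet> v K)\<bar> \<le> L * ?d\<^sup>2"
   proof -
    have nv: "?n \<bullet> v K = (?n \<bullet> snd (g (p k K)) + ?n \<bullet> snd (g (p (k-1) K))) / 2" by (simp add: v_def inner_add_right)
    have gen: "\<bar>(A + A') / 2 - (C + C') / 2 - x * ((P + P') / 2)\<bar> \<le> X"
     if "\<bar>A - C - x * P\<bar> \<le> X" "\<bar>A' - C' - x * P'\<bar> \<le> X" for A A' C C' P P' X x :: real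
    proof -
     have "(A + A') / 2 - (C + C') / 2 - x * ((P + P') / 2) = ((A - C - x * P) + (A' - C' - x * P')) / 2"
      by (simp add: field_simps)
     moreover have "\<bar>(m + m') / 2\<bar> \<le> X" if "\<bar>m\<bar> \<le> X" "\<bar>m'\<bar> \<le> X" for m m' :: real
      using that unfolding abs_le_iff by (auto simp: field_simps)
     ultimately show ?thesis using that by presburger
    qed
    show ?thesis unfolding nv by (rule gen[OF T1[OF k'(1)] T1[OF k'(2)]])
   qed
   then have "\<bar>?d * (y - ?n \<bullet> v K)\<bar> \<le> ?d * (L * ?d)"
   proof -
    assume *: "\<bar>(?av w k L' - ?av w k K) - ?d * (?n \<bullet> v K)\<bar> \<le> L * ?d\<^sup>2"
    have "?av w k L' - ?av w k K = ?d * y" using dd(2) by (simp add: y_def)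
    then have "?d * (y - ?n \<bullet> v K) = (?av w k L' - ?av w k K) - ?d * (?n \<bullet> v K)" by (simp only: right_diff_distrib)
    moreover have "?d * (L * ?d) = L * ?d\<^sup>2" by (simp add: power2_eq_square)
    ultimately show ?thesis using * by (simp only:)
   qed
   then have "\<bar>y - ?n \<bullet> v K\<bar> \<le> L * ?d" using dd(2) by (simp add: abs_mult)
   also have "\<dots> \<le> L * (\<zeta> * h)" using dz L by (intro mult_left_mono)
   finally have yb: "\<bar>y - ?n \<bullet> v K\<bar> \<le> L * \<zeta> * h" by (simp add: mult.assoc)
   have nv: "\<bar>?n \<bullet> v K\<bar> \<le> G" using Cauchy_Schwarz_ineq2[of ?n "v K"] n vG[OF mem(1)] by simp
   have "y\<^sup>2 - (?n \<bullet> v K)\<^sup>2 = (2 * (?n \<bullet> v K) + (y - ?n \<bullet> v K)) * (y - ?n \<bullet> v K)"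
    by (simp add: power2_eq_square algebra_simps)
   also have "\<dots> \<le> \<bar>2 * (?n \<bullet> v K) + (y - ?n \<bullet> v K)\<bar> * \<bar>y - ?n \<bullet> v K\<bar>"
    by (simp flip: abs_mult)
   also have "\<dots> \<le> (2 * G + L * \<zeta> * diameter \<Omega>) * (L * \<zeta> * h)"
   proof (rule mult_mono)
    have "L * \<zeta> * h \<le> L * \<zeta> * diameter \<Omega>" unfolding h_def using mesh_size_le L \<zeta> by (intro mult_left_mono) auto
    then show "\<bar>2 * (?n \<bullet> v K) + (y - ?n \<bullet> v K)\<bar> \<le> 2 * G + L * \<zeta> * diameter \<Omega>" using nv yb by linarith
   qed (use yb G L \<zeta> D0 in auto)
   also have "\<dots> = C1 * h" by (simp add: C1_def)
   finally show ?thesis by (simp add: q_def y_def)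
  qed
  have HJk: "(w k K - w (k-1) K) + \<tau> * ((1 + e) * (norm (v K))\<^sup>2) / 2 \<le> \<tau> * (L * \<tau> + e * G\<^sup>2 / 2)" if K: "K \<in> cells T" for K
  proof -
   let ?g = "g (p k K)" and ?g' = "g (p (k-1) K)"
   have pd: "p k K - p (k-1) K = (\<tau>, 0)" "p (k-1) K - p k K = (- \<tau>, 0)" using tk by (auto simp: p_def)
   have A: "\<bar>w k K - w (k-1) K - \<tau> * fst ?g'\<bar> \<le> L * \<tau>\<^sup>2"
    using taylor_C11[OF Q(2) f gL p[OF k'(2) K] p[OF k'(1) K]] unfolding pd by (simp add: w_def p_def inner_prod_def mult.commute)
   have A': "\<bar>w (k-1) K - w k K + \<tau> * fst ?g\<bar> \<le> L * \<tau>\<^sup>2"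
    using taylor_C11[OF Q(2) f gL p[OF k'(1) K] p[OF k'(2) K]] unfolding pd by (simp add: w_def p_def inner_prod_def mult.commute)
   have "(norm (v K))\<^sup>2 \<le> (norm (snd ?g))\<^sup>2 / 2 + (norm (snd ?g'))\<^sup>2 / 2"
   proof -
    have "0 \<le> (norm (snd ?g - snd ?g'))\<^sup>2" by simp
    then show ?thesis unfolding v_def power2_norm_eq_inner
     by (simp add: inner_add_left inner_add_right inner_diff_left inner_diff_right inner_commute)
   qed
   then have "fst ?g + fst ?g' \<le> - (norm (v K))\<^sup>2" using HJ[OF p[OF k'(1) K]] HJ[OF p[OF k'(2) K]] by linarith
   then have "\<tau> * (fst ?g + fst ?g') \<le> \<tau> * (- (norm (v K))\<^sup>2)" using \<tau> by (intro mult_left_mono) auto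
   then have 1: "w k K - w (k-1) K \<le> - (\<tau> * (norm (v K))\<^sup>2) / 2 + L * \<tau>\<^sup>2"
    using A A' by (simp add: algebra_simps abs_le_iff)
   have "e * (norm (v K))\<^sup>2 \<le> e * G\<^sup>2" using vG[OF K] e by (intro mult_left_mono power_mono) auto
   then have "\<tau> * (e * (norm (v K))\<^sup>2) \<le> \<tau> * (e * G\<^sup>2)" by (rule mult_left_mono[OF _ less_imp_le[OF \<tau>(1)]])
   moreover have "\<tau> * ((1 + e) * (norm (v K))\<^sup>2) / 2 = \<tau> * (norm (v K))\<^sup>2 / 2 + \<tau> * (e * (norm (v K))\<^sup>2) / 2"
    by (simp add: algebra_simps add_divide_distrib)
   moreover have "\<tau> * (L * \<tau> + e * G\<^sup>2 / 2) = L * \<tau>\<^sup>2 + \<tau> * (e * G\<^sup>2) / 2"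
    by (simp add: power2_eq_square algebra_simps)
   ultimately show ?thesis using 1 by linarith
  qed
  have S1: "(\<Sum>K\<in>cells T. cell_measure K * (w k K * a k K - w (k-1) K * a (k-1) K)) =
   (\<Sum>K\<in>cells T. cell_measure K * ?av a k K * (w k K - w (k-1) K)) + (\<Sum>K\<in>cells T. ?av w k K * (cell_measure K * (a k K - a (k-1) K)))"
   unfolding sum.distrib[symmetric] by (intro sum.cong refl) (simp add: field_simps)
  have "(\<Sum>K\<in>cells T. ?av w k K * (cell_measure K * (a k K - a (k-1) K))) =
    - \<tau> * (\<Sum>K\<in>cells T. ?av w k K * (\<Sum>s\<in>cell_faces T K. F k K s * face_measure s))"
   unfolding sum_distrib_left[of "- \<tau>"]
   by (intro sum.cong refl) (use discrete_mass_conservation(2)[OF ce k'(1,3)] in \<open>simp add: a_def \<tau>_def\<close>)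
  also have "\<dots> = \<tau> * (\<Sum>s\<in>internal_faces T. - (face_measure s * (\<Sum>K\<in>face_cells T s. F k K s * ?av w k K)))"
   unfolding sum_cells_flux[OF fl] by (simp add: sum_negf)
  also have "\<dots> \<le> \<tau> * (\<Sum>s\<in>internal_faces T. enn2real (?b k s) + face_measure s * (\<Sum>K\<in>face_cells T s. cell_face_dist T K s * ?av a k K * q K s) / 2)"
  proof (intro mult_left_mono sum_mono)
   fix s assume s: "s \<in> internal_faces T"
   show "- (face_measure s * (\<Sum>K\<in>face_cells T s. F k K s * ?av w k K)) \<le>
    enn2real (?b k s) + face_measure s * (\<Sum>K\<in>face_cells T s. cell_face_dist T K s * ?av a k K * q K s) / 2"
   proof (rule face_young[OF fl s])
    show "?av a k K \<ge> 0" if "K \<in> cells T" for K using a0[OF k'(1) that] a0[OF k'(2) that] by simp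
    show "?b k s \<noteq> \<infinity>" by (rule bfin[OF k s])
   qed (rule qb[OF s])
  qed (use \<tau> in simp)
  also have "\<dots> = \<tau> * (\<Sum>s\<in>internal_faces T. enn2real (?b k s)) +
    (\<tau> / 2) * (\<Sum>s\<in>internal_faces T. \<Sum>K\<in>face_cells T s. face_measure s * (cell_face_dist T K s * ?av a k K * q K s))"
   by (rule weighted_sum_split)
  finally have S2: "(\<Sum>K\<in>cells T. ?av w k K * (cell_measure K * (a k K - a (k-1) K))) \<le>
   \<tau> * (\<Sum>s\<in>internal_faces T. enn2real (?b k s)) +
    (\<tau> / 2) * (\<Sum>s\<in>internal_faces T. \<Sum>K\<in>face_cells T s. face_measure s * (cell_face_dist T K s * ?av a k K * q K s))" .
  have S3: "(\<Sum>s\<in>internal_faces T. \<Sum>K\<in>face_cells T s. face_measure s * (cell_face_dist T K s * ?av a k K * q K s)) =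
    (\<Sum>K\<in>cells T. \<Sum>s\<in>cell_faces T K. face_measure s * (cell_face_dist T K s * ?av a k K * q K s))"
   by (rule sum_cells_faces[symmetric])
  have S4: "(\<tau> / 2) * (\<Sum>K\<in>cells T. \<Sum>s\<in>cell_faces T K. face_measure s * (cell_face_dist T K s * ?av a k K * q K s)) \<le> (\<tau> / 2) * (\<Sum>K\<in>cells T. ?av a k K * (cell_measure K * (1 + e) * (norm (v K))\<^sup>2 + C1 * h * (real DIM('a) * (cell_measure K * (1 + e)))))"
  proof (intro mult_left_mono sum_mono)
   fix K assume K: "K \<in> cells T"
   have "(\<Sum>s\<in>cell_faces T K. face_measure s * (cell_face_dist T K s * ?av a k K * q K s)) =
    ?av a k K * ((\<Sum>s\<in>cell_faces T K. face_measure s * cell_face_dist T K s * (outward_normal K s \<bullet> v K)\<^sup>2)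
     + C1 * h * (\<Sum>s\<in>cell_faces T K. face_measure s * cell_face_dist T K s))"
    unfolding q_def sum_distrib_left distrib_left sum.distrib[symmetric] by (intro sum.cong refl) (simp add: mult_ac)
   also have "\<dots> \<le> ?av a k K * (cell_measure K * (1 + e) * (norm (v K))\<^sup>2 + C1 * h * (real DIM('a) * (cell_measure K * (1 + e))))"
   proof (rule mult_left_mono[OF add_mono[OF isotropy[OF iso K] mult_left_mono[OF isotropy_trace[OF iso K]]]])
    show "0 \<le> C1 * h" using C1 h by simp
    show "0 \<le> ?av a k K" using a0[OF k'(1) K] a0[OF k'(2) K] by simp
   qed
   finally show "(\<Sum>s\<in>cell_faces T K. face_measure s * (cell_face_dist T K s * ?av a k K * q K s)) \<le>
     ?av a k K * (cell_measure K * (1 + e) * (norm (v K))\<^sup>2 + C1 * h * (real DIM('a) * (cell_measure K * (1 + e))))" .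
  qed (use \<tau> in simp)
  have S: "(\<Sum>K\<in>cells T. cell_measure K * (w k K * a k K - w (k-1) K * a (k-1) K)) \<le>
   \<tau> * (\<Sum>s\<in>internal_faces T. enn2real (?b k s)) +
   (\<Sum>K\<in>cells T. cell_measure K * ?av a k K * ((w k K - w (k-1) K) + \<tau> * ((1 + e) * (norm (v K))\<^sup>2) / 2 + \<tau> * (real DIM('a) * (1 + e) * (C1 * h) / 2)))"
   unfolding S1 weighted_sum_collect[symmetric]
   by (rule add_left_mono[OF order_trans[OF S2[unfolded S3] add_left_mono[OF S4]]])
  have "(\<Sum>K\<in>cells T. cell_measure K * ?av a k K * ((w k K - w (k-1) K) + \<tau> * ((1 + e) * (norm (v K))\<^sup>2) / 2 + \<tau> * (real DIM('a) * (1 + e) * (C1 * h) / 2)))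
   \<le> (\<Sum>K\<in>cells T. cell_measure K * ?av a k K * (\<tau> * R))"
  proof (intro sum_mono mult_left_mono)
   fix K assume K: "K \<in> cells T"
   show "(w k K - w (k-1) K) + \<tau> * ((1 + e) * (norm (v K))\<^sup>2) / 2 + \<tau> * (real DIM('a) * (1 + e) * (C1 * h) / 2) \<le> \<tau> * R"
    using HJk[OF K] by (simp add: R_def distrib_left)
   show "0 \<le> cell_measure K * ?av a k K" using a0[OF k'(1) K] a0[OF k'(2) K] cell_measure_pos[OF K] by simp
  qed
  also have "\<dots> = ((\<Sum>K\<in>cells T. cell_measure K * a k K) + (\<Sum>K\<in>cells T. cell_measure K * a (k-1) K)) / 2 * (\<tau> * R)"
   unfolding sum.distrib[symmetric] sum_divide_distrib sum_distrib_right by (intro sum.cong refl) (simp add: field_simps)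
  also have "\<dots> = \<tau> * (M * R)" using aM[OF k'(1)] aM[OF k'(2)] by simp
  finally show ?thesis using S by linarith
 qed
 have tele: "(\<Sum>k=1..n. x k - x (k-1)) = x n - x 0" for x :: "nat \<Rightarrow> real" and n
  by (induction n) auto
 have "(\<Sum>K\<in>cells T. cell_measure K * (w (N+1) K * a (N+1) K)) - (\<Sum>K\<in>cells T. cell_measure K * (w 0 K * a 0 K))
  = (\<Sum>k=1..N+1. \<Sum>K\<in>cells T. cell_measure K * (w k K * a k K - w (k-1) K * a (k-1) K))"
  using tele[of "\<lambda>k. \<Sum>K\<in>cells T. cell_measure K * (w k K * a k K)" "N+1"] by (simp add: right_diff_distrib sum_subtractf)
 also have "\<dots> \<le> (\<Sum>k=1..N+1. \<tau> * (\<Sum>s\<in>internal_faces T. enn2real (?b k s)) + \<tau> * (M * R))"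
  by (intro sum_mono step)
 also have "\<dots> = enn2real (discrete_action N T' T (\<rho>, F)) + M * R"
 proof -
  have "(\<Sum>k=1..N+1. \<tau> * (M * R)) = (\<tau> * real (N + 1)) * (M * R)" by simp
  then show ?thesis unfolding actr sum.distrib \<tau>(2) by simp
 qed
 finally have A: "(\<Sum>K\<in>cells T. cell_measure K * (w (N+1) K * a (N+1) K)) - (\<Sum>K\<in>cells T. cell_measure K * (w 0 K * a 0 K)) \<le> enn2real (discrete_action N T' T (\<rho>, F)) + M * R" .
 define E where "E = G * (\<zeta> + max 1 \<zeta>) * h"
 have close: "\<bar>\<phi> (t k) x - w k K\<bar> \<le> E" if "k \<le> N + 1" "K \<in> cells T" "x \<in> parent K" for k K x
 proof -
  have xO: "x \<in> \<Omega>" using that(3) coarse.cell(6)[OF parent(1)[OF that(2)]] by blast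
  have "\<bar>\<phi> (t k) x - w k K\<bar> \<le> G * norm ((t k, x) - p k K)"
   using gradient_bound_lipschitz[OF Q(2) f gG, of "(t k, x)" "p k K"] p[OF that(1,2)] t[OF that(1)] xO by (simp add: mem_Q w_def p_def)
  also have "norm ((t k, x) - p k K) = norm (x - center T K)" by (simp add: p_def xx_def norm_Pair)
  also have "G * \<dots> \<le> G * (\<zeta> * mesh_size T + mesh_size T')"
   by (intro mult_left_mono center_parent_dist[OF reg that(2,3)] G)
  also have "\<dots> \<le> G * (\<zeta> * mesh_size T + max 1 \<zeta> * mesh_size T)"
   using cmp G by (intro mult_left_mono) (auto simp: coarse_comparable_def)
  finally show ?thesis by (simp add: E_def h_def algebra_simps)
 qed
 have cont: "continuous_on \<Omega> (\<phi> (t k))" if "k \<le> N + 1" for k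
 proof (rule has_derivative_continuous_on)
  fix x assume "x \<in> \<Omega>"
  then have "((\<lambda>(t, x). \<phi> t x) has_derivative (\<lambda>v. g (t k, x) \<bullet> v)) (at (t k, x) within {0..1} \<times> \<Omega>)"
   using f t[OF that] by (auto simp: has_gradient_on_def Q_def)
  from space_gradient[OF this t[OF that]]
  show "(\<phi> (t k) has_derivative (\<lambda>v. snd (g (t k, x)) \<bullet> v)) (at x within \<Omega>)" by simp
 qed
 have eqs: "a 0 K = sampling \<rho>in (parent K)" "a (N+1) K = sampling \<rho>f (parent K)" if "K \<in> cells T" for K
  using ce parent(1)[OF that] unfolding discrete_continuity_equation_def a_def by auto
 have "\<bar>(\<Sum>K\<in>cells T. cell_measure K * w (N+1) K * sampling \<rho>f (parent K)) - int_on \<Omega> (\<lambda>x. \<phi> (t (N+1)) x * \<rho>f x)\<bar> \<le> E * M"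
  using sampled_pairing[OF d(2) cont[of "N+1"] close[of "N+1"]] mass by simp
 moreover have "\<bar>(\<Sum>K\<in>cells T. cell_measure K * w 0 K * sampling \<rho>in (parent K)) - int_on \<Omega> (\<lambda>x. \<phi> (t 0) x * \<rho>in x)\<bar> \<le> E * M"
  using sampled_pairing[OF d(1) cont[of 0] close[of 0]] mass by simp
 moreover have "(\<Sum>K\<in>cells T. cell_measure K * w (N+1) K * sampling \<rho>f (parent K)) = (\<Sum>K\<in>cells T. cell_measure K * (w (N+1) K * a (N+1) K))"
  "(\<Sum>K\<in>cells T. cell_measure K * w 0 K * sampling \<rho>in (parent K)) = (\<Sum>K\<in>cells T. cell_measure K * (w 0 K * a 0 K))"
  using eqs by (auto intro!: sum.cong simp del: One_nat_def)
 ultimately have "dual_value \<Omega> \<rho>in \<rho>f \<phi> \<le> enn2real (discrete_action N T' T (\<rho>, F)) + M * R + 2 * (E * M)"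
  using A unfolding dual_value_def t0 t1 by linarith
 then show ?thesis by (simp add: R_def E_def h_def \<tau>_def algebra_simps)
qed

end

section \<open>Energy of the mean fluxes of a field\<close>

text \<open>Convexity of \<open>p \<mapsto> 1/p\<close>, with weights \<open>a / d\<close> and \<open>b / d\<close> whose sum may exceed 1.\<close>

lemma quotient_two_point_convex:
 fixes x :: real
 assumes "p > 0" "q > 0" "a \<ge> 0" "b \<ge> 0" "d > 0" "d \<le> a + b"
 shows "x\<^sup>2 / (2 * ((a * p + b * q) / d)) * d \<le> a * (x\<^sup>2 / (2 * p)) + b * (x\<^sup>2 / (2 * q))"
proof -
 have S: "a * p + b * q > 0"
 proof (cases "a > 0")
  case True then show ?thesis using assms by (simp add: add_pos_nonneg)
 next
  case False then have "b > 0" using assms by linarith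
  then show ?thesis using assms by (simp add: add_nonneg_pos)
 qed
 have "d\<^sup>2 \<le> (a + b)\<^sup>2" using assms by (intro power_mono) auto
 also have "\<dots> \<le> (a * p + b * q) * (a / p + b / q)"
 proof -
  have "(a * p + b * q) * (a / p + b / q) - (a + b)\<^sup>2 = a * b * ((p - q)\<^sup>2 / (p * q))"
   using assms by (simp add: field_simps power2_eq_square)
  moreover have "0 \<le> a * b * ((p - q)\<^sup>2 / (p * q))" using assms by simp
  ultimately show ?thesis by linarith
 qed
 finally have "d\<^sup>2 / (a * p + b * q) \<le> a / p + b / q" using S by (simp add: pos_divide_le_eq mult.commute)
 then have "x\<^sup>2 / 2 * (d\<^sup>2 / (a * p + b * q)) \<le> x\<^sup>2 / 2 * (a / p + b / q)" by (rule mult_left_mono) simp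
 moreover have "x\<^sup>2 / (2 * ((a * p + b * q) / d)) * d = x\<^sup>2 / 2 * (d\<^sup>2 / (a * p + b * q))"
  using assms S by (simp add: power2_eq_square)
 moreover have "x\<^sup>2 / 2 * (a / p + b / q) = a * (x\<^sup>2 / (2 * p)) + b * (x\<^sup>2 / (2 * q))"
  by (simp add: algebra_simps)
 ultimately show ?thesis by linarith
qed

lemma weighted_square_perturbation:
 fixes u v :: "'a::real_inner"
 assumes e: "\<epsilon> > 0" "R \<ge> \<epsilon>" "c \<ge> \<epsilon>" and b: "norm u \<le> b" "norm v \<le> b" and d: "norm (u - v) \<le> d" and s: "c - R \<le> s" "s \<ge> 0"
 shows "(norm u)\<^sup>2 / (2 * R) \<le> (norm v)\<^sup>2 / (2 * c) + (b * d / \<epsilon> + b\<^sup>2 * s / (2 * \<epsilon>\<^sup>2))"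
proof -
 have b0: "b \<ge> 0" and d0: "d \<ge> 0" using b d norm_ge_zero order_trans by blast+
 have pos: "R > 0" "c > 0" using e by auto
 have "(norm u)\<^sup>2 - (norm v)\<^sup>2 = (norm u + norm v) * (norm u - norm v)" by (simp add: power2_eq_square algebra_simps)
 also have "\<dots> \<le> (norm u + norm v) * d"
  using norm_triangle_ineq2[of u v] d by (intro mult_left_mono) auto
 also have "\<dots> \<le> (2 * b) * d" using b d0 by (intro mult_right_mono) auto
 finally have 1: "(norm u)\<^sup>2 \<le> (norm v)\<^sup>2 + 2 * b * d" by simp
 have "(norm u)\<^sup>2 / (2 * R) \<le> ((norm v)\<^sup>2 + 2 * b * d) / (2 * R)" using 1 pos by (intro divide_right_mono) auto
 also have "\<dots> = (norm v)\<^sup>2 / (2 * R) + b * d / R" using pos by (simp add: field_simps)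
 also have "b * d / R \<le> b * d / \<epsilon>" using b0 d0 e by (intro divide_left_mono) auto
 also have "(norm v)\<^sup>2 / (2 * R) \<le> (norm v)\<^sup>2 / (2 * c) + b\<^sup>2 * s / (2 * \<epsilon>\<^sup>2)"
 proof -
  have "(norm v)\<^sup>2 / (2 * R) - (norm v)\<^sup>2 / (2 * c) = (norm v)\<^sup>2 * (c - R) / (2 * (R * c))"
   using pos by (simp add: field_simps)
  also have "\<dots> \<le> (norm v)\<^sup>2 * s / (2 * (R * c))" using s pos by (intro divide_right_mono mult_left_mono) auto
  also have "\<dots> \<le> b\<^sup>2 * s / (2 * (R * c))" using b s pos by (intro divide_right_mono mult_right_mono power_mono) auto
  also have "\<dots> \<le> b\<^sup>2 * s / (2 * \<epsilon>\<^sup>2)"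
  proof (rule divide_left_mono)
   have "\<epsilon> * \<epsilon> \<le> R * c" using e by (intro mult_mono) auto
   then show "2 * \<epsilon>\<^sup>2 \<le> 2 * (R * c)" by (simp add: power2_eq_square)
   show "0 < 2 * (R * c) * (2 * \<epsilon>\<^sup>2)" using e pos by simp
  qed (use s in simp)
  finally show ?thesis by linarith
 qed
 finally show ?thesis by linarith
qed

context mesh begin

lemma face_subset_\<Omega>: "K \<in> cells T \<Longrightarrow> s \<subseteq> frontier K \<Longrightarrow> s \<subseteq> \<Omega>"
 using cell(5) by (auto simp: frontier_def)

lemma face_flux_antisym:
 assumes s: "s \<in> internal_faces T" "face_cells T s = {K, L}" "K \<noteq> L"
 shows "face_flux V L s = - face_flux V K s"
proof -
 have n: "outward_normal L s = - outward_normal K s" by (rule centers_along_normal(3)[OF s])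
 have l: "face_level L s = - face_level K s" by (simp add: face_level_def n)
 have "hp (- outward_normal K s) (- face_level K s) = hp (outward_normal K s) (face_level K s)"
  by (rule ext) (simp add: hp_def algebra_simps)
 then show ?thesis by (simp add: face_flux_def n l set_lebesgue_integral_def)
qed

lemma face_flux_approx:
 assumes K: "K \<in> cells T" and s: "s \<in> faces T" "s \<subseteq> frontier K" and V: "continuous_on \<Omega> V"
  and d: "\<And>y. y \<in> s \<Longrightarrow> norm (V y - U) \<le> d"
 shows "\<bar>face_flux V K s - face_measure s * (U \<bullet> outward_normal K s)\<bar> \<le> d * face_measure s"
proof -
 let ?n = "outward_normal K s" and ?b = "face_level K s"
 have n: "norm ?n = 1" by (rule normal(1)[OF K s])
 have sO: "s \<subseteq> \<Omega>" by (rule face_subset_\<Omega>[OF K s(2)])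
 have ss: "s \<in> sets borel" by (rule face_sets[OF s(1)])
 have p: "prism s = {x. hp ?n ?b x \<in> s \<and> \<bar>?n \<bullet> x - ?b\<bar> \<le> 1/2}" by (rule face_prism[OF K s])
 have pm[measurable]: "prism s \<in> sets borel" unfolding p using ss by measurable
 obtain R where R: "\<And>x. x \<in> \<Omega> \<Longrightarrow> norm x \<le> R" using \<Omega>(4) by (auto simp: bounded_iff)
 have pb: "bounded (prism s)"
  unfolding bounded_iff
 proof (intro exI[of _ "R + 1/2"] ballI)
  fix x assume x: "x \<in> prism s"
  have "x = hp ?n ?b x + (?n \<bullet> x - ?b) *\<^sub>R ?n" by (simp add: hp_def)
  also have "norm \<dots> \<le> R + 1/2" using x p sO R n by (intro order_trans[OF norm_triangle_ineq] add_mono) auto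
  finally show "norm x \<le> R + 1/2" .
 qed
 have d0: "d \<ge> 0" using d face(5)[OF s(1)] norm_ge_zero order_trans by blast
 define q where "q x = indicator (prism s) x *\<^sub>R ((V (hp ?n ?b x) - U) \<bullet> ?n)" for x
 have qb: "\<bar>q x\<bar> \<le> d * indicator (prism s) x" for x
  using d[of "hp ?n ?b x"] Cauchy_Schwarz_ineq2[of "V (hp ?n ?b x) - U" ?n] n d0 p by (auto simp: q_def indicator_def)
 have Vm: "(\<lambda>x. indicator \<Omega> x *\<^sub>R V x) \<in> borel_measurable borel"
  by (intro borel_measurable_continuous_on_indicator V \<Omega>_sets)
 have qm: "q \<in> borel_measurable borel"
 proof -
  have "(\<lambda>x. indicator (prism s) x *\<^sub>R ((indicator \<Omega> (hp ?n ?b x) *\<^sub>R V (hp ?n ?b x) - U) \<bullet> ?n)) \<in> borel_measurable borel"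
   using measurable_compose[OF hp_borel[of ?n ?b] Vm] by measurable
  moreover have "indicator (prism s) x *\<^sub>R ((indicator \<Omega> (hp ?n ?b x) *\<^sub>R V (hp ?n ?b x) - U) \<bullet> ?n) = q x" for x
   using sO p by (auto simp: q_def indicator_def)
  ultimately show ?thesis by (simp only:)
 qed
 have qi: "integrable lborel q"
 proof (rule integrable_lborel_bounded_support[OF qm _ _ pb])
  show "norm (q x) \<le> d" for x using qb[of x] d0 by (cases "x \<in> prism s") auto
 qed (simp add: q_def)
 have fin: "emeasure lborel (prism s) < \<infinity>" by (rule emeasure_bounded_finite[OF pb])
 have pi: "integrable lborel (indicator (prism s) :: 'a \<Rightarrow> real)" using fin pm by (intro integrable_real_indicator) auto
 have fm: "face_measure s = (\<integral>x. indicator (prism s) x \<partial>lborel)"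
  using pm by (simp add: face_measure_def)
 have "face_flux V K s = (\<integral>x. q x + indicator (prism s) x * (U \<bullet> ?n) \<partial>lborel)"
  unfolding face_flux_def set_lebesgue_integral_def
  by (intro Bochner_Integration.integral_cong refl) (simp add: q_def inner_diff_left algebra_simps)
 also have "\<dots> = (\<integral>x. q x \<partial>lborel) + face_measure s * (U \<bullet> ?n)"
  using Bochner_Integration.integral_add[OF qi integrable_mult_left[OF pi, of "U \<bullet> ?n"]] unfolding fm by simp
 finally have "\<bar>face_flux V K s - face_measure s * (U \<bullet> ?n)\<bar> = \<bar>\<integral>x. q x \<partial>lborel\<bar>" by simp
 also have "\<dots> \<le> (\<integral>x. d * indicator (prism s) x \<partial>lborel)"
  by (rule order_trans[OF integral_abs_bound integral_mono]) (use qi pi qb in auto)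
 also have "\<dots> = d * face_measure s" unfolding fm by simp
 finally show ?thesis .
qed

definition mean_flux :: "('a \<Rightarrow> 'a) \<Rightarrow> 'a set \<Rightarrow> 'a set \<Rightarrow> real" where
 "mean_flux V K s = face_flux V K s / face_measure s"

lemma mean_flux_is_flux: "is_flux T (mean_flux V)"
 unfolding is_flux_def mean_flux_def using face_flux_antisym by (auto simp flip: add_divide_distrib)

lemma mean_flux_total:
 assumes K: "K \<in> cells T" and s: "s \<in> cell_faces T K" and V: "continuous_on \<Omega> V"
 shows "mean_flux V K s * face_measure s = face_flux V K s"
proof (cases "face_measure s = 0")
 case True
 obtain C where C: "\<And>x. x \<in> \<Omega> \<Longrightarrow> norm (V x) \<le> C"
  using compact_imp_bounded[OF compact_continuous_image[OF V \<Omega>(1)]] by (auto simp: bounded_iff)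
 have "\<bar>face_flux V K s - face_measure s * (0 \<bullet> outward_normal K s)\<bar> \<le> C * face_measure s"
  by (rule face_flux_approx[OF K cell_facesD(1,2)[OF s] V]) (use C face_subset_\<Omega>[OF K cell_facesD(2)[OF s]] in auto)
 then show ?thesis using True by (simp add: mean_flux_def)
qed (simp add: mean_flux_def)

lemma discrete_div_mean_flux:
 assumes K: "K \<in> cells T" and V: "continuous_on \<Omega> V"
 shows "discrete_div T (mean_flux V) K = (\<Sum>s\<in>cell_faces T K. face_flux V K s) / cell_measure K"
 unfolding discrete_div_def using mean_flux_total[OF K _ V] by simp

lemma face_dist_le: "face_cells T s = {K, L} \<Longrightarrow> K \<noteq> L \<Longrightarrow> face_dist T s \<le> cell_face_dist T K s + cell_face_dist T L s"
 unfolding face_dist_eq cell_face_dist_def by (rule dist_triangle2)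

text \<open>By convexity the energy of a face splits between its two cells. In each cell the flux is \<open>V \<bullet> n\<close> at one
  point up to an error of order \<open>h\<close>, so the isotropy assumption bounds the sum by the energy of the
  constant field, and the Lipschitz continuity of \<open>V\<close> compares it with the integral over the cell.\<close>

theorem mean_flux_energy:
 assumes iso: "mesh_isotropic e T" and e: "e \<ge> 0"
  and V: "\<Lambda>-lipschitz_on \<Omega> V" "\<And>x. x \<in> \<Omega> \<Longrightarrow> norm (V x) \<le> b"
  and W: "continuous_on \<Omega> W" "\<And>x. x \<in> \<Omega> \<Longrightarrow> norm (W x) \<le> Cw * mesh_size T" and Cw: "Cw \<ge> 0"
  and \<epsilon>: "\<epsilon> > 0" and R: "\<And>K. K \<in> cells T \<Longrightarrow> R K \<ge> \<epsilon>"
  and c: "continuous_on \<Omega> c" "\<And>x. x \<in> \<Omega> \<Longrightarrow> c x \<ge> \<epsilon>"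
  and Rc: "\<And>K x. K \<in> cells T \<Longrightarrow> x \<in> K \<Longrightarrow> c x - R K \<le> S" and S: "S \<ge> 0"
 defines "C2 \<equiv> (2 * b + (\<Lambda> + Cw) * diameter \<Omega>) * (\<Lambda> + Cw)"
 shows "(\<Sum>s\<in>internal_faces T. B (linear_reconstruction T R s) (flux_size T (mean_flux (\<lambda>x. V x + W x)) s) *
   ennreal (face_measure s * face_dist T s)) \<le>
  ennreal ((1 + e) * (int_on \<Omega> (\<lambda>x. (norm (V x))\<^sup>2 / (2 * c x)) +
    measure lebesgue \<Omega> * (b * (\<Lambda> * mesh_size T) / \<epsilon> + b\<^sup>2 * S / (2 * \<epsilon>\<^sup>2) + C2 * mesh_size T * real DIM('a) / (2 * \<epsilon>))))"
proof -
 define h where "h = mesh_size T"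
 have h: "h > 0" "h \<le> diameter \<Omega>" unfolding h_def using mesh_size_pos mesh_size_le by auto
 let ?V = "\<lambda>x. V x + W x"
 let ?F = "mean_flux ?V"
 have Vc: "continuous_on \<Omega> V" using lipschitz_on_continuous_on[OF V(1)] .
 have VWc: "continuous_on \<Omega> ?V" by (intro continuous_intros Vc W)
 have \<Lambda>: "\<Lambda> \<ge> 0" using V(1) lipschitz_on_nonneg by blast
 have b: "b \<ge> 0" using V(2) \<Omega>(5) norm_ge_zero order_trans by blast
 have D0: "diameter \<Omega> \<ge> 0" by (rule diameter_ge_0[OF \<Omega>(4)])
 have C2: "C2 \<ge> 0" unfolding C2_def using b \<Lambda> Cw D0 by simp
 define y where "y K = (SOME x. x \<in> K)" for K :: "'a set"
 have y: "y K \<in> K" if "K \<in> cells T" for K unfolding y_def using cell(1)[OF that] by (simp add: some_in_eq)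
 define q where "q K s = (outward_normal K s \<bullet> V (y K))\<^sup>2 + C2 * h" for K s
 have Fq: "face_measure s * (?F K s)\<^sup>2 \<le> face_measure s * q K s" if K: "K \<in> cells T" and s: "s \<in> cell_faces T K" for K s
 proof (cases "face_measure s = 0")
  case False
  then have m: "face_measure s > 0" using face_measure_nonneg[of s] by linarith
  note sD = cell_facesD[OF s]
  let ?n = "outward_normal K s" and ?U = "V (y K)"
  have n: "norm ?n = 1" by (rule normal(1)[OF K sD(1,2)])
  have yO: "y K \<in> \<Omega>" using y[OF K] cell(6)[OF K] by blast
  have "norm (?V z - ?U) \<le> (\<Lambda> + Cw) * h" if z: "z \<in> s" for z
  proof -
   have zO: "z \<in> \<Omega>" using face_subset_\<Omega>[OF K sD(2)] z by blast
   have zK: "z \<in> closure K" using sD(2) z by (auto simp: frontier_def)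
   have "dist z (y K) \<le> diameter (closure K)"
    using zK y[OF K] closure_subset cell(4)[OF K] by (intro diameter_bounded_bound) auto
   also have "\<dots> \<le> h" unfolding diameter_closure[OF cell(4)[OF K]] h_def by (rule diameter_le_mesh_size[OF K])
   finally have "\<Lambda> * dist z (y K) \<le> \<Lambda> * h" using \<Lambda> by (intro mult_left_mono)
   then have "norm (V z - ?U) \<le> \<Lambda> * h" using lipschitz_onD[OF V(1) zO yO] by (simp add: dist_norm)
   moreover have "norm (W z) \<le> Cw * h" using W(2)[OF zO] by (simp add: h_def)
   moreover have "norm (?V z - ?U) \<le> norm (V z - ?U) + norm (W z)"
    using norm_triangle_ineq[of "V z - ?U" "W z"] by (simp add: algebra_simps)
   ultimately show ?thesis unfolding distrib_right by linarith
  qed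
  from face_flux_approx[OF K sD(1,2) VWc this]
  have "\<bar>face_flux ?V K s - face_measure s * (?U \<bullet> ?n)\<bar> \<le> ((\<Lambda> + Cw) * h) * face_measure s" .
  moreover have "face_flux ?V K s - face_measure s * (?U \<bullet> ?n) = (?F K s - ?n \<bullet> ?U) * face_measure s"
   using m by (simp add: mean_flux_def inner_commute left_diff_distrib)
  ultimately have "\<bar>?F K s - ?n \<bullet> ?U\<bar> * face_measure s \<le> ((\<Lambda> + Cw) * h) * face_measure s"
   using m by (simp add: abs_mult)
  then have d: "\<bar>?F K s - ?n \<bullet> ?U\<bar> \<le> (\<Lambda> + Cw) * h" using m by simp
  have nU: "\<bar>?n \<bullet> ?U\<bar> \<le> b" using Cauchy_Schwarz_ineq2[of ?n ?U] n V(2)[OF yO] by simp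
  have "(?F K s)\<^sup>2 - (?n \<bullet> ?U)\<^sup>2 = (2 * (?n \<bullet> ?U) + (?F K s - ?n \<bullet> ?U)) * (?F K s - ?n \<bullet> ?U)"
   by (simp add: power2_eq_square algebra_simps)
  also have "\<dots> \<le> \<bar>2 * (?n \<bullet> ?U) + (?F K s - ?n \<bullet> ?U)\<bar> * \<bar>?F K s - ?n \<bullet> ?U\<bar>" by (simp flip: abs_mult)
  also have "\<dots> \<le> (2 * b + (\<Lambda> + Cw) * diameter \<Omega>) * ((\<Lambda> + Cw) * h)"
  proof (rule mult_mono)
   have "(\<Lambda> + Cw) * h \<le> (\<Lambda> + Cw) * diameter \<Omega>" using h \<Lambda> Cw by (intro mult_left_mono) auto
   then show "\<bar>2 * (?n \<bullet> ?U) + (?F K s - ?n \<bullet> ?U)\<bar> \<le> 2 * b + (\<Lambda> + Cw) * diameter \<Omega>" using nU d by linarith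
  qed (use d b \<Lambda> Cw D0 in auto)
  also have "\<dots> = C2 * h" by (simp add: C2_def)
  finally have "(?F K s)\<^sup>2 \<le> q K s" by (simp add: q_def)
  then show ?thesis using m by simp
 qed simp
 have fterm: "B (linear_reconstruction T R s) (flux_size T ?F s) * ennreal (face_measure s * face_dist T s)
   \<le> ennreal (\<Sum>K\<in>face_cells T s. face_measure s * (cell_face_dist T K s * (q K s / (2 * R K))))"
  if s: "s \<in> internal_faces T" for s
 proof -
  obtain K L where KL: "face_cells T s = {K, L}" "K \<noteq> L" "K \<in> cells T" "L \<in> cells T" "s \<in> faces T"
   "s \<subseteq> frontier K" "s \<subseteq> frontier L" using internal_face_cells[OF s] by metis
  have sc: "s \<in> cell_faces T K" "s \<in> cell_faces T L" using s KL by (auto simp: cell_faces_def)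
  let ?d = "face_dist T s" and ?a = "cell_face_dist T K s" and ?a' = "cell_face_dist T L s" and ?m = "face_measure s"
  have d: "?d > 0" by (rule centers_along_normal(2)[OF s KL(1,2)])
  have RK: "R K > 0" "R L > 0" using R[OF KL(3)] R[OF KL(4)] \<epsilon> by auto
  have dle: "?d \<le> ?a + ?a'" by (rule face_dist_le[OF KL(1,2)])
  have lr: "linear_reconstruction T R s = (?a * R K + ?a' * R L) / ?d" by (rule linear_reconstruction_pair[OF KL(1,2)])
  have "\<epsilon> * ?d \<le> \<epsilon> * (?a + ?a')" using dle \<epsilon> by simp
  also have "\<dots> \<le> ?a * R K + ?a' * R L"
   using mult_left_mono[OF R[OF KL(3)], of ?a] mult_left_mono[OF R[OF KL(4)], of ?a']
   by (simp add: cell_face_dist_nonneg algebra_simps)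
  finally have "?a * R K + ?a' * R L > 0" using \<epsilon> d by (meson less_le_trans mult_pos_pos)
  then have lrp: "linear_reconstruction T R s > 0" using d lr by simp
  have fs: "flux_size T ?F s = \<bar>?F K s\<bar>" "?F L s = - ?F K s" by (rule flux_size_eq[OF mean_flux_is_flux s KL(1,2)])+
  have Bp: "B l \<bar>x\<bar> * ennreal y = ennreal (x\<^sup>2 / (2 * l) * y)" if "l > 0" "y \<ge> 0" for l x y :: real
   using that by (simp add: B_def ennreal_mult[symmetric])
  have "B (linear_reconstruction T R s) (flux_size T ?F s) * ennreal (?m * ?d) =
    ennreal ((?F K s)\<^sup>2 / (2 * ((?a * R K + ?a' * R L) / ?d)) * (?m * ?d))"
   unfolding fs(1) lr by (rule Bp) (use lrp lr mult_nonneg_nonneg[OF face_measure_nonneg less_imp_le[OF d]] in simp_all)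
  also have "(?F K s)\<^sup>2 / (2 * ((?a * R K + ?a' * R L) / ?d)) * (?m * ?d) =
    ?m * ((?F K s)\<^sup>2 / (2 * ((?a * R K + ?a' * R L) / ?d)) * ?d)" by (simp only: mult_ac)
  also have "ennreal \<dots> \<le> ennreal (?m * (?a * ((?F K s)\<^sup>2 / (2 * R K)) + ?a' * ((?F K s)\<^sup>2 / (2 * R L))))"
   by (intro ennreal_leI mult_left_mono quotient_two_point_convex RK cell_face_dist_nonneg d dle face_measure_nonneg)
  also have "?m * (?a * ((?F K s)\<^sup>2 / (2 * R K)) + ?a' * ((?F K s)\<^sup>2 / (2 * R L))) =
    (?m * (?F K s)\<^sup>2) * (?a / (2 * R K)) + (?m * (?F L s)\<^sup>2) * (?a' / (2 * R L))"
   using fs by (simp add: algebra_simps)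
  also have "\<dots> \<le> (?m * q K s) * (?a / (2 * R K)) + (?m * q L s) * (?a' / (2 * R L))"
   using RK by (intro add_mono mult_right_mono Fq KL sc) (auto simp: cell_face_dist_nonneg)
  also have "\<dots> = (\<Sum>K\<in>face_cells T s. ?m * (cell_face_dist T K s * (q K s / (2 * R K))))"
   using KL by (simp add: algebra_simps)
  finally show ?thesis by (simp add: ennreal_leI)
 qed
 have q0: "q K s \<ge> 0" for K s using C2 h by (simp add: q_def)
 have i: "integrable (lebesgue_on \<Omega>) (\<lambda>x. (norm (V x))\<^sup>2 / (2 * c x))"
 proof -
  have "continuous_on \<Omega> (\<lambda>x. (norm (V x))\<^sup>2 / (2 * c x))"
  proof -
   have "c x \<noteq> 0" if "x \<in> \<Omega>" for x using c(2)[OF that] \<epsilon> by linarith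
   then show ?thesis by (intro continuous_intros Vc c(1)) auto
  qed
  moreover have one: "integrable (lebesgue_on \<Omega>) (\<lambda>x. 1 :: real)"
   by (rule finite_measure.integrable_const[OF finite_measure_lebesgue_on[OF lmeasurable_compact[OF \<Omega>(1)]]])
  ultimately show ?thesis using integrable_mult_continuous[OF \<Omega>(1) one] by simp
 qed
 let ?E = "b * (\<Lambda> * h) / \<epsilon> + b\<^sup>2 * S / (2 * \<epsilon>\<^sup>2)"
 have cellb: "(\<Sum>s\<in>cell_faces T K. face_measure s * (cell_face_dist T K s * (q K s / (2 * R K)))) \<le>
   (1 + e) * (int_on K (\<lambda>x. (norm (V x))\<^sup>2 / (2 * c x)) + cell_measure K * (?E + C2 * h * real DIM('a) / (2 * \<epsilon>)))"
  if K: "K \<in> cells T" for K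
 proof -
  let ?U = "V (y K)"
  have RK: "R K > 0" using R[OF K] \<epsilon> by linarith
  have m: "cell_measure K > 0" by (rule cell_measure_pos[OF K])
  have "(\<Sum>s\<in>cell_faces T K. face_measure s * (cell_face_dist T K s * (q K s / (2 * R K)))) =
   ((\<Sum>s\<in>cell_faces T K. face_measure s * cell_face_dist T K s * (outward_normal K s \<bullet> ?U)\<^sup>2)
     + C2 * h * (\<Sum>s\<in>cell_faces T K. face_measure s * cell_face_dist T K s)) / (2 * R K)"
   unfolding q_def sum_distrib_left sum.distrib[symmetric] sum_divide_distrib by (intro sum.cong refl) (simp add: algebra_simps)
  also have "\<dots> \<le> (cell_measure K * (1 + e) * (norm ?U)\<^sup>2 + C2 * h * (real DIM('a) * (cell_measure K * (1 + e)))) / (2 * R K)"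
  proof (rule divide_right_mono[OF add_mono[OF isotropy[OF iso K] mult_left_mono[OF isotropy_trace[OF iso K]]]])
   show "0 \<le> C2 * h" using C2 h by simp
   show "0 \<le> 2 * R K" using RK by simp
  qed
  also have "\<dots> = (1 + e) * (cell_measure K * ((norm ?U)\<^sup>2 / (2 * R K)) + cell_measure K * (C2 * h * real DIM('a) / (2 * R K)))"
   using RK by (simp add: field_simps)
  also have "\<dots> \<le> (1 + e) * ((int_on K (\<lambda>x. (norm (V x))\<^sup>2 / (2 * c x)) + cell_measure K * ?E) + cell_measure K * (C2 * h * real DIM('a) / (2 * \<epsilon>)))"
  proof (intro mult_left_mono add_mono)
   have ik: "integrable (lebesgue_on K) (\<lambda>x. (norm (V x))\<^sup>2 / (2 * c x))" by (rule integrable_cell[OF K i])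
   have fm: "finite_measure (lebesgue_on K)"
    by (intro finite_measure_lebesgue_on bounded_set_imp_lmeasurable cell(4)[OF K] cell_sets(2)[OF K])
   have ic: "integrable (lebesgue_on K) (\<lambda>x. k :: real)" for k by (rule finite_measure.integrable_const[OF fm])
   have "cell_measure K * ((norm ?U)\<^sup>2 / (2 * R K)) = int_on K (\<lambda>x. (norm ?U)\<^sup>2 / (2 * R K))"
    by (simp only: integral_const_cell[OF K] mult.commute)
   also have "\<dots> \<le> int_on K (\<lambda>x. (norm (V x))\<^sup>2 / (2 * c x) + ?E)"
   proof (rule integral_mono)
    show "integrable (lebesgue_on K) (\<lambda>x. (norm ?U)\<^sup>2 / (2 * R K))" by (rule ic)
    show "integrable (lebesgue_on K) (\<lambda>x. (norm (V x))\<^sup>2 / (2 * c x) + ?E)" by (intro Bochner_Integration.integrable_add ik ic)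
    fix x assume "x \<in> space (lebesgue_on K)"
    then have x: "x \<in> K" by simp
    then have xO: "x \<in> \<Omega>" "y K \<in> \<Omega>" using cell(6)[OF K] y[OF K] by auto
    have "dist (y K) x \<le> diameter K" by (rule diameter_bounded_bound[OF cell(4)[OF K] y[OF K] x])
    also have "\<dots> \<le> h" unfolding h_def by (rule diameter_le_mesh_size[OF K])
    finally have "\<Lambda> * dist (y K) x \<le> \<Lambda> * h" using \<Lambda> by (intro mult_left_mono)
    then have "norm (?U - V x) \<le> \<Lambda> * h" using lipschitz_onD[OF V(1) xO(2,1)] by (simp add: dist_norm)
    then show "(norm ?U)\<^sup>2 / (2 * R K) \<le> (norm (V x))\<^sup>2 / (2 * c x) + ?E"
     by (intro weighted_square_perturbation[OF \<epsilon> R[OF K] c(2)[OF xO(1)] V(2)[OF xO(2)] V(2)[OF xO(1)]] Rc[OF K x] S)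
   qed
   also have "\<dots> = int_on K (\<lambda>x. (norm (V x))\<^sup>2 / (2 * c x)) + cell_measure K * ?E"
    by (subst Bochner_Integration.integral_add[OF ik ic]) (simp only: integral_const_cell[OF K] mult.commute)
   finally show "cell_measure K * ((norm ?U)\<^sup>2 / (2 * R K)) \<le> int_on K (\<lambda>x. (norm (V x))\<^sup>2 / (2 * c x)) + cell_measure K * ?E" .
   show "C2 * h * real DIM('a) / (2 * R K) \<le> C2 * h * real DIM('a) / (2 * \<epsilon>)"
    using C2 h R[OF K] \<epsilon> by (intro divide_left_mono) auto
  qed (use e m in auto)
  also have "\<dots> = (1 + e) * (int_on K (\<lambda>x. (norm (V x))\<^sup>2 / (2 * c x)) + cell_measure K * (?E + C2 * h * real DIM('a) / (2 * \<epsilon>)))"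
   by (simp add: distrib_left)
  finally show ?thesis .
 qed
 have meas: "(\<Sum>K\<in>cells T. cell_measure K) = measure lebesgue \<Omega>"
 proof -
  have one: "integrable (lebesgue_on \<Omega>) (\<lambda>x. 1 :: real)"
   by (rule finite_measure.integrable_const[OF finite_measure_lebesgue_on[OF lmeasurable_compact[OF \<Omega>(1)]]])
  show ?thesis using integral_sum_cells[OF one] integral_const_cell[of _ 1] by (simp add: measure_restrict_space \<Omega>_sets)
 qed
 have "(\<Sum>s\<in>internal_faces T. B (linear_reconstruction T R s) (flux_size T ?F s) * ennreal (face_measure s * face_dist T s))
  \<le> (\<Sum>s\<in>internal_faces T. ennreal (\<Sum>K\<in>face_cells T s. face_measure s * (cell_face_dist T K s * (q K s / (2 * R K)))))"
  by (intro sum_mono fterm)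
 also have "\<dots> = ennreal (\<Sum>s\<in>internal_faces T. \<Sum>K\<in>face_cells T s. face_measure s * (cell_face_dist T K s * (q K s / (2 * R K))))"
 proof (rule sum_ennreal)
  fix s assume "s \<in> internal_faces T"
  show "0 \<le> (\<Sum>K\<in>face_cells T s. face_measure s * (cell_face_dist T K s * (q K s / (2 * R K))))"
  proof (rule sum_nonneg)
   fix K assume "K \<in> face_cells T s"
   then have "R K > 0" using R[of K] \<epsilon> by (auto simp: face_cells_def)
   then show "0 \<le> face_measure s * (cell_face_dist T K s * (q K s / (2 * R K)))"
    using q0[of K s] by (simp add: face_measure_nonneg cell_face_dist_nonneg)
  qed
 qed
 also have "(\<Sum>s\<in>internal_faces T. \<Sum>K\<in>face_cells T s. face_measure s * (cell_face_dist T K s * (q K s / (2 * R K)))) =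
  (\<Sum>K\<in>cells T. \<Sum>s\<in>cell_faces T K. face_measure s * (cell_face_dist T K s * (q K s / (2 * R K))))"
  by (rule sum_cells_faces[symmetric])
 also have "ennreal \<dots> \<le> ennreal (\<Sum>K\<in>cells T. (1 + e) * (int_on K (\<lambda>x. (norm (V x))\<^sup>2 / (2 * c x)) + cell_measure K * (?E + C2 * h * real DIM('a) / (2 * \<epsilon>))))"
  by (intro ennreal_leI sum_mono cellb)
 also have "(\<Sum>K\<in>cells T. (1 + e) * (int_on K (\<lambda>x. (norm (V x))\<^sup>2 / (2 * c x)) + cell_measure K * (?E + C2 * h * real DIM('a) / (2 * \<epsilon>))))
  = (1 + e) * (int_on \<Omega> (\<lambda>x. (norm (V x))\<^sup>2 / (2 * c x)) + measure lebesgue \<Omega> * (?E + C2 * h * real DIM('a) / (2 * \<epsilon>)))"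
  unfolding integral_sum_cells[OF i] meas[symmetric] sum_distrib_right sum.distrib[symmetric] sum_distrib_left[symmetric] ..
 finally show ?thesis unfolding h_def .
qed

end

section \<open>Time regularity of the interpolation\<close>

lemma AE_lborel_pair_sections:
 assumes "AE z in (lborel :: ('a::euclidean_space \<times> 'b::euclidean_space) measure). P z"
 shows "AE x in lborel. AE y in lborel. P (x, y)" "AE y in lborel. AE x in lborel. P (x, y)"
proof -
 obtain N where N: "{z \<in> space lborel. \<not> P z} \<subseteq> N" "emeasure lborel N = 0" "N \<in> sets (lborel :: ('a \<times> 'b) measure)"
  using AE_E[OF assms] by blast
 then have nul: "N \<in> null_sets (lborel :: ('a \<times> 'b) measure)" by auto
 have ae: "AE z in lborel \<Otimes>\<^sub>M lborel. z \<notin> N" unfolding lborel_prod by (rule AE_not_in[OF nul])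
 have 1: "AE x in lborel. AE y in lborel. (x, y) \<notin> N" using lborel_pair.AE_pair[OF ae] .
 have m: "{z \<in> space (lborel \<Otimes>\<^sub>M lborel). (fst z, snd z) \<notin> N} \<in> sets (lborel \<Otimes>\<^sub>M lborel)"
 proof -
  have "{z \<in> space (lborel \<Otimes>\<^sub>M lborel). (fst z, snd z) \<notin> N} = space lborel - N" by (auto simp: space_pair_measure)
  then show ?thesis unfolding lborel_prod using sets.compl_sets[OF N(3)] by simp
 qed
 have 2: "AE y in lborel. AE x in lborel. (x, y) \<notin> N"
  using lborel_pair.AE_commute[of "\<lambda>x y. (x, y) \<notin> N", OF m] 1 by simp
 show "AE x in lborel. AE y in lborel. P (x, y)" using 1 by eventually_elim (use N(1) in \<open>auto elim!: eventually_mono\<close>)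
 show "AE y in lborel. AE x in lborel. P (x, y)" using 2 by eventually_elim (use N(1) in \<open>auto elim!: eventually_mono\<close>)
qed

lemma has_integral_AE_bound:
 fixes h :: "real \<Rightarrow> real"
 assumes h: "(h has_integral I) {a..b}" and ab: "a \<le> b" "{a..b} \<subseteq> {0..1}" and C: "C \<ge> 0"
  and ae: "AE t in lebesgue_on {0..1}. \<bar>h t\<bar> \<le> C"
 shows "\<bar>I\<bar> \<le> C * (b - a)"
proof -
 define N where "N = {t \<in> {0..1}. \<not> \<bar>h t\<bar> \<le> C}"
 have "AE t in lebesgue. t \<in> {0..1} \<longrightarrow> \<bar>h t\<bar> \<le> C"
  using ae by (subst (asm) AE_restrict_space_iff) auto
 then have "AE t in lebesgue. t \<notin> N" by (rule AE_mp) (auto simp: N_def)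
 then obtain N' where "N' \<in> null_sets lebesgue" "N \<subseteq> N'"
  by (auto simp: eventually_ae_filter)
 then have "negligible N" using negligible_subset negligible_iff_null_sets by blast
 then have "((\<lambda>t. if t \<in> N then 0 else h t) has_integral I) {a..b}"
  by (rule has_integral_spike[OF _ _ h]) auto
 then have "((\<lambda>t. if t \<in> N then 0 else h t) has_integral I) (cbox a b)" by simp
 then have "norm I \<le> C * measure lborel (cbox a b)"
 proof (rule has_integral_bound[OF C])
  show "norm (if t \<in> N then 0 else h t) \<le> C" if "t \<in> cbox a b" for t
   using that ab C by (auto simp: N_def)
 qed
 then show ?thesis using ab by simp
qed

lemma integrable_inner_continuous:
 fixes D :: "'a::euclidean_space set" and m h :: "'a \<Rightarrow> 'b::euclidean_space"
 assumes D: "compact D" and m: "integrable (lebesgue_on D) m" and h: "continuous_on D h"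
 shows "integrable (lebesgue_on D) (\<lambda>z. m z \<bullet> h z)"
proof -
 obtain C where C: "\<And>x. x \<in> D \<Longrightarrow> norm (h x) \<le> C"
  using compact_imp_bounded[OF compact_continuous_image[OF h D]] by (auto simp: bounded_iff)
 have Ds: "D \<in> sets lebesgue" using fmeasurableD[OF lmeasurable_compact[OF D]] .
 have hm: "h \<in> borel_measurable (lebesgue_on D)" by (rule continuous_imp_measurable_on_sets_lebesgue[OF h Ds])
 show ?thesis
 proof (rule Bochner_Integration.integrable_bound)
  show "integrable (lebesgue_on D) (\<lambda>z. C * norm (m z))" using m by simp
  show "(\<lambda>z. m z \<bullet> h z) \<in> borel_measurable (lebesgue_on D)" by (intro borel_measurable_inner borel_measurable_integrable m hm)
  show "AE z in lebesgue_on D. norm (m z \<bullet> h z) \<le> norm (C * norm (m z))"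
  proof (rule AE_I2)
   fix z assume "z \<in> space (lebesgue_on D)"
   then have "norm (h z) \<le> C" using C by simp
   then have "norm (m z) * norm (h z) \<le> norm (m z) * C" by (rule mult_left_mono) simp
   then show "norm (m z \<bullet> h z) \<le> norm (C * norm (m z))"
    using Cauchy_Schwarz_ineq2[of "m z" "h z"] by (simp add: abs_mult mult.commute) (meson abs_ge_self mult_right_mono norm_ge_zero order_trans)
  qed
 qed
qed

locale regular_flow = convex_body \<Omega> for \<Omega> :: "'a::euclidean_space set" +
 fixes \<rho> r :: "real \<Rightarrow> 'a \<Rightarrow> real" and m :: "real \<Rightarrow> 'a \<Rightarrow> 'a" and \<rho>in \<rho>f :: "'a \<Rightarrow> real" and \<epsilon> Lp Lr Lm :: real
 assumes \<epsilon>: "\<epsilon> > 0" and lower: "\<And>t x. t \<in> {0..1} \<Longrightarrow> x \<in> \<Omega> \<Longrightarrow> \<rho> t x \<ge> \<epsilon>"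
  and Lp: "Lp \<ge> 0" "AE t in lebesgue_on {0..1}. Lp-lipschitz_on \<Omega> (\<rho> t)"
  and Lr: "Lr \<ge> 0" "AE t in lebesgue_on {0..1}. Lr-lipschitz_on \<Omega> (r t) \<and> (\<forall>x\<in>\<Omega>. \<bar>r t x\<bar> \<le> Lr)"
  and deriv: "has_time_derivative \<Omega> \<rho> r"
  and Lm: "Lm \<ge> 0" "AE t in lebesgue_on {0..1}. Lm-lipschitz_on \<Omega> (m t) \<and> (\<forall>x\<in>\<Omega>. norm (m t x) \<le> Lm)"
  and ce: "continuity_equation \<Omega> \<rho>in \<rho>f (\<rho>, m)"
  and dens: "is_density \<Omega> \<rho>in" "is_density \<Omega> \<rho>f"
begin

lemma increment:
 assumes "s \<in> {0..1}" "t \<in> {0..1}" "s \<le> t" "x \<in> \<Omega>"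
 shows "((\<lambda>u. r u x) has_integral (\<rho> t x - \<rho> s x)) {s..t}"
proof -
 have 1: "((\<lambda>u. r u x) has_integral (\<rho> t x - \<rho> 0 x)) {0..t}" "((\<lambda>u. r u x) has_integral (\<rho> s x - \<rho> 0 x)) {0..s}"
  using deriv assms unfolding has_time_derivative_def by auto
 then have "(\<lambda>u. r u x) integrable_on {s..t}"
  using integrable_on_subinterval[of "\<lambda>u. r u x" "{0..t}" s t] assms by (auto simp: integrable_on_def)
 then obtain I where I: "((\<lambda>u. r u x) has_integral I) {s..t}" by (auto simp: integrable_on_def)
 have "((\<lambda>u. r u x) has_integral (\<rho> s x - \<rho> 0 x) + I) {0..t}"
  by (rule has_integral_combine[OF _ _ 1(2) I]) (use assms in auto)
 then have "(\<rho> s x - \<rho> 0 x) + I = \<rho> t x - \<rho> 0 x" using 1(1) has_integral_unique by blast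
 then have "I = \<rho> t x - \<rho> s x" by linarith
 then show ?thesis using I by blast
qed

lemma rho_time:
 assumes "s \<in> {0..1}" "t \<in> {0..1}" "x \<in> \<Omega>"
 shows "\<bar>\<rho> t x - \<rho> s x\<bar> \<le> Lr * \<bar>t - s\<bar>"
proof -
 have *: "\<bar>\<rho> t x - \<rho> s x\<bar> \<le> Lr * (t - s)" if st: "s \<in> {0..1}" "t \<in> {0..1}" "s \<le> t" for s t
 proof (rule has_integral_AE_bound[OF increment[OF st assms(3)] st(3) _ Lr(1)])
  show "AE u in lebesgue_on {0..1}. \<bar>r u x\<bar> \<le> Lr" using Lr(2) by eventually_elim (use assms(3) in auto)
 qed (use st in auto)
 show ?thesis using *[of s t] *[of t s] assms by (cases "s \<le> t") (auto simp: abs_minus_commute)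
qed

lemma rho_increment_lipschitz:
 assumes "s \<in> {0..1}" "t \<in> {0..1}" "s \<le> t" "x \<in> \<Omega>" "y \<in> \<Omega>"
 shows "\<bar>(\<rho> t x - \<rho> s x) - (\<rho> t y - \<rho> s y)\<bar> \<le> Lr * dist x y * (t - s)"
proof (rule has_integral_AE_bound[OF has_integral_diff[OF increment increment]])
 show "AE u in lebesgue_on {0..1}. \<bar>r u x - r u y\<bar> \<le> Lr * dist x y"
  using Lr(2)
 proof eventually_elim
  case (elim u)
  then show ?case using lipschitz_onD[of Lr \<Omega> "r u" x y] assms by (simp add: dist_real_def)
 qed
qed (use assms Lr in auto)

text \<open>The bound is known for almost all times; the Lipschitz continuity in time extends it to all of
  them.\<close>

lemma rho_lipschitz:
 assumes t: "t \<in> {0..1}" shows "Lp-lipschitz_on \<Omega> (\<rho> t)"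
proof (rule lipschitz_onI)
 fix x y assume xy: "x \<in> \<Omega>" "y \<in> \<Omega>"
 show "dist (\<rho> t x) (\<rho> t y) \<le> Lp * dist x y"
 proof (rule field_le_epsilon)
  fix e :: real assume e: "e > 0"
  define d where "d = e / (2 * (Lr + 1))"
  have d: "d > 0" using e Lr(1) by (simp add: d_def)
  obtain s where s: "s \<in> {0..1}" "dist t s < d" "Lp-lipschitz_on \<Omega> (\<rho> s)"
   using AE_lebesgue_on_dense[OF _ _ _ Lp(2) t d] by auto
  have c: "Lr * \<bar>t - s\<bar> \<le> e / 2"
  proof -
   have "Lr * \<bar>t - s\<bar> \<le> (Lr + 1) * d" using s(2) Lr(1) by (intro mult_mono) (auto simp: dist_real_def)
   also have "\<dots> = e / 2" using Lr(1) by (simp add: d_def field_simps)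
   finally show ?thesis .
  qed
  have "\<bar>\<rho> s x - \<rho> s y\<bar> \<le> Lp * dist x y" using lipschitz_onD[OF s(3) xy] by (simp add: dist_real_def)
  then show "dist (\<rho> t x) (\<rho> t y) \<le> Lp * dist x y + e"
   using rho_time[OF s(1) t xy(1)] rho_time[OF s(1) t xy(2)] c unfolding dist_real_def by linarith
 qed
qed (rule Lp)

lemma rho_continuous: "t \<in> {0..1} \<Longrightarrow> continuous_on \<Omega> (\<rho> t)"
 by (rule lipschitz_on_continuous_on[OF rho_lipschitz])

lemma rho_continuous_Q: "continuous_on Q (\<lambda>z. \<rho> (fst z) (snd z))"
proof (rule lipschitz_on_continuous_on)
 show "(Lr + Lp)-lipschitz_on Q (\<lambda>z. \<rho> (fst z) (snd z))"
 proof (rule lipschitz_onI)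
  fix z w assume "z \<in> Q" "w \<in> Q"
  then have m: "fst z \<in> {0..1}" "snd z \<in> \<Omega>" "fst w \<in> {0..1}" "snd w \<in> \<Omega>" by (auto simp: Q_def)
  have "\<bar>\<rho> (fst z) (snd z) - \<rho> (fst w) (snd z)\<bar> \<le> Lr * \<bar>fst z - fst w\<bar>" by (rule rho_time[OF m(3,1,2)])
  also have "\<dots> \<le> Lr * dist z w"
   using dist_fst_le[of z w] by (intro mult_left_mono Lr(1)) (simp add: dist_real_def)
  finally have "\<bar>\<rho> (fst z) (snd z) - \<rho> (fst w) (snd z)\<bar> \<le> Lr * dist z w" .
  moreover have "\<bar>\<rho> (fst w) (snd z) - \<rho> (fst w) (snd w)\<bar> \<le> Lp * dist z w"
  proof -
   have "\<bar>\<rho> (fst w) (snd z) - \<rho> (fst w) (snd w)\<bar> \<le> Lp * dist (snd z) (snd w)"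
    using lipschitz_onD[OF rho_lipschitz[OF m(3)] m(2,4)] by (simp only: dist_real_def)
   also have "\<dots> \<le> Lp * dist z w" by (intro mult_left_mono dist_snd_le Lp(1))
   finally show ?thesis .
  qed
  ultimately show "dist (\<rho> (fst z) (snd z)) (\<rho> (fst w) (snd w)) \<le> (Lr + Lp) * dist z w"
   unfolding dist_real_def distrib_right by linarith
 qed (use Lr Lp in auto)
qed

definition mm :: "real \<times> 'a \<Rightarrow> 'a" where "mm z = m (fst z) (snd z)"

lemma mm_integrable: "integrable (lebesgue_on Q) mm"
 using ce unfolding continuity_equation_def Q_def mm_def[abs_def] by (simp add: case_prod_unfold)

lemma space_continuous_Q: "continuous_on \<Omega> h \<Longrightarrow> continuous_on Q (\<lambda>z. h (snd z))"
 by (rule continuous_on_compose2[where g = h]) (auto simp: Q_def intro!: continuous_intros)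

lemma mm_pairing_integrable: "continuous_on \<Omega> h \<Longrightarrow> integrable (lebesgue_on Q) (\<lambda>z. mm z \<bullet> h (snd z))"
 by (rule integrable_inner_continuous[OF Q(1) mm_integrable space_continuous_Q])

lemma fst_measurable:
 fixes f :: "real \<Rightarrow> real"
 assumes "f \<in> borel_measurable borel" shows "(\<lambda>z. f (fst z)) \<in> borel_measurable (lebesgue_on Q)"
proof -
 have "(\<lambda>z. f (fst z)) \<in> borel_measurable (borel :: (real \<times> 'a) measure)"
  using assms by (simp flip: borel_prod)
 then show ?thesis by (intro measurable_restrict_space1 measurable_completion) simp
qed

definition J :: "('a \<Rightarrow> 'a) \<Rightarrow> real \<Rightarrow> real" where
 "J h b = int_on Q (\<lambda>z. indicator {..<b} (fst z) * (mm z \<bullet> h (snd z)))"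

lemma weighted_pairing_tendsto:
 assumes h: "continuous_on \<Omega> h" and f: "\<And>n. f n \<in> borel_measurable borel" "\<And>n t. \<bar>f n t\<bar> \<le> 1" and l: "l \<in> borel_measurable borel"
  and lim: "\<And>t. t \<in> {0<..<1} \<Longrightarrow> (\<lambda>n. f n t) \<longlonglongrightarrow> (l t :: real)"
 shows "(\<lambda>n. int_on Q (\<lambda>z. f n (fst z) * (mm z \<bullet> h (snd z)))) \<longlonglongrightarrow> int_on Q (\<lambda>z. l (fst z) * (mm z \<bullet> h (snd z)))"
proof (rule integral_dominated_convergence[where w = "\<lambda>z. \<bar>mm z \<bullet> h (snd z)\<bar>"])
 note i = mm_pairing_integrable[OF h]
 show "integrable (lebesgue_on Q) (\<lambda>z. \<bar>mm z \<bullet> h (snd z)\<bar>)" using i by simp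
 show "(\<lambda>z. l (fst z) * (mm z \<bullet> h (snd z))) \<in> borel_measurable (lebesgue_on Q)"
  by (intro borel_measurable_times fst_measurable l borel_measurable_integrable i)
 show "(\<lambda>z. f n (fst z) * (mm z \<bullet> h (snd z))) \<in> borel_measurable (lebesgue_on Q)" for n
  by (intro borel_measurable_times fst_measurable f borel_measurable_integrable i)
 show "AE z in lebesgue_on Q. (\<lambda>n. f n (fst z) * (mm z \<bullet> h (snd z))) \<longlonglongrightarrow> l (fst z) * (mm z \<bullet> h (snd z))"
  using AE_Q_interior_time by eventually_elim (intro tendsto_intros lim)
 show "AE z in lebesgue_on Q. norm (f n (fst z) * (mm z \<bullet> h (snd z))) \<le> \<bar>mm z \<bullet> h (snd z)\<bar>" for n
  using f(2) by (intro AE_I2) (auto simp: abs_mult intro!: mult_left_le_one_le)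
qed

lemma product_test_gradient:
 assumes \<xi>: "has_gradient_on \<Omega> \<xi> h" and \<theta>: "\<And>t. (\<theta> has_real_derivative \<theta>' t) (at t)"
 shows "has_gradient_on Q (\<lambda>z. \<theta> (fst z) * \<xi> (snd z)) (\<lambda>z. (\<theta>' (fst z) * \<xi> (snd z), \<theta> (fst z) *\<^sub>R h (snd z)))"
 unfolding has_gradient_on_def
proof
 fix z assume z: "z \<in> Q"
 have 1: "((\<lambda>z. \<theta> (fst z)) has_derivative (\<lambda>v. \<theta>' (fst z) * fst v)) (at z within Q)"
  using has_derivative_compose[OF has_derivative_fst[OF has_derivative_ident], of \<theta> "(*) (\<theta>' (fst z))" z Q] \<theta>[of "fst z"]
  by (simp add: has_field_derivative_def)
 have sub: "snd ` Q \<subseteq> \<Omega>" by (auto simp: Q_def)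
 have "(\<xi> has_derivative (\<lambda>v. h (snd z) \<bullet> v)) (at (snd z) within snd ` Q)"
  by (rule has_derivative_subset[OF _ sub]) (use \<xi> z in \<open>auto simp: has_gradient_on_def Q_def\<close>)
 from has_derivative_in_compose[OF has_derivative_snd[OF has_derivative_ident] this]
 have 2: "((\<lambda>z. \<xi> (snd z)) has_derivative (\<lambda>v. h (snd z) \<bullet> snd v)) (at z within Q)" by simp
 show "((\<lambda>z. \<theta> (fst z) * \<xi> (snd z)) has_derivative (\<lambda>v. (\<theta>' (fst z) * \<xi> (snd z), \<theta> (fst z) *\<^sub>R h (snd z)) \<bullet> v)) (at z within Q)"
  using has_derivative_mult[OF 1 2] by (simp add: inner_prod_def algebra_simps)
qed

lemma gradient_continuous: "has_gradient_on \<Omega> \<xi> h \<Longrightarrow> continuous_on \<Omega> \<xi>"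
 by (rule has_derivative_continuous_on[where f' = "\<lambda>z v. h z \<bullet> v"]) (simp add: has_gradient_on_def)

definition pairing :: "('a \<Rightarrow> real) \<Rightarrow> ('a \<Rightarrow> real) \<Rightarrow> real" where
 "pairing \<xi> f = int_on \<Omega> (\<lambda>x. \<xi> x * f x)"

lemma weak_product_test:
 assumes \<xi>: "has_gradient_on \<Omega> \<xi> h" "continuous_on \<Omega> h" and \<theta>: "\<And>t. (\<theta> has_real_derivative \<theta>' t) (at t)" "continuous_on UNIV \<theta>'"
 shows "int_on Q (\<lambda>z. \<rho> (fst z) (snd z) * (\<theta>' (fst z) * \<xi> (snd z))) +
   int_on Q (\<lambda>z. \<theta> (fst z) * (mm z \<bullet> h (snd z))) = \<theta> 1 * pairing \<xi> \<rho>f - \<theta> 0 * pairing \<xi> \<rho>in"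
proof -
 note c\<xi> = space_continuous_Q[OF gradient_continuous[OF \<xi>(1)]]
 have \<theta>c: "continuous_on UNIV \<theta>" using \<theta>(1) DERIV_isCont by (auto simp: continuous_on_eq_continuous_at)
 have \<theta>m: "continuous_on Q (\<lambda>z. \<theta> (fst z))" "continuous_on Q (\<lambda>z. \<theta>' (fst z))"
  by (rule continuous_on_compose2[OF \<theta>c], auto intro!: continuous_intros, rule continuous_on_compose2[OF \<theta>(2)], auto intro!: continuous_intros)
 let ?G = "\<lambda>z. (\<theta>' (fst z) * \<xi> (snd z), \<theta> (fst z) *\<^sub>R h (snd z))"
 have Gc: "continuous_on Q ?G" by (intro continuous_intros \<theta>m c\<xi> space_continuous_Q \<xi>)
 have "int_on Q (\<lambda>(t, x). \<rho> t x * fst (?G (t, x)) + m t x \<bullet> snd (?G (t, x)))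
   = int_on \<Omega> (\<lambda>x. (\<theta> (fst (1::real, x)) * \<xi> (snd (1::real, x))) * \<rho>f x) - int_on \<Omega> (\<lambda>x. (\<theta> (fst (0::real, x)) * \<xi> (snd (0::real, x))) * \<rho>in x)"
  using ce product_test_gradient[OF \<xi>(1) \<theta>(1)] Gc unfolding continuity_equation_def Q_def[symmetric] by blast
 also have "\<dots> = \<theta> 1 * pairing \<xi> \<rho>f - \<theta> 0 * pairing \<xi> \<rho>in" by (simp add: pairing_def mult.assoc)
 also have "int_on Q (\<lambda>(t, x). \<rho> t x * fst (?G (t, x)) + m t x \<bullet> snd (?G (t, x))) =
   int_on Q (\<lambda>z. \<rho> (fst z) (snd z) * (\<theta>' (fst z) * \<xi> (snd z)) + \<theta> (fst z) * (mm z \<bullet> h (snd z)))"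
  by (intro Bochner_Integration.integral_cong refl) (auto simp: mm_def case_prod_unfold)
 also have "\<dots> = int_on Q (\<lambda>z. \<rho> (fst z) (snd z) * (\<theta>' (fst z) * \<xi> (snd z))) + int_on Q (\<lambda>z. \<theta> (fst z) * (mm z \<bullet> h (snd z)))"
 proof (rule Bochner_Integration.integral_add)
  have "integrable (lebesgue_on Q) (\<lambda>z. \<rho> (fst z) (snd z))"
   using ce unfolding continuity_equation_def Q_def by (simp add: case_prod_unfold)
  then show "integrable (lebesgue_on Q) (\<lambda>z. \<rho> (fst z) (snd z) * (\<theta>' (fst z) * \<xi> (snd z)))"
   by (rule integrable_mult_continuous[OF Q(1)]) (intro continuous_intros \<theta>m c\<xi>)
  show "integrable (lebesgue_on Q) (\<lambda>z. \<theta> (fst z) * (mm z \<bullet> h (snd z)))"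
   using integrable_mult_continuous[OF Q(1) mm_pairing_integrable[OF \<xi>(2)] \<theta>m(1)] by (simp add: mult.commute)
 qed
 finally show ?thesis by simp
qed

lemma pairing_time:
 assumes \<xi>: "continuous_on \<Omega> \<xi>" and st: "s \<in> {0..1}" "t \<in> {0..1}"
 shows "\<bar>pairing \<xi> (\<rho> t) - pairing \<xi> (\<rho> s)\<bar> \<le> Lr * \<bar>t - s\<bar> * int_on \<Omega> (\<lambda>x. \<bar>\<xi> x\<bar>)"
proof -
 have one: "integrable (lebesgue_on \<Omega>) (\<lambda>x. 1 :: real)"
  by (rule finite_measure.integrable_const[OF finite_measure_lebesgue_on[OF lmeasurable_compact[OF compact]]])
 have ci: "integrable (lebesgue_on \<Omega>) f" if "continuous_on \<Omega> f" for f :: "'a \<Rightarrow> real"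
  using integrable_mult_continuous[OF compact one that] by simp
 have i: "integrable (lebesgue_on \<Omega>) (\<lambda>x. \<xi> x * \<rho> t x)" "integrable (lebesgue_on \<Omega>) (\<lambda>x. \<xi> x * \<rho> s x)"
  by (intro ci continuous_intros \<xi> rho_continuous st)+
 have "\<bar>pairing \<xi> (\<rho> t) - pairing \<xi> (\<rho> s)\<bar> = \<bar>int_on \<Omega> (\<lambda>x. \<xi> x * \<rho> t x - \<xi> x * \<rho> s x)\<bar>"
  unfolding pairing_def using Bochner_Integration.integral_diff[OF i] by simp
 also have "\<dots> \<le> int_on \<Omega> (\<lambda>x. Lr * \<bar>t - s\<bar> * \<bar>\<xi> x\<bar>)"
 proof (rule order_trans[OF integral_abs_bound integral_mono])
  show "integrable (lebesgue_on \<Omega>) (\<lambda>x. \<bar>\<xi> x * \<rho> t x - \<xi> x * \<rho> s x\<bar>)"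
   by (intro integrable_abs Bochner_Integration.integrable_diff i)
  show "integrable (lebesgue_on \<Omega>) (\<lambda>x. Lr * \<bar>t - s\<bar> * \<bar>\<xi> x\<bar>)" by (intro ci continuous_intros \<xi>)
  fix x assume "x \<in> space (lebesgue_on \<Omega>)"
  then have x: "x \<in> \<Omega>" by simp
  have "\<bar>\<xi> x * \<rho> t x - \<xi> x * \<rho> s x\<bar> = \<bar>\<xi> x\<bar> * \<bar>\<rho> t x - \<rho> s x\<bar>" by (simp flip: abs_mult right_diff_distrib)
  also have "\<dots> \<le> \<bar>\<xi> x\<bar> * (Lr * \<bar>t - s\<bar>)" by (intro mult_left_mono rho_time st x) simp
  finally show "\<bar>\<xi> x * \<rho> t x - \<xi> x * \<rho> s x\<bar> \<le> Lr * \<bar>t - s\<bar> * \<bar>\<xi> x\<bar>" by (simp add: mult.commute)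
 qed
 finally show ?thesis by simp
qed

text \<open>The kernel \<open>n tent ((b - t) n)\<close> is a probability density concentrated just before \<open>b\<close>, so the uniform
  time regularity of \<open>\<rho>\<close> identifies the limit.\<close>

lemma time_slice_average:
 assumes \<xi>: "continuous_on \<Omega> \<xi>" and b: "0 < b" "b \<le> 1" and n: "1 / b \<le> real n" "n > 0"
 shows "\<bar>int_on Q (\<lambda>z. \<rho> (fst z) (snd z) * ((real n * tent ((b - fst z) * real n)) * \<xi> (snd z))) - pairing \<xi> (\<rho> b)\<bar>
   \<le> Lr * int_on \<Omega> (\<lambda>x. \<bar>\<xi> x\<bar>) / real n"
proof -
 define X where "X = int_on \<Omega> (\<lambda>x. \<bar>\<xi> x\<bar>)"
 define w where "w t = real n * tent ((b - t) * real n)" for t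
 have wm[measurable]: "w \<in> borel_measurable borel" unfolding w_def by measurable
 have w0: "w t \<ge> 0" "w t \<le> 2 * real n" for t using tent[of "(b - t) * real n"] by (auto simp: w_def mult.commute[of _ "real n"] intro!: mult_left_mono)
 have wout: "w t = 0" if "t \<notin> {b - 1 / real n..b}" for t
 proof -
  have "(b - t) * real n \<le> 0 \<or> (b - t) * real n \<ge> 1"
   using that n by (cases "t > b") (auto simp: mult_le_0_iff field_simps)
  then show ?thesis using tent(2) by (simp add: w_def)
 qed
 have bn: "b - 1 / real n \<ge> 0" using n b by (simp add: field_simps)
 have wint: "(\<integral>t. w t \<partial>lborel) = 1"
 proof -
  have "(\<integral>t. tent t \<partial>lborel) = real n * (\<integral>t. tent (b * real n + (- real n) * t) \<partial>lborel)"
   using lborel_integral_real_affine[of "- real n" tent "b * real n"] n by simp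
  also have "\<dots> = (\<integral>t. w t \<partial>lborel)" by (simp add: w_def algebra_simps)
  finally show ?thesis using integral_tent by simp
 qed
 have wi: "integrable lborel w"
  by (rule integrable_lborel_bounded_support[where C = "2 * real n" and S = "{b - 1 / real n..b}"]) (use w0 wout in auto)
 define u where "u z = indicator Q z *\<^sub>R (\<rho> (fst z) (snd z) * (w (fst z) * \<xi> (snd z)))" for z
 have uc: "continuous_on Q (\<lambda>z. \<rho> (fst z) (snd z) * (w (fst z) * \<xi> (snd z)))"
  unfolding w_def by (intro continuous_intros rho_continuous_Q space_continuous_Q \<xi> continuous_on_compose2[OF continuous_tent[of UNIV]]) auto
 have Qb: "Q \<in> sets borel" by (rule borel_compact[OF Q(1)])
 have um: "u \<in> borel_measurable borel" unfolding u_def by (rule borel_measurable_continuous_on_indicator[OF Qb uc])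
 have ui: "integrable lborel u" unfolding u_def by (rule borel_integrable_compact[OF Q(1) uc])
 have "int_on Q (\<lambda>z. \<rho> (fst z) (snd z) * (w (fst z) * \<xi> (snd z))) = integral\<^sup>L lborel u"
  unfolding u_def by (rule lebesgue_on_eq_lborel[OF Qb um[unfolded u_def]])
 also have "\<dots> = (\<integral>t. \<integral>x. u (t, x) \<partial>lborel \<partial>lborel)" by (rule integral_lborel_fst[OF ui, symmetric])
 also have "\<dots> = (\<integral>t. w t * pairing \<xi> (\<rho> (max 0 (min 1 t))) \<partial>lborel)"
 proof (rule Bochner_Integration.integral_cong[OF refl])
  fix t
  show "(\<integral>x. u (t, x) \<partial>lborel) = w t * pairing \<xi> (\<rho> (max 0 (min 1 t)))"
  proof (cases "t \<in> {b - 1 / real n..b}")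
   case True
   then have t: "t \<in> {0..1}" "max 0 (min 1 t) = t" using bn b by auto
   have "(\<integral>x. u (t, x) \<partial>lborel) = (\<integral>x. w t * (indicator \<Omega> x *\<^sub>R (\<xi> x * \<rho> t x)) \<partial>lborel)"
    by (intro Bochner_Integration.integral_cong refl) (use t in \<open>auto simp: u_def Q_def indicator_def\<close>)
   also have "\<dots> = w t * (\<integral>x. indicator \<Omega> x *\<^sub>R (\<xi> x * \<rho> t x) \<partial>lborel)" by simp
   also have "(\<integral>x. indicator \<Omega> x *\<^sub>R (\<xi> x * \<rho> t x) \<partial>lborel) = pairing \<xi> (\<rho> t)" unfolding pairing_def
    by (intro lebesgue_on_eq_lborel[symmetric] borel_measurable_continuous_on_indicator continuous_intros \<xi> rho_continuous t borel_compact compact)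
   finally show ?thesis using t by simp
  qed (simp add: u_def wout)
 qed
 finally have A: "int_on Q (\<lambda>z. \<rho> (fst z) (snd z) * (w (fst z) * \<xi> (snd z))) = (\<integral>t. w t * pairing \<xi> (\<rho> (max 0 (min 1 t))) \<partial>lborel)" .
 let ?c = "\<lambda>t. max 0 (min 1 t) :: real"
 have Rb: "\<bar>pairing \<xi> (\<rho> (?c t)) - pairing \<xi> (\<rho> b)\<bar> \<le> Lr * \<bar>?c t - b\<bar> * X" for t
  unfolding X_def by (rule pairing_time[OF \<xi>]) (use b in auto)
 have Rcont: "continuous_on UNIV (\<lambda>t. pairing \<xi> (\<rho> (?c t)))"
 proof (rule lipschitz_on_continuous_on)
  have X0: "X \<ge> 0" unfolding X_def by (intro Bochner_Integration.integral_nonneg) auto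
  show "(Lr * X)-lipschitz_on UNIV (\<lambda>t. pairing \<xi> (\<rho> (?c t)))"
  proof (rule lipschitz_onI)
   fix s t :: real
   have "\<bar>pairing \<xi> (\<rho> (?c s)) - pairing \<xi> (\<rho> (?c t))\<bar> \<le> Lr * \<bar>?c s - ?c t\<bar> * X"
    unfolding X_def by (rule pairing_time[OF \<xi>]) auto
   also have "\<dots> \<le> Lr * \<bar>s - t\<bar> * X" using Lr(1) X0 by (intro mult_right_mono mult_left_mono) auto
   finally show "dist (pairing \<xi> (\<rho> (?c s))) (pairing \<xi> (\<rho> (?c t))) \<le> Lr * X * dist s t" by (simp add: dist_real_def mult_ac)
  qed (use Lr X0 in auto)
 qed
 have Rm[measurable]: "(\<lambda>t. pairing \<xi> (\<rho> (?c t))) \<in> borel_measurable borel" by (rule borel_measurable_continuous_onI[OF Rcont])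
 have wR: "\<bar>w t * (pairing \<xi> (\<rho> (?c t)) - pairing \<xi> (\<rho> b))\<bar> \<le> w t * (Lr * X / real n)" for t
 proof (cases "t \<in> {b - 1 / real n..b}")
  case True
  have X0: "X \<ge> 0" unfolding X_def by (intro Bochner_Integration.integral_nonneg) auto
  have "\<bar>?c t - b\<bar> \<le> 1 / real n" using True bn b by auto
  then have "Lr * \<bar>?c t - b\<bar> * X \<le> Lr * (1 / real n) * X" using Lr(1) X0 by (intro mult_right_mono mult_left_mono) auto
  then have "\<bar>pairing \<xi> (\<rho> (?c t)) - pairing \<xi> (\<rho> b)\<bar> \<le> Lr * X / real n" using Rb[of t] by (simp add: mult.commute)
  then show ?thesis unfolding abs_mult abs_of_nonneg[OF w0(1)] by (rule mult_left_mono[OF _ w0(1)])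
 qed (simp add: wout)
 have iR: "integrable lborel (\<lambda>t. w t * (pairing \<xi> (\<rho> (?c t)) - pairing \<xi> (\<rho> b)))"
 proof (rule Bochner_Integration.integrable_bound[OF integrable_mult_left[OF wi, of "Lr * X / real n"]])
  show "AE t in lborel. norm (w t * (pairing \<xi> (\<rho> (?c t)) - pairing \<xi> (\<rho> b))) \<le> norm (w t * (Lr * X / real n))"
   unfolding real_norm_def by (intro AE_I2 order_trans[OF wR abs_ge_self])
 qed measurable
 have "(\<integral>t. w t * pairing \<xi> (\<rho> (?c t)) \<partial>lborel) = (\<integral>t. w t * (pairing \<xi> (\<rho> (?c t)) - pairing \<xi> (\<rho> b)) + w t * pairing \<xi> (\<rho> b) \<partial>lborel)"
  by (simp add: algebra_simps)
 also have "\<dots> = (\<integral>t. w t * (pairing \<xi> (\<rho> (?c t)) - pairing \<xi> (\<rho> b)) \<partial>lborel) + pairing \<xi> (\<rho> b)"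
  using Bochner_Integration.integral_add[OF iR integrable_mult_left[OF wi, of "pairing \<xi> (\<rho> b)"]] wint by simp
 finally have "\<bar>(\<integral>t. w t * pairing \<xi> (\<rho> (?c t)) \<partial>lborel) - pairing \<xi> (\<rho> b)\<bar> = \<bar>\<integral>t. w t * (pairing \<xi> (\<rho> (?c t)) - pairing \<xi> (\<rho> b)) \<partial>lborel\<bar>" by simp
 also have "\<dots> \<le> (\<integral>t. w t * (Lr * X / real n) \<partial>lborel)"
  by (rule order_trans[OF integral_abs_bound integral_mono]) (use iR wi wR in auto)
 also have "\<dots> = Lr * X / real n" using wint by simp
 finally have fin: "\<bar>(\<integral>t. w t * pairing \<xi> (\<rho> (?c t)) \<partial>lborel) - pairing \<xi> (\<rho> b)\<bar> \<le> Lr * X / real n" .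
 show ?thesis using fin unfolding A[symmetric] unfolding w_def X_def .
qed

text \<open>Test the continuity equation with \<open>smoothstep ((b - t) n) \<xi> x\<close> and let \<open>n\<close> tend to infinity.\<close>

lemma weak_slice:
 assumes \<xi>: "has_gradient_on \<Omega> \<xi> h" "continuous_on \<Omega> h" and b: "0 < b" "b \<le> 1"
 shows "pairing \<xi> (\<rho> b) = pairing \<xi> \<rho>in + J h b"
proof -
 note c\<xi> = gradient_continuous[OF \<xi>(1)]
 define \<theta> where "\<theta> n t = smoothstep ((b - t) * real n)" for n t
 have \<theta>d: "(\<theta> n has_real_derivative - (real n * tent ((b - t) * real n))) (at t)" for n t
 proof -
  have "((\<lambda>t. (b - t) * real n) has_real_derivative - real n) (at t)" by (auto intro!: derivative_eq_intros)
  from DERIV_chain2[OF smoothstep_derivative this] show ?thesis by (simp add: \<theta>_def[abs_def] mult.commute)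
 qed
 have \<theta>b: "\<theta> n \<in> borel_measurable borel" for n unfolding \<theta>_def by measurable
 define A where "A n = int_on Q (\<lambda>z. \<rho> (fst z) (snd z) * ((real n * tent ((b - fst z) * real n)) * \<xi> (snd z)))" for n
 have eq: "int_on Q (\<lambda>z. \<theta> n (fst z) * (mm z \<bullet> h (snd z))) = A n - pairing \<xi> \<rho>in"
  if n: "1 / b \<le> real n" for n
 proof -
  have cont: "continuous_on UNIV (\<lambda>t. - (real n * tent ((b - t) * real n)))"
   by (intro continuous_intros continuous_on_compose2[OF continuous_tent[of UNIV]]) auto
  have "\<theta> n 1 = 0" unfolding \<theta>_def by (intro smoothstep(1) mult_nonpos_nonneg) (use b in auto)
  moreover have "\<theta> n 0 = 1" unfolding \<theta>_def by (intro smoothstep(2)) (use b n in \<open>simp add: field_simps\<close>)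
  ultimately show ?thesis using weak_product_test[OF \<xi> \<theta>d cont] by (simp add: A_def)
 qed
 have evn: "eventually (\<lambda>n. 1 / b \<le> real n \<and> n > 0) sequentially"
  using eventually_ge_at_top[of "nat \<lceil>1 / b\<rceil>"] eventually_gt_at_top[of 0] by eventually_elim linarith
 have A: "A \<longlonglongrightarrow> pairing \<xi> (\<rho> b)"
 proof (rule LIM_zero_cancel, rule Lim_null_comparison)
  show "eventually (\<lambda>n. norm (A n - pairing \<xi> (\<rho> b)) \<le> Lr * int_on \<Omega> (\<lambda>x. \<bar>\<xi> x\<bar>) / real n) sequentially"
   using evn by eventually_elim (use time_slice_average[OF c\<xi> b] in \<open>simp add: A_def\<close>)
  show "(\<lambda>n. Lr * int_on \<Omega> (\<lambda>x. \<bar>\<xi> x\<bar>) / real n) \<longlonglongrightarrow> 0" by (rule lim_const_over_n)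
 qed
 have "(\<lambda>n. int_on Q (\<lambda>z. \<theta> n (fst z) * (mm z \<bullet> h (snd z)))) \<longlonglongrightarrow> J h b"
  unfolding J_def
 proof (rule weighted_pairing_tendsto[OF \<xi>(2) \<theta>b])
  show "\<bar>\<theta> n t\<bar> \<le> 1" for n t unfolding \<theta>_def using smoothstep(3,4) by simp
  show "(\<lambda>n. \<theta> n t) \<longlonglongrightarrow> indicator {..<b} t" if "t \<in> {0<..<1}" for t
  proof (cases "t < b")
   case True
   have "eventually (\<lambda>n. \<theta> n t = 1) sequentially"
    using eventually_ge_at_top[of "nat \<lceil>1 / (b - t)\<rceil>"]
   proof eventually_elim
    case (elim n)
    then have "1 / (b - t) \<le> real n" by linarith
    then show ?case unfolding \<theta>_def using True by (intro smoothstep(2)) (simp add: field_simps)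
   qed
   then show ?thesis using True tendsto_eventually by simp
  next
   case False
   then have "\<theta> n t = 0" for n unfolding \<theta>_def by (intro smoothstep(1) mult_nonpos_nonneg) auto
   then show ?thesis using False by simp
  qed
 qed simp
 moreover have "(\<lambda>n. int_on Q (\<lambda>z. \<theta> n (fst z) * (mm z \<bullet> h (snd z)))) \<longlonglongrightarrow> pairing \<xi> (\<rho> b) - pairing \<xi> \<rho>in"
  by (rule Lim_transform_eventually[OF tendsto_diff[OF A tendsto_const]]) (use evn eq in \<open>auto elim!: eventually_mono\<close>)
 ultimately have "J h b = pairing \<xi> (\<rho> b) - pairing \<xi> \<rho>in" using LIMSEQ_unique by blast
 then show ?thesis by simp
qed

text \<open>The initial and final densities are prescribed only through the weak formulation; the slices of \<open>\<rho>\<close> at the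
  end times agree with them as functionals.\<close>

lemma endpoint_slices:
 assumes \<xi>: "has_gradient_on \<Omega> \<xi> h" "continuous_on \<Omega> h"
 shows "pairing \<xi> (\<rho> 0) = pairing \<xi> \<rho>in" "pairing \<xi> (\<rho> 1) = pairing \<xi> \<rho>f"
proof -
 note c\<xi> = gradient_continuous[OF \<xi>(1)]
 let ?b = "\<lambda>n. 1 / real (Suc n)"
 have b: "0 < ?b n" "?b n \<le> 1" for n by auto
 have b0: "?b \<longlonglongrightarrow> 0" using LIMSEQ_inverse_real_of_nat by (simp add: inverse_eq_divide)
 have "(\<lambda>n. J h (?b n)) \<longlonglongrightarrow> int_on Q (\<lambda>z. (\<lambda>_. 0) (fst z) * (mm z \<bullet> h (snd z)))"
  unfolding J_def
 proof (rule weighted_pairing_tendsto[OF \<xi>(2)])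
  fix t :: real assume t: "t \<in> {0<..<1}"
  have "eventually (\<lambda>n. ?b n < t) sequentially" using order_tendstoD(2)[OF b0] t by simp
  then show "(\<lambda>n. indicator {..<?b n} t) \<longlonglongrightarrow> (0 :: real)"
   by (intro tendsto_eventually) (auto elim!: eventually_mono)
 qed (auto simp: indicator_def)
 then have J0: "(\<lambda>n. J h (?b n)) \<longlonglongrightarrow> 0" by simp
 have "(\<lambda>n. pairing \<xi> (\<rho> (?b n))) \<longlonglongrightarrow> pairing \<xi> (\<rho> 0)"
 proof (rule LIM_zero_cancel, rule Lim_null_comparison)
  show "eventually (\<lambda>n. norm (pairing \<xi> (\<rho> (?b n)) - pairing \<xi> (\<rho> 0)) \<le> Lr * ?b n * int_on \<Omega> (\<lambda>x. \<bar>\<xi> x\<bar>)) sequentially"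
  proof (intro always_eventually allI)
   fix n
   show "norm (pairing \<xi> (\<rho> (?b n)) - pairing \<xi> (\<rho> 0)) \<le> Lr * ?b n * int_on \<Omega> (\<lambda>x. \<bar>\<xi> x\<bar>)"
    using pairing_time[OF c\<xi>, of 0 "?b n"] b[of n] by simp
  qed
  show "(\<lambda>n. Lr * ?b n * int_on \<Omega> (\<lambda>x. \<bar>\<xi> x\<bar>)) \<longlonglongrightarrow> 0"
  proof -
   have "(\<lambda>n. Lr * ?b n * int_on \<Omega> (\<lambda>x. \<bar>\<xi> x\<bar>)) \<longlonglongrightarrow> Lr * 0 * int_on \<Omega> (\<lambda>x. \<bar>\<xi> x\<bar>)"
    by (intro tendsto_intros b0)
   then show ?thesis by simp
  qed
 qed
 moreover have "(\<lambda>n. pairing \<xi> (\<rho> (?b n))) \<longlonglongrightarrow> pairing \<xi> \<rho>in + 0"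
  unfolding weak_slice[OF \<xi> b] by (intro tendsto_add tendsto_const J0)
 ultimately show "pairing \<xi> (\<rho> 0) = pairing \<xi> \<rho>in" using LIMSEQ_unique by fastforce
 have "J h 1 = int_on Q (\<lambda>z. 1 * (mm z \<bullet> h (snd z)))"
  unfolding J_def
 proof (rule integral_cong_AE)
  show "AE z in lebesgue_on Q. indicator {..<1} (fst z) * (mm z \<bullet> h (snd z)) = 1 * (mm z \<bullet> h (snd z))"
   using AE_Q_interior_time by eventually_elim auto
  show "(\<lambda>z. indicator {..<1} (fst z) * (mm z \<bullet> h (snd z))) \<in> borel_measurable (lebesgue_on Q)"
   by (intro borel_measurable_times fst_measurable borel_measurable_integrable[OF mm_pairing_integrable[OF \<xi>(2)]]) simp
 qed (use borel_measurable_integrable[OF mm_pairing_integrable[OF \<xi>(2)]] in simp)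
 also have "\<dots> = pairing \<xi> \<rho>f - pairing \<xi> \<rho>in"
  using weak_product_test[OF \<xi>, of "\<lambda>_. 1" "\<lambda>_. 0"] by simp
 finally show "pairing \<xi> (\<rho> 1) = pairing \<xi> \<rho>f" using weak_slice[OF \<xi>, of 1] by simp
qed

lemma weak_increment:
 assumes \<xi>: "has_gradient_on \<Omega> \<xi> h" "continuous_on \<Omega> h" and ab: "0 \<le> a" "a < b" "b \<le> 1"
 shows "pairing \<xi> (\<rho> b) - pairing \<xi> (\<rho> a) = J h b - J h a"
proof (cases "a = 0")
 case True
 have "J h 0 = int_on Q (\<lambda>z. 0)"
  unfolding J_def by (intro Bochner_Integration.integral_cong refl) (auto simp: Q_def indicator_def)
 then show ?thesis using True weak_slice[OF \<xi>, of b] endpoint_slices(1)[OF \<xi>] ab by simp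
next
 case False then show ?thesis using weak_slice[OF \<xi>, of a] weak_slice[OF \<xi>, of b] ab by simp
qed

end

section \<open>Time averages of the momentum\<close>

context regular_flow begin

lemma AE_mm: "AE z in lebesgue_on Q. norm (mm z) \<le> Lm"
proof -
 have "AE t in lebesgue. t \<in> {0..1} \<longrightarrow> Lm-lipschitz_on \<Omega> (m t) \<and> (\<forall>x\<in>\<Omega>. norm (m t x) \<le> Lm)"
  using Lm(2) by (subst (asm) AE_restrict_space_iff) auto
 then have "AE t in lborel. t \<in> {0..1} \<longrightarrow> Lm-lipschitz_on \<Omega> (m t) \<and> (\<forall>x\<in>\<Omega>. norm (m t x) \<le> Lm)"
  by (simp only: AE_completion_iff)
 from AE_lborel_pair_fst[OF this]
 have "AE z in (lborel :: (real \<times> 'a) measure). fst z \<in> {0..1} \<longrightarrow> Lm-lipschitz_on \<Omega> (m (fst z)) \<and> (\<forall>x\<in>\<Omega>. norm (m (fst z) x) \<le> Lm)"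
  unfolding lborel_prod .
 then have "AE z in lborel. z \<in> Q \<longrightarrow> norm (mm z) \<le> Lm"
  by eventually_elim (auto simp: Q_def mm_def)
 then have "AE z in lebesgue. z \<in> Q \<longrightarrow> norm (mm z) \<le> Lm" by (simp only: AE_completion_iff)
 then show ?thesis using Q(4) by (subst AE_restrict_space_iff) auto
qed

text \<open>Slices of a Lebesgue measurable function need not be measurable; a Borel representative makes
  Fubini's theorem applicable.\<close>

lemma borel_representative:
 obtains w where "w \<in> borel_measurable borel" "integrable lborel w" "AE z in lborel. indicator Q z *\<^sub>R mm z = w z"
proof -
 let ?w = "\<lambda>z. indicator Q z *\<^sub>R mm z"
 have i: "integrable lebesgue ?w" using mm_integrable Q(4) by (simp add: integrable_restrict_space)
 have "\<exists>g'\<in>borel_measurable lborel. AE z in lborel. ?w z \<bullet> k = g' z" for k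
 proof (rule completion_ex_borel_measurable_real)
  show "(\<lambda>z. ?w z \<bullet> k) \<in> borel_measurable lebesgue"
   using borel_measurable_integrable[OF i] by (intro borel_measurable_inner) auto
 qed
 then obtain g where g: "\<And>k. g k \<in> borel_measurable lborel" "\<And>k. AE z in lborel. ?w z \<bullet> k = g k z" by metis
 define w where "w z = (\<Sum>k\<in>Basis. g k z *\<^sub>R k)" for z
 have "AE z in lborel. \<forall>k\<in>Basis. ?w z \<bullet> k = g k z" using g(2) by (intro AE_finite_allI) auto
 then have ae: "AE z in lborel. ?w z = w z"
 proof eventually_elim
  case (elim z)
  have "?w z = (\<Sum>k\<in>Basis. (?w z \<bullet> k) *\<^sub>R k)" by (rule euclidean_representation[symmetric])
  also have "\<dots> = w z" unfolding w_def by (intro sum.cong refl) (use elim in simp)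
  finally show ?case .
 qed
 have wm: "w \<in> borel_measurable borel" unfolding w_def using g(1) by (intro borel_measurable_sum borel_measurable_scaleR) auto
 have wl: "w \<in> borel_measurable lebesgue" using wm by (intro measurable_completion) simp
 have "integrable lebesgue w"
  by (rule integrable_cong_AE_imp[OF i wl]) (use ae in \<open>simp add: AE_completion_iff eq_commute\<close>)
 then have "integrable lborel w" using wm by (simp add: integrable_completion)
 then show ?thesis using that wm ae by blast
qed

text \<open>The average of the slices is defined at almost every point and inherits their Lipschitz constant there. A
  set of full measure being dense, it extends to all of \<open>\<Omega>\<close>.\<close>

theorem time_average:
 assumes ab: "0 \<le> a" "a < b" "b \<le> 1"
 obtains V where "Lm-lipschitz_on \<Omega> V" "\<And>x. x \<in> \<Omega> \<Longrightarrow> norm (V x) \<le> Lm"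
  "\<And>h. continuous_on \<Omega> h \<Longrightarrow> (b - a) * int_on \<Omega> (\<lambda>x. V x \<bullet> h x) =
    int_on Q (\<lambda>z. indicator {a..<b} (fst z) * (mm z \<bullet> h (snd z)))"
proof -
 obtain w where w: "w \<in> borel_measurable borel" "integrable lborel w" "AE z in lborel. indicator Q z *\<^sub>R mm z = w z"
  by (rule borel_representative)
 let ?I = "{a..<b}"
 have ws: "(\<lambda>t. w (t, x)) \<in> borel_measurable borel" for x
  using measurable_compose[OF _ w(1), of "\<lambda>t. (t, x)" borel] by (simp flip: borel_prod)
 define S where "S = {x \<in> \<Omega>. AE t in lborel. indicator Q (t, x) *\<^sub>R mm (t, x) = w (t, x)}"
 have aet: "AE t in lborel. t \<in> {0..1} \<longrightarrow> Lm-lipschitz_on \<Omega> (m t) \<and> (\<forall>x\<in>\<Omega>. norm (m t x) \<le> Lm)"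
 proof -
  have "AE t in lebesgue. t \<in> {0..1} \<longrightarrow> Lm-lipschitz_on \<Omega> (m t) \<and> (\<forall>x\<in>\<Omega>. norm (m t x) \<le> Lm)"
   using Lm(2) by (subst (asm) AE_restrict_space_iff) auto
  then show ?thesis by (simp only: AE_completion_iff)
 qed
 have Isub: "?I \<subseteq> {0..1}" using ab by auto
 define u where "u x t = indicator ?I t *\<^sub>R w (t, x)" for x t
 have um: "u x \<in> borel_measurable borel" for x unfolding u_def using ws by measurable
 have ub: "AE t in lborel. norm (u x t) \<le> Lm * indicator ?I t" if x: "x \<in> S" for x
 proof -
  have "AE t in lborel. indicator Q (t, x) *\<^sub>R mm (t, x) = w (t, x)" using x by (simp add: S_def)
  then show ?thesis using aet
  proof eventually_elim
   case (elim t)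
   show ?case
   proof (cases "t \<in> ?I")
    case True
    then have "t \<in> {0..1}" using Isub by blast
    then have "w (t, x) = m t x" "norm (m t x) \<le> Lm" using elim x by (auto simp: S_def Q_def mm_def)
    then show ?thesis using True by (simp add: u_def)
   qed (simp add: u_def)
  qed
 qed
 have Ii: "integrable lborel (\<lambda>t. c * indicator ?I t :: real)" for c
  using emeasure_bounded_finite[of ?I] by (intro integrable_mult_right integrable_real_indicator) auto
 have Iint: "(\<integral>t. c * indicator ?I t \<partial>lborel) = c * (b - a)" for c :: real using ab by simp
 have ui: "integrable lborel (u x)" if x: "x \<in> S" for x
 proof (rule Bochner_Integration.integrable_bound[OF Ii[of Lm]])
  show "AE t in lborel. norm (u x t) \<le> norm (Lm * indicator ?I t :: real)"
   using ub[OF x] by eventually_elim (use Lm(1) in simp)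
 qed (use um in simp)
 define V0 where "V0 x = (1 / (b - a)) *\<^sub>R (\<integral>t. u x t \<partial>lborel)" for x
 have V0b: "norm (V0 x) \<le> Lm" if x: "x \<in> S" for x
 proof -
  have "norm (\<integral>t. u x t \<partial>lborel) \<le> (\<integral>t. Lm * indicator ?I t \<partial>lborel)"
   by (rule order_trans[OF integral_norm_bound integral_mono_AE[OF integrable_norm[OF ui[OF x]] Ii ub[OF x]]])
  then have "norm (\<integral>t. u x t \<partial>lborel) \<le> Lm * (b - a)" unfolding Iint .
  then show ?thesis using ab by (simp add: V0_def pos_divide_le_eq)
 qed
 have V0l: "Lm-lipschitz_on S V0"
 proof (rule lipschitz_onI)
  fix x y assume xy: "x \<in> S" "y \<in> S"
  have d: "AE t in lborel. norm (u x t - u y t) \<le> (Lm * dist x y) * indicator ?I t"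
  proof -
   have "AE t in lborel. indicator Q (t, x) *\<^sub>R mm (t, x) = w (t, x)" "AE t in lborel. indicator Q (t, y) *\<^sub>R mm (t, y) = w (t, y)"
    using xy by (simp_all add: S_def)
   then show ?thesis using aet
   proof eventually_elim
    case (elim t)
    show ?case
    proof (cases "t \<in> ?I")
     case True
     then have "t \<in> {0..1}" using Isub by blast
     then have "w (t, x) = m t x" "w (t, y) = m t y" "Lm-lipschitz_on \<Omega> (m t)" "x \<in> \<Omega>" "y \<in> \<Omega>"
      using elim xy by (auto simp: S_def Q_def mm_def)
     then show ?thesis using True lipschitz_onD[of Lm \<Omega> "m t" x y] by (simp add: u_def dist_norm)
    qed (simp add: u_def)
   qed
  qed
  have "norm ((\<integral>t. u x t \<partial>lborel) - (\<integral>t. u y t \<partial>lborel)) = norm (\<integral>t. u x t - u y t \<partial>lborel)"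
   using Bochner_Integration.integral_diff[OF ui[OF xy(1)] ui[OF xy(2)]] by simp
  also have "\<dots> \<le> (\<integral>t. (Lm * dist x y) * indicator ?I t \<partial>lborel)"
   by (rule order_trans[OF integral_norm_bound integral_mono_AE[OF integrable_norm[OF Bochner_Integration.integrable_diff[OF ui[OF xy(1)] ui[OF xy(2)]]] Ii d]])
  also have "\<dots> = Lm * dist x y * (b - a)" by (rule Iint)
  finally have n: "norm ((\<integral>t. u x t \<partial>lborel) - (\<integral>t. u y t \<partial>lborel)) \<le> Lm * dist x y * (b - a)" .
  have "dist (V0 x) (V0 y) = norm ((\<integral>t. u x t \<partial>lborel) - (\<integral>t. u y t \<partial>lborel)) / (b - a)"
   using ab by (simp add: V0_def dist_norm flip: scaleR_diff_right)
  also have "\<dots> \<le> Lm * dist x y" using n ab by (simp add: pos_divide_le_eq)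
  finally show "dist (V0 x) (V0 y) \<le> Lm * dist x y" .
 qed (rule Lm(1))
 have aeS: "AE x in lborel. x \<in> \<Omega> \<longrightarrow> x \<in> S"
  using AE_lborel_pair_sections(2)[OF w(3)] by eventually_elim (auto simp: S_def)
 have \<Omega>s: "\<Omega> \<in> sets lebesgue" "\<Omega> \<in> sets borel" "closed \<Omega>"
  using fmeasurableD[OF lmeasurable_compact[OF compact]] borel_compact[OF compact] compact_imp_closed[OF compact] by auto
 have aeSl: "AE x in lebesgue_on \<Omega>. x \<in> S"
 proof -
  have "AE x in lebesgue. x \<in> \<Omega> \<longrightarrow> x \<in> S" using aeS by (simp only: AE_completion_iff)
  then show ?thesis using \<Omega>s(1) by (subst AE_restrict_space_iff) auto
 qed
 have dense: "\<exists>y\<in>S. dist x y < e" if "x \<in> \<Omega>" "e > 0" for x e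
  using AE_lebesgue_on_dense[OF conv int \<Omega>s(1) aeSl that] by blast
 have clS: "closure S = \<Omega>"
 proof
  show "closure S \<subseteq> \<Omega>" by (rule closure_minimal[OF _ \<Omega>s(3)]) (auto simp: S_def)
  show "\<Omega> \<subseteq> closure S" using dense by (auto simp: closure_approachable dist_commute)
 qed
 obtain V where V: "Lm-lipschitz_on \<Omega> V" "\<And>x. x \<in> S \<Longrightarrow> V x = V0 x"
  using lipschitz_extend_closure[OF V0l] unfolding clS by blast
 have Vb: "norm (V x) \<le> Lm" if x: "x \<in> \<Omega>" for x
 proof (rule field_le_epsilon)
  fix e :: real assume e: "e > 0"
  define d where "d = e / (Lm + 1)"
  have d: "d > 0" using e Lm(1) by (simp add: d_def)
  obtain y where y: "y \<in> S" "dist x y < d" using dense[OF x d] by blast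
  have yO: "y \<in> \<Omega>" using y(1) by (simp add: S_def)
  have "norm (V x - V y) \<le> Lm * dist x y" using lipschitz_onD[OF V(1) x yO] by (simp add: dist_norm)
  also have "\<dots> \<le> (Lm + 1) * d" using y(2) Lm(1) by (intro mult_mono) auto
  also have "\<dots> = e" using Lm(1) by (simp add: d_def)
  finally have "norm (V x - V y) \<le> e" .
  moreover have "norm (V y) \<le> Lm" using V(2)[OF y(1)] V0b[OF y(1)] by simp
  ultimately show "norm (V x) \<le> Lm + e" using norm_triangle_sub[of "V x" "V y"] by linarith
 qed
 show ?thesis
 proof (rule that[OF V(1) Vb])
  fix h assume h: "continuous_on \<Omega> (h :: 'a \<Rightarrow> 'a)"
  define hb where "hb x = indicator \<Omega> x *\<^sub>R h x" for x
  have hbm[measurable]: "hb \<in> borel_measurable borel" unfolding hb_def by (intro borel_measurable_continuous_on_indicator h \<Omega>s)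
  obtain H where H: "\<And>x. x \<in> \<Omega> \<Longrightarrow> norm (h x) \<le> H"
   using compact_imp_bounded[OF compact_continuous_image[OF h compact]] by (auto simp: bounded_iff)
  obtain x0 where x0: "x0 \<in> \<Omega>" using int interior_subset by blast
  have H0: "H \<ge> 0" using H[OF x0] norm_ge_zero order_trans by blast
  have Hb: "norm (hb x) \<le> H" for x using H[of x] H0 by (auto simp: hb_def indicator_def)
  define k where "k z = indicator ?I (fst z) * (w z \<bullet> hb (snd z))" for z
  have km: "k \<in> borel_measurable borel"
  proof -
   have "(\<lambda>z. hb (snd z)) \<in> borel_measurable (borel :: (real \<times> 'a) measure)" by (simp flip: borel_prod)
   moreover have "(\<lambda>z. indicator ?I (fst z) :: real) \<in> borel_measurable (borel :: (real \<times> 'a) measure)" by (simp flip: borel_prod)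
   ultimately show ?thesis unfolding k_def by (intro borel_measurable_times borel_measurable_inner w(1))
  qed
  have ki: "integrable lborel k"
  proof (rule Bochner_Integration.integrable_bound)
   show "integrable lborel (\<lambda>z. H * norm (w z))" using w(2) by simp
   show "AE z in lborel. norm (k z) \<le> norm (H * norm (w z))"
   proof (rule AE_I2)
    fix z
    have "\<bar>w z \<bullet> hb (snd z)\<bar> \<le> norm (w z) * norm (hb (snd z))" by (rule Cauchy_Schwarz_ineq2)
    also have "\<dots> \<le> norm (w z) * H" by (intro mult_left_mono Hb) simp
    finally show "norm (k z) \<le> norm (H * norm (w z))" using H0 by (auto simp: k_def indicator_def abs_mult mult.commute)
   qed
  qed (use km in simp)
  have Vc: "continuous_on \<Omega> V" by (rule lipschitz_on_continuous_on[OF V(1)])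
  have "int_on \<Omega> (\<lambda>x. V x \<bullet> h x) = (\<integral>x. indicator \<Omega> x *\<^sub>R (V x \<bullet> h x) \<partial>lborel)"
   by (intro lebesgue_on_eq_lborel \<Omega>s borel_measurable_continuous_on_indicator continuous_on_inner Vc h)
  also have "(b - a) * \<dots> = (\<integral>x. (b - a) * (indicator \<Omega> x *\<^sub>R (V x \<bullet> h x)) \<partial>lborel)" by simp
  also have "\<dots> = (\<integral>x. \<integral>t. k (t, x) \<partial>lborel \<partial>lborel)"
  proof (rule integral_cong_AE)
   have "(\<lambda>x. indicator \<Omega> x *\<^sub>R (V x \<bullet> h x)) \<in> borel_measurable borel"
    by (intro borel_measurable_continuous_on_indicator continuous_on_inner Vc h \<Omega>s)
   then show "(\<lambda>x. (b - a) * (indicator \<Omega> x *\<^sub>R (V x \<bullet> h x))) \<in> borel_measurable lborel" by simp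
   have "integrable (lborel \<Otimes>\<^sub>M lborel) (case_prod (\<lambda>t x. k (t, x)))" using ki by (simp add: lborel_prod)
   then show "(\<lambda>x. \<integral>t. k (t, x) \<partial>lborel) \<in> borel_measurable lborel"
    by (intro borel_measurable_integrable lborel_pair.integrable_snd)
   show "AE x in lborel. (b - a) * (indicator \<Omega> x *\<^sub>R (V x \<bullet> h x)) = (\<integral>t. k (t, x) \<partial>lborel)"
    using aeS
   proof eventually_elim
    case (elim x)
    show ?case
    proof (cases "x \<in> \<Omega>")
     case True
     then have x: "x \<in> S" using elim by blast
     have "(\<integral>t. k (t, x) \<partial>lborel) = (\<integral>t. u x t \<bullet> h x \<partial>lborel)"
      using True by (intro Bochner_Integration.integral_cong refl) (simp add: k_def u_def hb_def)
     also have "\<dots> = (\<integral>t. u x t \<partial>lborel) \<bullet> h x" using ui[OF x] by simp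
     also have "\<dots> = (b - a) * (V0 x \<bullet> h x)" using ab by (simp add: V0_def)
     finally show ?thesis using True V(2)[OF x] by simp
    qed (simp add: k_def hb_def)
   qed
  qed
  also have "\<dots> = integral\<^sup>L lborel k" by (rule integral_lborel_snd[OF ki])
  also have "\<dots> = integral\<^sup>L lebesgue k" using km by (simp add: integral_completion)
  also have "\<dots> = integral\<^sup>L lebesgue (\<lambda>z. indicator Q z *\<^sub>R (indicator ?I (fst z) * (mm z \<bullet> h (snd z))))"
  proof (rule integral_cong_AE)
   show "k \<in> borel_measurable lebesgue" using km by (intro measurable_completion) simp
   have "integrable (lebesgue_on Q) (\<lambda>z. mm z \<bullet> h (snd z))" by (rule mm_pairing_integrable[OF h])
   then have "(\<lambda>z. indicator ?I (fst z) * (mm z \<bullet> h (snd z))) \<in> borel_measurable (lebesgue_on Q)"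
    by (intro borel_measurable_times fst_measurable[OF borel_measurable_indicator] borel_measurable_integrable) auto
   then show "(\<lambda>z. indicator Q z *\<^sub>R (indicator ?I (fst z) * (mm z \<bullet> h (snd z)))) \<in> borel_measurable lebesgue"
    using Q(4) by (subst (asm) borel_measurable_restrict_space_iff) auto
   have "AE z in lebesgue. indicator Q z *\<^sub>R mm z = w z" using w(3) by (simp only: AE_completion_iff)
   then show "AE z in lebesgue. k z = indicator Q z *\<^sub>R (indicator ?I (fst z) * (mm z \<bullet> h (snd z)))"
   proof eventually_elim
    case (elim z)
    show ?case
    proof (cases "z \<in> Q")
     case True
     then have "snd z \<in> \<Omega>" by (auto simp: Q_def)
     then show ?thesis using True elim by (simp add: k_def hb_def)
    next
     case False
     then have "w z = 0" using elim by simp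
     then show ?thesis using False by (simp add: k_def)
    qed
   qed
  qed
  also have "\<dots> = int_on Q (\<lambda>z. indicator ?I (fst z) * (mm z \<bullet> h (snd z)))"
   using Q(4) by (simp add: integral_restrict_space)
  finally show "(b - a) * int_on \<Omega> (\<lambda>x. V x \<bullet> h x) = int_on Q (\<lambda>z. indicator ?I (fst z) * (mm z \<bullet> h (snd z)))" .
 qed
qed

end

section \<open>Averages over cells and slabs\<close>

context mesh begin

lemma one_integrable: "integrable (lebesgue_on \<Omega>) (\<lambda>x. c :: real)"
 by (rule finite_measure.integrable_const[OF finite_measure_lebesgue_on[OF lmeasurable_compact[OF \<Omega>(1)]]])

lemma continuous_integrable: "continuous_on \<Omega> f \<Longrightarrow> integrable (lebesgue_on \<Omega>) (f :: 'a \<Rightarrow> real)"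
 using integrable_mult_continuous[OF \<Omega>(1) one_integrable[of 1], of f] by simp

lemma sampling_ge:
 assumes K: "K \<in> cells T" and f: "continuous_on \<Omega> f" and lo: "\<And>x. x \<in> K \<Longrightarrow> f x \<ge> lo"
 shows "sampling f K \<ge> lo"
proof -
 have m: "cell_measure K > 0" by (rule cell_measure_pos[OF K])
 have "lo * cell_measure K = int_on K (\<lambda>x. lo)" by (rule integral_const_cell[OF K, symmetric])
 also have "\<dots> \<le> int_on K f"
  by (intro integral_mono integrable_cell[OF K] one_integrable continuous_integrable f) (use lo in simp)
 finally show ?thesis using m by (simp add: sampling_def pos_le_divide_eq)
qed

lemma sampling_uminus: "sampling (\<lambda>x. - f x) K = - sampling f K" for f :: "'a \<Rightarrow> real"
 by (simp add: sampling_def)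

lemma sampling_close:
 assumes K: "K \<in> cells T" and f: "L-lipschitz_on \<Omega> f" and x: "x \<in> K"
 shows "\<bar>sampling f K - f x\<bar> \<le> L * mesh_size T"
proof -
 have L: "L \<ge> 0" using f lipschitz_on_nonneg by blast
 have c: "continuous_on \<Omega> f" by (rule lipschitz_on_continuous_on[OF f])
 have d: "\<bar>f y - f x\<bar> \<le> L * mesh_size T" if y: "y \<in> K" for y
 proof -
  have "\<bar>f y - f x\<bar> \<le> L * dist y x" using lipschitz_onD[OF f, of y x] cell(6)[OF K] x y by (auto simp: dist_real_def)
  also have "\<dots> \<le> L * mesh_size T"
   using diameter_bounded_bound[OF cell(4)[OF K] y x] diameter_le_mesh_size[OF K] by (intro mult_left_mono L) linarith
  finally show ?thesis .
 qed
 have "sampling f K \<ge> f x - L * mesh_size T" by (rule sampling_ge[OF K c]) (use d in \<open>fastforce simp: abs_le_iff\<close>)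
 moreover have "sampling (\<lambda>x. - f x) K \<ge> - f x - L * mesh_size T"
  by (rule sampling_ge[OF K continuous_on_minus[OF c]]) (use d in \<open>fastforce simp: abs_le_iff\<close>)
 ultimately show ?thesis unfolding sampling_uminus by linarith
qed

text \<open>The difference between a Lipschitz function and its cell averages has zero mean, is of the order
  of the mesh size and is continuous off the cell boundaries.\<close>

lemma cell_average_correction:
 assumes f: "L-lipschitz_on \<Omega> f"
 shows "\<exists>W. continuous_on UNIV W \<and> (\<forall>z. norm (W z) \<le> 2 ^ DIM('a) * 2 * diameter \<Omega> * (L * mesh_size T)) \<and>
  (\<forall>\<psi> h. has_gradient_on \<Omega> \<psi> h \<and> continuous_on \<Omega> h \<longrightarrow>
    int_on \<Omega> (\<lambda>x. \<psi> x * (\<Sum>K\<in>cells T. indicator K x * sampling f K)) =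
    int_on \<Omega> (\<lambda>x. \<psi> x * f x) + int_on \<Omega> (\<lambda>x. W x \<bullet> h x))"
proof -
 have L: "L \<ge> 0" using f lipschitz_on_nonneg by blast
 have c: "continuous_on \<Omega> f" by (rule lipschitz_on_continuous_on[OF f])
 define fb where "fb x = indicator \<Omega> x * f x" for x
 have fbm[measurable]: "fb \<in> borel_measurable borel"
  using borel_measurable_continuous_on_indicator[OF \<Omega>_sets(1) c] unfolding fb_def[abs_def] by simp
 define g where "g x = (\<Sum>K\<in>cells T. indicator K x * (sampling f K - fb x))" for x
 have gK: "g x = sampling f K - f x" if "K \<in> cells T" "x \<in> K" for K x
  unfolding g_def using sum_indicator_cells[OF that(2,1), of "\<lambda>K. sampling f K - fb x"] cell(6)[OF that(1)] that(2)
  by (auto simp: fb_def)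
 have g0: "g x = 0" if "\<And>K. K \<in> cells T \<Longrightarrow> x \<notin> K" for x
  unfolding g_def using that by (intro sum.neutral) (simp add: indicator_def)
 have gm: "g \<in> borel_measurable borel"
  unfolding g_def using cell_sets(1) by (intro borel_measurable_sum borel_measurable_times borel_measurable_diff borel_measurable_indicator) auto
 have gb: "\<bar>g x\<bar> \<le> L * mesh_size T" for x
 proof (cases "\<exists>K\<in>cells T. x \<in> K")
  case True
  then obtain K where K: "K \<in> cells T" "x \<in> K" by blast
  show ?thesis unfolding gK[OF K] by (rule sampling_close[OF K(1) f K(2)])
 next
  case False
  have "L * mesh_size T \<ge> 0" using L mesh_size_pos by simp
  then show ?thesis using g0[of x] False by simp
 qed
 let ?N = "\<Union>K\<in>cells T. frontier K"
 have N: "closed ?N" "negligible ?N"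
 proof -
  show "closed ?N" using finite_cells by (intro closed_UN) auto
  have "negligible (frontier K)" if "K \<in> cells T" for K using negligible_convex_frontier[OF cell(3)[OF that]] .
  then show "negligible ?N" using finite_cells by (intro negligible_Union) auto
 qed
 have gc: "isCont g x" if x: "x \<in> interior \<Omega>" "x \<notin> ?N" for x
 proof -
  have "x \<in> \<Omega>" using x(1) interior_subset by blast
  then obtain K where K: "K \<in> cells T" "x \<in> closure K" using \<Omega>_cover by blast
  then have xK: "x \<in> K" using x(2) interior_subset[of K] by (auto simp: frontier_def)
  have "continuous_on K (\<lambda>x. sampling f K - f x)" by (intro continuous_intros continuous_on_subset[OF c cell(6)[OF K(1)]])
  then have "continuous_on K g" by (rule continuous_on_eq) (use gK[OF K(1)] in simp)
  then show ?thesis using xK cell(2)[OF K(1)] by (simp add: continuous_on_eq_continuous_at)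
 qed
 have ae: "AE x in lebesgue_on \<Omega>. g x = (\<Sum>K\<in>cells T. indicator K x * sampling f K) - f x"
  using AE_in_cell by eventually_elim (auto simp: gK sum_indicator_cells)
 have fi: "integrable (lebesgue_on \<Omega>) f" by (rule continuous_integrable[OF c])
 have si: "integrable (lebesgue_on \<Omega>) (\<lambda>x. \<Sum>K\<in>cells T. indicator K x * sampling f K)"
  by (intro Bochner_Integration.integrable_sum indicator_integrable one_integrable cell_sets)
 have gml: "g \<in> borel_measurable (lebesgue_on \<Omega>)" using gm by (intro measurable_restrict_space1 measurable_completion) simp
 have eqi: "int_on \<Omega> (\<lambda>x. \<psi> x * g x) = int_on \<Omega> (\<lambda>x. \<psi> x * (\<Sum>K\<in>cells T. indicator K x * sampling f K)) - int_on \<Omega> (\<lambda>x. \<psi> x * f x)"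
  if \<psi>: "continuous_on \<Omega> \<psi>" for \<psi>
 proof -
  have i: "integrable (lebesgue_on \<Omega>) (\<lambda>x. \<psi> x * (\<Sum>K\<in>cells T. indicator K x * sampling f K))" "integrable (lebesgue_on \<Omega>) (\<lambda>x. \<psi> x * f x)"
   using integrable_mult_continuous[OF \<Omega>(1) si \<psi>] integrable_mult_continuous[OF \<Omega>(1) fi \<psi>] by (simp_all add: mult.commute)
  have \<psi>m: "\<psi> \<in> borel_measurable (lebesgue_on \<Omega>)" by (rule continuous_imp_measurable_on_sets_lebesgue[OF \<psi> \<Omega>_sets(2)])
  have "int_on \<Omega> (\<lambda>x. \<psi> x * g x) = int_on \<Omega> (\<lambda>x. \<psi> x * (\<Sum>K\<in>cells T. indicator K x * sampling f K) - \<psi> x * f x)"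
  proof (rule integral_cong_AE)
   show "(\<lambda>x. \<psi> x * g x) \<in> borel_measurable (lebesgue_on \<Omega>)" by (intro borel_measurable_times \<psi>m gml)
   show "(\<lambda>x. \<psi> x * (\<Sum>K\<in>cells T. indicator K x * sampling f K) - \<psi> x * f x) \<in> borel_measurable (lebesgue_on \<Omega>)"
    by (intro borel_measurable_integrable Bochner_Integration.integrable_diff i)
   show "AE x in lebesgue_on \<Omega>. \<psi> x * g x = \<psi> x * (\<Sum>K\<in>cells T. indicator K x * sampling f K) - \<psi> x * f x"
    using ae by eventually_elim (simp only: right_diff_distrib)
  qed
  then show ?thesis using Bochner_Integration.integral_diff[OF i] by (simp only:)
 qed
 have lb: "(\<integral>x. indicator \<Omega> x * u x \<partial>lborel) = int_on \<Omega> u" if "(\<lambda>x. indicator \<Omega> x *\<^sub>R u x) \<in> borel_measurable borel" for u :: "'a \<Rightarrow> real"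
  using lebesgue_on_eq_lborel[OF \<Omega>_sets(1) that] by simp
 have mean: "(\<integral>x. indicator \<Omega> x * g x \<partial>lborel) = 0"
 proof -
  have "(\<integral>x. indicator \<Omega> x * g x \<partial>lborel) = int_on \<Omega> (\<lambda>x. 1 * g x)"
   by (subst lb) (use gm in auto)
  also have "\<dots> = int_on \<Omega> (\<lambda>x. \<Sum>K\<in>cells T. indicator K x * sampling f K) - int_on \<Omega> f"
   using eqi[of "\<lambda>_. 1"] by simp
  also have "int_on \<Omega> (\<lambda>x. \<Sum>K\<in>cells T. indicator K x * sampling f K) = (\<Sum>K\<in>cells T. int_on \<Omega> (\<lambda>x. indicator K x * sampling f K))"
   by (intro Bochner_Integration.integral_sum indicator_integrable one_integrable cell_sets)
  also have "\<dots> = (\<Sum>K\<in>cells T. int_on K f)"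
  proof (rule sum.cong[OF refl])
   fix K assume K: "K \<in> cells T"
   have "int_on \<Omega> (\<lambda>x. indicator K x * sampling f K) = sampling f K * cell_measure K"
    by (rule trans[OF cell_integral[OF K, symmetric] integral_const_cell[OF K]])
   then show "int_on \<Omega> (\<lambda>x. indicator K x * sampling f K) = int_on K f"
    using cell_measure_pos[OF K] by (simp add: sampling_def)
  qed
  also have "\<dots> = int_on \<Omega> f" by (rule integral_sum_cells[OF fi, symmetric])
  finally show ?thesis by simp
 qed
 obtain W where W: "continuous_on UNIV W" "\<And>z. norm (W z) \<le> 2 ^ DIM('a) * 2 * diameter \<Omega> * (L * mesh_size T)"
  "\<And>\<psi> h. has_gradient_on \<Omega> \<psi> h \<Longrightarrow> continuous_on \<Omega> h \<Longrightarrow>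
    (\<integral>x. indicator \<Omega> x * (\<psi> x * g x) \<partial>lborel) = (\<integral>x. indicator \<Omega> x * (W x \<bullet> h x) \<partial>lborel)"
  using bounded_field_with_divergence[OF \<Omega>(1,2) int\<Omega> gm gb N gc mean] by blast
 show ?thesis
 proof (intro exI[of _ W] conjI allI impI W(1,2), elim conjE)
  fix \<psi> h assume h: "has_gradient_on \<Omega> \<psi> h" "continuous_on \<Omega> h"
  have \<psi>c: "continuous_on \<Omega> \<psi>"
   by (rule has_derivative_continuous_on[where f' = "\<lambda>z v. h z \<bullet> v"]) (use h(1) in \<open>simp add: has_gradient_on_def\<close>)
  have "(\<lambda>x. (indicator \<Omega> x *\<^sub>R \<psi> x) * g x) \<in> borel_measurable borel"
   by (intro borel_measurable_times gm borel_measurable_continuous_on_indicator \<psi>c \<Omega>_sets)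
  then have "(\<lambda>x. indicator \<Omega> x *\<^sub>R (\<psi> x * g x)) \<in> borel_measurable borel" by (simp add: mult.assoc)
  then have 1: "(\<integral>x. indicator \<Omega> x * (\<psi> x * g x) \<partial>lborel) = int_on \<Omega> (\<lambda>x. \<psi> x * g x)" by (rule lb)
  have 2: "(\<integral>x. indicator \<Omega> x * (W x \<bullet> h x) \<partial>lborel) = int_on \<Omega> (\<lambda>x. W x \<bullet> h x)"
   by (intro lb borel_measurable_continuous_on_indicator \<Omega>_sets continuous_on_inner h continuous_on_subset[OF W(1)]) auto
  show "int_on \<Omega> (\<lambda>x. \<psi> x * (\<Sum>K\<in>cells T. indicator K x * sampling f K)) =
    int_on \<Omega> (\<lambda>x. \<psi> x * f x) + int_on \<Omega> (\<lambda>x. W x \<bullet> h x)"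
   using W(3)[OF h] eqi[OF \<psi>c] unfolding 1 2 by linarith
 qed
qed

end

context regular_flow begin

lemma Q_const_integrable: "integrable (lebesgue_on Q) (\<lambda>z. c :: real)"
 by (rule finite_measure.integrable_const[OF finite_measure_lebesgue_on[OF lmeasurable_compact[OF Q(1)]]])

lemma slab_integral:
 assumes q: "continuous_on \<Omega> q" and ab: "0 \<le> a" "a < b" "b \<le> 1"
 shows "int_on Q (\<lambda>z. indicator {a..<b} (fst z) * q (snd z)) = (b - a) * int_on \<Omega> q"
proof -
 define u where "u z = indicator {a..<b} (fst z) * (indicator \<Omega> (snd z) *\<^sub>R q (snd z))" for z :: "real \<times> 'a"
 have \<Omega>b: "\<Omega> \<in> sets borel" using borel_compact[OF compact] .
 have qm: "(\<lambda>x. indicator \<Omega> x *\<^sub>R q x) \<in> borel_measurable borel" by (rule borel_measurable_continuous_on_indicator[OF \<Omega>b q])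
 have um: "u \<in> borel_measurable borel"
 proof -
  have "(\<lambda>z. indicator \<Omega> (snd z) *\<^sub>R q (snd z)) \<in> borel_measurable (borel :: (real \<times> 'a) measure)"
   by (rule measurable_compose[OF _ qm]) (simp flip: borel_prod)
  moreover have "(\<lambda>z. indicator {a..<b} (fst z) :: real) \<in> borel_measurable (borel :: (real \<times> 'a) measure)" by (simp flip: borel_prod)
  ultimately show ?thesis unfolding u_def by (intro borel_measurable_times)
 qed
 obtain C where C: "\<And>x. x \<in> \<Omega> \<Longrightarrow> \<bar>q x\<bar> \<le> C"
  using compact_imp_bounded[OF compact_continuous_image[OF q compact]] by (auto simp: bounded_iff)
 obtain x0 where x0: "x0 \<in> \<Omega>" using int interior_subset by blast
 have C0: "C \<ge> 0" using C[OF x0] by linarith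
 have ui: "integrable lborel u"
 proof (rule integrable_lborel_bounded_support[OF um _ _ compact_imp_bounded[OF Q(1)]])
  show "norm (u z) \<le> C" for z using C[of "snd z"] C0 by (auto simp: u_def indicator_def)
  show "u z = 0" if "z \<notin> Q" for z using that ab by (cases z) (auto simp: u_def Q_def indicator_def)
 qed
 have Qb: "Q \<in> sets borel" by (rule borel_compact[OF Q(1)])
 have eq: "(\<lambda>z. indicator Q z *\<^sub>R (indicator {a..<b} (fst z) * q (snd z))) = u"
  by (rule ext) (use ab in \<open>auto simp: u_def Q_def indicator_def\<close>)
 have "int_on Q (\<lambda>z. indicator {a..<b} (fst z) * q (snd z)) = integral\<^sup>L lborel u"
  using lebesgue_on_eq_lborel[OF Qb, of "\<lambda>z. indicator {a..<b} (fst z) * q (snd z)"] um unfolding eq by simp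
 also have "\<dots> = (\<integral>t. \<integral>x. u (t, x) \<partial>lborel \<partial>lborel)" by (rule integral_lborel_fst[OF ui, symmetric])
 also have "\<dots> = (\<integral>t. indicator {a..<b} t * (\<integral>x. indicator \<Omega> x *\<^sub>R q x \<partial>lborel) \<partial>lborel)" by (simp add: u_def)
 also have "\<dots> = (b - a) * (\<integral>x. indicator \<Omega> x *\<^sub>R q x \<partial>lborel)" using ab by simp
 also have "(\<integral>x. indicator \<Omega> x *\<^sub>R q x \<partial>lborel) = int_on \<Omega> q" by (rule lebesgue_on_eq_lborel[OF \<Omega>b qm, symmetric])
 finally show ?thesis .
qed

lemma energy_integrable:
 assumes c: "continuous_on Q c" "\<And>z. z \<in> Q \<Longrightarrow> c z \<ge> \<epsilon>"
 shows "integrable (lebesgue_on Q) (\<lambda>z. (norm (mm z))\<^sup>2 / (2 * c z))"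
proof -
 have n: "integrable (lebesgue_on Q) (\<lambda>z. (norm (mm z))\<^sup>2)"
 proof (rule Bochner_Integration.integrable_bound[OF Q_const_integrable[of "Lm\<^sup>2"]])
  show "(\<lambda>z. (norm (mm z))\<^sup>2) \<in> borel_measurable (lebesgue_on Q)"
   by (intro borel_measurable_power measurable_compose[OF borel_measurable_integrable[OF mm_integrable] borel_measurable_norm])
  show "AE z in lebesgue_on Q. norm ((norm (mm z))\<^sup>2) \<le> norm (Lm\<^sup>2)"
   using AE_mm by eventually_elim (simp add: power_mono)
 qed
 have "continuous_on Q (\<lambda>z. 1 / (2 * c z))"
 proof -
  have "c z \<noteq> 0" if "z \<in> Q" for z using c(2)[OF that] \<epsilon> by linarith
  then show ?thesis by (intro continuous_intros c(1)) auto
 qed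
 from integrable_mult_continuous[OF Q(1) n this] show ?thesis by simp
qed

lemma slab_weighted_integrable:
 assumes "integrable (lebesgue_on Q) f" shows "integrable (lebesgue_on Q) (\<lambda>z. indicator {a..<b} (fst z) * (f z :: real))"
proof (rule Bochner_Integration.integrable_bound[OF assms])
 show "(\<lambda>z. indicator {a..<b} (fst z) * f z) \<in> borel_measurable (lebesgue_on Q)"
  by (intro borel_measurable_times fst_measurable[OF borel_measurable_indicator] borel_measurable_integrable[OF assms]) simp
 show "AE z in lebesgue_on Q. norm (indicator {a..<b} (fst z) * f z) \<le> norm (f z)"
  by (rule AE_I2) (simp add: indicator_def)
qed

text \<open>Testing the average momentum against \<open>V / \<rho>\<close> and using Young's inequality bounds its energy
 by that of the momentum itself.\<close>

lemma average_energy: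
 assumes ab: "0 \<le> a" "a < b" "b \<le> 1" and V: "continuous_on \<Omega> V"
  and avg: "\<And>h. continuous_on \<Omega> h \<Longrightarrow> (b - a) * int_on \<Omega> (\<lambda>x. V x \<bullet> h x) =
    int_on Q (\<lambda>z. indicator {a..<b} (fst z) * (mm z \<bullet> h (snd z)))"
 shows "(b - a) * int_on \<Omega> (\<lambda>x. (norm (V x))\<^sup>2 / (2 * \<rho> b x)) \<le>
   int_on Q (\<lambda>z. indicator {a..<b} (fst z) * ((norm (mm z))\<^sup>2 / (2 * \<rho> (fst z) (snd z)) + Lm\<^sup>2 * Lr * (b - a) / (2 * \<epsilon>\<^sup>2)))"
proof -
 have b01: "b \<in> {0..1}" using ab by auto
 have pc: "continuous_on \<Omega> (\<rho> b)" by (rule rho_continuous[OF b01])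
 have pp: "\<rho> b x > 0" "\<rho> b x \<ge> \<epsilon>" if "x \<in> \<Omega>" for x using lower[OF b01 that] \<epsilon> by auto
 let ?I = "\<lambda>z. indicator {a..<b} (fst z) :: real"
 let ?q = "\<lambda>x. (norm (V x))\<^sup>2 / (2 * \<rho> b x)"
 have qc: "continuous_on \<Omega> ?q" using pp(1) by (intro continuous_intros V pc) force
 let ?h = "\<lambda>x. (1 / \<rho> b x) *\<^sub>R V x"
 have hc: "continuous_on \<Omega> ?h" using pp(1) by (intro continuous_intros V pc) force
 have pcQ: "continuous_on Q (\<lambda>z. \<rho> b (snd z))" by (rule space_continuous_Q[OF pc])
 have i1: "integrable (lebesgue_on Q) (\<lambda>z. ?I z * ((norm (mm z))\<^sup>2 / (2 * \<rho> b (snd z))))"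
  by (intro slab_weighted_integrable energy_integrable pcQ) (use pp(2) in \<open>auto simp: Q_def\<close>)
 have i2: "integrable (lebesgue_on Q) (\<lambda>z. ?I z * ?q (snd z))"
 proof (rule slab_weighted_integrable)
  show "integrable (lebesgue_on Q) (\<lambda>z. ?q (snd z))"
   using integrable_mult_continuous[OF Q(1) Q_const_integrable[of 1] space_continuous_Q[OF qc]] by simp
 qed
 have i3: "integrable (lebesgue_on Q) (\<lambda>z. ?I z * (mm z \<bullet> ?h (snd z)))"
  by (rule slab_weighted_integrable[OF mm_pairing_integrable[OF hc]])
 have "(b - a) * int_on \<Omega> (\<lambda>x. V x \<bullet> ?h x) = int_on Q (\<lambda>z. ?I z * (mm z \<bullet> ?h (snd z)))"
  by (rule avg[OF hc])
 also have "\<dots> \<le> int_on Q (\<lambda>z. ?I z * ((norm (mm z))\<^sup>2 / (2 * \<rho> b (snd z))) + ?I z * ?q (snd z))"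
 proof (rule integral_mono[OF i3 Bochner_Integration.integrable_add[OF i1 i2]])
  fix z assume "z \<in> space (lebesgue_on Q)"
  then have x: "snd z \<in> \<Omega>" by (auto simp: Q_def)
  have "0 \<le> (norm (mm z - V (snd z)))\<^sup>2" by simp
  then have "2 * (mm z \<bullet> V (snd z)) \<le> (norm (mm z))\<^sup>2 + (norm (V (snd z)))\<^sup>2"
   unfolding power2_norm_eq_inner by (simp add: inner_diff_left inner_diff_right inner_commute)
  then have "2 * (mm z \<bullet> V (snd z)) / (2 * \<rho> b (snd z)) \<le> ((norm (mm z))\<^sup>2 + (norm (V (snd z)))\<^sup>2) / (2 * \<rho> b (snd z))"
   using pp(1)[OF x] by (intro divide_right_mono) auto
  then have "mm z \<bullet> ?h (snd z) \<le> (norm (mm z))\<^sup>2 / (2 * \<rho> b (snd z)) + ?q (snd z)"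
   by (simp add: add_divide_distrib)
  then show "?I z * (mm z \<bullet> ?h (snd z)) \<le> ?I z * ((norm (mm z))\<^sup>2 / (2 * \<rho> b (snd z))) + ?I z * ?q (snd z)"
   by (simp add: indicator_def)
 qed
 also have "\<dots> = int_on Q (\<lambda>z. ?I z * ((norm (mm z))\<^sup>2 / (2 * \<rho> b (snd z)))) + (b - a) * int_on \<Omega> ?q"
  using Bochner_Integration.integral_add[OF i1 i2] slab_integral[OF qc ab] by simp
 also have "int_on \<Omega> (\<lambda>x. V x \<bullet> ?h x) = 2 * int_on \<Omega> ?q"
  unfolding integral_mult_right_zero[symmetric]
  by (intro Bochner_Integration.integral_cong refl) (simp add: power2_norm_eq_inner)
 finally have "(b - a) * int_on \<Omega> ?q \<le> int_on Q (\<lambda>z. ?I z * ((norm (mm z))\<^sup>2 / (2 * \<rho> b (snd z))))" by simp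
 also have "\<dots> \<le> int_on Q (\<lambda>z. ?I z * ((norm (mm z))\<^sup>2 / (2 * \<rho> (fst z) (snd z)) + Lm\<^sup>2 * Lr * (b - a) / (2 * \<epsilon>\<^sup>2)))"
 proof (rule integral_mono_AE[OF i1])
  show "integrable (lebesgue_on Q) (\<lambda>z. ?I z * ((norm (mm z))\<^sup>2 / (2 * \<rho> (fst z) (snd z)) + Lm\<^sup>2 * Lr * (b - a) / (2 * \<epsilon>\<^sup>2)))"
   by (intro slab_weighted_integrable Bochner_Integration.integrable_add energy_integrable rho_continuous_Q Q_const_integrable)
    (use lower in \<open>auto simp: Q_def\<close>)
  have "AE z in lebesgue_on Q. z \<in> Q" by (rule AE_I2) simp
  then show "AE z in lebesgue_on Q. ?I z * ((norm (mm z))\<^sup>2 / (2 * \<rho> b (snd z))) \<le> ?I z * ((norm (mm z))\<^sup>2 / (2 * \<rho> (fst z) (snd z)) + Lm\<^sup>2 * Lr * (b - a) / (2 * \<epsilon>\<^sup>2))"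
   using AE_mm
  proof eventually_elim
   case (elim z)
   have zz: "fst z \<in> {0..1}" "snd z \<in> \<Omega>" using elim by (auto simp: Q_def)
   show ?case
   proof (cases "fst z \<in> {a..<b}")
    case True
    have "\<rho> (fst z) (snd z) - \<rho> b (snd z) \<le> Lr * (b - a)"
    proof -
     have "\<bar>\<rho> b (snd z) - \<rho> (fst z) (snd z)\<bar> \<le> Lr * \<bar>b - fst z\<bar>" by (rule rho_time[OF zz(1) b01 zz(2)])
     also have "\<dots> \<le> Lr * (b - a)" using True by (intro mult_left_mono Lr(1)) auto
     finally show ?thesis by linarith
    qed
    then have "(norm (mm z))\<^sup>2 / (2 * \<rho> b (snd z)) \<le> (norm (mm z))\<^sup>2 / (2 * \<rho> (fst z) (snd z)) + (Lm * 0 / \<epsilon> + Lm\<^sup>2 * (Lr * (b - a)) / (2 * \<epsilon>\<^sup>2))"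
     using elim(2) Lr(1) ab by (intro weighted_square_perturbation[OF \<epsilon> pp(2)[OF zz(2)] lower[OF zz]]) auto
    then show ?thesis using True by (simp add: mult.assoc)
   qed simp
  qed
 qed
 finally show ?thesis .
qed

end

section \<open>The sampled interpolation as a competitor\<close>

text \<open>The bound of \<open>cell_average_correction\<close> for an \<open>L\<close>-Lipschitz function, per unit of mesh size.\<close>

definition correction_bound :: "'a::euclidean_space set \<Rightarrow> real \<Rightarrow> real" where
 "correction_bound \<Omega> L = 2 ^ DIM('a) * 2 * diameter \<Omega> * L"

text \<open>The three contributions in the inner bracket are the errors of \<open>mean_flux_energy\<close>: oscillation of the
  momentum in a cell, of the density in a coarse cell and a time step, and of the flux on a face. The
  remaining term stems from \<open>average_energy\<close>.\<close>

definition flow_error :: "'a::euclidean_space set \<Rightarrow> real \<Rightarrow> real \<Rightarrow> real \<Rightarrow> real \<Rightarrow> real \<Rightarrow> real" where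
 "flow_error \<Omega> \<epsilon> Lp Lr Lm \<kappa> = measure lebesgue \<Omega> * (Lm\<^sup>2 * Lr / (2 * \<epsilon>\<^sup>2) + (Lm * Lm / \<epsilon> + Lm\<^sup>2 * (Lp * \<kappa> + Lr) / (2 * \<epsilon>\<^sup>2) +
   (2 * Lm + (Lm + correction_bound \<Omega> (Lr * \<kappa>)) * diameter \<Omega>) * (Lm + correction_bound \<Omega> (Lr * \<kappa>)) * real DIM('a) / (2 * \<epsilon>)))"

locale flow_on_mesh = mesh_pair \<Omega> T T' + regular_flow \<Omega> \<rho> r m \<rho>in \<rho>f \<epsilon> Lp Lr Lm
 for \<Omega> :: "'a::euclidean_space set" and T T' :: "'a mesh" and \<rho> r :: "real \<Rightarrow> 'a \<Rightarrow> real"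
  and m :: "real \<Rightarrow> 'a \<Rightarrow> 'a" and \<rho>in \<rho>f :: "'a \<Rightarrow> real" and \<epsilon> Lp Lr Lm :: real +
 fixes \<kappa> e :: real
 assumes \<kappa>: "mesh_size T' \<le> \<kappa> * mesh_size T" and iso: "mesh_isotropic e T" and e: "e \<ge> 0"
begin

lemma \<kappa>_nonneg: "\<kappa> \<ge> 0"
proof -
 have "0 < \<kappa> * mesh_size T" using coarse.mesh_size_pos \<kappa> by linarith
 then show ?thesis using mesh_size_pos by (simp add: zero_less_mult_iff)
qed

text \<open>The bumps of a coarse cell are \<open>C\<^sup>1\<close> test functions whose pairings determine the cell average.\<close>

lemma endpoint_samples:
 assumes K': "K' \<in> cells T'"
 shows "sampling (\<rho> 0) K' = sampling \<rho>in K'" "sampling (\<rho> 1) K' = sampling \<rho>f K'"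
proof -
 have eq: "sampling f K' = sampling g K'"
  if i: "integrable (lebesgue_on \<Omega>) f" "integrable (lebesgue_on \<Omega>) g"
   and p: "\<And>\<xi> h. has_gradient_on \<Omega> \<xi> h \<Longrightarrow> continuous_on \<Omega> h \<Longrightarrow> pairing \<xi> f = pairing \<xi> g" for f g
 proof -
  have "int_on \<Omega> (\<lambda>x. coarse.bump K' d x * f x) = int_on \<Omega> (\<lambda>x. coarse.bump K' d x * g x)" if "d > 0" for d
   using p[OF coarse.bump_gradient[OF that] coarse.continuous_bump_grad] unfolding pairing_def .
  then have "int_on \<Omega> (\<lambda>x. coarse.bump K' (1 / real (Suc n)) x * f x) = int_on \<Omega> (\<lambda>x. coarse.bump K' (1 / real (Suc n)) x * g x)" for n
   by simp
  then have "int_on K' f = int_on K' g"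
   using coarse.bump_integral_tendsto[OF K' i(1)] coarse.bump_integral_tendsto[OF K' i(2)] LIMSEQ_unique by (simp only:)
  then show ?thesis by (simp add: sampling_def)
 qed
 have i: "integrable (lebesgue_on \<Omega>) (\<rho> 0)" "integrable (lebesgue_on \<Omega>) (\<rho> 1)"
  by (intro continuous_integrable rho_continuous; simp)+
 show "sampling (\<rho> 0) K' = sampling \<rho>in K'"
  by (rule eq[OF i(1)]) (use dens(1) endpoint_slices in \<open>auto simp: is_density_def\<close>)
 show "sampling (\<rho> 1) K' = sampling \<rho>f K'"
  by (rule eq[OF i(2)]) (use dens(2) endpoint_slices in \<open>auto simp: is_density_def\<close>)
qed

text \<open>The momentum averaged over a time slab balances the increment of the density; adding the
 correction field of the increment replaces the latter by its averages over the coarse cells, and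
 the fluxes of the sum through the fine faces then satisfy the discrete continuity equation.\<close>

lemma slice_flux:
 assumes ab: "0 \<le> a" "a < b" "b \<le> 1"
 obtains V W where "Lm-lipschitz_on \<Omega> V" "\<And>x. x \<in> \<Omega> \<Longrightarrow> norm (V x) \<le> Lm"
  "\<And>h. continuous_on \<Omega> h \<Longrightarrow> (b - a) * int_on \<Omega> (\<lambda>x. V x \<bullet> h x) =
    int_on Q (\<lambda>z. indicator {a..<b} (fst z) * (mm z \<bullet> h (snd z)))"
  "continuous_on \<Omega> W" "\<And>x. norm (W x) \<le> correction_bound \<Omega> (Lr * \<kappa>) * mesh_size T"
  "\<And>K. K \<in> cells T \<Longrightarrow> (sampling (\<rho> b) (parent K) - sampling (\<rho> a) (parent K)) / (b - a) +
    discrete_div T (mean_flux (\<lambda>x. V x + W x)) K = 0"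
proof -
 have a01: "a \<in> {0..1}" and b01: "b \<in> {0..1}" using ab by auto
 note rc = rho_continuous[OF a01] rho_continuous[OF b01]
 define f where "f x = (\<rho> b x - \<rho> a x) / (b - a)" for x
 have f: "Lr-lipschitz_on \<Omega> f"
 proof (rule lipschitz_onI[OF _ Lr(1)])
  fix x y assume xy: "x \<in> \<Omega>" "y \<in> \<Omega>"
  have "f x - f y = ((\<rho> b x - \<rho> a x) - (\<rho> b y - \<rho> a y)) / (b - a)" by (simp add: f_def diff_divide_distrib)
  then have "\<bar>f x - f y\<bar> = \<bar>(\<rho> b x - \<rho> a x) - (\<rho> b y - \<rho> a y)\<bar> / (b - a)" using ab by (simp add: abs_divide)
  moreover have "\<bar>(\<rho> b x - \<rho> a x) - (\<rho> b y - \<rho> a y)\<bar> \<le> Lr * dist x y * (b - a)"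
   using rho_increment_lipschitz[OF a01 b01 _ xy] ab by simp
  ultimately show "dist (f x) (f y) \<le> Lr * dist x y" using ab by (simp add: dist_real_def pos_divide_le_eq)
 qed
 have fc: "continuous_on \<Omega> f" by (rule lipschitz_on_continuous_on[OF f])
 have "\<exists>V. Lm-lipschitz_on \<Omega> V \<and> (\<forall>x\<in>\<Omega>. norm (V x) \<le> Lm) \<and>
  (\<forall>h. continuous_on \<Omega> h \<longrightarrow> (b - a) * int_on \<Omega> (\<lambda>x. V x \<bullet> h x) =
    int_on Q (\<lambda>z. indicator {a..<b} (fst z) * (mm z \<bullet> h (snd z))))"
 proof (rule time_average[OF ab], goal_cases)
  case (1 V)
  show ?case by (intro exI[of _ V] conjI ballI allI impI 1)
 qed
 then obtain V where V: "Lm-lipschitz_on \<Omega> V" "\<And>x. x \<in> \<Omega> \<Longrightarrow> norm (V x) \<le> Lm"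
  "\<And>h. continuous_on \<Omega> h \<Longrightarrow> (b - a) * int_on \<Omega> (\<lambda>x. V x \<bullet> h x) =
    int_on Q (\<lambda>z. indicator {a..<b} (fst z) * (mm z \<bullet> h (snd z)))"
  by blast
 have Vc: "continuous_on \<Omega> V" by (rule lipschitz_on_continuous_on[OF V(1)])
 define fb where "fb x = (\<Sum>K'\<in>cells T'. indicator K' x * sampling f K')" for x
 obtain W where W: "continuous_on UNIV W" "\<And>z. norm (W z) \<le> 2 ^ DIM('a) * 2 * diameter \<Omega> * (Lr * mesh_size T')"
  "\<And>\<psi> h. has_gradient_on \<Omega> \<psi> h \<Longrightarrow> continuous_on \<Omega> h \<Longrightarrow>
    int_on \<Omega> (\<lambda>x. \<psi> x * fb x) =
    int_on \<Omega> (\<lambda>x. \<psi> x * f x) + int_on \<Omega> (\<lambda>x. W x \<bullet> h x)"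
  using coarse.cell_average_correction[OF f] unfolding fb_def[symmetric] by blast
 have Wc: "continuous_on \<Omega> W" by (rule continuous_on_subset[OF W(1)]) simp
 have Wb: "norm (W x) \<le> correction_bound \<Omega> (Lr * \<kappa>) * mesh_size T" for x
 proof -
  have D0: "diameter \<Omega> \<ge> 0" by (rule diameter_ge_0[OF \<Omega>(4)])
  have "Lr * mesh_size T' \<le> Lr * (\<kappa> * mesh_size T)" by (rule mult_left_mono[OF \<kappa> Lr(1)])
  then have "2 ^ DIM('a) * 2 * diameter \<Omega> * (Lr * mesh_size T') \<le> 2 ^ DIM('a) * 2 * diameter \<Omega> * (Lr * (\<kappa> * mesh_size T))"
   by (rule mult_left_mono) (use D0 in simp)
  also have "\<dots> = correction_bound \<Omega> (Lr * \<kappa>) * mesh_size T" by (simp add: correction_bound_def)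
  finally show ?thesis using W(2)[of x] by linarith
 qed
 have fbi: "integrable (lebesgue_on \<Omega>) fb"
  unfolding fb_def by (intro Bochner_Integration.integrable_sum indicator_integrable one_integrable coarse.cell_sets)
 have VWc: "continuous_on \<Omega> (\<lambda>x. V x + W x)" by (intro continuous_intros Vc Wc)
 have weak: "int_on \<Omega> (\<lambda>x. \<psi> x * fb x) = int_on \<Omega> (\<lambda>x. (V x + W x) \<bullet> h x)"
  if \<psi>: "has_gradient_on \<Omega> \<psi> h" "continuous_on \<Omega> h" for \<psi> h
 proof -
  have \<psi>c: "continuous_on \<Omega> \<psi>" by (rule gradient_continuous[OF \<psi>(1)])
  have "pairing \<psi> (\<rho> b) - pairing \<psi> (\<rho> a) = int_on \<Omega> (\<lambda>x. \<psi> x * \<rho> b x - \<psi> x * \<rho> a x)"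
   unfolding pairing_def by (rule Bochner_Integration.integral_diff[symmetric]; intro continuous_integrable continuous_intros \<psi>c rc)
  also have "\<dots> = int_on \<Omega> (\<lambda>x. (b - a) * (\<psi> x * f x))"
   by (intro Bochner_Integration.integral_cong refl) (use ab in \<open>simp add: f_def flip: right_diff_distrib\<close>)
  also have "\<dots> = (b - a) * int_on \<Omega> (\<lambda>x. \<psi> x * f x)" by simp
  finally have 1: "pairing \<psi> (\<rho> b) - pairing \<psi> (\<rho> a) = (b - a) * int_on \<Omega> (\<lambda>x. \<psi> x * f x)" .
  have i: "integrable (lebesgue_on Q) (\<lambda>z. indicator {..<c} (fst z) * (mm z \<bullet> h (snd z)))" for c
  proof (rule Bochner_Integration.integrable_bound[OF mm_pairing_integrable[OF \<psi>(2)]])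
   show "(\<lambda>z. indicator {..<c} (fst z) * (mm z \<bullet> h (snd z))) \<in> borel_measurable (lebesgue_on Q)"
    by (intro borel_measurable_times fst_measurable[OF borel_measurable_indicator] borel_measurable_integrable[OF mm_pairing_integrable[OF \<psi>(2)]]) simp
  qed (rule AE_I2, simp add: indicator_def)
  have "J h b - J h a = int_on Q (\<lambda>z. indicator {..<b} (fst z) * (mm z \<bullet> h (snd z)) - indicator {..<a} (fst z) * (mm z \<bullet> h (snd z)))"
   unfolding J_def by (rule Bochner_Integration.integral_diff[OF i i, symmetric])
  also have "\<dots> = int_on Q (\<lambda>z. indicator {a..<b} (fst z) * (mm z \<bullet> h (snd z)))"
   by (intro Bochner_Integration.integral_cong refl) (use ab in \<open>auto simp: indicator_def\<close>)
  also have "\<dots> = (b - a) * int_on \<Omega> (\<lambda>x. V x \<bullet> h x)" by (rule V(3)[OF \<psi>(2), symmetric])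
  finally have "(b - a) * int_on \<Omega> (\<lambda>x. \<psi> x * f x) = (b - a) * int_on \<Omega> (\<lambda>x. V x \<bullet> h x)"
   using 1 weak_increment[OF \<psi> ab] by linarith
  then have 2: "int_on \<Omega> (\<lambda>x. \<psi> x * f x) = int_on \<Omega> (\<lambda>x. V x \<bullet> h x)" using ab by simp
  have "int_on \<Omega> (\<lambda>x. V x \<bullet> h x + W x \<bullet> h x) = int_on \<Omega> (\<lambda>x. V x \<bullet> h x) + int_on \<Omega> (\<lambda>x. W x \<bullet> h x)"
   by (rule Bochner_Integration.integral_add; intro continuous_integrable continuous_on_inner Vc Wc \<psi>)
  then show ?thesis using W(3)[OF \<psi>] 2 unfolding inner_add_left by linarith
 qed
 have bal: "(sampling (\<rho> b) (parent K) - sampling (\<rho> a) (parent K)) / (b - a) + discrete_div T (mean_flux (\<lambda>x. V x + W x)) K = 0"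
  if K: "K \<in> cells T" for K
 proof -
  note P = parent(1,2)[OF K]
  have "int_on K fb = int_on K (\<lambda>x. sampling f (parent K))"
  proof (rule Bochner_Integration.integral_cong[OF refl])
   fix x assume "x \<in> space (lebesgue_on K)"
   then have "x \<in> parent K" using P(2) by auto
   then show "fb x = sampling f (parent K)" unfolding fb_def by (rule coarse.sum_indicator_cells[OF _ P(1)])
  qed
  also have "\<dots> = sampling f (parent K) * cell_measure K" by (rule integral_const_cell[OF K])
  finally have "sampling f (parent K) * cell_measure K = - (\<Sum>s\<in>cell_faces T K. face_flux (\<lambda>x. V x + W x) K s)"
   using cell_flux_balance[OF K fbi VWc weak] by simp
  then have 1: "sampling f (parent K) + discrete_div T (mean_flux (\<lambda>x. V x + W x)) K = 0"
   unfolding discrete_div_mean_flux[OF K VWc] using cell_measure_pos[OF K] by (simp add: field_simps)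
  have "int_on (parent K) (\<lambda>x. \<rho> b x - \<rho> a x) = int_on (parent K) (\<rho> b) - int_on (parent K) (\<rho> a)"
   by (intro Bochner_Integration.integral_diff coarse.integrable_cell[OF P(1)] continuous_integrable rc)
  moreover have "int_on (parent K) f = int_on (parent K) (\<lambda>x. \<rho> b x - \<rho> a x) / (b - a)"
   unfolding f_def by (rule integral_divide_zero)
  moreover have "1 / u * ((y - y') / v) = (1 / u * y - 1 / u * y') / v" for u v y y' :: real
   by (simp add: diff_divide_distrib mult.commute[of u])
  ultimately have "sampling f (parent K) = (sampling (\<rho> b) (parent K) - sampling (\<rho> a) (parent K)) / (b - a)"
   by (simp only: sampling_def)
  then show ?thesis using 1 by simp
 qed
 show ?thesis by (rule that[OF V Wc Wb bal])
qed

definition energy :: "real \<times> 'a \<Rightarrow> real" where "energy z = (norm (mm z))\<^sup>2 / (2 * \<rho> (fst z) (snd z))"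

lemma energy_nonneg: "z \<in> Q \<Longrightarrow> energy z \<ge> 0"
 using lower[of "fst z" "snd z"] \<epsilon> by (auto simp: energy_def Q_def)

lemma energy_integrable': "integrable (lebesgue_on Q) energy"
 unfolding energy_def[abs_def] by (rule energy_integrable[OF rho_continuous_Q]) (use lower in \<open>auto simp: Q_def\<close>)

lemma flow_error_nonneg: "flow_error \<Omega> \<epsilon> Lp Lr Lm \<kappa> \<ge> 0" and correction_nonneg: "correction_bound \<Omega> (Lr * \<kappa>) \<ge> 0"
proof -
 have D0: "diameter \<Omega> \<ge> 0" by (rule diameter_ge_0[OF \<Omega>(4)])
 show c: "correction_bound \<Omega> (Lr * \<kappa>) \<ge> 0" unfolding correction_bound_def using D0 Lr(1) \<kappa>_nonneg by simp
 show "flow_error \<Omega> \<epsilon> Lp Lr Lm \<kappa> \<ge> 0"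
  unfolding flow_error_def using D0 c Lr(1) Lm(1) Lp(1) \<kappa>_nonneg \<epsilon>
  by (intro mult_nonneg_nonneg add_nonneg_nonneg divide_nonneg_nonneg) auto
qed

lemma slice_energy:
 assumes ab: "0 \<le> a" "a < b" "b \<le> 1"
  and V: "Lm-lipschitz_on \<Omega> V" "\<And>x. x \<in> \<Omega> \<Longrightarrow> norm (V x) \<le> Lm"
  and avg: "\<And>h. continuous_on \<Omega> h \<Longrightarrow> (b - a) * int_on \<Omega> (\<lambda>x. V x \<bullet> h x) =
    int_on Q (\<lambda>z. indicator {a..<b} (fst z) * (mm z \<bullet> h (snd z)))"
  and W: "continuous_on \<Omega> W" "\<And>x. norm (W x) \<le> correction_bound \<Omega> (Lr * \<kappa>) * mesh_size T"
 shows "ennreal (b - a) * (\<Sum>s\<in>internal_faces T.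
   B (linear_reconstruction T (\<lambda>K. (sampling (\<rho> b) (parent K) + sampling (\<rho> a) (parent K)) / 2) s)
    (flux_size T (mean_flux (\<lambda>x. V x + W x)) s) * ennreal (face_measure s * face_dist T s)) \<le>
  ennreal ((1 + e) * (int_on Q (\<lambda>z. indicator {a..<b} (fst z) * energy z) +
    (b - a) * (flow_error \<Omega> \<epsilon> Lp Lr Lm \<kappa> * (mesh_size T + (b - a)))))"
proof -
 have a01: "a \<in> {0..1}" and b01: "b \<in> {0..1}" using ab by auto
 note rc = rho_continuous[OF a01] rho_continuous[OF b01]
 define s where "s = mesh_size T + (b - a)"
 have s: "0 < mesh_size T" "mesh_size T \<le> s" "b - a \<le> s" "s \<ge> 0" using ab mesh_size_pos by (auto simp: s_def)
 define Cw where "Cw = correction_bound \<Omega> (Lr * \<kappa>)"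
 have Cw: "Cw \<ge> 0" unfolding Cw_def by (rule correction_nonneg)
 have D0: "diameter \<Omega> \<ge> 0" by (rule diameter_ge_0[OF \<Omega>(4)])
 define S where "S = (Lp * \<kappa> + Lr) * s"
 have S: "S \<ge> 0" unfolding S_def using Lp(1) Lr(1) \<kappa>_nonneg s by simp
 define R where "R K = (sampling (\<rho> b) (parent K) + sampling (\<rho> a) (parent K)) / 2" for K
 have R: "R K \<ge> \<epsilon>" if K: "K \<in> cells T" for K
 proof -
  have "sampling (\<rho> b) (parent K) \<ge> \<epsilon>" "sampling (\<rho> a) (parent K) \<ge> \<epsilon>"
   using coarse.cell(6)[OF parent(1)[OF K]] a01 b01
   by (auto intro!: coarse.sampling_ge[OF parent(1)[OF K]] rc lower)
  then show ?thesis by (simp add: R_def)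
 qed
 have Rc: "\<rho> b x - R K \<le> S" if K: "K \<in> cells T" and x: "x \<in> K" for K x
 proof -
  have xP: "x \<in> parent K" using x parent(2)[OF K] by blast
  have xO: "x \<in> \<Omega>" using x cell(6)[OF K] by blast
  have "\<bar>sampling (\<rho> b) (parent K) - \<rho> b x\<bar> \<le> Lp * mesh_size T'" "\<bar>sampling (\<rho> a) (parent K) - \<rho> a x\<bar> \<le> Lp * mesh_size T'"
   by (rule coarse.sampling_close[OF parent(1)[OF K] rho_lipschitz xP], fact)+
  moreover have "\<bar>\<rho> b x - \<rho> a x\<bar> \<le> Lr * (b - a)" using rho_time[OF a01 b01 xO] ab by simp
  moreover have "Lp * mesh_size T' \<le> Lp * (\<kappa> * mesh_size T)" by (rule mult_left_mono[OF \<kappa> Lp(1)])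
  moreover have "Lp * (\<kappa> * mesh_size T) \<le> Lp * \<kappa> * s" using Lp(1) \<kappa>_nonneg s by (simp add: mult_left_mono flip: mult.assoc)
  moreover have "Lr * (b - a) \<le> Lr * s" "0 \<le> Lr * (b - a)" using Lr(1) s ab by (auto intro: mult_left_mono)
  ultimately show ?thesis unfolding R_def S_def distrib_right add_divide_distrib by linarith
 qed
 let ?A = "\<Sum>s\<in>internal_faces T. B (linear_reconstruction T R s) (flux_size T (mean_flux (\<lambda>x. V x + W x)) s) * ennreal (face_measure s * face_dist T s)"
 define C2 where "C2 = (2 * Lm + (Lm + Cw) * diameter \<Omega>) * (Lm + Cw)"
 have C2: "C2 \<ge> 0" unfolding C2_def using Lm(1) Cw D0 by simp
 define X where "X = Lm * (Lm * mesh_size T) / \<epsilon> + Lm\<^sup>2 * S / (2 * \<epsilon>\<^sup>2) + C2 * mesh_size T * real DIM('a) / (2 * \<epsilon>)"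
 define c6 where "c6 = Lm * Lm / \<epsilon> + Lm\<^sup>2 * (Lp * \<kappa> + Lr) / (2 * \<epsilon>\<^sup>2) + C2 * real DIM('a) / (2 * \<epsilon>)"
 define c7 where "c7 = Lm\<^sup>2 * Lr / (2 * \<epsilon>\<^sup>2)"
 define I where "I = int_on \<Omega> (\<lambda>x. (norm (V x))\<^sup>2 / (2 * \<rho> b x))"
 define E where "E = int_on Q (\<lambda>z. indicator {a..<b} (fst z) * energy z)"
 define w where "w = measure lebesgue \<Omega>"
 have w: "w \<ge> 0" by (simp add: w_def)
 have A: "?A \<le> ennreal ((1 + e) * (I + w * X))"
  unfolding X_def C2_def I_def w_def
  by (rule mean_flux_energy[OF iso e V W(1) _ Cw \<epsilon> R rc(2) _ Rc S]) (use W(2) lower b01 in \<open>auto simp: Cw_def\<close>)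
 have X: "X \<le> c6 * s"
 proof -
  have "Lm * (Lm * mesh_size T) / \<epsilon> \<le> Lm * (Lm * s) / \<epsilon>" using Lm(1) s \<epsilon> by (intro divide_right_mono mult_left_mono) auto
  moreover have "C2 * mesh_size T * real DIM('a) / (2 * \<epsilon>) \<le> C2 * s * real DIM('a) / (2 * \<epsilon>)"
   using C2 s \<epsilon> by (intro divide_right_mono mult_right_mono mult_left_mono) auto
  moreover have "c6 * s = Lm * (Lm * s) / \<epsilon> + Lm\<^sup>2 * S / (2 * \<epsilon>\<^sup>2) + C2 * s * real DIM('a) / (2 * \<epsilon>)"
   unfolding c6_def S_def by (simp add: algebra_simps add_divide_distrib)
  ultimately show ?thesis unfolding X_def by linarith
 qed
 have avgE: "(b - a) * I \<le> E + (b - a) * (c7 * (b - a) * w)"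
 proof -
  have "(b - a) * I \<le> int_on Q (\<lambda>z. indicator {a..<b} (fst z) * (energy z + c7 * (b - a)))"
   using average_energy[OF ab lipschitz_on_continuous_on[OF V(1)] avg] unfolding I_def energy_def c7_def by simp
  also have "\<dots> = int_on Q (\<lambda>z. indicator {a..<b} (fst z) * energy z + indicator {a..<b} (fst z) * (c7 * (b - a)))"
   by (simp only: distrib_left)
  also have "\<dots> = E + int_on Q (\<lambda>z. indicator {a..<b} (fst z) * (c7 * (b - a)))"
   unfolding E_def
   by (rule Bochner_Integration.integral_add[OF slab_weighted_integrable[OF energy_integrable'] slab_weighted_integrable[OF Q_const_integrable]])
  also have "int_on Q (\<lambda>z. indicator {a..<b} (fst z) * (c7 * (b - a))) = (b - a) * int_on \<Omega> (\<lambda>x. c7 * (b - a))"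
   by (rule slab_integral[OF continuous_on_const ab])
  also have "int_on \<Omega> (\<lambda>x. c7 * (b - a)) = c7 * (b - a) * w"
   unfolding w_def by (simp add: measure_restrict_space \<Omega>_sets)
  finally show ?thesis .
 qed
 have fe: "flow_error \<Omega> \<epsilon> Lp Lr Lm \<kappa> = w * (c7 + c6)"
  unfolding flow_error_def c6_def c7_def w_def C2_def Cw_def by simp
 have c7: "c7 \<ge> 0" unfolding c7_def using Lr(1) by simp
 have "(b - a) * (I + w * X) \<le> E + (b - a) * (w * (c7 + c6) * s)"
 proof -
  have "c7 * (b - a) * w \<le> c7 * s * w" using c7 s w by (intro mult_right_mono mult_left_mono) auto
  moreover have "w * X \<le> w * (c6 * s)" using X w by (rule mult_left_mono)
  ultimately have "c7 * (b - a) * w + w * X \<le> w * (c7 + c6) * s" by (simp add: algebra_simps)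
  then have "(b - a) * (c7 * (b - a) * w + w * X) \<le> (b - a) * (w * (c7 + c6) * s)" using ab by (intro mult_left_mono) auto
  then show ?thesis using avgE unfolding distrib_left by linarith
 qed
 then have "(1 + e) * ((b - a) * (I + w * X)) \<le> (1 + e) * (E + (b - a) * (w * (c7 + c6) * s))"
  using e by (intro mult_left_mono) auto
 then have fin: "(b - a) * ((1 + e) * (I + w * X)) \<le> (1 + e) * (E + (b - a) * (flow_error \<Omega> \<epsilon> Lp Lr Lm \<kappa> * s))"
  unfolding fe by (simp only: mult.left_commute)
 have "ennreal (b - a) * ?A \<le> ennreal (b - a) * ennreal ((1 + e) * (I + w * X))" by (rule mult_left_mono[OF A]) simp
 also have "\<dots> = ennreal ((b - a) * ((1 + e) * (I + w * X)))" using ab by (intro ennreal_mult'[symmetric]) simp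
 also have "\<dots> \<le> ennreal ((1 + e) * (E + (b - a) * (flow_error \<Omega> \<epsilon> Lp Lr Lm \<kappa> * s)))" using fin by (rule ennreal_leI)
 finally show ?thesis unfolding R_def E_def s_def .
qed

lemma energy_action: "action \<Omega> (\<rho>, m) = ennreal (int_on Q energy)"
proof -
 have "action \<Omega> (\<rho>, m) = (\<integral>\<^sup>+z. ennreal (energy z) \<partial>lebesgue_on Q)"
  unfolding action_def Q_def[symmetric] prod.case
 proof (rule nn_integral_cong)
  fix z assume "z \<in> space (lebesgue_on Q)"
  then have "\<rho> (fst z) (snd z) > 0" using lower[of "fst z" "snd z"] \<epsilon> by (auto simp: Q_def)
  then show "(case z of (t, x) \<Rightarrow> B (\<rho> t x) (m t x)) = ennreal (energy z)"
   by (simp add: case_prod_unfold B_def energy_def mm_def)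
 qed
 also have "\<dots> = ennreal (int_on Q energy)"
  by (rule nn_integral_eq_integral[OF energy_integrable']) (use energy_nonneg in \<open>auto intro: AE_I2\<close>)
 finally show ?thesis .
qed

lemma energy_le: "int_on Q energy \<le> Lm\<^sup>2 / (2 * \<epsilon>) * measure lebesgue Q"
proof -
 have "AE z in lebesgue_on Q. z \<in> Q" by (rule AE_I2) simp
 then have "AE z in lebesgue_on Q. energy z \<le> Lm\<^sup>2 / (2 * \<epsilon>)"
  using AE_mm
 proof eventually_elim
  case (elim z)
  have "\<rho> (fst z) (snd z) \<ge> \<epsilon>" using lower elim(1) by (auto simp: Q_def)
  then show ?case unfolding energy_def using elim(2) \<epsilon> by (intro frac_le power_mono) auto
 qed
 then have "int_on Q energy \<le> int_on Q (\<lambda>z. Lm\<^sup>2 / (2 * \<epsilon>))"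
  by (rule integral_mono_AE[OF energy_integrable' Q_const_integrable])
 also have "\<dots> = Lm\<^sup>2 / (2 * \<epsilon>) * measure lebesgue Q" using Q(4) by (simp add: measure_restrict_space)
 finally show ?thesis .
qed

lemma slab_partition:
 assumes "(\<tau>::real) \<ge> 0"
 shows "(\<Sum>k=1..n. indicator {real (k - 1) * \<tau>..<real k * \<tau>} x) = (indicator {0..<real n * \<tau>} x :: real)"
proof (induction n)
 case (Suc n)
 have "real n * \<tau> \<le> real (Suc n) * \<tau>" "0 \<le> real n * \<tau>" using assms by (auto intro: mult_right_mono)
 then have "indicator {0..<real n * \<tau>} x + indicator {real n * \<tau>..<real (Suc n) * \<tau>} x = (indicator {0..<real (Suc n) * \<tau>} x :: real)"
  by (auto simp: indicator_def)
 then show ?case using Suc by simp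
qed simp

text \<open>The slabs are disjoint, so the energies of the time steps add up to at most the total energy.\<close>

theorem discrete_energy_bound:
 "discrete_W2_sq N T' T (sampling \<rho>in) (sampling \<rho>f) \<le>
   ennreal (2 * ((1 + e) * (int_on Q energy + flow_error \<Omega> \<epsilon> Lp Lr Lm \<kappa> * (mesh_size T + time_step N))))"
proof -
 define \<tau> where "\<tau> = time_step N"
 have \<tau>: "\<tau> > 0" "real (N + 1) * \<tau> = 1" by (auto simp: \<tau>_def time_step_def)
 define t where "t k = real k * \<tau>" for k
 have t01: "t k \<in> {0..1}" if "k \<le> N + 1" for k
 proof -
  have "real k * \<tau> \<le> real (N + 1) * \<tau>" using that \<tau>(1) by (intro mult_right_mono) auto
  then have "real k * \<tau> \<le> 1" unfolding \<tau>(2) .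
  then show ?thesis using \<tau>(1) by (simp add: t_def)
 qed
 have tk: "0 \<le> t (k - 1)" "t (k - 1) < t k" "t k \<le> 1" "t k - t (k - 1) = \<tau>" if "k \<in> {1..N + 1}" for k
  using that t01[of k] t01[of "k - 1"] \<tau> by (auto simp: t_def of_nat_diff left_diff_distrib)
 define good where "good a b V W \<longleftrightarrow> Lm-lipschitz_on \<Omega> V \<and> (\<forall>x\<in>\<Omega>. norm (V x) \<le> Lm) \<and>
  (\<forall>h. continuous_on \<Omega> h \<longrightarrow> (b - a) * int_on \<Omega> (\<lambda>x. V x \<bullet> h x) =
    int_on Q (\<lambda>z. indicator {a..<b} (fst z) * (mm z \<bullet> h (snd z)))) \<and>
  continuous_on \<Omega> W \<and> (\<forall>x. norm (W x) \<le> correction_bound \<Omega> (Lr * \<kappa>) * mesh_size T) \<and>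
  (\<forall>K\<in>cells T. (sampling (\<rho> b) (parent K) - sampling (\<rho> a) (parent K)) / (b - a) +
    discrete_div T (mean_flux (\<lambda>x. V x + W x)) K = 0)" for a b V W
 have "\<exists>U. good (t (k - 1)) (t k) (fst U) (snd U)" if k: "k \<in> {1..N + 1}" for k
 proof (rule slice_flux[OF tk(1-3)[OF k]], goal_cases)
  case (1 V W)
  have "good (t (k - 1)) (t k) V W" unfolding good_def by (intro conjI ballI allI impI 1)
  then show ?case by (intro exI[of _ "(V, W)"]) simp
 qed
 then obtain U where U: "\<And>k. k \<in> {1..N + 1} \<Longrightarrow> good (t (k - 1)) (t k) (fst (U k)) (snd (U k))" by metis
 define F where "F k = mean_flux (\<lambda>x. fst (U k) x + snd (U k) x)" for k
 define R where "R k = sampling (\<rho> (t k))" for k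
 have ends: "t 0 = 0" "t (N + 1) = 1" using \<tau> by (auto simp: t_def)
 have dce: "discrete_continuity_equation N T' T (sampling \<rho>in) (sampling \<rho>f) (R, F)"
  unfolding discrete_continuity_equation_def prod.case
 proof (intro conjI ballI)
  show "is_flux T (F k)" for k unfolding F_def by (rule mean_flux_is_flux)
  show "injection T' (\<lambda>K'. (R k K' - R (k - 1) K') / time_step N) K + discrete_div T (F k) K = 0"
   if k: "k \<in> {1..N + 1}" and K: "K \<in> cells T" for k K
   using U[OF k] K unfolding good_def tk(4)[OF k] injection_parent R_def F_def \<tau>_def by blast
  show "R 0 K' = sampling \<rho>in K'" "R (N + 1) K' = sampling \<rho>f K'" if "K' \<in> cells T'" for K'
   unfolding R_def ends using endpoint_samples[OF that] by auto
 qed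
 have Rnn: "\<forall>k\<le>N + 1. \<forall>K'\<in>cells T'. 0 \<le> R k K'"
 proof (intro allI impI ballI)
  fix k K' assume k: "k \<le> N + 1" and K': "K' \<in> cells T'"
  have "0 \<le> \<rho> (t k) x" if "x \<in> K'" for x using lower[OF t01[OF k]] coarse.cell(6)[OF K'] that \<epsilon> by force
  then show "0 \<le> R k K'" unfolding R_def by (intro coarse.sampling_ge[OF K' rho_continuous[OF t01[OF k]]])
 qed
 define Ce where "Ce = flow_error \<Omega> \<epsilon> Lp Lr Lm \<kappa> * (mesh_size T + \<tau>)"
 have Ce: "Ce \<ge> 0" unfolding Ce_def using flow_error_nonneg mesh_size_pos \<tau> by (intro mult_nonneg_nonneg) auto
 define a where "a k = int_on Q (\<lambda>z. indicator {t (k - 1)..<t k} (fst z) * energy z)" for k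
 have a0: "a k \<ge> 0" for k unfolding a_def using energy_nonneg by (intro Bochner_Integration.integral_nonneg) auto
 have "discrete_action N T' T (R, F) = (\<Sum>k=1..N+1. ennreal \<tau> * (\<Sum>s\<in>internal_faces T.
   B (linear_reconstruction T (\<lambda>K. (sampling (\<rho> (t k)) (parent K) + sampling (\<rho> (t (k - 1))) (parent K)) / 2) s)
    (flux_size T (mean_flux (\<lambda>x. fst (U k) x + snd (U k) x)) s) * ennreal (face_measure s * face_dist T s)))"
  unfolding discrete_action_def prod.case if_P[OF Rnn] injection_parent[abs_def] unfolding R_def F_def \<tau>_def ..
 also have "\<dots> \<le> (\<Sum>k=1..N+1. ennreal ((1 + e) * (a k + \<tau> * Ce)))"
 proof (rule sum_mono)
  fix k assume k: "k \<in> {1..N + 1}"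
  show "ennreal \<tau> * (\<Sum>s\<in>internal_faces T.
   B (linear_reconstruction T (\<lambda>K. (sampling (\<rho> (t k)) (parent K) + sampling (\<rho> (t (k - 1))) (parent K)) / 2) s)
    (flux_size T (mean_flux (\<lambda>x. fst (U k) x + snd (U k) x)) s) * ennreal (face_measure s * face_dist T s))
   \<le> ennreal ((1 + e) * (a k + \<tau> * Ce))"
   using slice_energy[OF tk(1-3)[OF k], of "fst (U k)" "snd (U k)"] U[OF k] unfolding good_def tk(4)[OF k] a_def Ce_def by blast
 qed
 also have "\<dots> = ennreal (\<Sum>k=1..N+1. (1 + e) * (a k + \<tau> * Ce))"
  using e a0 Ce \<tau> by (intro sum_ennreal mult_nonneg_nonneg add_nonneg_nonneg) auto
 also have "(\<Sum>k=1..N+1. (1 + e) * (a k + \<tau> * Ce)) = (1 + e) * ((\<Sum>k=1..N+1. a k) + (real (N + 1) * \<tau>) * Ce)"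
  by (simp only: sum_distrib_left[symmetric] sum.distrib sum_constant card_atLeastAtMost) (simp add: algebra_simps)
 finally have act: "discrete_action N T' T (R, F) \<le> ennreal ((1 + e) * ((\<Sum>k=1..N+1. a k) + Ce))" unfolding \<tau>(2) by simp
 have "(\<Sum>k=1..N+1. a k) = int_on Q (\<lambda>z. \<Sum>k=1..N+1. indicator {t (k - 1)..<t k} (fst z) * energy z)"
  unfolding a_def by (rule Bochner_Integration.integral_sum[symmetric]) (rule slab_weighted_integrable[OF energy_integrable'])
 also have "\<dots> \<le> int_on Q energy"
 proof (rule integral_mono[OF _ energy_integrable'])
  show "integrable (lebesgue_on Q) (\<lambda>z. \<Sum>k=1..N+1. indicator {t (k - 1)..<t k} (fst z) * energy z)"
   by (intro Bochner_Integration.integrable_sum slab_weighted_integrable[OF energy_integrable'])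
  fix z assume "z \<in> space (lebesgue_on Q)"
  then have "energy z \<ge> 0" by (intro energy_nonneg) simp
  moreover have "(\<Sum>k=1..N+1. indicator {t (k - 1)..<t k} (fst z) * energy z) = indicator {0..<real (N + 1) * \<tau>} (fst z) * energy z"
   using slab_partition[of \<tau> "fst z" "N + 1"] \<tau>(1) unfolding t_def sum_distrib_right[symmetric] by simp
  ultimately show "(\<Sum>k=1..N+1. indicator {t (k - 1)..<t k} (fst z) * energy z) \<le> energy z" by (simp add: indicator_def)
 qed
 finally have "(1 + e) * ((\<Sum>k=1..N+1. a k) + Ce) \<le> (1 + e) * (int_on Q energy + Ce)"
  using e by (intro mult_left_mono add_mono) auto
 then have act': "discrete_action N T' T (R, F) \<le> ennreal ((1 + e) * (int_on Q energy + Ce))"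
  using act ennreal_leI order_trans by blast
 have "discrete_W2_sq N T' T (sampling \<rho>in) (sampling \<rho>f) \<le> 2 * discrete_action N T' T (R, F)"
  unfolding discrete_W2_sq_def by (intro mult_left_mono INF_lower) (use dce in auto)
 also have "\<dots> \<le> 2 * ennreal ((1 + e) * (int_on Q energy + Ce))" by (rule mult_left_mono[OF act']) simp
 also have "\<dots> = ennreal (2 * ((1 + e) * (int_on Q energy + Ce)))" by (simp add: ennreal_mult')
 finally show ?thesis unfolding Ce_def \<tau>_def .
qed

theorem discrete_distance_upper_bound:
 assumes min: "W2_sq \<Omega> \<rho>in \<rho>f = 2 * action \<Omega> (\<rho>, m)"
 shows "discrete_W2_sq N T' T (sampling \<rho>in) (sampling \<rho>f) \<le> W2_sq \<Omega> \<rho>in \<rho>f +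
  ennreal (2 * (flow_error \<Omega> \<epsilon> Lp Lr Lm \<kappa> * (diameter \<Omega> + 2) + Lm\<^sup>2 / (2 * \<epsilon>) * measure lebesgue Q) * (mesh_size T + time_step N + e))"
proof -
 define P where "P = int_on Q energy"
 define Pm where "Pm = Lm\<^sup>2 / (2 * \<epsilon>) * measure lebesgue Q"
 define s where "s = mesh_size T + time_step N"
 define c where "c = flow_error \<Omega> \<epsilon> Lp Lr Lm \<kappa>"
 define D where "D = diameter \<Omega>"
 have P: "0 \<le> P" "P \<le> Pm"
  unfolding P_def Pm_def using energy_le energy_nonneg by (auto intro!: Bochner_Integration.integral_nonneg)
 have c: "c \<ge> 0" unfolding c_def by (rule flow_error_nonneg)
 have D0: "D \<ge> 0" unfolding D_def by (rule diameter_ge_0[OF \<Omega>(4)])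
 have s: "0 \<le> s" "s \<le> D + 1"
  using mesh_size_pos mesh_size_le by (auto simp: s_def D_def time_step_def intro!: add_mono)
 have "(1 + e) * (P + c * s) \<le> P + (c * (D + 2) + Pm) * (s + e)"
 proof -
  have "e * P \<le> e * Pm" "0 \<le> Pm * s" using P e s by (auto intro: mult_left_mono)
  moreover have "e * (c * s) \<le> e * (c * (D + 1))" using s c e by (intro mult_left_mono) auto
  moreover have "0 \<le> c * e" "0 \<le> c * s" "0 \<le> c * D * s" using c e s D0 by auto
  moreover have "(c * (D + 2) + Pm) * (s + e) = c * D * s + 2 * (c * s) + e * (c * (D + 1)) + c * e + Pm * s + e * Pm"
   by (simp add: algebra_simps)
  moreover have "(1 + e) * (P + c * s) = P + c * s + e * P + e * (c * s)" by (simp add: algebra_simps)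
  ultimately show ?thesis by linarith
 qed
 then have "2 * ((1 + e) * (P + c * s)) \<le> 2 * P + 2 * (c * (D + 2) + Pm) * (s + e)"
  unfolding mult.assoc[of 2] by linarith
 then have "ennreal (2 * ((1 + e) * (P + c * s))) \<le> ennreal (2 * P + 2 * (c * (D + 2) + Pm) * (s + e))" by (rule ennreal_leI)
 also have "\<dots> = ennreal (2 * P) + ennreal (2 * (c * (D + 2) + Pm) * (s + e))"
  using P c D0 s e by (intro ennreal_plus mult_nonneg_nonneg add_nonneg_nonneg) auto
 also have "ennreal (2 * P) = W2_sq \<Omega> \<rho>in \<rho>f" unfolding min energy_action P_def by (simp add: ennreal_mult')
 finally show ?thesis
  using discrete_energy_bound[of N] unfolding P_def Pm_def s_def c_def D_def by (rule order_trans[rotated])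
qed

end

section \<open>The lower bound\<close>

lemma ennreal_le_add_ereal:
 assumes "x \<le> y + ennreal r" "r \<ge> 0"
 shows "enn2ereal x \<le> enn2ereal y + ereal r" "enn2ereal x - ereal r \<le> enn2ereal y"
proof -
 show 1: "enn2ereal x \<le> enn2ereal y + ereal r"
  using assms unfolding less_eq_ennreal.rep_eq plus_ennreal.rep_eq by simp
 show "enn2ereal x - ereal r \<le> enn2ereal y" using 1 by (simp add: ereal_minus_le)
qed

theorem (in mesh_pair) discrete_distance_lower_bound:
 assumes f: "has_gradient_on Q (\<lambda>(t, x). \<phi> t x) g" and gL: "L-lipschitz_on Q g"
  and gG: "\<And>z. z \<in> Q \<Longrightarrow> norm (g z) \<le> G"
  and d: "is_density \<Omega> \<rho>in" "is_density \<Omega> \<rho>f" and mass: "mass \<Omega> \<rho>in = M" "mass \<Omega> \<rho>f = M"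
  and opt: "optimal_potential \<Omega> \<rho>in \<rho>f \<phi>" and ass: "associated_interpolation \<Omega> \<rho>in \<rho>f \<phi> \<rho>"
  and reg: "mesh_regular \<zeta> T" and iso: "mesh_isotropic e T" and e: "e \<ge> 0" and cmp: "coarse_comparable \<zeta> T' T"
 defines "C1 \<equiv> (2 * G + L * \<zeta> * diameter \<Omega>) * (L * \<zeta>)"
 assumes Y: "M * (2 * G * (\<zeta> + max 1 \<zeta>) * mesh_size T + L * time_step N + e * G\<^sup>2 / 2 + real DIM('a) * (1 + e) * (C1 * mesh_size T) / 2) \<le> Y" "0 \<le> Y"
 shows "W2_sq \<Omega> \<rho>in \<rho>f \<le> discrete_W2_sq N T' T (sampling \<rho>in) (sampling \<rho>f) + ennreal (2 * Y)"
proof -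
 note gap = duality_gap_le_0[OF f gL d opt ass]
 let ?d = "dual_value \<Omega> \<rho>in \<rho>f \<phi>"
 have "ennreal (?d - Y) \<le> discrete_action N T' T c"
  if c: "discrete_continuity_equation N T' T (sampling \<rho>in) (sampling \<rho>f) c" for c
 proof (cases "discrete_action N T' T c = \<infinity>")
  case False
  obtain R F where cRF: "c = (R, F)" by (cases c)
  have "?d \<le> enn2real (discrete_action N T' T c) + Y"
   using discrete_dual_bound[OF f gL gG gap(2) d mass reg iso e cmp c[unfolded cRF] False[unfolded cRF]] Y(1)
   unfolding cRF C1_def by linarith
  then have "ennreal (?d - Y) \<le> ennreal (enn2real (discrete_action N T' T c))" by (intro ennreal_leI) simp
  also have "\<dots> = discrete_action N T' T c" using False by (intro ennreal_enn2real) (simp add: less_top)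
  finally show ?thesis .
 qed simp
 then have "2 * ennreal (?d - Y) \<le> discrete_W2_sq N T' T (sampling \<rho>in) (sampling \<rho>f)"
  unfolding discrete_W2_sq_def by (intro mult_left_mono INF_greatest) auto
 moreover have "ennreal (2 * ?d) \<le> 2 * ennreal (?d - Y) + ennreal (2 * Y)"
 proof (cases "?d - Y \<ge> 0")
  case True
  have "ennreal (2 * ?d) = ennreal (2 * (?d - Y) + 2 * Y)" by (simp add: algebra_simps)
  also have "\<dots> = ennreal (2 * (?d - Y)) + ennreal (2 * Y)" using True Y(2) by (intro ennreal_plus) auto
  also have "ennreal (2 * (?d - Y)) = 2 * ennreal (?d - Y)"
   using ennreal_mult'[of 2 "?d - Y", OF zero_le_numeral] by (simp only: ennreal_numeral)
  finally show ?thesis by (rule eq_refl)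
 next
  case False
  then have "ennreal (2 * ?d) \<le> ennreal (2 * Y)" by (intro ennreal_leI) simp
  then show ?thesis using False by (simp add: ennreal_neg)
 qed
 ultimately show ?thesis using gap(1) by (meson add_right_mono order_trans)
qed

section \<open>Constants independent of the mesh\<close>

lemma AE_unit_interval_ex: "AE t in lebesgue_on {0..1::real}. P t \<Longrightarrow> \<exists>t. P t"
 using AE_lebesgue_on_dense[of "{0..1::real}" P 0 1] by auto

lemma scaled_lipschitz:
 fixes V :: "'a::euclidean_space \<Rightarrow> 'b::real_normed_vector"
 assumes p: "a-lipschitz_on S p" "\<And>x. x \<in> S \<Longrightarrow> \<bar>p x\<bar> \<le> a" and V: "b-lipschitz_on S V" "\<And>x. x \<in> S \<Longrightarrow> norm (V x) \<le> b"
 shows "(2 * a * b)-lipschitz_on S (\<lambda>x. p x *\<^sub>R V x)" "x \<in> S \<Longrightarrow> norm (p x *\<^sub>R V x) \<le> 2 * a * b"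
proof -
 have ab: "a \<ge> 0" "b \<ge> 0" using p(1) V(1) lipschitz_on_nonneg by blast+
 show "(2 * a * b)-lipschitz_on S (\<lambda>x. p x *\<^sub>R V x)"
 proof (rule lipschitz_onI)
  fix x y assume xy: "x \<in> S" "y \<in> S"
  have "p x *\<^sub>R V x - p y *\<^sub>R V y = p x *\<^sub>R (V x - V y) + (p x - p y) *\<^sub>R V y" by (simp add: algebra_simps)
  also have "norm \<dots> \<le> \<bar>p x\<bar> * norm (V x - V y) + \<bar>p x - p y\<bar> * norm (V y)"
   by (rule norm_triangle_le) simp
  also have "\<dots> \<le> a * (b * dist x y) + (a * dist x y) * b"
   using lipschitz_onD[OF p(1) xy] lipschitz_onD[OF V(1) xy] p(2) V(2) xy ab
   by (intro add_mono mult_mono) (auto simp: dist_norm)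
  finally show "dist (p x *\<^sub>R V x) (p y *\<^sub>R V y) \<le> 2 * a * b * dist x y" by (simp add: dist_norm)
 qed (use ab in simp)
 assume x: "x \<in> S"
 have "norm (p x *\<^sub>R V x) \<le> a * b" using p(2)[OF x] V(2)[OF x] ab by (auto intro: mult_mono)
 then show "norm (p x *\<^sub>R V x) \<le> 2 * a * b" using mult_nonneg_nonneg[OF ab] by linarith
qed

lemma minimal_action:
 assumes "associated_interpolation \<Omega> \<rho>in \<rho>f \<phi> \<rho>"
 shows "continuity_equation \<Omega> \<rho>in \<rho>f (\<rho>, \<lambda>t x. \<rho> t x *\<^sub>R grad \<Omega> (\<phi> t) x)"
  "W2_sq \<Omega> \<rho>in \<rho>f = 2 * action \<Omega> (\<rho>, \<lambda>t x. \<rho> t x *\<^sub>R grad \<Omega> (\<phi> t) x)"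
proof -
 show ce: "continuity_equation \<Omega> \<rho>in \<rho>f (\<rho>, \<lambda>t x. \<rho> t x *\<^sub>R grad \<Omega> (\<phi> t) x)"
  using assms unfolding associated_interpolation_def is_arg_min_def by blast
 have "(INF c\<in>Collect (continuity_equation \<Omega> \<rho>in \<rho>f). action \<Omega> c) = action \<Omega> (\<rho>, \<lambda>t x. \<rho> t x *\<^sub>R grad \<Omega> (\<phi> t) x)"
 proof (rule antisym)
  show "(INF c\<in>Collect (continuity_equation \<Omega> \<rho>in \<rho>f). action \<Omega> c) \<le> action \<Omega> (\<rho>, \<lambda>t x. \<rho> t x *\<^sub>R grad \<Omega> (\<phi> t) x)"
   by (rule INF_lower) (simp add: ce)
  show "action \<Omega> (\<rho>, \<lambda>t x. \<rho> t x *\<^sub>R grad \<Omega> (\<phi> t) x) \<le> (INF c\<in>Collect (continuity_equation \<Omega> \<rho>in \<rho>f). action \<Omega> c)"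
   using assms unfolding associated_interpolation_def is_arg_min_def by (intro INF_greatest) (auto simp: not_less)
 qed
 then show "W2_sq \<Omega> \<rho>in \<rho>f = 2 * action \<Omega> (\<rho>, \<lambda>t x. \<rho> t x *\<^sub>R grad \<Omega> (\<phi> t) x)" by (simp add: W2_sq_def)
qed

text \<open>Every term of the error is at most linear in \<open>h + \<tau> + e\<close>, since \<open>h\<close> is bounded by the diameter \<open>D\<close>
  of the domain.\<close>

lemma lower_bound_constant:
 fixes M :: real
 assumes nn: "M \<ge> 0" "h \<ge> 0" "h \<le> D" "\<tau> \<ge> 0" "e \<ge> 0" "L \<ge> 0"
 shows "M * (a * h + L * \<tau> + e * G\<^sup>2 / 2 + real n * (1 + e) * (C1 * h) / 2) \<le>
  M * (\<bar>a\<bar> + L + G\<^sup>2 + real n * \<bar>C1\<bar> * (1 + D)) * (h + \<tau> + e)"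
proof -
 define s where "s = h + \<tau> + e"
 have s: "h \<le> s" "\<tau> \<le> s" "e \<le> s" "s \<ge> 0" using nn by (auto simp: s_def)
 have "a * h \<le> \<bar>a\<bar> * s" using s nn by (intro mult_mono) auto
 moreover have "L * \<tau> \<le> L * s" using s nn by (intro mult_left_mono) auto
 moreover have "e * G\<^sup>2 / 2 \<le> G\<^sup>2 * s"
 proof -
  have "e * G\<^sup>2 \<le> s * G\<^sup>2" using s by (intro mult_right_mono) auto
  moreover have "0 \<le> e * G\<^sup>2" using nn by simp
  ultimately show ?thesis by (simp add: mult.commute)
 qed
 moreover have "real n * (1 + e) * (C1 * h) / 2 \<le> real n * \<bar>C1\<bar> * (1 + D) * s"
 proof -
  have "C1 * h \<le> \<bar>C1\<bar> * h" using nn by (intro mult_right_mono) auto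
  then have "real n * (1 + e) * (C1 * h) \<le> real n * (1 + e) * (\<bar>C1\<bar> * h)" using nn by (intro mult_left_mono) auto
  also have "\<dots> = real n * \<bar>C1\<bar> * (h + e * h)" by (simp add: algebra_simps)
  also have "\<dots> \<le> real n * \<bar>C1\<bar> * (s + s * D)" using s nn by (intro mult_left_mono add_mono mult_mono) auto
  finally have "real n * (1 + e) * (C1 * h) \<le> real n * \<bar>C1\<bar> * (1 + D) * s" by (simp add: algebra_simps)
  moreover have "0 \<le> real n * \<bar>C1\<bar> * (1 + D) * s" using nn s by (intro mult_nonneg_nonneg) auto
  ultimately show ?thesis by linarith
 qed
 ultimately have "a * h + L * \<tau> + e * G\<^sup>2 / 2 + real n * (1 + e) * (C1 * h) / 2 \<le> (\<bar>a\<bar> + L + G\<^sup>2 + real n * \<bar>C1\<bar> * (1 + D)) * s"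
  unfolding distrib_right by linarith
 then show ?thesis using nn(1) unfolding s_def mult.assoc[of M] by (rule mult_left_mono)
qed

theorem theorem3p4:
  fixes \<Omega> :: "'a::euclidean_space set"
  assumes "DIM('a) = 2 \<or> DIM('a) = 3" and "polytope \<Omega>" and "interior \<Omega> \<noteq> {}"
  shows
    "(\<forall>\<phi> \<zeta> M. C11_on ({0..1} \<times> \<Omega>) (\<lambda>(t, x). \<phi> t x) \<longrightarrow>
       (\<exists>C>0. \<forall>\<rho>in \<rho>f \<rho>.
          is_density \<Omega> \<rho>in \<and> is_density \<Omega> \<rho>f \<and> mass \<Omega> \<rho>in = M \<and> mass \<Omega> \<rho>f = M \<and>
          optimal_potential \<Omega> \<rho>in \<rho>f \<phi> \<and> associated_interpolation \<Omega> \<rho>in \<rho>f \<phi> \<rho> \<longrightarrow>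
          (\<forall>\<eta> T' T N. vanishing_rate \<eta> \<and> mesh_assumptions \<Omega> \<zeta> \<eta> T' T \<longrightarrow>
             enn2ereal (discrete_W2_sq N T' T (sampling \<rho>in) (sampling \<rho>f)) \<ge>
             enn2ereal (W2_sq \<Omega> \<rho>in \<rho>f)
               - ereal (C * (mesh_size T + time_step N + \<eta> (mesh_size T))))))
     \<and>
     (\<forall>\<phi> \<rho> \<epsilon> \<zeta>. Linf_C11 \<Omega> \<phi> \<and> Linf_C01 \<Omega> \<rho> \<and>
         (\<exists>r. has_time_derivative \<Omega> \<rho> r \<and> Linf_C01 \<Omega> r) \<and>
         \<epsilon> > 0 \<and> (\<forall>t\<in>{0..1}. \<forall>x\<in>\<Omega>. \<rho> t x \<ge> \<epsilon>) \<longrightarrow>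
       (\<exists>C>0. \<forall>\<rho>in \<rho>f.
          is_density \<Omega> \<rho>in \<and> is_density \<Omega> \<rho>f \<and> mass \<Omega> \<rho>in = mass \<Omega> \<rho>f \<and>
          optimal_potential \<Omega> \<rho>in \<rho>f \<phi> \<and> associated_interpolation \<Omega> \<rho>in \<rho>f \<phi> \<rho> \<longrightarrow>
          (\<forall>\<eta> T' T N. vanishing_rate \<eta> \<and> mesh_assumptions \<Omega> \<zeta> \<eta> T' T \<longrightarrow>
             enn2ereal (discrete_W2_sq N T' T (sampling \<rho>in) (sampling \<rho>f)) \<le>
             enn2ereal (W2_sq \<Omega> \<rho>in \<rho>f)
               + ereal (C * (mesh_size T + time_step N + \<eta> (mesh_size T))))))"
proof (intro conjI allI impI)
 have \<Omega>: "compact \<Omega>" "convex \<Omega>" using assms(2) polytope_imp_compact polytope_imp_convex by blast+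
 have \<Omega>s: "\<Omega> \<in> sets lebesgue" using \<Omega>(1) lmeasurable_compact by blast
 interpret body: convex_body \<Omega> by unfold_locales (rule \<Omega> assms)+
 have D0: "diameter \<Omega> \<ge> 0" using \<Omega>(1) compact_imp_bounded diameter_ge_0 by blast
 {
  fix \<phi> :: "real \<Rightarrow> 'a \<Rightarrow> real" and \<zeta> M :: real
  assume "C11_on ({0..1} \<times> \<Omega>) (\<lambda>(t, x). \<phi> t x)"
  then obtain g L where f: "has_gradient_on body.Q (\<lambda>(t, x). \<phi> t x) g" and gL: "L-lipschitz_on body.Q g"
   unfolding C11_on_def body.Q_def by blast
  have L: "L \<ge> 0" using gL lipschitz_on_nonneg by blast
  obtain G where G: "\<And>z. z \<in> body.Q \<Longrightarrow> norm (g z) \<le> G"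
   using compact_imp_bounded[OF compact_continuous_image[OF lipschitz_on_continuous_on[OF gL] body.Q(1)]] by (auto simp: bounded_iff)
  define a where "a = 2 * G * (\<zeta> + max 1 \<zeta>)"
  define C1 where "C1 = (2 * G + L * \<zeta> * diameter \<Omega>) * (L * \<zeta>)"
  define C0 where "C0 = \<bar>M\<bar> * (\<bar>a\<bar> + L + G\<^sup>2 + real DIM('a) * \<bar>C1\<bar> * (1 + diameter \<Omega>))"
  have C0: "C0 \<ge> 0" unfolding C0_def using L D0 by simp
  show "\<exists>C>0. \<forall>\<rho>in \<rho>f \<rho>.
     is_density \<Omega> \<rho>in \<and> is_density \<Omega> \<rho>f \<and> mass \<Omega> \<rho>in = M \<and> mass \<Omega> \<rho>f = M \<and>
     optimal_potential \<Omega> \<rho>in \<rho>f \<phi> \<and> associated_interpolation \<Omega> \<rho>in \<rho>f \<phi> \<rho> \<longrightarrow>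
     (\<forall>\<eta> T' T N. vanishing_rate \<eta> \<and> mesh_assumptions \<Omega> \<zeta> \<eta> T' T \<longrightarrow>
       enn2ereal (discrete_W2_sq N T' T (sampling \<rho>in) (sampling \<rho>f)) \<ge>
       enn2ereal (W2_sq \<Omega> \<rho>in \<rho>f)
        - ereal (C * (mesh_size T + time_step N + \<eta> (mesh_size T))))"
  proof (intro exI[of _ "2 * (C0 + 1)"] conjI allI impI; (elim conjE)?)
   show "0 < 2 * (C0 + 1)" using C0 by simp
   fix \<rho>in \<rho>f \<rho> \<eta> T' T N
   assume d: "is_density \<Omega> \<rho>in" "is_density \<Omega> \<rho>f" and mass: "mass \<Omega> \<rho>in = M" "mass \<Omega> \<rho>f = M"
    and opt: "optimal_potential \<Omega> \<rho>in \<rho>f \<phi>" and ass: "associated_interpolation \<Omega> \<rho>in \<rho>f \<phi> \<rho>"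
    and \<eta>: "vanishing_rate \<eta>" and mesh: "mesh_assumptions \<Omega> \<zeta> \<eta> T' T"
   note ma = mesh[unfolded mesh_assumptions_def]
   interpret mesh_pair \<Omega> T T' by unfold_locales (use ma assms in blast)+
   define e where "e = \<eta> (mesh_size T)"
   have e: "e \<ge> 0" using \<eta> mesh_size_pos unfolding e_def vanishing_rate_def by (meson less_imp_le)
   have \<tau>: "time_step N \<ge> 0" by (simp add: time_step_def)
   have M: "M \<ge> 0" using d(1) mass(1) unfolding mass_def is_density_def by (auto intro!: Bochner_Integration.integral_nonneg)
   define s where "s = mesh_size T + time_step N + e"
   have s: "s \<ge> 0" unfolding s_def using e \<tau> mesh_size_pos by linarith
   have "M * (a * mesh_size T + L * time_step N + e * G\<^sup>2 / 2 + real DIM('a) * (1 + e) * (C1 * mesh_size T) / 2) \<le> C0 * s"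
    unfolding C0_def s_def using lower_bound_constant[OF M less_imp_le[OF mesh_size_pos] mesh_size_le \<tau> e L] M by simp
   also have "C0 * s \<le> (C0 + 1) * s" using s by (simp add: distrib_right)
   finally have "W2_sq \<Omega> \<rho>in \<rho>f \<le> discrete_W2_sq N T' T (sampling \<rho>in) (sampling \<rho>f) + ennreal (2 * ((C0 + 1) * s))"
    unfolding a_def C1_def
    by (intro discrete_distance_lower_bound[OF f gL G d mass opt ass _ _ e]) (use ma C0 s in \<open>auto simp: e_def\<close>)
   then show "enn2ereal (W2_sq \<Omega> \<rho>in \<rho>f) - ereal (2 * (C0 + 1) * (mesh_size T + time_step N + \<eta> (mesh_size T)))
     \<le> enn2ereal (discrete_W2_sq N T' T (sampling \<rho>in) (sampling \<rho>f))"
    unfolding s_def e_def mult.assoc[of 2] by (rule ennreal_le_add_ereal(2)) (use C0 s in \<open>simp add: s_def e_def\<close>)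
  qed
 }
 {
  fix \<phi> \<rho> :: "real \<Rightarrow> 'a \<Rightarrow> real" and \<epsilon> \<zeta> :: real
  assume "Linf_C11 \<Omega> \<phi> \<and> Linf_C01 \<Omega> \<rho> \<and> (\<exists>r. has_time_derivative \<Omega> \<rho> r \<and> Linf_C01 \<Omega> r) \<and>
     \<epsilon> > 0 \<and> (\<forall>t\<in>{0..1}. \<forall>x\<in>\<Omega>. \<rho> t x \<ge> \<epsilon>)"
  then obtain r where \<phi>: "Linf_C11 \<Omega> \<phi>" and \<rho>: "Linf_C01 \<Omega> \<rho>" and r: "has_time_derivative \<Omega> \<rho> r" "Linf_C01 \<Omega> r"
   and \<epsilon>: "\<epsilon> > 0" and lower: "\<And>t x. t \<in> {0..1} \<Longrightarrow> x \<in> \<Omega> \<Longrightarrow> \<rho> t x \<ge> \<epsilon>" by blast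
  obtain L\<phi> where L\<phi>: "AE t in lebesgue_on {0..1}. \<exists>g. has_gradient_on \<Omega> (\<phi> t) g \<and> L\<phi>-lipschitz_on \<Omega> g \<and> (\<forall>x\<in>\<Omega>. \<bar>\<phi> t x\<bar> \<le> L\<phi> \<and> norm (g x) \<le> L\<phi>)"
   using \<phi> unfolding Linf_C11_def by blast
  obtain Lp where Lp: "AE t in lebesgue_on {0..1}. Lp-lipschitz_on \<Omega> (\<rho> t) \<and> (\<forall>x\<in>\<Omega>. \<bar>\<rho> t x\<bar> \<le> Lp)"
   using \<rho> unfolding Linf_C01_def by blast
  obtain Lr where Lr: "AE t in lebesgue_on {0..1}. Lr-lipschitz_on \<Omega> (r t) \<and> (\<forall>x\<in>\<Omega>. \<bar>r t x\<bar> \<le> Lr)"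
   using r(2) unfolding Linf_C01_def by blast
  have L0: "L\<phi> \<ge> 0" "Lp \<ge> 0" "Lr \<ge> 0"
   using AE_unit_interval_ex[OF L\<phi>] AE_unit_interval_ex[OF Lp] AE_unit_interval_ex[OF Lr] lipschitz_on_nonneg by blast+
  define m where "m t x = \<rho> t x *\<^sub>R grad \<Omega> (\<phi> t) x" for t x
  define Lm where "Lm = 2 * Lp * L\<phi>"
  have Lm0: "Lm \<ge> 0" unfolding Lm_def using L0 by simp
  have Lm: "AE t in lebesgue_on {0..1}. Lm-lipschitz_on \<Omega> (m t) \<and> (\<forall>x\<in>\<Omega>. norm (m t x) \<le> Lm)"
   using L\<phi> Lp
  proof eventually_elim
   case (elim t)
   then obtain g where g: "has_gradient_on \<Omega> (\<phi> t) g" "L\<phi>-lipschitz_on \<Omega> g" "\<And>x. x \<in> \<Omega> \<Longrightarrow> norm (g x) \<le> L\<phi>" by blast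
   have p: "Lp-lipschitz_on \<Omega> (\<rho> t)" "\<And>x. x \<in> \<Omega> \<Longrightarrow> \<bar>\<rho> t x\<bar> \<le> Lp" using elim by auto
   have mg: "m t x = \<rho> t x *\<^sub>R g x" if "x \<in> \<Omega>" for x
    using grad_eq[OF \<Omega>(2) assms(3) that] g(1) that unfolding m_def has_gradient_on_def by simp
   have "Lm-lipschitz_on \<Omega> (m t)"
    unfolding Lm_def by (rule lipschitz_on_transform[OF scaled_lipschitz(1)[OF p g(2,3)]]) (simp_all add: mg)
   then show ?case using scaled_lipschitz(2)[OF p g(2,3)] mg unfolding Lm_def by auto
  qed
  define \<kappa> where "\<kappa> = max 1 \<zeta>"
  define C0 where "C0 = 2 * (flow_error \<Omega> \<epsilon> Lp Lr Lm \<kappa> * (diameter \<Omega> + 2) + Lm\<^sup>2 / (2 * \<epsilon>) * measure lebesgue body.Q)"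
  show "\<exists>C>0. \<forall>\<rho>in \<rho>f.
     is_density \<Omega> \<rho>in \<and> is_density \<Omega> \<rho>f \<and> mass \<Omega> \<rho>in = mass \<Omega> \<rho>f \<and>
     optimal_potential \<Omega> \<rho>in \<rho>f \<phi> \<and> associated_interpolation \<Omega> \<rho>in \<rho>f \<phi> \<rho> \<longrightarrow>
     (\<forall>\<eta> T' T N. vanishing_rate \<eta> \<and> mesh_assumptions \<Omega> \<zeta> \<eta> T' T \<longrightarrow>
       enn2ereal (discrete_W2_sq N T' T (sampling \<rho>in) (sampling \<rho>f)) \<le>
       enn2ereal (W2_sq \<Omega> \<rho>in \<rho>f)
        + ereal (C * (mesh_size T + time_step N + \<eta> (mesh_size T))))"
  proof (intro exI[of _ "\<bar>C0\<bar> + 1"] conjI allI impI; (elim conjE)?)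
   show "0 < \<bar>C0\<bar> + 1" by simp
   fix \<rho>in \<rho>f \<eta> T' T N
   assume d: "is_density \<Omega> \<rho>in" "is_density \<Omega> \<rho>f"
    and ass: "associated_interpolation \<Omega> \<rho>in \<rho>f \<phi> \<rho>"
    and \<eta>: "vanishing_rate \<eta>" and mesh: "mesh_assumptions \<Omega> \<zeta> \<eta> T' T"
   note ma = mesh[unfolded mesh_assumptions_def coarse_comparable_def]
   have adm: "admissible_mesh \<Omega> T" "admissible_mesh \<Omega> T'" "subordinate T' T" and comp: "mesh_size T' \<le> \<kappa> * mesh_size T"
    and iso: "mesh_isotropic (\<eta> (mesh_size T)) T" using ma unfolding \<kappa>_def by auto
   interpret pair: mesh_pair \<Omega> T T' by unfold_locales (rule adm assms)+
   define e where "e = \<eta> (mesh_size T)"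
   have e: "e \<ge> 0" using \<eta> pair.mesh_size_pos unfolding e_def vanishing_rate_def by (meson less_imp_le)
   have Lp': "AE t in lebesgue_on {0..1}. Lp-lipschitz_on \<Omega> (\<rho> t)" using Lp by eventually_elim blast
   have ce: "continuity_equation \<Omega> \<rho>in \<rho>f (\<rho>, m)" using minimal_action(1)[OF ass] unfolding m_def[abs_def] .
   interpret flow_on_mesh \<Omega> T T' \<rho> r m \<rho>in \<rho>f \<epsilon> Lp Lr Lm \<kappa> e
    by unfold_locales (fact \<epsilon> lower L0 Lp' Lr r Lm0 Lm ce d comp iso[folded e_def] e)+
   define s where "s = mesh_size T + time_step N + e"
   have s: "s \<ge> 0" unfolding s_def using e pair.mesh_size_pos by (simp add: time_step_def)
   have "W2_sq \<Omega> \<rho>in \<rho>f = 2 * action \<Omega> (\<rho>, m)" using minimal_action(2)[OF ass] unfolding m_def[abs_def] .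
   from discrete_distance_upper_bound[OF this, of N]
   have "discrete_W2_sq N T' T (sampling \<rho>in) (sampling \<rho>f) \<le> W2_sq \<Omega> \<rho>in \<rho>f + ennreal (C0 * s)"
    unfolding C0_def s_def .
   also have "\<dots> \<le> W2_sq \<Omega> \<rho>in \<rho>f + ennreal ((\<bar>C0\<bar> + 1) * s)"
    using s by (intro add_left_mono ennreal_leI mult_right_mono) auto
   finally show "enn2ereal (discrete_W2_sq N T' T (sampling \<rho>in) (sampling \<rho>f)) \<le> enn2ereal (W2_sq \<Omega> \<rho>in \<rho>f)
     + ereal ((\<bar>C0\<bar> + 1) * (mesh_size T + time_step N + \<eta> (mesh_size T)))"
    unfolding s_def e_def by (rule ennreal_le_add_ereal(1)) (use s in \<open>simp add: s_def e_def\<close>)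
  qed
 }
qed

end
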